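(* Let $\mathfrak g$ be a dg Lie algebra. The Chevalley-Eilenberg functor $$C(\mathfrak g,-)\colon\mathbf{lfMod}_{\mathfrak g}^\infty\to\mathbf{Mod}_{C(\mathfrak g)},\qquad M\mapsto(C(\mathfrak g,M),d_{\mathrm{tot}}^M),\quad f\mapsto \mathrm{id}_{C(\mathfrak g)}\otimes\sum_{k\ge0}f_k,$$ is fully faithful. Moreover, it defines an equivalence of categories $$C(\mathfrak g,-)\colon\mathbf{lfMod}_{\mathfrak g}^\infty\xrightarrow{\ \simeq\ }\mathbf{fgsMod}_{C(\mathfrak g)},$$ where $\mathbf{fgsMod}_{C(\mathfrak g)}\subset\mathbf{Mod}_{C(\mathfrak g)}$ is the subcategory consisting of finitely generated and semifree dg $C(\mathfrak g)$-modules.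
   Context: Conventions: $\mathbb K$ is $\mathbb R$ or $\mathbb C$; graded means $\mathbb Z$-graded; dg Lie algebras and (underlying spaces of) $\infty$-modules are finite dimensional; differentials have degree $+1$; $V[p]^i=V^{i+p}$. For a dg Lie algebra $\mathfrak g=(\mathfrak g,d,[-,-])$, $C(\mathfrak g)=\bigoplus_{p\ge0}C^p(\mathfrak g)$, $C^p(\mathfrak g)=S^p(\mathfrak g^\vee[-1])$, with differential $d_{\mathrm{CE}}=d_0+d_1$, $d_0$ induced by the dual of $d$ and $d_1$ the derivation with $d_1(\xi[-1])(x[1],y[1])=(-1)^{|\xi|+1+|x|}\xi([x,y])$. Put $C^k(\mathfrak g,M)=C^k(\mathfrak g)\otimes M$, $C(\mathfrak g,M)=C(\mathfrak g)\otimes M$. $\mathbf{Mod}_{C(\mathfrak g)}$ is the category of dg $C(\mathfrak g)$-modules with degree $0$ $C(\mathfrak g)$-linear maps commuting with differentials. A dg $C(\mathfrak g)$-module is semifree if, after forgetting the differential, it is a free graded $C(\mathfrak g)$-module. A locally finite $\infty$-$\mathfrak g$-module is a cochain complex $(M,d^M)$ with degree $+1$ maps $d_k^M\colon M\to C^k(\mathfrak g,M)$, $k\ge 0$, $d_0^M=d^M$, such that for each $m$, $d_k^M(m)=0$ for large $k$, and $d_{\mathrm{tot}}^M=d_{\mathrm{CE}}\otimes\mathrm{id}_M+\sum_k\mathrm{id}_{C(\mathfrak g)}\otimes d_k^M$ squares to zero on $C(\mathfrak g,M)$. An $\infty$-morphism $f\colon M\rightsquigarrow N$ is a family of degree $0$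 maps $f_k\colon M\to C^k(\mathfrak g,N)$, $k\ge0$, with $f_k(m)=0$ for large $k$ (depending on $m$), whose $C(\mathfrak g)$-linear extension $F=\mathrm{id}_{C(\mathfrak g)}\otimes\sum_kf_k$ satisfies $F d_{\mathrm{tot}}^M=d_{\mathrm{tot}}^NF$; composition is that of the extensions. $\mathbf{lfMod}_{\mathfrak g}^\infty$ is the resulting category. *)

theory Defs
  imports Complex_Main "HOL-Algebra.Module" "HOL-Algebra.QuotRing"
begin

section \<open>Ground field\<close>

text \<open>The class of fields isomorphic to \<open>\<real>\<close> or to \<open>\<complex>\<close>.\<close>

class real_or_complex = field_char_0 +
  assumes real_or_complex:
    "(\<exists>h :: 'a \<Rightarrow> real. bij h \<and> (\<forall>x y. h (x + y) = h x + h y) \<and> (\<forall>x y. h (x * y) = h x * h y)) \<or>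
     (\<exists>h :: 'a \<Rightarrow> complex. bij h \<and> (\<forall>x y. h (x + y) = h x + h y) \<and> (\<forall>x y. h (x * y) = h x * h y))"

instance real :: real_or_complex
  by standard (rule disjI1, rule exI[of _ "\<lambda>x. x"], simp add: bij_id[unfolded id_def])

instance complex :: real_or_complex
  by standard (rule disjI2, rule exI[of _ "\<lambda>x. x"], simp add: bij_id[unfolded id_def])

definition scalars :: "'k::field ring" where
  "scalars = \<lparr>carrier = UNIV, mult = (*), one = 1, zero = 0, add = (+)\<rparr>"


section \<open>Graded vector spaces, dg Lie algebras\<close>

text \<open>Graded objects are total spaces together with the family of their homogeneous parts; all
  of them are records extending \<^typ>\<open>('r, 'v) module\<close>. As in HOL-Algebra, the ring
  multiplication and unit of such a record carry no meaning unless the record is an algebra.\<close>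

record ('r, 'v) graded = "('r, 'v) module" +
  grade :: "int \<Rightarrow> 'v set"

record ('r, 'v) dg = "('r, 'v) graded" +
  diff :: "'v \<Rightarrow> 'v"

record ('k, 'g) dg_lie = "('k, 'g) dg" +
  bracket :: "'g \<Rightarrow> 'g \<Rightarrow> 'g"

definition decomposes ::
    "('v, 'e) ring_scheme \<Rightarrow> ('i \<Rightarrow> 'v set) \<Rightarrow> 'v \<Rightarrow> ('i \<Rightarrow> 'v) \<Rightarrow> bool" where
  "decomposes V A x f \<longleftrightarrow> (\<forall>i. f i \<in> A i) \<and> finite {i. f i \<noteq> \<zero>\<^bsub>V\<^esub>} \<and>
     x = (\<Oplus>\<^bsub>V\<^esub>i\<in>{i. f i \<noteq> \<zero>\<^bsub>V\<^esub>}. f i)"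

definition component :: "('v, 'e) ring_scheme \<Rightarrow> ('i \<Rightarrow> 'v set) \<Rightarrow> 'i \<Rightarrow> 'v \<Rightarrow> 'v" where
  "component V A i x = (THE f. decomposes V A x f) i"

locale internal_direct_sum = abelian_group V
  for V :: "('v, 'e) ring_scheme" (structure) and A :: "'i \<Rightarrow> 'v set" +
  assumes summand: "additive_subgroup (A i) V"
    and decomposition: "x \<in> carrier V \<Longrightarrow> \<exists>!f. decomposes V A x f"

locale graded_vector_space = module scalars V + internal_direct_sum V "grade V"
  for V :: "('k::field, 'v, 'e) graded_scheme" (structure) +
  assumes grade_smult: "x \<in> grade V i \<Longrightarrow> a \<odot> x \<in> grade V i"

text \<open>\<open>koszul V n x\<close> is \<open>(-1)\<^sup>n x\<close>.\<close>

definition koszul :: "('v, 'e) ring_scheme \<Rightarrow> int \<Rightarrow> 'v \<Rightarrow> 'v" where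
  "koszul V n x = (if even n then x else \<ominus>\<^bsub>V\<^esub> x)"

text \<open>The grading involution, \<open>x \<mapsto> (-1)\<^bsup>|x|\<^esup> x\<close> on homogeneous elements.\<close>

definition parity :: "('r, 'v, 'e) graded_scheme \<Rightarrow> 'v \<Rightarrow> 'v" where
  "parity V x = (\<Oplus>\<^bsub>V\<^esub>i\<in>{i. component V (grade V) i x \<noteq> \<zero>\<^bsub>V\<^esub>}.
     koszul V i (component V (grade V) i x))"

definition linear_map ::
    "('r, 'a) ring_scheme \<Rightarrow> ('r, 'v, 'e) module_scheme \<Rightarrow> ('r, 'w, 'f) module_scheme \<Rightarrow>
     ('v \<Rightarrow> 'w) \<Rightarrow> bool" where
  "linear_map R V W f \<longleftrightarrow> f \<in> carrier V \<rightarrow> carrier W \<and>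
     (\<forall>x\<in>carrier V. \<forall>y\<in>carrier V. f (x \<oplus>\<^bsub>V\<^esub> y) = f x \<oplus>\<^bsub>W\<^esub> f y) \<and>
     (\<forall>a\<in>carrier R. \<forall>x\<in>carrier V. f (a \<odot>\<^bsub>V\<^esub> x) = a \<odot>\<^bsub>W\<^esub> f x)"

definition has_degree ::
    "int \<Rightarrow> ('r, 'v, 'e) graded_scheme \<Rightarrow> ('s, 'w, 'f) graded_scheme \<Rightarrow> ('v \<Rightarrow> 'w) \<Rightarrow> bool" where
  "has_degree n V W f \<longleftrightarrow> (\<forall>i. \<forall>x\<in>grade V i. f x \<in> grade W (i + n))"

text \<open>Over the ground field this says finite dimensional.\<close>

definition finitely_generated ::
    "('r, 'a) ring_scheme \<Rightarrow> ('r, 'v, 'e) module_scheme \<Rightarrow> bool" where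
  "finitely_generated R V \<longleftrightarrow> (\<exists>B. finite B \<and> B \<subseteq> carrier V \<and>
     (\<forall>x\<in>carrier V. \<exists>c \<in> B \<rightarrow> carrier R. x = (\<Oplus>\<^bsub>V\<^esub>b\<in>B. c b \<odot>\<^bsub>V\<^esub> b)))"

definition linear_span ::
    "('r, 'a) ring_scheme \<Rightarrow> ('r, 'v, 'e) module_scheme \<Rightarrow> 'v set \<Rightarrow> 'v set" where
  "linear_span R V S = \<Inter>{H. submodule H R V \<and> S \<subseteq> H}"

locale finite_dim_complex = graded_vector_space V
  for V :: "('k::field, 'v, 'e) dg_scheme" (structure) +
  assumes finite_dim: "finitely_generated scalars V"
    and diff_linear: "linear_map scalars V V (diff V)"
    and diff_degree: "has_degree 1 V V (diff V)"
    and diff_diff: "x \<in> carrier V \<Longrightarrow> diff V (diff V x) = \<zero>"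

locale dg_lie_algebra = finite_dim_complex g
  for g :: "('k::field, 'g, 'e) dg_lie_scheme" (structure) +
  assumes bracket_linear_left:
      "y \<in> carrier g \<Longrightarrow> linear_map scalars g g (\<lambda>x. bracket g x y)"
    and bracket_linear_right:
      "x \<in> carrier g \<Longrightarrow> linear_map scalars g g (\<lambda>y. bracket g x y)"
    and bracket_degree:
      "\<lbrakk>x \<in> grade g i; y \<in> grade g j\<rbrakk> \<Longrightarrow> bracket g x y \<in> grade g (i + j)"
    and bracket_antisym:
      "\<lbrakk>x \<in> grade g i; y \<in> grade g j\<rbrakk> \<Longrightarrow> bracket g x y = koszul g (i * j + 1) (bracket g y x)"
    and jacobi:
      "\<lbrakk>x \<in> grade g i; y \<in> grade g j; z \<in> grade g l\<rbrakk> \<Longrightarrow>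
       bracket g x (bracket g y z) =
         bracket g (bracket g x y) z \<oplus> koszul g (i * j) (bracket g y (bracket g x z))"
    and diff_bracket:
      "\<lbrakk>x \<in> grade g i; y \<in> grade g j\<rbrakk> \<Longrightarrow>
       diff g (bracket g x y) =
         bracket g (diff g x) y \<oplus> koszul g i (bracket g x (diff g y))"


section \<open>Duals and shifts\<close>

text \<open>Functionals are extended by zero outside the carrier. Conventions:
  \<open>(V\<^sup>\<or>)\<^sup>i\<close> is the dual of \<open>V\<^bsup>-i\<^esup>\<close>, the differential of the dual is
  \<open>\<xi> \<mapsto> -(-1)\<^bsup>|\<xi>|\<^esup> \<xi> \<circ> d\<close>, and the differential of \<open>V[p]\<close> is \<open>(-1)\<^sup>p d\<close>.\<close>

definition dual_space :: "('k::field, 'v, 'e) graded_scheme \<Rightarrow> ('k, 'v \<Rightarrow> 'k) graded" where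
  "dual_space V = \<lparr>
     carrier = {\<xi>. linear_map scalars V (\<lparr>carrier = UNIV, mult = (*), one = 1, zero = 0,
                      add = (+), smult = (*)\<rparr>) \<xi> \<and> (\<forall>x. x \<notin> carrier V \<longrightarrow> \<xi> x = 0)},
     mult = undefined, one = undefined,
     zero = (\<lambda>x. 0), add = (\<lambda>\<xi> \<eta> x. \<xi> x + \<eta> x), smult = (\<lambda>a \<xi> x. a * \<xi> x),
     grade = (\<lambda>i. {\<xi>. linear_map scalars V (\<lparr>carrier = UNIV, mult = (*), one = 1, zero = 0,
                      add = (+), smult = (*)\<rparr>) \<xi> \<and> (\<forall>x. x \<notin> carrier V \<longrightarrow> \<xi> x = 0) \<and>
                    (\<forall>j. j \<noteq> - i \<longrightarrow> (\<forall>x\<in>grade V j. \<xi> x = 0))})\<rparr>"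

definition dual :: "('k::field, 'v, 'e) dg_scheme \<Rightarrow> ('k, 'v \<Rightarrow> 'k) dg" where
  "dual V = graded.extend (dual_space V)
     (dg.fields (\<lambda>\<xi> x. if x \<in> carrier V then - parity (dual_space V) \<xi> (diff V x) else 0))"

definition shift :: "int \<Rightarrow> ('r, 'v, 'e) dg_scheme \<Rightarrow> ('r, 'v, 'e) dg_scheme" where
  "shift p V = V\<lparr>grade := (\<lambda>i. grade V (i + p)), diff := (\<lambda>x. koszul V p (diff V x))\<rparr>"


section \<open>Free modules and quotients\<close>

definition free_module :: "'x set \<Rightarrow> ('k::field, 'x \<Rightarrow> 'k) module" where
  "free_module X = \<lparr>
     carrier = {f. finite {x. f x \<noteq> 0} \<and> {x. f x \<noteq> 0} \<subseteq> X},
     mult = undefined, one = undefined,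
     zero = (\<lambda>x. 0), add = (\<lambda>f h x. f x + h x), smult = (\<lambda>a f x. a * f x)\<rparr>"

definition single :: "'x \<Rightarrow> 'x \<Rightarrow> 'k::field" where
  "single x = (\<lambda>y. if y = x then 1 else 0)"

text \<open>Scalar multiplication on cosets of a subspace \<open>N\<close> of \<open>F\<close>; compare
  \<^const>\<open>rcoset_mult\<close>.\<close>

definition coset_smult ::
    "('k, 'x, 'e) module_scheme \<Rightarrow> 'x set \<Rightarrow> 'k \<Rightarrow> 'x set \<Rightarrow> 'x set" where
  "coset_smult F N a X = (\<Union>x\<in>X. N +>\<^bsub>F\<^esub> (a \<odot>\<^bsub>F\<^esub> x))"


section \<open>The symmetric algebra of a graded vector space\<close>

text \<open>\<open>S(V)\<close> is the free associative algebra on the homogeneous elements of \<open>V\<close> modulo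
  linearity in each degree (which gives the tensor algebra) and graded commutativity. The letter
  \<open>(i, v)\<close> stands for \<open>v\<close> regarded as an element of \<open>V\<^sup>i\<close>; multiplication is convolution
  along concatenation of words.\<close>

type_synonym ('k, 'v) words = "(int \<times> 'v) list \<Rightarrow> 'k"
type_synonym ('k, 'v) sym = "('k, 'v) words set"

definition letters :: "('k, 'v, 'e) graded_scheme \<Rightarrow> (int \<times> 'v) set" where
  "letters V = {(i, v). v \<in> grade V i}"

definition word_algebra :: "('k::field, 'v, 'e) graded_scheme \<Rightarrow> ('k, ('k, 'v) words) module" where
  "word_algebra V = (free_module (lists (letters V)))\<lparr>
     mult := (\<lambda>f h w. \<Sum>n\<le>length w. f (take n w) * h (drop n w)),
     one := single []\<rparr>"

definition sym_relations :: "('k::field, 'v, 'e) graded_scheme \<Rightarrow> ('k, 'v) words set" where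
  "sym_relations V =
     {(\<lambda>w. single [(i, v \<oplus>\<^bsub>V\<^esub> v')] w - single [(i, v)] w - single [(i, v')] w) | i v v'.
        v \<in> grade V i \<and> v' \<in> grade V i} \<union>
     {(\<lambda>w. single [(i, a \<odot>\<^bsub>V\<^esub> v)] w - a * single [(i, v)] w) | i a v.
        v \<in> grade V i} \<union>
     {(\<lambda>w. single [(i, v), (j, u)] w - (-1) powi (i * j) * single [(j, u), (i, v)] w) | i v j u.
        v \<in> grade V i \<and> u \<in> grade V j}"

definition sym_ideal :: "('k::field, 'v, 'e) graded_scheme \<Rightarrow> ('k, 'v) words set" where
  "sym_ideal V = Idl\<^bsub>word_algebra V\<^esub> (sym_relations V)"

definition sym_class :: "('k::field, 'v, 'e) graded_scheme \<Rightarrow> ('k, 'v) words \<Rightarrow> ('k, 'v) sym" where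
  "sym_class V f = sym_ideal V +>\<^bsub>word_algebra V\<^esub> f"

definition sym_algebra :: "('k::field, 'v, 'e) graded_scheme \<Rightarrow> ('k, ('k, 'v) sym) graded" where
  "sym_algebra V = (let Q = word_algebra V Quot sym_ideal V in \<lparr>
     carrier = carrier Q, mult = mult Q, one = one Q, zero = zero Q, add = add Q,
     smult = coset_smult (word_algebra V) (sym_ideal V),
     grade = (\<lambda>n. sym_class V ` {f \<in> carrier (word_algebra V).
                    \<forall>w. f w \<noteq> 0 \<longrightarrow> sum_list (map fst w) = n})\<rparr>)"

definition sym_power :: "('k::field, 'v, 'e) graded_scheme \<Rightarrow> nat \<Rightarrow> ('k, 'v) sym set" where
  "sym_power V p = sym_class V ` {f \<in> carrier (word_algebra V). \<forall>w. f w \<noteq> 0 \<longrightarrow> length w = p}"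

text \<open>The element of degree \<open>i\<close> of \<open>S\<^sup>1(V)\<close> given by \<open>v \<in> V\<^sup>i\<close>.\<close>

definition sym_gen :: "('k::field, 'v, 'e) graded_scheme \<Rightarrow> int \<Rightarrow> 'v \<Rightarrow> ('k, 'v) sym" where
  "sym_gen V i v = sym_class V (single [(i, v)])"

definition derivation :: "('k::field, 'a, 'e) graded_scheme \<Rightarrow> ('a \<Rightarrow> 'a) \<Rightarrow> bool" where
  "derivation A D \<longleftrightarrow> linear_map scalars A A D \<and> has_degree 1 A A D \<and>
     (\<forall>i. \<forall>a\<in>grade A i. \<forall>b\<in>carrier A.
        D (a \<otimes>\<^bsub>A\<^esub> b) = (D a \<otimes>\<^bsub>A\<^esub> b) \<oplus>\<^bsub>A\<^esub> koszul A i (a \<otimes>\<^bsub>A\<^esub> D b))"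


section \<open>The Chevalley-Eilenberg algebra\<close>

type_synonym ('k, 'g) CE = "('k, 'g \<Rightarrow> 'k) sym"

abbreviation CE_gens :: "('k::field, 'g) dg_lie \<Rightarrow> ('k, 'g \<Rightarrow> 'k) dg" where
  "CE_gens g \<equiv> shift (-1) (dual (dg.truncate g))"

definition CE_alg :: "('k::field, 'g) dg_lie \<Rightarrow> ('k, ('k, 'g) CE) graded" where
  "CE_alg g = sym_algebra (CE_gens g)"

definition CE_power :: "('k::field, 'g) dg_lie \<Rightarrow> nat \<Rightarrow> ('k, 'g) CE set" where
  "CE_power g p = sym_power (CE_gens g) p"

text \<open>The differentials below are determined uniquely by the properties used to select them.\<close>

definition CE_d0 :: "('k::field, 'g) dg_lie \<Rightarrow> ('k, 'g) CE \<Rightarrow> ('k, 'g) CE" where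
  "CE_d0 g = (SOME D. derivation (CE_alg g) D \<and>
     (\<forall>i. \<forall>\<xi>\<in>grade (CE_gens g) i.
        D (sym_gen (CE_gens g) i \<xi>) = sym_gen (CE_gens g) (i + 1) (diff (CE_gens g) \<xi>)))"

text \<open>The value at \<open>(x[1], y[1])\<close>, for \<open>x\<close> of degree \<open>a\<close>, of the quadratic element represented
  by \<open>f\<close>. By the Koszul rule, for \<open>\<xi>\<close>, \<open>\<eta>\<close> of degrees \<open>i\<close>, \<open>j\<close> in \<open>g\<^sup>\<or>[-1]\<close>,
  \<open>(\<xi>\<eta>)(x[1], y[1]) = (\<xi> \<otimes> \<eta> + (-1)\<^bsup>ij\<^esup> \<eta> \<otimes> \<xi>)(x[1] \<otimes> y[1])\<close> with
  \<open>(\<xi> \<otimes> \<eta>)(x[1] \<otimes> y[1]) = (-1)\<^bsup>j(a-1)\<^esup> \<xi>(x) \<eta>(y)\<close>. The value depends on \<open>f\<close>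
  only through its class in the symmetric algebra.\<close>

definition quadratic_value :: "('k::field, 'g \<Rightarrow> 'k) words \<Rightarrow> int \<Rightarrow> 'g \<Rightarrow> 'g \<Rightarrow> 'k" where
  "quadratic_value f a x y = (\<Sum>w\<in>{w. f w \<noteq> 0}. f w *
     (case w of
        [(i, \<xi>), (j, \<eta>)] \<Rightarrow> (-1) powi (j * (a - 1)) * \<xi> x * \<eta> y +
                            (-1) powi (i * j) * (-1) powi (i * (a - 1)) * \<eta> x * \<xi> y
      | _ \<Rightarrow> 0))"

text \<open>A functional \<open>\<xi>\<close> has degree \<open>i - 1\<close> if it lies in degree \<open>i\<close> of \<open>g\<^sup>\<or>[-1]\<close>.\<close>

definition CE_d1 :: "('k::field, 'g) dg_lie \<Rightarrow> ('k, 'g) CE \<Rightarrow> ('k, 'g) CE" where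
  "CE_d1 g = (SOME D. derivation (CE_alg g) D \<and>
     (\<forall>i. \<forall>\<xi>\<in>grade (CE_gens g) i. \<exists>f\<in>carrier (word_algebra (CE_gens g)).
        (\<forall>w. f w \<noteq> 0 \<longrightarrow> length w = 2) \<and>
        D (sym_gen (CE_gens g) i \<xi>) = sym_class (CE_gens g) f \<and>
        (\<forall>a b. \<forall>x\<in>grade g a. \<forall>y\<in>grade g b.
           quadratic_value f a x y = (-1) powi ((i - 1) + 1 + a) * \<xi> (bracket g x y))))"

definition CE_diff :: "('k::field, 'g) dg_lie \<Rightarrow> ('k, 'g) CE \<Rightarrow> ('k, 'g) CE" where
  "CE_diff g c = CE_d0 g c \<oplus>\<^bsub>CE_alg g\<^esub> CE_d1 g c"

definition CE :: "('k::field, 'g) dg_lie \<Rightarrow> ('k, ('k, 'g) CE) dg" where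
  "CE g = graded.extend (CE_alg g) (dg.fields (CE_diff g))"


section \<open>Tensor products over the ground field\<close>

type_synonym ('k, 'c, 'm) tens = "('c \<times> 'm \<Rightarrow> 'k) set"

definition tensor_free ::
    "('k::field, 'c, 'e) module_scheme \<Rightarrow> ('k, 'm, 'f) module_scheme \<Rightarrow> ('k, 'c \<times> 'm \<Rightarrow> 'k) module" where
  "tensor_free C M = free_module (carrier C \<times> carrier M)"

definition tensor_null ::
    "('k::field, 'c, 'e) module_scheme \<Rightarrow> ('k, 'm, 'f) module_scheme \<Rightarrow> ('c \<times> 'm \<Rightarrow> 'k) set" where
  "tensor_null C M = linear_span scalars (tensor_free C M)
     ({(\<lambda>p. single (c \<oplus>\<^bsub>C\<^esub> c', m) p - single (c, m) p - single (c', m) p) | c c' m.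
         c \<in> carrier C \<and> c' \<in> carrier C \<and> m \<in> carrier M} \<union>
      {(\<lambda>p. single (c, m \<oplus>\<^bsub>M\<^esub> m') p - single (c, m) p - single (c, m') p) | c m m'.
         c \<in> carrier C \<and> m \<in> carrier M \<and> m' \<in> carrier M} \<union>
      {(\<lambda>p. single (a \<odot>\<^bsub>C\<^esub> c, m) p - a * single (c, m) p) | a c m.
         c \<in> carrier C \<and> m \<in> carrier M} \<union>
      {(\<lambda>p. single (c, a \<odot>\<^bsub>M\<^esub> m) p - a * single (c, m) p) | a c m.
         c \<in> carrier C \<and> m \<in> carrier M})"

definition tensor_space ::
    "('k::field, 'c, 'e) module_scheme \<Rightarrow> ('k, 'm, 'f) module_scheme \<Rightarrow>
     ('k, ('k, 'c, 'm) tens) module" where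
  "tensor_space C M = \<lparr>
     carrier = a_rcosets\<^bsub>tensor_free C M\<^esub> (tensor_null C M),
     mult = undefined, one = undefined,
     zero = tensor_null C M, add = set_add (tensor_free C M),
     smult = coset_smult (tensor_free C M) (tensor_null C M)\<rparr>"

definition tensor_elem ::
    "('k::field, 'c, 'e) module_scheme \<Rightarrow> ('k, 'm, 'f) module_scheme \<Rightarrow> 'c \<Rightarrow> 'm \<Rightarrow>
     ('k, 'c, 'm) tens" where
  "tensor_elem C M c m = tensor_null C M +>\<^bsub>tensor_free C M\<^esub> single (c, m)"

definition tensor ::
    "('k::field, 'c, 'e) graded_scheme \<Rightarrow> ('k, 'm, 'f) graded_scheme \<Rightarrow>
     ('k, ('k, 'c, 'm) tens) graded" where
  "tensor C M = module.extend (tensor_space C M)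
     (graded.fields (\<lambda>n. linear_span scalars (tensor_space C M)
        {tensor_elem C M c m | c m i j. c \<in> grade C i \<and> m \<in> grade M j \<and> i + j = n}))"

text \<open>The linear map \<open>C \<otimes> M \<rightarrow> W\<close> with \<open>c \<otimes> m \<mapsto> \<beta> c m\<close>, for bilinear \<open>\<beta>\<close>.\<close>

definition tensor_lift ::
    "('k::field, 'w, 'e) module_scheme \<Rightarrow> ('c \<Rightarrow> 'm \<Rightarrow> 'w) \<Rightarrow> ('k, 'c, 'm) tens \<Rightarrow> 'w" where
  "tensor_lift W \<beta> t = (let f = (SOME f. f \<in> t) in
     \<Oplus>\<^bsub>W\<^esub>p\<in>{p. f p \<noteq> 0}. f p \<odot>\<^bsub>W\<^esub> \<beta> (fst p) (snd p))"


section \<open>Cochains with coefficients\<close>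

type_synonym ('k, 'g, 'm) cochain = "('k, ('k, 'g) CE, 'm) tens"

abbreviation cochains ::
    "('k::field, 'g) dg_lie \<Rightarrow> ('k, 'm, 'e) graded_scheme \<Rightarrow> ('k, ('k, 'g, 'm) cochain) graded" where
  "cochains g M \<equiv> tensor (CE_alg g) M"

text \<open>The subspace \<open>C\<^sup>k(g, M) = C\<^sup>k(g) \<otimes> M\<close> of \<open>C(g, M)\<close>.\<close>

definition cochains_power ::
    "('k::field, 'g) dg_lie \<Rightarrow> ('k, 'm, 'e) graded_scheme \<Rightarrow> nat \<Rightarrow> ('k, 'g, 'm) cochain set" where
  "cochains_power g M k = linear_span scalars (cochains g M)
     {tensor_elem (CE_alg g) M c m | c m. c \<in> CE_power g k \<and> m \<in> carrier M}"

definition cochains_act ::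
    "('k::field, 'g) dg_lie \<Rightarrow> ('k, 'm, 'e) graded_scheme \<Rightarrow> ('k, 'g) CE \<Rightarrow>
     ('k, 'g, 'm) cochain \<Rightarrow> ('k, 'g, 'm) cochain" where
  "cochains_act g M c = tensor_lift (cochains g M)
     (\<lambda>c' m. tensor_elem (CE_alg g) M (c \<otimes>\<^bsub>CE_alg g\<^esub> c') m)"

text \<open>\<open>id \<otimes> \<phi>\<close> followed by the multiplication of \<open>C(g)\<close>, for \<open>\<phi>: M \<rightarrow> C(g, N)\<close> of
  degree \<open>0\<close> resp. \<open>1\<close>; the latter carries the Koszul sign
  \<open>(id \<otimes> \<phi>)(c \<otimes> m) = (-1)\<^bsup>|c|\<^esup> c \<phi>(m)\<close>.\<close>

definition extend_even ::
    "('k::field, 'g) dg_lie \<Rightarrow> ('k, 'n, 'e) graded_scheme \<Rightarrow> ('m \<Rightarrow> ('k, 'g, 'n) cochain) \<Rightarrow>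
     ('k, 'g, 'm) cochain \<Rightarrow> ('k, 'g, 'n) cochain" where
  "extend_even g N \<phi> = tensor_lift (cochains g N) (\<lambda>c m. cochains_act g N c (\<phi> m))"

definition extend_odd ::
    "('k::field, 'g) dg_lie \<Rightarrow> ('k, 'n, 'e) graded_scheme \<Rightarrow> ('m \<Rightarrow> ('k, 'g, 'n) cochain) \<Rightarrow>
     ('k, 'g, 'm) cochain \<Rightarrow> ('k, 'g, 'n) cochain" where
  "extend_odd g N \<phi> = tensor_lift (cochains g N)
     (\<lambda>c m. cochains_act g N (parity (CE_alg g) c) (\<phi> m))"

definition total ::
    "('k::field, 'g) dg_lie \<Rightarrow> ('k, 'n, 'e) graded_scheme \<Rightarrow> (nat \<Rightarrow> 'm \<Rightarrow> ('k, 'g, 'n) cochain) \<Rightarrow>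
     'm \<Rightarrow> ('k, 'g, 'n) cochain" where
  "total g N \<phi> m = (\<Oplus>\<^bsub>cochains g N\<^esub>k\<in>{k. \<phi> k m \<noteq> \<zero>\<^bsub>cochains g N\<^esub>}. \<phi> k m)"

text \<open>A family of linear maps \<open>\<phi>\<^sub>k: M \<rightarrow> C\<^sup>k(g, N)\<close> of degree \<open>n\<close>, locally finite in \<open>k\<close>.\<close>

definition locally_finite_family ::
    "int \<Rightarrow> ('k::field, 'g) dg_lie \<Rightarrow> ('k, 'm, 'e) graded_scheme \<Rightarrow> ('k, 'n, 'f) graded_scheme \<Rightarrow>
     (nat \<Rightarrow> 'm \<Rightarrow> ('k, 'g, 'n) cochain) \<Rightarrow> bool" where
  "locally_finite_family n g M N \<phi> \<longleftrightarrow>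
     (\<forall>k. linear_map scalars M (cochains g N) (\<phi> k) \<and>
          has_degree n M (cochains g N) (\<phi> k) \<and>
          \<phi> k ` carrier M \<subseteq> cochains_power g N k) \<and>
     (\<forall>m\<in>carrier M. \<exists>l. \<forall>k\<ge>l. \<phi> k m = \<zero>\<^bsub>cochains g N\<^esub>)"


section \<open>Categories, functors, equivalences\<close>

text \<open>\<open>Comp C X Y Z h f\<close> is the composite of \<open>f: X \<rightarrow> Y\<close> and \<open>h: Y \<rightarrow> Z\<close>. Hom-sets of
  different pairs of objects need not be disjoint.\<close>

record ('o, 'a) category =
  Obj :: "'o set"
  Hom :: "'o \<Rightarrow> 'o \<Rightarrow> 'a set"
  Id :: "'o \<Rightarrow> 'a"
  Comp :: "'o \<Rightarrow> 'o \<Rightarrow> 'o \<Rightarrow> 'a \<Rightarrow> 'a \<Rightarrow> 'a"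

definition is_category :: "('o, 'a) category \<Rightarrow> bool" where
  "is_category C \<longleftrightarrow>
     (\<forall>X\<in>Obj C. Id C X \<in> Hom C X X) \<and>
     (\<forall>X\<in>Obj C. \<forall>Y\<in>Obj C. \<forall>Z\<in>Obj C. \<forall>f\<in>Hom C X Y. \<forall>h\<in>Hom C Y Z. Comp C X Y Z h f \<in> Hom C X Z) \<and>
     (\<forall>X\<in>Obj C. \<forall>Y\<in>Obj C. \<forall>f\<in>Hom C X Y. Comp C X X Y f (Id C X) = f \<and> Comp C X Y Y (Id C Y) f = f) \<and>
     (\<forall>W\<in>Obj C. \<forall>X\<in>Obj C. \<forall>Y\<in>Obj C. \<forall>Z\<in>Obj C. \<forall>f\<in>Hom C W X. \<forall>h\<in>Hom C X Y. \<forall>k\<in>Hom C Y Z.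
        Comp C W X Z (Comp C X Y Z k h) f = Comp C W Y Z k (Comp C W X Y h f))"

definition full_subcategory :: "('o, 'a) category \<Rightarrow> 'o set \<Rightarrow> ('o, 'a) category" where
  "full_subcategory C S = C\<lparr>Obj := Obj C \<inter> S\<rparr>"

record ('o, 'a, 'p, 'b) cat_map =
  on_obj :: "'o \<Rightarrow> 'p"
  on_hom :: "'o \<Rightarrow> 'o \<Rightarrow> 'a \<Rightarrow> 'b"

definition is_functor :: "('o, 'a) category \<Rightarrow> ('p, 'b) category \<Rightarrow> ('o, 'a, 'p, 'b) cat_map \<Rightarrow> bool" where
  "is_functor C D F \<longleftrightarrow> is_category C \<and> is_category D \<and>
     (\<forall>X\<in>Obj C. on_obj F X \<in> Obj D) \<and>
     (\<forall>X\<in>Obj C. \<forall>Y\<in>Obj C. \<forall>f\<in>Hom C X Y. on_hom F X Y f \<in> Hom D (on_obj F X) (on_obj F Y)) \<and>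
     (\<forall>X\<in>Obj C. on_hom F X X (Id C X) = Id D (on_obj F X)) \<and>
     (\<forall>X\<in>Obj C. \<forall>Y\<in>Obj C. \<forall>Z\<in>Obj C. \<forall>f\<in>Hom C X Y. \<forall>h\<in>Hom C Y Z.
        on_hom F X Z (Comp C X Y Z h f) =
        Comp D (on_obj F X) (on_obj F Y) (on_obj F Z) (on_hom F Y Z h) (on_hom F X Y f))"

definition fully_faithful :: "('o, 'a) category \<Rightarrow> ('p, 'b) category \<Rightarrow> ('o, 'a, 'p, 'b) cat_map \<Rightarrow> bool" where
  "fully_faithful C D F \<longleftrightarrow> is_functor C D F \<and>
     (\<forall>X\<in>Obj C. \<forall>Y\<in>Obj C. bij_betw (on_hom F X Y) (Hom C X Y) (Hom D (on_obj F X) (on_obj F Y)))"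

definition id_functor :: "('o, 'a, 'o, 'a) cat_map" where
  "id_functor = \<lparr>on_obj = (\<lambda>X. X), on_hom = (\<lambda>X Y f. f)\<rparr>"

definition comp_functor ::
    "('p, 'b, 'q, 'c) cat_map \<Rightarrow> ('o, 'a, 'p, 'b) cat_map \<Rightarrow> ('o, 'a, 'q, 'c) cat_map" where
  "comp_functor G F = \<lparr>on_obj = (\<lambda>X. on_obj G (on_obj F X)),
     on_hom = (\<lambda>X Y f. on_hom G (on_obj F X) (on_obj F Y) (on_hom F X Y f))\<rparr>"

definition is_iso :: "('o, 'a) category \<Rightarrow> 'o \<Rightarrow> 'o \<Rightarrow> 'a \<Rightarrow> bool" where
  "is_iso C X Y f \<longleftrightarrow> f \<in> Hom C X Y \<and>
     (\<exists>h\<in>Hom C Y X. Comp C X Y X h f = Id C X \<and> Comp C Y X Y f h = Id C Y)"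

definition natural_iso ::
    "('o, 'a) category \<Rightarrow> ('p, 'b) category \<Rightarrow> ('o, 'a, 'p, 'b) cat_map \<Rightarrow> ('o, 'a, 'p, 'b) cat_map \<Rightarrow>
     ('o \<Rightarrow> 'b) \<Rightarrow> bool" where
  "natural_iso C D F G \<eta> \<longleftrightarrow>
     (\<forall>X\<in>Obj C. is_iso D (on_obj F X) (on_obj G X) (\<eta> X)) \<and>
     (\<forall>X\<in>Obj C. \<forall>Y\<in>Obj C. \<forall>f\<in>Hom C X Y.
        Comp D (on_obj F X) (on_obj F Y) (on_obj G Y) (\<eta> Y) (on_hom F X Y f) =
        Comp D (on_obj F X) (on_obj G X) (on_obj G Y) (on_hom G X Y f) (\<eta> X))"

definition is_equivalence :: "('o, 'a) category \<Rightarrow> ('p, 'b) category \<Rightarrow> ('o, 'a, 'p, 'b) cat_map \<Rightarrow> bool" where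
  "is_equivalence C D F \<longleftrightarrow> is_functor C D F \<and>
     (\<exists>G \<eta> \<epsilon>. is_functor D C G \<and>
        natural_iso C C id_functor (comp_functor G F) \<eta> \<and>
        natural_iso D D (comp_functor F G) id_functor \<epsilon>)"


section \<open>Differential graded modules\<close>

text \<open>The locale \<^locale>\<open>module\<close> is only available over commutative rings.\<close>

locale dg_module = A?: ring A + internal_direct_sum P "grade P"
  for A :: "('k, 'c, 'e) dg_scheme" (structure) and P :: "('c, 'p, 'f) dg_scheme" (structure) +
  assumes act_closed: "\<lbrakk>c \<in> carrier A; x \<in> carrier P\<rbrakk> \<Longrightarrow> c \<odot>\<^bsub>P\<^esub> x \<in> carrier P"
    and act_l_distr:
      "\<lbrakk>c \<in> carrier A; c' \<in> carrier A; x \<in> carrier P\<rbrakk> \<Longrightarrow>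
       (c \<oplus>\<^bsub>A\<^esub> c') \<odot>\<^bsub>P\<^esub> x = c \<odot>\<^bsub>P\<^esub> x \<oplus>\<^bsub>P\<^esub> c' \<odot>\<^bsub>P\<^esub> x"
    and act_r_distr:
      "\<lbrakk>c \<in> carrier A; x \<in> carrier P; y \<in> carrier P\<rbrakk> \<Longrightarrow>
       c \<odot>\<^bsub>P\<^esub> (x \<oplus>\<^bsub>P\<^esub> y) = c \<odot>\<^bsub>P\<^esub> x \<oplus>\<^bsub>P\<^esub> c \<odot>\<^bsub>P\<^esub> y"
    and act_assoc:
      "\<lbrakk>c \<in> carrier A; c' \<in> carrier A; x \<in> carrier P\<rbrakk> \<Longrightarrow>
       (c \<otimes>\<^bsub>A\<^esub> c') \<odot>\<^bsub>P\<^esub> x = c \<odot>\<^bsub>P\<^esub> (c' \<odot>\<^bsub>P\<^esub> x)"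
    and act_one: "x \<in> carrier P \<Longrightarrow> \<one>\<^bsub>A\<^esub> \<odot>\<^bsub>P\<^esub> x = x"
    and act_degree: "\<lbrakk>c \<in> grade A i; x \<in> grade P j\<rbrakk> \<Longrightarrow> c \<odot>\<^bsub>P\<^esub> x \<in> grade P (i + j)"
    and diff_closed: "x \<in> carrier P \<Longrightarrow> diff P x \<in> carrier P"
    and diff_add:
      "\<lbrakk>x \<in> carrier P; y \<in> carrier P\<rbrakk> \<Longrightarrow> diff P (x \<oplus>\<^bsub>P\<^esub> y) = diff P x \<oplus>\<^bsub>P\<^esub> diff P y"
    and diff_degree: "has_degree 1 P P (diff P)"
    and diff_diff: "x \<in> carrier P \<Longrightarrow> diff P (diff P x) = \<zero>\<^bsub>P\<^esub>"
    and diff_act: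
      "\<lbrakk>c \<in> grade A i; x \<in> carrier P\<rbrakk> \<Longrightarrow>
       diff P (c \<odot>\<^bsub>P\<^esub> x) = diff A c \<odot>\<^bsub>P\<^esub> x \<oplus>\<^bsub>P\<^esub> koszul P i (c \<odot>\<^bsub>P\<^esub> diff P x)"

text \<open>Morphisms are taken to be extensional functions, so that they are determined by their values
  on the carrier.\<close>

definition dgMod :: "('k, 'c) dg \<Rightarrow> (('c, 'p) dg, 'p \<Rightarrow> 'p) category" where
  "dgMod A = \<lparr>
     Obj = {P. dg_module A P},
     Hom = (\<lambda>P Q. {F \<in> extensional (carrier P).
              linear_map A P Q F \<and> has_degree 0 P Q F \<and>
              (\<forall>x\<in>carrier P. F (diff P x) = diff Q (F x))}),
     Id = (\<lambda>P. \<lambda>x\<in>carrier P. x),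
     Comp = (\<lambda>P Q R G F. compose (carrier P) G F)\<rparr>"

text \<open>A free graded module is one with a basis of homogeneous elements.\<close>

definition semifree :: "('k, 'c, 'e) dg_scheme \<Rightarrow> ('c, 'p, 'f) dg_scheme \<Rightarrow> bool" where
  "semifree A P \<longleftrightarrow> (\<exists>B. (\<forall>b\<in>B. \<exists>i. b \<in> grade P i) \<and>
     (\<forall>x\<in>carrier P. \<exists>!c. (\<forall>b. c b \<in> carrier A) \<and> (\<forall>b. b \<notin> B \<longrightarrow> c b = \<zero>\<^bsub>A\<^esub>) \<and>
        finite {b. c b \<noteq> \<zero>\<^bsub>A\<^esub>} \<and>
        x = (\<Oplus>\<^bsub>P\<^esub>b\<in>{b. c b \<noteq> \<zero>\<^bsub>A\<^esub>}. c b \<odot>\<^bsub>P\<^esub> b)))"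

definition fgsMod :: "('k, 'c) dg \<Rightarrow> (('c, 'p) dg, 'p \<Rightarrow> 'p) category" where
  "fgsMod A = full_subcategory (dgMod A) {P. finitely_generated A P \<and> semifree A P}"


section \<open>Locally finite infinity-modules\<close>

text \<open>The field \<open>diff\<close> is the differential \<open>d\<^sup>M\<close>, the field \<open>structure_map\<close> the family of the
  \<open>d\<^sub>k\<^sup>M\<close>.\<close>

record ('k, 'm, 't) dg_family = "('k, 'm) dg" +
  structure_map :: "nat \<Rightarrow> 'm \<Rightarrow> 't"

type_synonym ('k, 'g, 'm) infty_module = "('k, 'm, ('k, 'g, 'm) cochain) dg_family"
type_synonym ('k, 'g, 'm) infty_hom = "nat \<Rightarrow> 'm \<Rightarrow> ('k, 'g, 'm) cochain"

definition d_tot ::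
    "('k::field, 'g) dg_lie \<Rightarrow> ('k, 'g, 'm) infty_module \<Rightarrow>
     ('k, 'g, 'm) cochain \<Rightarrow> ('k, 'g, 'm) cochain" where
  "d_tot g M t =
     tensor_lift (cochains g M) (\<lambda>c m. tensor_elem (CE_alg g) M (CE_diff g c) m) t
       \<oplus>\<^bsub>cochains g M\<^esub> extend_odd g M (total g M (structure_map M)) t"

text \<open>The condition on the zeroth structure map is \<open>d\<^sub>0\<^sup>M = d\<^sup>M\<close> under
  \<open>C\<^sup>0(g, M) = M\<close>.\<close>

definition is_infty_module :: "('k::field, 'g) dg_lie \<Rightarrow> ('k, 'g, 'm) infty_module \<Rightarrow> bool" where
  "is_infty_module g M \<longleftrightarrow> finite_dim_complex M \<and>
     locally_finite_family 1 g M M (structure_map M) \<and>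
     (\<forall>m\<in>carrier M. structure_map M 0 m = tensor_elem (CE_alg g) M \<one>\<^bsub>CE_alg g\<^esub> (diff M m)) \<and>
     (\<forall>t\<in>carrier (cochains g M). d_tot g M (d_tot g M t) = \<zero>\<^bsub>cochains g M\<^esub>)"

definition infty_extension ::
    "('k::field, 'g) dg_lie \<Rightarrow> ('k, 'g, 'm) infty_module \<Rightarrow> ('k, 'g, 'm) infty_hom \<Rightarrow>
     ('k, 'g, 'm) cochain \<Rightarrow> ('k, 'g, 'm) cochain" where
  "infty_extension g N f = extend_even g N (total g N f)"

definition is_infty_hom ::
    "('k::field, 'g) dg_lie \<Rightarrow> ('k, 'g, 'm) infty_module \<Rightarrow> ('k, 'g, 'm) infty_module \<Rightarrow>
     ('k, 'g, 'm) infty_hom \<Rightarrow> bool" where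
  "is_infty_hom g M N f \<longleftrightarrow> locally_finite_family 0 g M N f \<and>
     (\<forall>t\<in>carrier (cochains g M).
        infty_extension g N f (d_tot g M t) = d_tot g N (infty_extension g N f t))"

text \<open>The composite is the family whose extension is the composite of the extensions: its
  \<open>k\<close>-th member is the \<open>C\<^sup>k(g, L)\<close>-component of that composite restricted to \<open>M\<close>.\<close>

definition lfMod ::
    "('k::field, 'g) dg_lie \<Rightarrow> (('k, 'g, 'm) infty_module, ('k, 'g, 'm) infty_hom) category" where
  "lfMod g = \<lparr>
     Obj = {M. is_infty_module g M},
     Hom = (\<lambda>M N. {f. (\<forall>k. f k \<in> extensional (carrier M)) \<and> is_infty_hom g M N f}),
     Id = (\<lambda>M k. \<lambda>m\<in>carrier M.
             if k = 0 then tensor_elem (CE_alg g) M \<one>\<^bsub>CE_alg g\<^esub> m else \<zero>\<^bsub>cochains g M\<^esub>),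
     Comp = (\<lambda>M N L h f k. \<lambda>m\<in>carrier M.
             component (cochains g L) (cochains_power g L) k
               (infty_extension g L h (infty_extension g N f
                  (tensor_elem (CE_alg g) M \<one>\<^bsub>CE_alg g\<^esub> m))))\<rparr>"


section \<open>The Chevalley-Eilenberg functor\<close>

text \<open>The type \<open>'m\<close> is the universe in which the carriers of infinity-modules live; the target
  category then consists of the dg modules whose carriers lie in the type of \<open>C(g, M)\<close>. Every
  finite dimensional space has a copy in \<open>'m\<close> as soon as the ground field embeds into \<open>'m\<close> as a
  set; without this, \<open>lfMod g\<close> contains only zero modules.\<close>

definition CE_module ::
    "('k::field, 'g) dg_lie \<Rightarrow> ('k, 'g, 'm) infty_module \<Rightarrow>
     (('k, 'g) CE, ('k, 'g, 'm) cochain) dg" where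
  "CE_module g M = \<lparr>
     carrier = carrier (cochains g M), mult = undefined, one = undefined,
     zero = zero (cochains g M), add = add (cochains g M),
     smult = cochains_act g M,
     grade = grade (cochains g M),
     diff = d_tot g M\<rparr>"

definition CE_functor ::
    "('k::field, 'g) dg_lie \<Rightarrow>
     (('k, 'g, 'm) infty_module, ('k, 'g, 'm) infty_hom,
      (('k, 'g) CE, ('k, 'g, 'm) cochain) dg, ('k, 'g, 'm) cochain \<Rightarrow> ('k, 'g, 'm) cochain) cat_map" where
  "CE_functor g = \<lparr>
     on_obj = CE_module g,
     on_hom = (\<lambda>M N f. restrict (infty_extension g N f) (carrier (cochains g M)))\<rparr>"

end

theory Submission
  imports Defs
begin

text \<open>A \<open>C(g)\<close>-linear map \<open>F: C(g, M) \<rightarrow> C(g, N)\<close> is determined by its values on \<open>1 \<otimes> m\<close>, and these are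
  recovered from their components in the subspaces \<open>C\<^sup>k(g, N)\<close>, only finitely many of which are nonzero;
  this makes the functor bijective on morphisms.

  If \<open>P\<close> is semifree and finitely generated, the basis occurring in the generators is finite, so that,
  forgetting differentials, \<open>P\<close> is \<open>C(g) \<otimes> M\<close> for the graded vector space \<open>M\<close> spanned by the basis.
  The differential pulled back from \<open>P\<close> satisfies the Leibniz rule over \<open>C(g)\<close>, so it is the total
  differential of the components of its restriction to \<open>1 \<otimes> M\<close>. The component in \<open>C\<^sup>0(g, M) = M\<close> is a
  differential because the augmentation \<open>C(g) \<rightarrow> k\<close> kills the image of the differential of \<open>C(g)\<close>.

  Both parts need that \<open>C(g)\<close> is graded by degree and by word length and that the derivations
  in the Chevalley-Eilenberg differential exist: maps out of the symmetric algebra are given by functions on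
  words which respect the relations in every context.\<close>

section \<open>Vector spaces over the ground field: sums, linear maps, spans, direct sums,
  homogeneous bases\<close>

section \<open>Linear algebra\<close>

text \<open>The two parts of the differential of C(g) are given only by \<open>SOME\<close>, so
  nothing is known about them until operators with the selecting properties are exhibited. For the
  bracket part this takes structure constants in a homogeneous basis of g and a division by 2, hence
  characteristic zero. The properties of C(g) used afterwards are collected in the locale
  \<open>CE_algebra\<close>.

  Symmetric algebras and tensor products are quotients of free modules, so every map out of them
  must be shown to respect relations. A homogeneous basis of M keeps this manageable: its coordinate
  functions are linear, they give the projections of C(g, M) onto its degrees, and they exhibit the
  elements 1 \<otimes> b as free generators.

  In essential surjectivity the basis consists of cochains, whereas M must have its elements in
  \<open>'m\<close>. So M is a copy of the functions from the basis to k, placed inside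
  \<open>'m\<close> by an injection that factors through k. It exists because an infinite set is as
  large as its square, so that finitely many scalars can be encoded in one.\<close>

lemma scalars_simps [simp]:
  "carrier scalars = UNIV" "x \<otimes>\<^bsub>scalars\<^esub> y = x * y" "\<one>\<^bsub>scalars\<^esub> = 1"
  "\<zero>\<^bsub>scalars\<^esub> = 0" "x \<oplus>\<^bsub>scalars\<^esub> y = x + y"
  by (simp_all add: scalars_def)

lemma cring_scalars: "cring (scalars :: 'k::field ring)"
proof (rule cringI)
  show "abelian_group (scalars :: 'k ring)"
    by (rule abelian_groupI) (auto simp: algebra_simps intro: exI[of _ "- x" for x])
  show "Group.comm_monoid (scalars :: 'k ring)"
    by (rule comm_monoidI) (auto simp: algebra_simps)
qed (auto simp: algebra_simps)

lemma scalars_minus [simp]: "\<ominus>\<^bsub>scalars\<^esub> (x :: 'k::field) = - x"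
proof -
  interpret cring "scalars :: 'k ring" by (rule cring_scalars)
  show ?thesis by (rule minus_equality) auto
qed

lemma vector_spaceI:
  assumes "abelian_group V"
    and "\<And>a x. x \<in> carrier V \<Longrightarrow> a \<odot>\<^bsub>V\<^esub> x \<in> carrier V"
    and "\<And>a b x. x \<in> carrier V \<Longrightarrow> (a + b) \<odot>\<^bsub>V\<^esub> x = a \<odot>\<^bsub>V\<^esub> x \<oplus>\<^bsub>V\<^esub> b \<odot>\<^bsub>V\<^esub> x"
    and "\<And>a x y. x \<in> carrier V \<Longrightarrow> y \<in> carrier V \<Longrightarrow> a \<odot>\<^bsub>V\<^esub> (x \<oplus>\<^bsub>V\<^esub> y) = a \<odot>\<^bsub>V\<^esub> x \<oplus>\<^bsub>V\<^esub> a \<odot>\<^bsub>V\<^esub> y"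
    and "\<And>a b x. x \<in> carrier V \<Longrightarrow> (a * b) \<odot>\<^bsub>V\<^esub> x = a \<odot>\<^bsub>V\<^esub> (b \<odot>\<^bsub>V\<^esub> x)"
    and "\<And>x. x \<in> carrier V \<Longrightarrow> 1 \<odot>\<^bsub>V\<^esub> x = x"
  shows "module scalars V"
  using assms by (intro moduleI cring_scalars) auto

lemma vector_spaceD:
  assumes "module scalars V"
  shows "x \<in> carrier V \<Longrightarrow> a \<odot>\<^bsub>V\<^esub> x \<in> carrier V"
    and "x \<in> carrier V \<Longrightarrow> (a + b) \<odot>\<^bsub>V\<^esub> x = a \<odot>\<^bsub>V\<^esub> x \<oplus>\<^bsub>V\<^esub> b \<odot>\<^bsub>V\<^esub> x"
    and "x \<in> carrier V \<Longrightarrow> y \<in> carrier V \<Longrightarrow> a \<odot>\<^bsub>V\<^esub> (x \<oplus>\<^bsub>V\<^esub> y) = a \<odot>\<^bsub>V\<^esub> x \<oplus>\<^bsub>V\<^esub> a \<odot>\<^bsub>V\<^esub> y"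
    and "x \<in> carrier V \<Longrightarrow> (a * b) \<odot>\<^bsub>V\<^esub> x = a \<odot>\<^bsub>V\<^esub> (b \<odot>\<^bsub>V\<^esub> x)"
    and "x \<in> carrier V \<Longrightarrow> 1 \<odot>\<^bsub>V\<^esub> x = x"
    and "x \<in> carrier V \<Longrightarrow> 0 \<odot>\<^bsub>V\<^esub> x = \<zero>\<^bsub>V\<^esub>"
    and "a \<odot>\<^bsub>V\<^esub> \<zero>\<^bsub>V\<^esub> = \<zero>\<^bsub>V\<^esub>"
    and "x \<in> carrier V \<Longrightarrow> \<ominus>\<^bsub>V\<^esub> x = (- 1) \<odot>\<^bsub>V\<^esub> x"
    and "abelian_group V"
  using module.smult_closed[OF assms] module.smult_l_distr[OF assms]
    module.smult_r_distr[OF assms] module.smult_assoc1[OF assms] module.smult_one[OF assms]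
    module.smult_l_null[OF assms] module.smult_r_null[OF assms]
    module.smult_l_minus[OF assms, of "\<one>\<^bsub>scalars\<^esub>"] module.axioms(2)[OF assms]
  by auto

text \<open>Many records below share carrier, addition and zero and differ in other fields, such as
  \<open>CE_module g M\<close> and \<open>cochains g M\<close>. Sums, inverses and decompositions
  move between them by this and the following congruences.\<close>

lemma finsum_ring_cong:
  assumes "carrier V = carrier W" "add V = add W" "zero V = zero W"
  shows "finsum V = finsum W"
proof -
  have "finsum V f A = finsum W f A" for f :: "'i \<Rightarrow> 'a" and A
    using assms by (simp add: finsum_def finprod_def)
  then show ?thesis by blast
qed

lemma abelian_group_cong:
  assumes "carrier V = carrier W" "add V = add W" "zero V = zero W" "abelian_group V"
  shows "abelian_group W"
  using abelian_groupE[OF assms(4)] assms(1-3) by (intro abelian_groupI) auto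

lemma a_inv_cong:
  assumes "carrier V = carrier W" "add V = add W" "zero V = zero W"
  shows "a_inv V = a_inv W"
  using assms by (simp add: a_inv_def m_inv_def fun_eq_iff)

lemma additive_subgroup_cong:
  assumes "carrier V = carrier W" "add V = add W" "zero V = zero W" "additive_subgroup A V"
  shows "additive_subgroup A W"
proof -
  have "m_inv (add_monoid V) = m_inv (add_monoid W)"
    using assms(1-3) by (simp add: m_inv_def fun_eq_iff)
  then show ?thesis
    using assms unfolding additive_subgroup_def subgroup_def by simp
qed

lemma internal_direct_sum_cong:
  assumes "carrier V = carrier W" "add V = add W" "zero V = zero W" "internal_direct_sum V A"
  shows "internal_direct_sum W A"
proof -
  interpret V: internal_direct_sum V A by fact
  show ?thesis
  proof (intro internal_direct_sum.intro internal_direct_sum_axioms.intro)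
    show "abelian_group W"
      using abelian_group_cong[OF assms(1-3)] V.abelian_group_axioms by blast
    show "additive_subgroup (A i) W" for i
      using additive_subgroup_cong[OF assms(1-3) V.summand] .
    show "\<exists>!f. decomposes W A x f" if "x \<in> carrier W" for x
      using V.decomposition[of x] that
      by (simp add: decomposes_def finsum_ring_cong[OF assms(1-3)] assms(1,3))
  qed
qed

lemma (in abelian_monoid) finsum_superset:
  assumes "finite J" "I \<subseteq> J" "\<And>i. i \<in> J - I \<Longrightarrow> f i = \<zero>" "f \<in> J \<rightarrow> carrier G"
  shows "finsum G f I = finsum G f J"
  using assms by (intro add.finprod_mono_neutral_cong_left) auto

lemma (in abelian_monoid) finsum_delta:
  assumes "finite J" "k \<in> J" "x \<in> carrier G"
  shows "(\<Oplus>i\<in>J. if i = k then x else \<zero>) = x"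
proof -
  have "(\<Oplus>i\<in>J. if i = k then x else \<zero>) = (\<Oplus>i\<in>{k}. if i = k then x else \<zero>)"
    using assms by (intro finsum_superset[symmetric]) auto
  then show ?thesis using assms by simp
qed

subsection \<open>Linear maps and spans\<close>

lemma linear_mapI:
  assumes "\<And>x. x \<in> carrier V \<Longrightarrow> f x \<in> carrier W"
    and "\<And>x y. x \<in> carrier V \<Longrightarrow> y \<in> carrier V \<Longrightarrow> f (x \<oplus>\<^bsub>V\<^esub> y) = f x \<oplus>\<^bsub>W\<^esub> f y"
    and "\<And>a x. a \<in> carrier R \<Longrightarrow> x \<in> carrier V \<Longrightarrow> f (a \<odot>\<^bsub>V\<^esub> x) = a \<odot>\<^bsub>W\<^esub> f x"
  shows "linear_map R V W f"
  using assms unfolding linear_map_def by auto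

lemma linear_mapD:
  assumes "linear_map R V W f"
  shows "x \<in> carrier V \<Longrightarrow> f x \<in> carrier W"
    and "x \<in> carrier V \<Longrightarrow> y \<in> carrier V \<Longrightarrow> f (x \<oplus>\<^bsub>V\<^esub> y) = f x \<oplus>\<^bsub>W\<^esub> f y"
    and "a \<in> carrier R \<Longrightarrow> x \<in> carrier V \<Longrightarrow> f (a \<odot>\<^bsub>V\<^esub> x) = a \<odot>\<^bsub>W\<^esub> f x"
  using assms unfolding linear_map_def by auto

lemma linear_mapD':
  assumes "linear_map scalars V W f"
  shows "x \<in> carrier V \<Longrightarrow> f x \<in> carrier W"
    and "x \<in> carrier V \<Longrightarrow> y \<in> carrier V \<Longrightarrow> f (x \<oplus>\<^bsub>V\<^esub> y) = f x \<oplus>\<^bsub>W\<^esub> f y"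
    and "x \<in> carrier V \<Longrightarrow> f (a \<odot>\<^bsub>V\<^esub> x) = a \<odot>\<^bsub>W\<^esub> f x"
  using linear_mapD[OF assms] by auto

lemma linear_map_zero:
  assumes "linear_map R V W f" "abelian_group V" "abelian_group W"
  shows "f \<zero>\<^bsub>V\<^esub> = \<zero>\<^bsub>W\<^esub>"
proof -
  interpret V: abelian_group V by fact
  interpret W: abelian_group W by fact
  note f = linear_mapD[OF assms(1)]
  have "f \<zero>\<^bsub>V\<^esub> \<oplus>\<^bsub>W\<^esub> f \<zero>\<^bsub>V\<^esub> = f \<zero>\<^bsub>V\<^esub>"
    using f(2)[of "\<zero>\<^bsub>V\<^esub>" "\<zero>\<^bsub>V\<^esub>"] by simp
  then show ?thesis using f(1)[of "\<zero>\<^bsub>V\<^esub>"] by (metis V.zero_closed W.add.r_cancel_one')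
qed

lemma linear_map_minus:
  assumes "linear_map R V W f" "abelian_group V" "abelian_group W" "x \<in> carrier V"
  shows "f (\<ominus>\<^bsub>V\<^esub> x) = \<ominus>\<^bsub>W\<^esub> f x"
proof -
  interpret V: abelian_group V by fact
  interpret W: abelian_group W by fact
  note f = linear_mapD[OF assms(1)]
  have "f (\<ominus>\<^bsub>V\<^esub> x) \<oplus>\<^bsub>W\<^esub> f x = \<zero>\<^bsub>W\<^esub>"
    using f(2)[of "\<ominus>\<^bsub>V\<^esub> x" x] assms(4) linear_map_zero[OF assms(1-3)] by (simp add: V.l_neg)
  then show ?thesis using f(1) assms(4) by (simp add: W.minus_equality)
qed

text \<open>Additivity is what carries the proof, so \<open>R\<close> can be any scalars, later also
  \<open>CE g\<close>. Over an infinite \<open>I\<close> both sums are zero by the convention of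
  \<open>finsum\<close>.\<close>

lemma linear_map_finsum:
  assumes "linear_map R V W f" "abelian_group V" "abelian_group W" "g \<in> I \<rightarrow> carrier V"
  shows "f (\<Oplus>\<^bsub>V\<^esub>i\<in>I. g i) = (\<Oplus>\<^bsub>W\<^esub>i\<in>I. f (g i))"
proof -
  interpret V: abelian_group V by fact
  interpret W: abelian_group W by fact
  note f = linear_mapD[OF assms(1)]
  show ?thesis using assms(4)
  proof (induction I rule: infinite_finite_induct)
    case (infinite I)
    then show ?case by (simp add: linear_map_zero[OF assms(1-3)])
  next
    case empty
    then show ?case by (simp add: linear_map_zero[OF assms(1-3)])
  next
    case (insert i I)
    have "(\<lambda>i. f (g i)) \<in> I \<rightarrow> carrier W" "f (g i) \<in> carrier W"
      using insert f(1) by auto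
    then show ?case using insert f by (simp add: Pi_def)
  qed
qed

lemma linear_map_compose:
  assumes "linear_map R U V f" "linear_map R V W h"
  shows "linear_map R U W (\<lambda>x. h (f x))"
  using linear_mapD[OF assms(1)] linear_mapD[OF assms(2)] by (intro linear_mapI) auto

lemma linear_map_add:
  assumes "linear_map scalars V W f" "linear_map scalars V W h" "module scalars V" "module scalars W"
  shows "linear_map scalars V W (\<lambda>x. f x \<oplus>\<^bsub>W\<^esub> h x)"
proof -
  interpret V: module scalars V by fact
  interpret W: module scalars W by fact
  note f = linear_mapD[OF assms(1)] and h = linear_mapD[OF assms(2)]
  show ?thesis
    by (rule linear_mapI) (use f h in \<open>auto simp: W.a_ac W.smult_r_distr V.smult_closed\<close>)
qed

lemma linear_map_smult:
  assumes "linear_map scalars V W f" "module scalars V" "module scalars W"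
  shows "linear_map scalars V W (\<lambda>x. a \<odot>\<^bsub>W\<^esub> f x)"
proof -
  interpret V: module scalars V by fact
  interpret W: module scalars W by fact
  note f = linear_mapD[OF assms(1)]
  show ?thesis
    by (rule linear_mapI)
      (use f in \<open>auto simp: W.smult_r_distr V.smult_closed mult.commute
         simp flip: vector_spaceD(4)[OF assms(3)]\<close>)
qed

lemma linear_map_finsum_fun:
  assumes "module scalars V" "module scalars W" "\<And>i. i \<in> I \<Longrightarrow> linear_map scalars V W (f i)"
  shows "linear_map scalars V W (\<lambda>x. \<Oplus>\<^bsub>W\<^esub>i\<in>I. f i x)"
proof -
  interpret V: module scalars V by fact
  interpret W: module scalars W by fact
  show ?thesis
    using assms(3)
  proof (induction I rule: infinite_finite_induct)
    case (insert i I)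
    have "linear_map scalars V W (\<lambda>x. f i x \<oplus>\<^bsub>W\<^esub> (\<Oplus>\<^bsub>W\<^esub>i\<in>I. f i x))"
      using insert by (intro linear_map_add[OF _ _ assms(1,2)]) auto
    moreover have "(\<Oplus>\<^bsub>W\<^esub>i\<in>insert i I. f i x) = f i x \<oplus>\<^bsub>W\<^esub> (\<Oplus>\<^bsub>W\<^esub>i\<in>I. f i x)" if "x \<in> carrier V" for x
    proof (rule W.finsum_insert[OF insert(1,2)])
      show "(\<lambda>i. f i x) \<in> I \<rightarrow> carrier W" "f i x \<in> carrier W"
        using linear_mapD(1)[OF insert(4)] that by auto
    qed
    ultimately show ?case by (auto simp: linear_map_def)
  qed (auto intro!: linear_mapI)
qed

lemma submodule_linear_span:
  assumes "module R V" "S \<subseteq> carrier V"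
  shows "submodule (linear_span R V S) R V"
proof -
  interpret V: module R V by fact
  have c: "carrier V \<in> {H. submodule H R V \<and> S \<subseteq> H}"
    using V.carrier_is_submodule assms by auto
  show ?thesis
    unfolding linear_span_def using c V.submoduleE
    by (intro V.submoduleI) (auto simp: submodule_def subgroup.one_closed[of _ "add_monoid V", simplified])
qed

lemma linear_span_superset: "S \<subseteq> linear_span R V S"
  by (auto simp: linear_span_def)

lemma linear_span_least: "submodule H R V \<Longrightarrow> S \<subseteq> H \<Longrightarrow> linear_span R V S \<subseteq> H"
  by (auto simp: linear_span_def)

lemma submoduleD:
  assumes "submodule H R V" "module R V"
  shows "H \<subseteq> carrier V" "\<zero>\<^bsub>V\<^esub> \<in> H" "\<And>x y. x \<in> H \<Longrightarrow> y \<in> H \<Longrightarrow> x \<oplus>\<^bsub>V\<^esub> y \<in> H"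
    "\<And>a x. a \<in> carrier R \<Longrightarrow> x \<in> H \<Longrightarrow> a \<odot>\<^bsub>V\<^esub> x \<in> H" "\<And>x. x \<in> H \<Longrightarrow> \<ominus>\<^bsub>V\<^esub> x \<in> H"
  using module.submoduleE[OF assms(2,1)] subgroup.one_closed[of H "add_monoid V"] assms(1)
  by (auto simp: submodule_def)

lemma submodule_additive: "submodule H R V \<Longrightarrow> additive_subgroup H V"
  by (simp add: submodule_def additive_subgroup_def)

lemma submodule_finsum:
  assumes "submodule H R V" "module R V" "f \<in> I \<rightarrow> H"
  shows "(\<Oplus>\<^bsub>V\<^esub>i\<in>I. f i) \<in> H"
proof -
  interpret V: module R V by fact
  note H = submoduleD[OF assms(1,2)]
  show ?thesis using assms(3)
  proof (induction I rule: infinite_finite_induct)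
    case (insert i I)
    then have "f \<in> I \<rightarrow> carrier V" "f i \<in> carrier V" using H(1) by auto
    then show ?case using insert H by auto
  qed (use H in auto)
qed

lemma submodule_vimage:
  assumes "linear_map R V W f" "module R V" "module R W" "submodule H R W"
  shows "submodule {x \<in> carrier V. f x \<in> H} R V"
proof -
  interpret V: module R V by fact
  interpret W: module R W by fact
  note f = linear_mapD[OF assms(1)]
  note f0 = linear_map_zero[OF assms(1) V.abelian_group_axioms W.abelian_group_axioms]
  note fm = linear_map_minus[OF assms(1) V.abelian_group_axioms W.abelian_group_axioms]
  note H = submoduleD[OF assms(4,3)]
  show ?thesis
    by (rule V.submoduleI) (use f f0 fm H in auto)
qed

lemma submodule_equalizer:
  assumes "linear_map R V W f" "linear_map R V W h" "module R V" "module R W"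
  shows "submodule {x \<in> carrier V. f x = h x} R V"
proof -
  interpret V: module R V by fact
  interpret W: module R W by fact
  note f = linear_mapD[OF assms(1)] and h = linear_mapD[OF assms(2)]
  note f0 = linear_map_zero[OF _ V.abelian_group_axioms W.abelian_group_axioms]
  note fm = linear_map_minus[OF _ V.abelian_group_axioms W.abelian_group_axioms]
  show ?thesis
    by (rule V.submoduleI)
      (use f h f0[OF assms(1)] f0[OF assms(2)] fm[OF assms(1)] fm[OF assms(2)] in auto)
qed

lemma submodule_zero: "module R V \<Longrightarrow> submodule {\<zero>\<^bsub>V\<^esub>} R V"
proof -
  assume "module R V"
  then interpret V: module R V .
  show ?thesis by (rule V.submoduleI) auto
qed

text \<open>The equalizer of two linear maps is a submodule. Comparisons of maps on free modules and
  on graded pieces of tensor products are reduced to generators in this way.\<close>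

lemma linear_map_eq_on_span:
  assumes "linear_map R V W f" "linear_map R V W h" "module R V" "module R W"
    and "S \<subseteq> carrier V" "\<And>x. x \<in> S \<Longrightarrow> f x = h x" "x \<in> linear_span R V S"
  shows "f x = h x"
  using linear_span_least[OF submodule_equalizer[OF assms(1-4)], of S] assms(5-7) by auto

lemma linear_map_span_into:
  assumes "linear_map R V W f" "module R V" "module R W" "submodule H R W"
    and "S \<subseteq> carrier V" "\<And>x. x \<in> S \<Longrightarrow> f x \<in> H" "x \<in> linear_span R V S"
  shows "f x \<in> H"
  using linear_span_least[OF submodule_vimage[OF assms(1-4)], of S] assms(5-7) by auto

lemma finsum_in_linear_span:
  assumes "module R V" "S \<subseteq> carrier V" "\<And>i. i \<in> I \<Longrightarrow> f i \<in> linear_span R V S"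
  shows "(\<Oplus>\<^bsub>V\<^esub>i\<in>I. f i) \<in> linear_span R V S"
  using assms by (intro submodule_finsum[OF submodule_linear_span]) auto

subsection \<open>Internal direct sums\<close>

context internal_direct_sum
begin

lemma summand_closed: "A i \<subseteq> carrier V" "\<zero> \<in> A i" "x \<in> A i \<Longrightarrow> y \<in> A i \<Longrightarrow> x \<oplus> y \<in> A i"
  by (fact additive_subgroup.a_subset[OF summand] additive_subgroup.zero_closed[OF summand]
    additive_subgroup.a_closed[OF summand])+

lemma decomposes_component:
  assumes "x \<in> carrier V" shows "decomposes V A x (\<lambda>i. component V A i x)"
  using theI'[OF decomposition[OF assms]] by (simp add: component_def)

lemma component_in: "x \<in> carrier V \<Longrightarrow> component V A i x \<in> A i"
  using decomposes_component[of x] unfolding decomposes_def by blast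

lemma component_closed: "x \<in> carrier V \<Longrightarrow> component V A i x \<in> carrier V"
  using component_in summand_closed(1) by blast

lemma finite_support: "x \<in> carrier V \<Longrightarrow> finite {i. component V A i x \<noteq> \<zero>}"
  using decomposes_component[of x] unfolding decomposes_def by blast

lemma sum_support:
  assumes "x \<in> carrier V"
  shows "(\<Oplus>i\<in>{i. component V A i x \<noteq> \<zero>}. component V A i x) = x"
  by (rule sym) (use decomposes_component[OF assms] in \<open>unfold decomposes_def, blast\<close>)

lemma sum_components:
  assumes "x \<in> carrier V" "finite J" "\<And>i. i \<notin> J \<Longrightarrow> component V A i x = \<zero>"
  shows "(\<Oplus>i\<in>J. component V A i x) = x"
proof -
  have "(\<Oplus>i\<in>J. component V A i x) = (\<Oplus>i\<in>{i. component V A i x \<noteq> \<zero>}. component V A i x)"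
    using assms(2,3) component_closed[OF assms(1)] by (intro finsum_superset[symmetric]) auto
  then show ?thesis using sum_support[OF assms(1)] by simp
qed

text \<open>\<open>J\<close> may be larger than the support of \<open>f\<close>; this lets sums over
  unions of supports be read off as decompositions.\<close>

lemma component_eqI:
  assumes "finite J" "\<And>i. i \<in> J \<Longrightarrow> f i \<in> A i" "\<And>i. i \<notin> J \<Longrightarrow> f i = \<zero>" "x = (\<Oplus>i\<in>J. f i)"
  shows "component V A i x = f i"
proof -
  have A: "f i \<in> A i" for i using assms(2,3) summand_closed(2) by (cases "i \<in> J") auto
  then have c: "f i \<in> carrier V" for i using summand_closed(1) by blast
  have s: "{i. f i \<noteq> \<zero>} \<subseteq> J" using assms(3) by auto
  have "x = (\<Oplus>i\<in>{i. f i \<noteq> \<zero>}. f i)"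
    unfolding assms(4) using c by (intro finsum_superset[OF assms(1) s, symmetric]) auto
  then have f: "decomposes V A x f"
    unfolding decomposes_def by (intro conjI allI A finite_subset[OF s assms(1)])
  have x: "x \<in> carrier V" unfolding assms(4) using c by (intro finsum_closed) auto
  obtain h where h: "\<And>h'. decomposes V A x h' \<Longrightarrow> h' = h"
    using decomposition[OF x] by (elim ex1E) blast
  have "(\<lambda>i. component V A i x) = f"
    using h[OF decomposes_component[OF x]] h[OF f] by simp
  then show ?thesis by (rule fun_cong)
qed

lemma component_delta:
  assumes "x \<in> A i" shows "component V A j x = (if j = i then x else \<zero>)"
proof (rule component_eqI[of "{i}"])
  have "x \<in> carrier V" using assms summand_closed(1) by blast
  then show "x = (\<Oplus>j\<in>{i}. if j = i then x else \<zero>)" by simp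
qed (use assms in auto)

lemma component_same: "x \<in> A i \<Longrightarrow> component V A i x = x"
  and component_other: "x \<in> A i \<Longrightarrow> j \<noteq> i \<Longrightarrow> component V A j x = \<zero>"
  by (simp_all add: component_delta)

lemma component_add:
  assumes "x \<in> carrier V" "y \<in> carrier V"
  shows "component V A i (x \<oplus> y) = component V A i x \<oplus> component V A i y"
proof -
  let ?J = "{i. component V A i x \<noteq> \<zero>} \<union> {i. component V A i y \<noteq> \<zero>}"
  have J: "finite ?J" using finite_support[OF assms(1)] finite_support[OF assms(2)] by blast
  have "(\<Oplus>i\<in>?J. component V A i x) = x"
    by (rule sum_components[OF assms(1) J]) blast
  moreover have "(\<Oplus>i\<in>?J. component V A i y) = y"
    by (rule sum_components[OF assms(2) J]) blast
  ultimately have "x \<oplus> y = (\<Oplus>i\<in>?J. component V A i x) \<oplus> (\<Oplus>i\<in>?J. component V A i y)"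
    by (simp only:)
  also have "\<dots> = (\<Oplus>i\<in>?J. component V A i x \<oplus> component V A i y)"
    using component_closed[OF assms(1)] component_closed[OF assms(2)]
    by (intro finsum_addf[symmetric]) auto
  finally show ?thesis
    using component_in[OF assms(1)] component_in[OF assms(2)]
    by (intro component_eqI[OF J, where f = "\<lambda>i. component V A i x \<oplus> component V A i y"])
      (simp_all add: summand_closed(3))
qed

end

lemma component_linear:
  fixes V (structure)
  assumes "internal_direct_sum V A" "module R V" "\<And>i. submodule (A i) R V"
  shows "linear_map R V V (component V A i)"
proof (rule linear_mapI)
  interpret internal_direct_sum V A by fact
  interpret M: module R V by fact
  fix a x assume a: "a \<in> carrier R" and x: "x \<in> carrier V"
  let ?J = "{i. component V A i x \<noteq> \<zero>}"
  have "a \<odot> x = a \<odot> (\<Oplus>i\<in>?J. component V A i x)" by (simp only: sum_support[OF x])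
  also have "\<dots> = (\<Oplus>i\<in>?J. a \<odot> component V A i x)"
    using a component_closed[OF x] by (intro M.finsum_smult_ldistr finite_support[OF x]) auto
  finally have *: "a \<odot> x = (\<Oplus>i\<in>?J. a \<odot> component V A i x)" .
  show "component V A i (a \<odot> x) = a \<odot> component V A i x"
    by (rule component_eqI[OF finite_support[OF x] _ _ *])
      (use component_in[OF x] a submoduleD(4)[OF assms(3,2)] in simp_all)
qed (fact internal_direct_sum.component_closed[OF assms(1)]
    internal_direct_sum.component_add[OF assms(1)])+

lemma (in internal_direct_sum) eq_by_components:
  assumes "x \<in> carrier V" "y \<in> carrier V" "\<And>i. component V A i x = component V A i y"
  shows "x = y"
proof -
  have "(\<Oplus>i\<in>{i. component V A i x \<noteq> \<zero>}. component V A i x) =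
      (\<Oplus>i\<in>{i. component V A i y \<noteq> \<zero>}. component V A i y)"
    by (simp only: assms(3))
  then show ?thesis by (simp only: sum_support[OF assms(1)] sum_support[OF assms(2)])
qed

text \<open>Existence of decompositions holds on a submodule containing all summands, hence
  everywhere by \<open>span\<close>; uniqueness follows by applying the projections to a
  decomposition. The gradings of the dual, of the symmetric algebra and of C(g, M) all come from
  this criterion, which also makes the abstract \<open>component\<close> computable as
  \<open>p i\<close>.\<close>

lemma direct_sum_of_projections:
  assumes V: "module R V" and A: "\<And>i. submodule (A i) R V"
    and p: "\<And>i. linear_map R V V (p i)"
    and same: "\<And>i x. x \<in> A i \<Longrightarrow> p i x = x"
    and other: "\<And>i j x. x \<in> A i \<Longrightarrow> j \<noteq> i \<Longrightarrow> p j x = \<zero>\<^bsub>V\<^esub>"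
    and span: "carrier V \<subseteq> linear_span R V (\<Union>i. A i)"
  shows "internal_direct_sum V A"
    and "x \<in> carrier V \<Longrightarrow> component V A i x = p i x"
proof -
  interpret V: module R V by fact
  have Ac: "A i \<subseteq> carrier V" for i using submoduleD(1)[OF A V] .
  note pD = linear_mapD[OF p]
  have p0: "p i \<zero>\<^bsub>V\<^esub> = \<zero>\<^bsub>V\<^esub>" for i
    using linear_map_zero[OF p V.abelian_group_axioms V.abelian_group_axioms] .
  have pin: "p i x \<in> A i" if "x \<in> carrier V" for i x
  proof (rule linear_map_span_into[OF p V V A, of "\<Union>i. A i"])
    fix y assume "y \<in> (\<Union>i. A i)"
    then obtain j where "y \<in> A j" by auto
    then show "p i y \<in> A i" using same other submoduleD(2)[OF A V] by (cases "i = j") auto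
  qed (use Ac span that in auto)
  \<comment> \<open>The elements recovered from finitely many of their projections. It remains to
    see that they form a submodule containing every \<open>A i\<close>.\<close>
  let ?H = "{x \<in> carrier V. \<exists>J. finite J \<and> (\<forall>i. i \<notin> J \<longrightarrow> p i x = \<zero>\<^bsub>V\<^esub>) \<and> x = (\<Oplus>\<^bsub>V\<^esub>i\<in>J. p i x)}"
  have HI: "x \<in> ?H" if "finite J" "\<forall>i. i \<notin> J \<longrightarrow> p i x = \<zero>\<^bsub>V\<^esub>" "x = (\<Oplus>\<^bsub>V\<^esub>i\<in>J. p i x)" "x \<in> carrier V" for x J
    using that by (intro CollectI conjI exI[of _ J])
  have enlarge: "x = (\<Oplus>\<^bsub>V\<^esub>i\<in>K. p i x)"
    if "x \<in> carrier V" "finite K" "J \<subseteq> K" "\<forall>i. i \<notin> J \<longrightarrow> p i x = \<zero>\<^bsub>V\<^esub>" "x = (\<Oplus>\<^bsub>V\<^esub>i\<in>J. p i x)" for x J K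
    using V.finsum_superset[of K J "\<lambda>i. p i x"] that pD(1) by auto
  have add: "x \<oplus>\<^bsub>V\<^esub> y \<in> ?H" if x: "x \<in> ?H" and y: "y \<in> ?H" for x y
  proof -
    obtain J where J: "finite J" "\<forall>i. i \<notin> J \<longrightarrow> p i x = \<zero>\<^bsub>V\<^esub>" "x = (\<Oplus>\<^bsub>V\<^esub>i\<in>J. p i x)" using x by blast
    obtain K where K: "finite K" "\<forall>i. i \<notin> K \<longrightarrow> p i y = \<zero>\<^bsub>V\<^esub>" "y = (\<Oplus>\<^bsub>V\<^esub>i\<in>K. p i y)" using y by blast
    have xc: "x \<in> carrier V" and yc: "y \<in> carrier V" using x y by blast+
    have "x = (\<Oplus>\<^bsub>V\<^esub>i\<in>J \<union> K. p i x)"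
      by (rule enlarge[OF xc _ _ J(2,3)]) (use J(1) K(1) in auto)
    moreover have "y = (\<Oplus>\<^bsub>V\<^esub>i\<in>J \<union> K. p i y)"
      by (rule enlarge[OF yc _ _ K(2,3)]) (use J(1) K(1) in auto)
    ultimately have "x \<oplus>\<^bsub>V\<^esub> y = (\<Oplus>\<^bsub>V\<^esub>i\<in>J \<union> K. p i x) \<oplus>\<^bsub>V\<^esub> (\<Oplus>\<^bsub>V\<^esub>i\<in>J \<union> K. p i y)"
      by (rule arg_cong2)
    also have "\<dots> = (\<Oplus>\<^bsub>V\<^esub>i\<in>J \<union> K. p i x \<oplus>\<^bsub>V\<^esub> p i y)"
      using xc yc pD(1) by (intro V.finsum_addf[symmetric]) auto
    also have "\<dots> = (\<Oplus>\<^bsub>V\<^esub>i\<in>J \<union> K. p i (x \<oplus>\<^bsub>V\<^esub> y))"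
      using xc yc pD by (intro V.finsum_cong') auto
    finally have "x \<oplus>\<^bsub>V\<^esub> y = (\<Oplus>\<^bsub>V\<^esub>i\<in>J \<union> K. p i (x \<oplus>\<^bsub>V\<^esub> y))" .
    moreover have "\<forall>i. i \<notin> J \<union> K \<longrightarrow> p i (x \<oplus>\<^bsub>V\<^esub> y) = \<zero>\<^bsub>V\<^esub>"
      using J(2) K(2) pD(2)[OF xc yc] by simp
    moreover have "finite (J \<union> K)" using J(1) K(1) by simp
    ultimately show ?thesis using xc yc V.a_closed by blast
  qed
  have smult: "a \<odot>\<^bsub>V\<^esub> x \<in> ?H" if a: "a \<in> carrier R" and x: "x \<in> ?H" for a x
  proof -
    obtain J where J: "finite J" "\<forall>i. i \<notin> J \<longrightarrow> p i x = \<zero>\<^bsub>V\<^esub>" "x = (\<Oplus>\<^bsub>V\<^esub>i\<in>J. p i x)" using x by blast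
    have xc: "x \<in> carrier V" using x by blast
    have "a \<odot>\<^bsub>V\<^esub> x = a \<odot>\<^bsub>V\<^esub> (\<Oplus>\<^bsub>V\<^esub>i\<in>J. p i x)" by (rule arg_cong[OF J(3)])
    also have "\<dots> = (\<Oplus>\<^bsub>V\<^esub>i\<in>J. a \<odot>\<^bsub>V\<^esub> p i x)"
      using xc a J(1) pD(1) by (intro V.finsum_smult_ldistr) auto
    also have "\<dots> = (\<Oplus>\<^bsub>V\<^esub>i\<in>J. p i (a \<odot>\<^bsub>V\<^esub> x))"
      using xc a pD by (intro V.finsum_cong') auto
    finally have "a \<odot>\<^bsub>V\<^esub> x = (\<Oplus>\<^bsub>V\<^esub>i\<in>J. p i (a \<odot>\<^bsub>V\<^esub> x))" .
    moreover have "\<forall>i. i \<notin> J \<longrightarrow> p i (a \<odot>\<^bsub>V\<^esub> x) = \<zero>\<^bsub>V\<^esub>"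
      using J(2) pD(3)[OF a xc] a by simp
    ultimately show ?thesis using xc a J(1) V.smult_closed by blast
  qed
  have "submodule ?H R V"
  proof (rule V.submoduleI)
    show "\<ominus>\<^bsub>V\<^esub> x \<in> ?H" if x: "x \<in> ?H" for x
    proof -
      have "x \<in> carrier V" using x by blast
      then have "\<ominus>\<^bsub>V\<^esub> x = (\<ominus>\<^bsub>R\<^esub> \<one>\<^bsub>R\<^esub>) \<odot>\<^bsub>V\<^esub> x" using V.smult_l_minus[of "\<one>\<^bsub>R\<^esub>" x] by simp
      moreover have "\<ominus>\<^bsub>R\<^esub> \<one>\<^bsub>R\<^esub> \<in> carrier R" by simp
      ultimately show ?thesis using smult[OF _ x] by (simp only:)
    qed
    show "\<zero>\<^bsub>V\<^esub> \<in> ?H" using p0 by (auto intro!: exI[of _ "{}"])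
    show "?H \<subseteq> carrier V" by blast
  qed (fact add smult)+
  moreover have "(\<Union>i. A i) \<subseteq> ?H"
  proof
    fix x assume "x \<in> (\<Union>i. A i)"
    then obtain i where i: "x \<in> A i" by auto
    then have xc: "x \<in> carrier V" using Ac by blast
    have "finite {i}" by simp
    moreover have "\<forall>j. j \<notin> {i} \<longrightarrow> p j x = \<zero>\<^bsub>V\<^esub>" using other[OF i] by simp
    moreover have "x = (\<Oplus>\<^bsub>V\<^esub>j\<in>{i}. p j x)" using same[OF i] xc pD(1)[OF xc] by simp
    ultimately show "x \<in> ?H" using xc by (rule HI)
  qed
  ultimately have H: "carrier V \<subseteq> ?H" by (rule order.trans[OF span linear_span_least])
  have dec: "decomposes V A x (\<lambda>i. p i x)" if "x \<in> carrier V" for x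
  proof -
    obtain J where J: "finite J" "\<forall>i. i \<notin> J \<longrightarrow> p i x = \<zero>\<^bsub>V\<^esub>" "x = (\<Oplus>\<^bsub>V\<^esub>i\<in>J. p i x)"
      using H \<open>x \<in> carrier V\<close> by blast
    have s: "{i. p i x \<noteq> \<zero>\<^bsub>V\<^esub>} \<subseteq> J" using J(2) by auto
    then have "(\<Oplus>\<^bsub>V\<^esub>i\<in>{i. p i x \<noteq> \<zero>\<^bsub>V\<^esub>}. p i x) = (\<Oplus>\<^bsub>V\<^esub>i\<in>J. p i x)"
      using pD(1)[OF that] by (intro V.finsum_superset[OF J(1)]) auto
    also have "\<dots> = x" using J(3) by (rule sym)
    finally have "x = (\<Oplus>\<^bsub>V\<^esub>i\<in>{i. p i x \<noteq> \<zero>\<^bsub>V\<^esub>}. p i x)" by (rule sym)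
    then show ?thesis
      unfolding decomposes_def by (intro conjI allI pin[OF that] finite_subset[OF s J(1)])
  qed
  have uniq: "f = (\<lambda>i. p i x)" if "decomposes V A x f" "x \<in> carrier V" for f x
  proof
    fix i
    let ?S = "{j. f j \<noteq> \<zero>\<^bsub>V\<^esub>}"
    have f: "f j \<in> A j" "f j \<in> carrier V" for j using that(1) Ac unfolding decomposes_def by blast+
    have S: "finite ?S" using that by (simp add: decomposes_def)
    have "x = (\<Oplus>\<^bsub>V\<^esub>j\<in>?S. f j)" using that(1) unfolding decomposes_def by blast
    then have "p i x = p i (\<Oplus>\<^bsub>V\<^esub>j\<in>?S. f j)" by (rule arg_cong)
    also have "\<dots> = (\<Oplus>\<^bsub>V\<^esub>j\<in>?S. p i (f j))"
      using f by (intro linear_map_finsum[OF p V.abelian_group_axioms V.abelian_group_axioms]) auto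
    \<comment> \<open>The index \<open>i\<close> is added because it need not lie in the support of
      \<open>f\<close>.\<close>
    also have "\<dots> = (\<Oplus>\<^bsub>V\<^esub>j\<in>insert i ?S. p i (f j))"
      using S f(2) p0 pD(1) by (intro V.finsum_superset) auto
    also have "\<dots> = (\<Oplus>\<^bsub>V\<^esub>j\<in>insert i ?S. if j = i then f i else \<zero>\<^bsub>V\<^esub>)"
      using f(2) same[OF f(1)] other[OF f(1)] by (intro V.finsum_cong') auto
    also have "\<dots> = f i" using S f(2) by (intro V.finsum_delta) auto
    finally show "f i = p i x" by (rule sym)
  qed
  show ds: "internal_direct_sum V A"
  proof (intro internal_direct_sum.intro internal_direct_sum_axioms.intro)
    show "\<exists>!f. decomposes V A x f" if "x \<in> carrier V" for x
      by (rule ex1I[of _ "\<lambda>i. p i x"]) (fact dec[OF that], rule uniq[OF _ that])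
  qed (fact V.abelian_group_axioms submodule_additive[OF A])+
  show "component V A i x = p i x" if "x \<in> carrier V"
    using fun_cong[OF uniq[OF internal_direct_sum.decomposes_component[OF ds that] that]] .
qed

subsection \<open>Homogeneous bases\<close>

lemma lincomb_closed:
  assumes "module scalars V" "B \<subseteq> carrier V"
  shows "(\<Oplus>\<^bsub>V\<^esub>b\<in>B. c b \<odot>\<^bsub>V\<^esub> b) \<in> carrier V"
proof -
  interpret module scalars V by fact
  show ?thesis using assms(2) by (intro finsum_closed) auto
qed

lemma lincomb_add:
  assumes "module scalars V" "B \<subseteq> carrier V"
  shows "(\<Oplus>\<^bsub>V\<^esub>b\<in>B. c b \<odot>\<^bsub>V\<^esub> b) \<oplus>\<^bsub>V\<^esub> (\<Oplus>\<^bsub>V\<^esub>b\<in>B. d b \<odot>\<^bsub>V\<^esub> b) = (\<Oplus>\<^bsub>V\<^esub>b\<in>B. (c b + d b) \<odot>\<^bsub>V\<^esub> b)"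
proof -
  interpret module scalars V by fact
  have "(\<Oplus>\<^bsub>V\<^esub>b\<in>B. (c b + d b) \<odot>\<^bsub>V\<^esub> b) = (\<Oplus>\<^bsub>V\<^esub>b\<in>B. c b \<odot>\<^bsub>V\<^esub> b \<oplus>\<^bsub>V\<^esub> d b \<odot>\<^bsub>V\<^esub> b)"
    using assms(2) by (intro finsum_cong') (auto simp: vector_spaceD(2)[OF assms(1)])
  also have "\<dots> = (\<Oplus>\<^bsub>V\<^esub>b\<in>B. c b \<odot>\<^bsub>V\<^esub> b) \<oplus>\<^bsub>V\<^esub> (\<Oplus>\<^bsub>V\<^esub>b\<in>B. d b \<odot>\<^bsub>V\<^esub> b)"
    using assms(2) by (intro finsum_addf) auto
  finally show ?thesis by simp
qed

lemma lincomb_smult: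
  assumes "module scalars V" "B \<subseteq> carrier V" "finite B"
  shows "a \<odot>\<^bsub>V\<^esub> (\<Oplus>\<^bsub>V\<^esub>b\<in>B. c b \<odot>\<^bsub>V\<^esub> b) = (\<Oplus>\<^bsub>V\<^esub>b\<in>B. (a * c b) \<odot>\<^bsub>V\<^esub> b)"
proof -
  interpret module scalars V by fact
  have "(\<Oplus>\<^bsub>V\<^esub>b\<in>B. (a * c b) \<odot>\<^bsub>V\<^esub> b) = (\<Oplus>\<^bsub>V\<^esub>b\<in>B. a \<odot>\<^bsub>V\<^esub> (c b \<odot>\<^bsub>V\<^esub> b))"
    using assms(2) by (intro finsum_cong') (auto simp: vector_spaceD(4)[OF assms(1)])
  also have "\<dots> = a \<odot>\<^bsub>V\<^esub> (\<Oplus>\<^bsub>V\<^esub>b\<in>B. c b \<odot>\<^bsub>V\<^esub> b)"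
    using assms by (intro finsum_smult_ldistr[symmetric]) auto
  finally show ?thesis by simp
qed

lemma lincomb_delta:
  assumes "module scalars V" "B \<subseteq> carrier V" "finite B" "b \<in> B"
  shows "(\<Oplus>\<^bsub>V\<^esub>b'\<in>B. (if b' = b then a else 0) \<odot>\<^bsub>V\<^esub> b') = a \<odot>\<^bsub>V\<^esub> b"
proof -
  interpret module scalars V by fact
  have "(\<Oplus>\<^bsub>V\<^esub>b'\<in>B. (if b' = b then a else 0) \<odot>\<^bsub>V\<^esub> b') = (\<Oplus>\<^bsub>V\<^esub>b'\<in>B. if b' = b then a \<odot>\<^bsub>V\<^esub> b else \<zero>\<^bsub>V\<^esub>)"
    using assms(2,4) by (intro finsum_cong') (auto simp: vector_spaceD(6)[OF assms(1)])
  then show ?thesis using assms finsum_delta[of B b "a \<odot>\<^bsub>V\<^esub> b"] by auto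
qed

lemma linear_span_finite:
  assumes "module scalars V" "B \<subseteq> carrier V" "finite B" "x \<in> linear_span scalars V B"
  shows "\<exists>c. x = (\<Oplus>\<^bsub>V\<^esub>b\<in>B. c b \<odot>\<^bsub>V\<^esub> b)"
proof -
  interpret module scalars V by fact
  let ?H = "range (\<lambda>c. \<Oplus>\<^bsub>V\<^esub>b\<in>B. c b \<odot>\<^bsub>V\<^esub> b)"
  have HI: "x \<in> ?H" if "x = (\<Oplus>\<^bsub>V\<^esub>b\<in>B. c b \<odot>\<^bsub>V\<^esub> b)" for x c
    using that by blast
  have smult: "a \<odot>\<^bsub>V\<^esub> x \<in> ?H" if x: "x \<in> ?H" for a x
  proof -
    obtain c where "x = (\<Oplus>\<^bsub>V\<^esub>b\<in>B. c b \<odot>\<^bsub>V\<^esub> b)" using x by blast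
    then have "a \<odot>\<^bsub>V\<^esub> x = (\<Oplus>\<^bsub>V\<^esub>b\<in>B. (a * c b) \<odot>\<^bsub>V\<^esub> b)"
      by (simp only: lincomb_smult[OF assms(1-3)])
    then show ?thesis by (rule HI)
  qed
  have c: "?H \<subseteq> carrier V" using lincomb_closed[OF assms(1,2)] by blast
  have "submodule ?H scalars V"
  proof (rule submoduleI[OF c])
    have "(\<Oplus>\<^bsub>V\<^esub>b\<in>B. 0 \<odot>\<^bsub>V\<^esub> b) = \<zero>\<^bsub>V\<^esub>"
      using assms(2) vector_spaceD(6)[OF assms(1)] by (intro add.finprod_one_eqI) blast
    then show "\<zero>\<^bsub>V\<^esub> \<in> ?H" by (intro HI[of _ "\<lambda>_. 0"]) (rule sym)
    show "\<ominus>\<^bsub>V\<^esub> x \<in> ?H" if "x \<in> ?H" for x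
      using smult[OF that, of "- 1"] subsetD[OF c that] by (simp only: vector_spaceD(8)[OF assms(1)])
    show "x \<oplus>\<^bsub>V\<^esub> y \<in> ?H" if x: "x \<in> ?H" and y: "y \<in> ?H" for x y
    proof -
      obtain c where "x = (\<Oplus>\<^bsub>V\<^esub>b\<in>B. c b \<odot>\<^bsub>V\<^esub> b)" using x by blast
      moreover obtain d where "y = (\<Oplus>\<^bsub>V\<^esub>b\<in>B. d b \<odot>\<^bsub>V\<^esub> b)" using y by blast
      ultimately have "x \<oplus>\<^bsub>V\<^esub> y = (\<Oplus>\<^bsub>V\<^esub>b\<in>B. (c b + d b) \<odot>\<^bsub>V\<^esub> b)"
        by (simp only: lincomb_add[OF assms(1,2)])
      then show ?thesis by (rule HI)
    qed
  qed (rule smult)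
  moreover have "B \<subseteq> ?H"
  proof
    fix b assume b: "b \<in> B"
    have "(\<Oplus>\<^bsub>V\<^esub>b'\<in>B. (if b' = b then 1 else 0) \<odot>\<^bsub>V\<^esub> b') = b"
      using lincomb_delta[OF assms(1-3) b] vector_spaceD(5)[OF assms(1)] assms(2) b by (metis subsetD)
    then show "b \<in> ?H" by (intro HI[of _ "\<lambda>b'. if b' = b then 1 else 0"]) (rule sym)
  qed
  ultimately have "linear_span scalars V B \<subseteq> ?H" by (rule linear_span_least)
  then have "x \<in> ?H" using assms(4) by (rule subsetD)
  then show ?thesis by (rule rangeE) (rule exI)
qed

text \<open>The coordinate functions belong to the data, so that bilinear maps out of a tensor
  product can be written down with them. \<open>deg\<close> and \<open>co\<close> are constrained
  only for elements of \<open>B\<close> (and arguments in the carrier); \<open>co_grade\<close>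
  expresses that an element of degree \<open>j\<close> involves only basis elements of that
  degree.\<close>

locale homogeneous_basis =
  fixes V :: "('k::field, 'v, 'e) graded_scheme" (structure)
    and B :: "'v set" and deg :: "'v \<Rightarrow> int" and co :: "'v \<Rightarrow> 'v \<Rightarrow> 'k"
  assumes finite_basis: "finite B"
    and basis_closed: "B \<subseteq> carrier V"
    and basis_grade: "b \<in> B \<Longrightarrow> b \<in> grade V (deg b)"
    and co_add: "b \<in> B \<Longrightarrow> x \<in> carrier V \<Longrightarrow> y \<in> carrier V \<Longrightarrow> co b (x \<oplus> y) = co b x + co b y"
    and co_smult: "b \<in> B \<Longrightarrow> x \<in> carrier V \<Longrightarrow> co b (a \<odot> x) = a * co b x"
    and expand: "x \<in> carrier V \<Longrightarrow> x = (\<Oplus>b\<in>B. co b x \<odot> b)"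
    and co_basis: "b \<in> B \<Longrightarrow> b' \<in> B \<Longrightarrow> co b b' = (if b' = b then 1 else 0)"
    and co_grade: "x \<in> grade V j \<Longrightarrow> b \<in> B \<Longrightarrow> deg b \<noteq> j \<Longrightarrow> co b x = 0"

lemma (in graded_vector_space) submodule_grade: "submodule (grade V i) scalars V"
proof (rule submoduleI)
  show "grade V i \<subseteq> carrier V" "\<zero> \<in> grade V i"
    by (fact summand_closed)+
  show "\<ominus> x \<in> grade V i" if "x \<in> grade V i" for x
    using additive_subgroup.a_inv_closed[OF summand] abelian_group_axioms that by blast
  show "x \<oplus> y \<in> grade V i" if "x \<in> grade V i" "y \<in> grade V i" for x y
    using that by (rule summand_closed)
qed (rule grade_smult)

text \<open>The homogeneous components of finitely many generators span as well. A spanning set of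
  homogeneous elements with the least number of elements is independent: a nontrivial relation could
  be solved for one of them, which could then be dropped.\<close>

lemma (in graded_vector_space) ex_homogeneous_basis:
  assumes "finitely_generated scalars V"
  shows "\<exists>B deg co. homogeneous_basis V B deg co"
proof -
  have V: "module scalars V" by (rule module_axioms)
  define hspan where "hspan B \<longleftrightarrow>
    finite B \<and> B \<subseteq> (\<Union>i. grade V i) \<and> carrier V \<subseteq> linear_span scalars V B" for B
  have gc: "(\<Union>i. grade V i) \<subseteq> carrier V" using summand_closed(1) by blast
  obtain G where G: "finite G" "G \<subseteq> carrier V"
    "\<forall>x\<in>carrier V. \<exists>c \<in> G \<rightarrow> carrier scalars. x = (\<Oplus>b\<in>G. c b \<odot> b)"
    using assms unfolding finitely_generated_def by blast
  define H where "H = (\<Union>b\<in>G. (\<lambda>i. component V (grade V) i b) ` {i. component V (grade V) i b \<noteq> \<zero>})"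
  have "hspan H"
    unfolding hspan_def
  proof (intro conjI subsetI)
    show "finite H" using G(1,2) finite_support unfolding H_def by blast
    show HU: "x \<in> (\<Union>i. grade V i)" if "x \<in> H" for x
      using that G(2) component_in unfolding H_def by blast
    then have Hc: "H \<subseteq> carrier V" using gc by blast
    note sp = submoduleD[OF submodule_linear_span[OF V Hc] V]
    have b: "b \<in> linear_span scalars V H" if "b \<in> G" for b
    proof -
      have "(\<Oplus>i\<in>{i. component V (grade V) i b \<noteq> \<zero>}. component V (grade V) i b) \<in> linear_span scalars V H"
      proof (rule finsum_in_linear_span[OF V Hc])
        fix i assume "i \<in> {i. component V (grade V) i b \<noteq> \<zero>}"
        then have "component V (grade V) i b \<in> H" using that unfolding H_def by blast
        then show "component V (grade V) i b \<in> linear_span scalars V H"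
          using linear_span_superset by (rule subsetD[rotated])
      qed
      moreover have "b \<in> carrier V" using G(2) that by blast
      ultimately show ?thesis by (simp only: sum_support)
    qed
    fix x assume "x \<in> carrier V"
    then obtain c where "x = (\<Oplus>b\<in>G. c b \<odot> b)" using G(3) by blast
    moreover have "(\<Oplus>b\<in>G. c b \<odot> b) \<in> linear_span scalars V H"
      using b sp(4) by (intro finsum_in_linear_span[OF V Hc]) simp
    ultimately show "x \<in> linear_span scalars V H" by (simp only:)
  qed
  then obtain B where B: "hspan B" and least: "\<And>B'. hspan B' \<Longrightarrow> card B \<le> card B'"
    using ex_has_least_nat[of hspan H card] by blast
  have fin: "finite B" and Bg: "B \<subseteq> (\<Union>i. grade V i)" and Bs: "carrier V \<subseteq> linear_span scalars V B"
    using B unfolding hspan_def by blast+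
  have Bc: "B \<subseteq> carrier V" using Bg gc by blast
  have indep: "c b = 0" if c: "(\<Oplus>b\<in>B. c b \<odot> b) = \<zero>" and b: "b \<in> B" for c b
  proof (rule ccontr)
    assume "c b \<noteq> 0"
    let ?B = "B - {b}"
    have B': "?B \<subseteq> carrier V" using Bc by blast
    have bc: "b \<in> carrier V" using b Bc by blast
    note sp = submoduleD[OF submodule_linear_span[OF V B'] V]
    let ?s = "\<Oplus>b\<in>?B. c b \<odot> b"
    have sc: "?s \<in> carrier V" using B' by (intro finsum_closed) auto
    have "?s \<in> linear_span scalars V ?B"
      using B' linear_span_superset[of ?B scalars V] sp(4) by (intro finsum_in_linear_span[OF V B']) auto
    then have m: "(- 1 / c b) \<odot> ?s \<in> linear_span scalars V ?B" using sp(4) by simp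
    have cB: "(\<lambda>b. c b \<odot> b) \<in> ?B \<rightarrow> carrier V" using B' by auto
    have "insert b ?B = B" using b by blast
    then have "\<zero> = c b \<odot> b \<oplus> ?s"
      using c finsum_insert[of ?B b "\<lambda>b. c b \<odot> b"] fin cB bc by simp
    then have "c b \<odot> b = \<ominus> ?s" using bc sc minus_equality[of "c b \<odot> b" ?s] by simp
    then have "(1 / c b) \<odot> (c b \<odot> b) = (1 / c b) \<odot> ((- 1) \<odot> ?s)"
      by (simp only: vector_spaceD(8)[OF V sc])
    then have "b = (- 1 / c b) \<odot> ?s"
      using \<open>c b \<noteq> 0\<close> by (simp add: vector_spaceD(4,5)[OF V, symmetric] bc sc vector_spaceD(5)[OF V])
    then have "b \<in> linear_span scalars V ?B" using m by (simp only:)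
    then have "B \<subseteq> linear_span scalars V ?B" using linear_span_superset[of ?B scalars V] by blast
    then have "linear_span scalars V B \<subseteq> linear_span scalars V ?B"
      by (rule linear_span_least[OF submodule_linear_span[OF V B']])
    then have "hspan ?B" using fin Bg Bs unfolding hspan_def by blast
    then have "card B \<le> card ?B" by (rule least)
    then show False using b fin by (metis card_Diff1_less not_le)
  qed
  have uniq: "c b = d b" if "(\<Oplus>b\<in>B. c b \<odot> b) = (\<Oplus>b\<in>B. d b \<odot> b)" "b \<in> B" for c d b
  proof -
    have "(\<Oplus>b\<in>B. (c b - d b) \<odot> b) = (\<Oplus>b\<in>B. c b \<odot> b) \<oplus> (\<Oplus>b\<in>B. ((- 1) * d b) \<odot> b)"
      by (simp add: lincomb_add[OF V Bc])
    also have "\<dots> = (\<Oplus>b\<in>B. d b \<odot> b) \<oplus> (- 1) \<odot> (\<Oplus>b\<in>B. d b \<odot> b)"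
      using that(1) by (simp only: lincomb_smult[OF V Bc fin])
    also have "\<dots> = \<zero>"
      using lincomb_closed[OF V Bc, of d] by (simp add: vector_spaceD(8)[OF V, symmetric] r_neg)
    finally show ?thesis using indep[of "\<lambda>b. c b - d b" b] that(2) by simp
  qed
  \<comment> \<open>Some family of coefficients is chosen for each \<open>x\<close>. By
    \<open>uniq\<close> its values on \<open>B\<close> do not depend on the choice, so coordinates
    are computed by exhibiting any expansion (\<open>coI\<close>).\<close>
  define co where "co b x = (SOME c. x = (\<Oplus>b\<in>B. c b \<odot> b)) b" for b x
  have expand: "x = (\<Oplus>b\<in>B. co b x \<odot> b)" if "x \<in> carrier V" for x
  proof -
    have "x \<in> linear_span scalars V B" using Bs that by blast
    from linear_span_finite[OF V Bc fin this]
    show ?thesis unfolding co_def by (rule someI_ex)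
  qed
  have coI: "co b x = c b" if "x = (\<Oplus>b\<in>B. c b \<odot> b)" "b \<in> B" for c b x
  proof (rule uniq[OF _ that(2)])
    have "x \<in> carrier V" using that(1) lincomb_closed[OF V Bc] by (simp only:)
    from expand[OF this] show "(\<Oplus>b\<in>B. co b x \<odot> b) = (\<Oplus>b\<in>B. c b \<odot> b)" using that(1) by simp
  qed
  obtain deg where deg: "\<And>b. b \<in> B \<Longrightarrow> b \<in> grade V (deg b)"
    using Bg by (metis (no_types) UN_E subsetD)
  have "homogeneous_basis V B deg co"
  proof
    show "co b (x \<oplus> y) = co b x + co b y" if "b \<in> B" "x \<in> carrier V" "y \<in> carrier V" for b x y
    proof (rule coI[OF _ that(1)])
      show "x \<oplus> y = (\<Oplus>b\<in>B. (co b x + co b y) \<odot> b)"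
        using expand[OF that(2)] expand[OF that(3)] lincomb_add[OF V Bc, of "\<lambda>b. co b x" "\<lambda>b. co b y"]
        by argo
    qed
    show "co b (a \<odot> x) = a * co b x" if "b \<in> B" "x \<in> carrier V" for a b x
    proof (rule coI[OF _ that(1)])
      show "a \<odot> x = (\<Oplus>b\<in>B. (a * co b x) \<odot> b)"
        using expand[OF that(2)] lincomb_smult[OF V Bc fin, of a "\<lambda>b. co b x"] by argo
    qed
    show "co b b' = (if b' = b then 1 else 0)" if "b \<in> B" "b' \<in> B" for b b'
    proof -
      have "b' = (\<Oplus>b\<in>B. (if b = b' then 1 else 0) \<odot> b)"
        using lincomb_delta[OF V Bc fin that(2), of 1] that(2) Bc vector_spaceD(5)[OF V, of b'] by auto
      from coI[OF this that(1)] show ?thesis by simp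
    qed
    show "co b x = 0" if "x \<in> grade V j" "b \<in> B" "deg b \<noteq> j" for x j b
    proof -
      have xc: "x \<in> carrier V" using that(1) gc by blast
      have lin: "linear_map scalars V V (component V (grade V) j)"
        using component_linear[OF internal_direct_sum_axioms V submodule_grade] .
      \<comment> \<open>Projecting the expansion of \<open>x\<close> onto degree \<open>j\<close>
        yields a second expansion, in which the coefficients of basis elements of other degrees are
        replaced by 0.\<close>
      have "x = component V (grade V) j x" using component_same[OF that(1)] by simp
      also have "\<dots> = component V (grade V) j (\<Oplus>b\<in>B. co b x \<odot> b)"
        by (rule arg_cong[OF expand[OF xc]])
      also have "\<dots> = (\<Oplus>b\<in>B. component V (grade V) j (co b x \<odot> b))"
        using Bc by (intro linear_map_finsum[OF lin abelian_group_axioms abelian_group_axioms]) auto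
      also have "\<dots> = (\<Oplus>b\<in>B. (if deg b = j then co b x else 0) \<odot> b)"
      proof (rule finsum_cong')
        show "component V (grade V) j (co b x \<odot> b) = (if deg b = j then co b x else 0) \<odot> b"
          if "b \<in> B" for b
        proof -
          have "b \<in> carrier V" using that Bc by blast
          then show ?thesis
            using component_delta[OF grade_smult[OF deg[OF that]], of j "co b x"]
            by (auto simp: vector_spaceD(6)[OF V])
        qed
      qed (use Bc in auto)
      finally have "x = (\<Oplus>b\<in>B. (if deg b = j then co b x else 0) \<odot> b)" .
      from coI[OF this that(2)] show ?thesis using that(3) by simp
    qed
  qed (fact fin Bc deg expand)+
  then show ?thesis by blast
qed

section \<open>Quotients of free vector spaces and the universal property of the tensor
  product\<close>

section \<open>Free modules, quotients and tensor products\<close>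

lemma free_module_simps [simp]:
  "carrier (free_module X) = {f. finite {x. f x \<noteq> 0} \<and> {x. f x \<noteq> 0} \<subseteq> X}"
  "\<zero>\<^bsub>free_module X\<^esub> = (\<lambda>x. 0)" "f \<oplus>\<^bsub>free_module X\<^esub> h = (\<lambda>x. f x + h x)"
  "a \<odot>\<^bsub>free_module X\<^esub> f = (\<lambda>x. a * f x)"
  by (simp_all add: free_module_def)

lemma module_free: "module scalars (free_module X :: ('k::field, 'x \<Rightarrow> 'k) module)"
proof (rule vector_spaceI)
  show "abelian_group (free_module X :: ('k, 'x \<Rightarrow> 'k) module)"
  proof (rule abelian_groupI)
    fix f h :: "'x \<Rightarrow> 'k" assume f: "f \<in> carrier (free_module X)" and h: "h \<in> carrier (free_module X)"
    have sub: "{x. f x + h x \<noteq> 0} \<subseteq> {x. f x \<noteq> 0} \<union> {x. h x \<noteq> 0}" by auto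
    show "f \<oplus>\<^bsub>free_module X\<^esub> h \<in> carrier (free_module X)"
      using f h finite_subset[OF sub] sub
      by (simp only: free_module_simps mem_Collect_eq finite_Un) (blast intro: order_trans)
    show "\<exists>h\<in>carrier (free_module X). h \<oplus>\<^bsub>free_module X\<^esub> f = \<zero>\<^bsub>free_module X\<^esub>"
      using f by (intro bexI[of _ "\<lambda>x. - f x"]) auto
  qed (auto simp: algebra_simps)
  fix a and f :: "'x \<Rightarrow> 'k" assume f: "f \<in> carrier (free_module X)"
  have sub: "{x. a * f x \<noteq> 0} \<subseteq> {x. f x \<noteq> 0}" by auto
  show "a \<odot>\<^bsub>free_module X\<^esub> f \<in> carrier (free_module X)"
    using f finite_subset[OF sub] sub
    by (simp only: free_module_simps mem_Collect_eq) (blast intro: order_trans)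
qed (auto simp: algebra_simps)

lemma single_support: "{y. single x y \<noteq> (0 :: 'k::field)} = {x}"
  by (simp add: single_def)

lemma single_closed: "x \<in> X \<Longrightarrow> single x \<in> carrier (free_module X)"
  by (simp add: single_support)

lemma free_module_span:
  "carrier (free_module X :: ('k::field, 'x \<Rightarrow> 'k) module) \<subseteq> linear_span scalars (free_module X) (single ` X)"
proof (rule subsetI)
  have S: "single ` X \<subseteq> carrier (free_module X :: ('k, 'x \<Rightarrow> 'k) module)" by (rule image_subsetI) (rule single_closed)
  note sp = submoduleD[OF submodule_linear_span[OF module_free S] module_free]
  have "f \<in> linear_span scalars (free_module X) (single ` X)"
    if "finite J" "J \<subseteq> X" "{x. f x \<noteq> 0} \<subseteq> J" for J and f :: "'x \<Rightarrow> 'k"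
    using that
  proof (induction J arbitrary: f rule: finite_induct)
    case empty
    then have "f = (\<lambda>x. 0)" by auto
    then show ?case using sp(2) by simp
  next
    case (insert x J)
    have "(\<lambda>y. if y = x then 0 else f y) \<in> linear_span scalars (free_module X) (single ` X)"
      using insert by (intro insert.IH) auto
    moreover have "single x \<in> linear_span scalars (free_module X) (single ` X)"
      by (rule subsetD[OF linear_span_superset]) (use insert.prems(1) in simp)
    ultimately have "(\<lambda>y. if y = x then 0 else f y) \<oplus>\<^bsub>free_module X\<^esub> (f x \<odot>\<^bsub>free_module X\<^esub> single x)
        \<in> linear_span scalars (free_module X) (single ` X)"
      by (intro sp(3,4)) simp_all
    moreover have "(\<lambda>y. if y = x then 0 else f y) \<oplus>\<^bsub>free_module X\<^esub> (f x \<odot>\<^bsub>free_module X\<^esub> single x) = f"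
      by (auto simp: single_def)
    ultimately show ?case by simp
  qed
  then show "f \<in> linear_span scalars (free_module X) (single ` X)"
    if "f \<in> carrier (free_module X)" for f :: "'x \<Rightarrow> 'k"
    using that by auto
qed

lemma free_module_eqI:
  assumes "linear_map scalars (free_module X) W f" "linear_map scalars (free_module X) W h"
    "module scalars W" "\<And>x. x \<in> X \<Longrightarrow> f (single x) = h (single x)" "t \<in> carrier (free_module X)"
  shows "f t = h t"
proof (rule linear_map_eq_on_span[OF assms(1,2) module_free assms(3)])
  show "t \<in> linear_span scalars (free_module X) (single ` X)"
    using assms(5) free_module_span by blast
  show "single ` X \<subseteq> carrier (free_module X)" by (rule image_subsetI) (rule single_closed)
qed (use assms(4) in auto)

definition free_lift :: "('k::field, 'w, 'e) module_scheme \<Rightarrow> ('x \<Rightarrow> 'w) \<Rightarrow> ('x \<Rightarrow> 'k) \<Rightarrow> 'w" where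
  "free_lift W \<phi> f = (\<Oplus>\<^bsub>W\<^esub>x\<in>{x. f x \<noteq> 0}. f x \<odot>\<^bsub>W\<^esub> \<phi> x)"

lemma free_lift_superset:
  assumes "module scalars W" "\<phi> \<in> X \<rightarrow> carrier W" "finite J" "J \<subseteq> X" "{x. f x \<noteq> 0} \<subseteq> J"
  shows "free_lift W \<phi> f = (\<Oplus>\<^bsub>W\<^esub>x\<in>J. f x \<odot>\<^bsub>W\<^esub> \<phi> x)"
proof -
  interpret W: module scalars W by fact
  have \<phi>: "x \<in> J \<Longrightarrow> \<phi> x \<in> carrier W" for x using assms(2,4) by auto
  show ?thesis
    unfolding free_lift_def using vector_spaceD(6)[OF assms(1) \<phi>] \<phi>
    by (intro W.finsum_superset assms(3,5)) auto
qed

lemma free_lift_linear: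
  fixes W :: "('k::field, 'w, 'e) module_scheme" and \<phi> :: "'x \<Rightarrow> 'w"
  assumes W: "module scalars W" and \<phi>: "\<phi> \<in> X \<rightarrow> carrier W"
  shows "linear_map scalars (free_module X) W (free_lift W \<phi>)"
proof (rule linear_mapI)
  interpret W: module scalars W by fact
  note lift = free_lift_superset[OF W \<phi>]
  fix f :: "'x \<Rightarrow> 'k" assume f: "f \<in> carrier (free_module X)"
  then have \<phi>f: "f x \<noteq> 0 \<Longrightarrow> \<phi> x \<in> carrier W" for x using \<phi> by auto
  show "free_lift W \<phi> f \<in> carrier W"
    unfolding free_lift_def using \<phi>f by (intro W.finsum_closed) auto
  show "free_lift W \<phi> (f \<oplus>\<^bsub>free_module X\<^esub> h) = free_lift W \<phi> f \<oplus>\<^bsub>W\<^esub> free_lift W \<phi> h"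
    if h: "h \<in> carrier (free_module X)" for h :: "'x \<Rightarrow> 'k"
  proof -
    let ?J = "{x. f x \<noteq> 0} \<union> {x. h x \<noteq> 0}"
    have J: "finite ?J" "?J \<subseteq> X" using f h by auto
    then have \<phi>J: "\<And>x. x \<in> ?J \<Longrightarrow> \<phi> x \<in> carrier W" using \<phi> by blast
    have "free_lift W \<phi> (\<lambda>x. f x + h x) = (\<Oplus>\<^bsub>W\<^esub>x\<in>?J. (f x + h x) \<odot>\<^bsub>W\<^esub> \<phi> x)"
      by (rule lift[OF J]) auto
    also have "\<dots> = (\<Oplus>\<^bsub>W\<^esub>x\<in>?J. f x \<odot>\<^bsub>W\<^esub> \<phi> x \<oplus>\<^bsub>W\<^esub> h x \<odot>\<^bsub>W\<^esub> \<phi> x)"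
      using vector_spaceD(2)[OF W \<phi>J] vector_spaceD(1)[OF W \<phi>J] by (intro W.finsum_cong') auto
    also have "\<dots> = (\<Oplus>\<^bsub>W\<^esub>x\<in>?J. f x \<odot>\<^bsub>W\<^esub> \<phi> x) \<oplus>\<^bsub>W\<^esub> (\<Oplus>\<^bsub>W\<^esub>x\<in>?J. h x \<odot>\<^bsub>W\<^esub> \<phi> x)"
      using vector_spaceD(1)[OF W \<phi>J] by (intro W.finsum_addf) auto
    also have "(\<Oplus>\<^bsub>W\<^esub>x\<in>?J. f x \<odot>\<^bsub>W\<^esub> \<phi> x) = free_lift W \<phi> f" by (rule lift[OF J, symmetric]) auto
    also have "(\<Oplus>\<^bsub>W\<^esub>x\<in>?J. h x \<odot>\<^bsub>W\<^esub> \<phi> x) = free_lift W \<phi> h" by (rule lift[OF J, symmetric]) auto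
    finally show ?thesis by simp
  qed
  show "free_lift W \<phi> (a \<odot>\<^bsub>free_module X\<^esub> f) = a \<odot>\<^bsub>W\<^esub> free_lift W \<phi> f" for a
  proof -
    let ?J = "{x. f x \<noteq> 0}"
    have J: "finite ?J" "?J \<subseteq> X" using f by auto
    have "free_lift W \<phi> (\<lambda>x. a * f x) = (\<Oplus>\<^bsub>W\<^esub>x\<in>?J. (a * f x) \<odot>\<^bsub>W\<^esub> \<phi> x)"
      by (rule lift[OF J]) auto
    also have "\<dots> = (\<Oplus>\<^bsub>W\<^esub>x\<in>?J. a \<odot>\<^bsub>W\<^esub> (f x \<odot>\<^bsub>W\<^esub> \<phi> x))"
      using vector_spaceD(4)[OF W \<phi>f] vector_spaceD(1)[OF W] \<phi>f by (intro W.finsum_cong') auto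
    also have "\<dots> = a \<odot>\<^bsub>W\<^esub> free_lift W \<phi> f"
      unfolding free_lift_def using J \<phi>f by (intro W.finsum_smult_ldistr[symmetric]) auto
    finally show ?thesis by simp
  qed
qed

lemma free_lift_single:
  assumes "module scalars W" "\<phi> x \<in> carrier W"
  shows "free_lift W \<phi> (single x) = \<phi> x"
proof -
  interpret W: module scalars W by fact
  have "single x x = (1::'a)" by (simp add: single_def)
  then show ?thesis
    using assms(2) vector_spaceD(5)[OF assms] by (simp add: free_lift_def single_support)
qed

text \<open>The defining relations of symmetric algebras and tensor products are written as
  pointwise differences of functions, not with the operations of the record; this and the next lemma
  translate.\<close>

lemma free_linear_diff:
  assumes "linear_map scalars (free_module X) W L" "module scalars W"
    "f \<in> carrier (free_module X)" "h \<in> carrier (free_module X)"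
  shows "L (\<lambda>x. f x - h x) = L f \<ominus>\<^bsub>W\<^esub> L h" and "(\<lambda>x. f x - h x) \<in> carrier (free_module X)"
proof -
  interpret F: module scalars "free_module X" by (rule module_free)
  have "(- 1) \<odot>\<^bsub>free_module X\<^esub> h \<in> carrier (free_module X)" using assms(4) by (intro F.smult_closed) simp_all
  then have "L (f \<oplus>\<^bsub>free_module X\<^esub> (- 1) \<odot>\<^bsub>free_module X\<^esub> h) = L f \<oplus>\<^bsub>W\<^esub> (- 1) \<odot>\<^bsub>W\<^esub> L h"
    and "f \<oplus>\<^bsub>free_module X\<^esub> (- 1) \<odot>\<^bsub>free_module X\<^esub> h \<in> carrier (free_module X)"
    using linear_mapD'(2)[OF assms(1,3)] linear_mapD'(3)[OF assms(1,4)] F.a_closed[OF assms(3)]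
    by metis+
  then show "L (\<lambda>x. f x - h x) = L f \<ominus>\<^bsub>W\<^esub> L h" "(\<lambda>x. f x - h x) \<in> carrier (free_module X)"
    using vector_spaceD(8)[OF assms(2) linear_mapD'(1)[OF assms(1,4)]] by (simp_all add: a_minus_def)
qed

lemma free_linear_smult:
  assumes "linear_map scalars (free_module X) W L" "f \<in> carrier (free_module X)"
  shows "L (\<lambda>x. a * f x) = a \<odot>\<^bsub>W\<^esub> L f" and "(\<lambda>x. a * f x) \<in> carrier (free_module X)"
proof -
  interpret F: module scalars "free_module X" by (rule module_free)
  show "L (\<lambda>x. a * f x) = a \<odot>\<^bsub>W\<^esub> L f" using linear_mapD'(3)[OF assms, of a] by simp
  show "(\<lambda>x. a * f x) \<in> carrier (free_module X)" using F.smult_closed[of a f] assms(2) by simp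
qed

subsection \<open>Quotients\<close>

text \<open>\<open>Q\<close> is any record with the linear structure of \<open>F / N\<close>; its
  further fields are free, so that the locale covers both \<open>sym_algebra\<close> and
  \<open>tensor\<close>.\<close>

locale vector_space_quotient =
  fixes F :: "('k::field, 'x, 'e) module_scheme" (structure) and N :: "'x set"
    and Q :: "('k, 'x set, 'f) module_scheme"
  assumes module_F: "module scalars F" and submodule_N: "submodule N scalars F"
    and carrier_Q: "carrier Q = a_rcosets N" and zero_Q: "zero Q = N" and add_Q: "add Q = set_add F"
    and smult_Q: "smult Q = coset_smult F N"
begin

interpretation F: module scalars F by (rule module_F)

interpretation N: abelian_subgroup N F
  using submodule_additive[OF submodule_N] F.abelian_group_axioms by (intro abelian_subgroupI3)

lemma carrier_Q_image: "carrier Q = (\<lambda>x. N +> x) ` carrier F"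
  by (auto simp: carrier_Q A_RCOSETS_def')

lemma coset_add: "x \<in> carrier F \<Longrightarrow> y \<in> carrier F \<Longrightarrow> (N +> x) \<oplus>\<^bsub>Q\<^esub> (N +> y) = N +> (x \<oplus> y)"
  by (simp add: add_Q N.a_rcos_sum)

lemma coset_memD:
  assumes "y \<in> N +> x" "x \<in> carrier F"
  shows "\<exists>n\<in>N. y = n \<oplus> x" and "y \<in> carrier F" and "N +> y = N +> x"
proof -
  show "\<exists>n\<in>N. y = n \<oplus> x" using assms(1) by (auto simp: a_r_coset_def')
  then show "y \<in> carrier F" using N.a_subset assms(2) by auto
  show "N +> y = N +> x" using N.a_repr_independence'[OF assms] by simp
qed

text \<open>The union in \<open>coset_smult\<close> runs over cosets that all coincide, because
  \<open>N\<close> is stable under scalars.\<close>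

lemma coset_smult:
  assumes "x \<in> carrier F"
  shows "a \<odot>\<^bsub>Q\<^esub> (N +> x) = N +> (a \<odot> x)"
proof -
  have "N +> (a \<odot> y) = N +> (a \<odot> x)" if y: "y \<in> N +> x" for y
  proof -
    obtain n where n: "n \<in> N" "y = n \<oplus> x" using coset_memD(1)[OF y assms] by blast
    have nc: "n \<in> carrier F" using n(1) N.a_subset by blast
    have "a \<odot> y = a \<odot> n \<oplus> a \<odot> x" using vector_spaceD(3)[OF module_F nc assms] n(2) by simp
    moreover have "a \<odot> n \<in> N" using submoduleD(4)[OF submodule_N module_F _ n(1)] by simp
    ultimately have "a \<odot> y \<in> N +> (a \<odot> x)" by (auto simp: a_r_coset_def')
    then show ?thesis using coset_memD(3) vector_spaceD(1)[OF module_F assms] by blast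
  qed
  then show ?thesis
    using N.a_rcos_self[OF assms] unfolding smult_Q coset_smult_def by blast
qed

lemma coset_zero: "x \<in> N \<Longrightarrow> N +> x = \<zero>\<^bsub>Q\<^esub>"
  unfolding zero_Q using F.a_coset_join2[of x N] N.a_subgroup N.a_subset by auto

lemma module_Q: "module scalars Q"
proof (rule vector_spaceI)
  have z: "\<zero>\<^bsub>Q\<^esub> = N +> \<zero>" using coset_zero[OF submoduleD(2)[OF submodule_N module_F]] by (rule sym)
  show "abelian_group Q"
  proof (rule abelian_groupI)
    fix X assume "X \<in> carrier Q"
    then obtain x where x: "X = N +> x" "x \<in> carrier F" unfolding carrier_Q_image by blast
    then have "(N +> (\<ominus> x)) \<oplus>\<^bsub>Q\<^esub> X = \<zero>\<^bsub>Q\<^esub>" "N +> (\<ominus> x) \<in> carrier Q"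
      by (simp_all add: z coset_add F.l_neg carrier_Q_image)
    then show "\<exists>Y\<in>carrier Q. Y \<oplus>\<^bsub>Q\<^esub> X = \<zero>\<^bsub>Q\<^esub>" by (rule bexI)
  qed (auto simp: z carrier_Q_image coset_add F.a_ac)
qed (auto simp: carrier_Q_image coset_add coset_smult vector_spaceD(2-5)[OF module_F]
    vector_spaceD(1)[OF module_F])

lemma coset_linear: "linear_map scalars F Q (\<lambda>x. N +> x)"
  by (rule linear_mapI) (auto simp: carrier_Q_image coset_add coset_smult)

text \<open>Maps on cosets are evaluated at a chosen representative, as in
  \<open>tensor_lift\<close>. Representatives differ by elements of \<open>N\<close>, on which
  \<open>L\<close> vanishes, so the choice does not affect the value.\<close>

lemma descend:
  assumes "linear_map scalars F W L" "module scalars W" "\<And>x. x \<in> N \<Longrightarrow> L x = \<zero>\<^bsub>W\<^esub>" "x \<in> carrier F"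
  shows "L (SOME y. y \<in> N +> x) = L x"
proof -
  interpret W: module scalars W by fact
  have "(SOME y. y \<in> N +> x) \<in> N +> x"
    using N.a_rcos_self[OF assms(4)] by (rule someI[of "\<lambda>y. y \<in> N +> x"])
  then obtain n where n: "n \<in> N" "(SOME y. y \<in> N +> x) = n \<oplus> x"
    using coset_memD(1) assms(4) by blast
  then have "L (SOME y. y \<in> N +> x) = L n \<oplus>\<^bsub>W\<^esub> L x"
    using linear_mapD(2)[OF assms(1) _ assms(4), of n] N.a_subset by auto
  then show ?thesis using assms(3)[OF n(1)] linear_mapD(1)[OF assms(1,4)] by simp
qed

lemma descend_linear:
  assumes "linear_map scalars F W L" "module scalars W" "\<And>x. x \<in> N \<Longrightarrow> L x = \<zero>\<^bsub>W\<^esub>"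
  shows "linear_map scalars Q W (\<lambda>t. L (SOME y. y \<in> t))"
  by (rule linear_mapI)
    (auto simp: carrier_Q_image coset_add coset_smult descend[OF assms] linear_mapD'[OF assms(1)]
      vector_spaceD(1)[OF module_F])

end

subsection \<open>Tensor products\<close>

lemma linear_span_cong:
  assumes "carrier V = carrier W" "add V = add W" "zero V = zero W" "smult V = smult W"
  shows "linear_span R V = linear_span R W"
proof -
  have "m_inv (add_monoid V) = m_inv (add_monoid W)"
    using assms(1-3) by (simp add: m_inv_def fun_eq_iff)
  then have "submodule H R V = submodule H R W" for H
    using assms by (simp add: submodule_def submodule_axioms_def subgroup_def)
  then show ?thesis by (simp add: linear_span_def fun_eq_iff)
qed

lemma tensor_simps:
  "carrier (tensor C M) = carrier (tensor_space C M)" "zero (tensor C M) = zero (tensor_space C M)"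
  "add (tensor C M) = add (tensor_space C M)" "smult (tensor C M) = smult (tensor_space C M)"
  "grade (tensor C M) n = linear_span scalars (tensor_space C M)
     {tensor_elem C M c m | c m i j. c \<in> grade C i \<and> m \<in> grade M j \<and> i + j = n}"
  by (simp_all add: tensor_def module.defs graded.defs)

definition bilinear ::
    "('k::field, 'c, 'e) module_scheme \<Rightarrow> ('k, 'm, 'f) module_scheme \<Rightarrow> ('k, 'w, 'h) module_scheme \<Rightarrow>
     ('c \<Rightarrow> 'm \<Rightarrow> 'w) \<Rightarrow> bool" where
  "bilinear C M W \<beta> \<longleftrightarrow> (\<forall>m\<in>carrier M. linear_map scalars C W (\<lambda>c. \<beta> c m)) \<and>
     (\<forall>c\<in>carrier C. linear_map scalars M W (\<beta> c))"

lemma bilinearI: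
  assumes "\<And>m. m \<in> carrier M \<Longrightarrow> linear_map scalars C W (\<lambda>c. \<beta> c m)"
    and "\<And>c. c \<in> carrier C \<Longrightarrow> linear_map scalars M W (\<beta> c)"
  shows "bilinear C M W \<beta>"
  using assms by (simp add: bilinear_def)

text \<open>The spanning set inside \<open>tensor_null\<close>, separated from the span so that a
  relation can be analysed case by case.\<close>

definition tensor_relations ::
    "('k::field, 'c, 'e) module_scheme \<Rightarrow> ('k, 'm, 'f) module_scheme \<Rightarrow> ('c \<times> 'm \<Rightarrow> 'k) set" where
  "tensor_relations C M =
     ({(\<lambda>p. single (c \<oplus>\<^bsub>C\<^esub> c', m) p - single (c, m) p - single (c', m) p) | c c' m.
         c \<in> carrier C \<and> c' \<in> carrier C \<and> m \<in> carrier M} \<union>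
      {(\<lambda>p. single (c, m \<oplus>\<^bsub>M\<^esub> m') p - single (c, m) p - single (c, m') p) | c m m'.
         c \<in> carrier C \<and> m \<in> carrier M \<and> m' \<in> carrier M} \<union>
      {(\<lambda>p. single (a \<odot>\<^bsub>C\<^esub> c, m) p - a * single (c, m) p) | a c m.
         c \<in> carrier C \<and> m \<in> carrier M} \<union>
      {(\<lambda>p. single (c, a \<odot>\<^bsub>M\<^esub> m) p - a * single (c, m) p) | a c m.
         c \<in> carrier C \<and> m \<in> carrier M})"

locale tensor_product =
  fixes C :: "('k::field, 'c, 'e) graded_scheme" and M :: "('k, 'm, 'f) graded_scheme"
  assumes module_left: "module scalars C" and module_right: "module scalars M"
begin

interpretation C: module scalars C by (rule module_left)
interpretation M: module scalars M by (rule module_right)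

lemma tensor_null_eq: "tensor_null C M = linear_span scalars (tensor_free C M) (tensor_relations C M)"
  by (simp add: tensor_null_def tensor_relations_def)

lemma pair_closed: "c \<in> carrier C \<Longrightarrow> m \<in> carrier M \<Longrightarrow> single (c, m) \<in> carrier (tensor_free C M)"
  unfolding tensor_free_def by (rule single_closed) blast

lemma module_tensor_free: "module scalars (tensor_free C M)"
  unfolding tensor_free_def by (rule module_free)

lemma tensor_free_diff:
  assumes "linear_map scalars (tensor_free C M) W L" "module scalars W"
    "f \<in> carrier (tensor_free C M)" "h \<in> carrier (tensor_free C M)"
  shows "L (\<lambda>x. f x - h x) = L f \<ominus>\<^bsub>W\<^esub> L h" and "(\<lambda>x. f x - h x) \<in> carrier (tensor_free C M)"
  using free_linear_diff assms unfolding tensor_free_def by blast+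

lemma tensor_free_smult:
  assumes "linear_map scalars (tensor_free C M) W L" "f \<in> carrier (tensor_free C M)"
  shows "L (\<lambda>x. a * f x) = a \<odot>\<^bsub>W\<^esub> L f" and "(\<lambda>x. a * f x) \<in> carrier (tensor_free C M)"
  using free_linear_smult assms unfolding tensor_free_def by blast+

text \<open>Used in two directions. For the quotient map the left-hand sides vanish, which makes
  \<open>tensor_elem\<close> bilinear; for the free extension of a bilinear map the right-hand sides
  vanish, which makes it descend.\<close>

lemma relation_values:
  assumes L: "linear_map scalars (tensor_free C M) W L" and W: "module scalars W"
  shows "\<lbrakk>c \<in> carrier C; c' \<in> carrier C; m \<in> carrier M\<rbrakk> \<Longrightarrow>
      L (\<lambda>p. single (c \<oplus>\<^bsub>C\<^esub> c', m) p - single (c, m) p - single (c', m) p) =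
      L (single (c \<oplus>\<^bsub>C\<^esub> c', m)) \<ominus>\<^bsub>W\<^esub> L (single (c, m)) \<ominus>\<^bsub>W\<^esub> L (single (c', m))"
    and "\<lbrakk>c \<in> carrier C; m \<in> carrier M; m' \<in> carrier M\<rbrakk> \<Longrightarrow>
      L (\<lambda>p. single (c, m \<oplus>\<^bsub>M\<^esub> m') p - single (c, m) p - single (c, m') p) =
      L (single (c, m \<oplus>\<^bsub>M\<^esub> m')) \<ominus>\<^bsub>W\<^esub> L (single (c, m)) \<ominus>\<^bsub>W\<^esub> L (single (c, m'))"
    and "\<lbrakk>c \<in> carrier C; m \<in> carrier M\<rbrakk> \<Longrightarrow>
      L (\<lambda>p. single (a \<odot>\<^bsub>C\<^esub> c, m) p - a * single (c, m) p) =
      L (single (a \<odot>\<^bsub>C\<^esub> c, m)) \<ominus>\<^bsub>W\<^esub> a \<odot>\<^bsub>W\<^esub> L (single (c, m))"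
    and "\<lbrakk>c \<in> carrier C; m \<in> carrier M\<rbrakk> \<Longrightarrow>
      L (\<lambda>p. single (c, a \<odot>\<^bsub>M\<^esub> m) p - a * single (c, m) p) =
      L (single (c, a \<odot>\<^bsub>M\<^esub> m)) \<ominus>\<^bsub>W\<^esub> a \<odot>\<^bsub>W\<^esub> L (single (c, m))"
  by (simp_all add: tensor_free_diff[OF L W] tensor_free_smult[OF L] pair_closed)

lemma relations_closed: "tensor_relations C M \<subseteq> carrier (tensor_free C M)"
proof -
  have L: "linear_map scalars (tensor_free C M) (tensor_free C M) (\<lambda>x. x)"
    by (rule linear_mapI) auto
  note d = tensor_free_diff(2)[OF L module_tensor_free] tensor_free_smult(2)[OF L] pair_closed
  show ?thesis unfolding tensor_relations_def by (auto intro!: d)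
qed

sublocale vector_space_quotient "tensor_free C M" "tensor_null C M" "tensor C M"
proof (rule vector_space_quotient.intro)
  show "module scalars (tensor_free C M)" by (rule module_tensor_free)
  show "submodule (tensor_null C M) scalars (tensor_free C M)"
    unfolding tensor_null_eq by (rule submodule_linear_span[OF module_tensor_free relations_closed])
qed (simp_all add: tensor_simps tensor_space_def)

lemmas module_tensor = module_Q

lemma tensor_elem_coset: "tensor_elem C M c m = tensor_null C M +>\<^bsub>tensor_free C M\<^esub> single (c, m)"
  by (simp add: tensor_elem_def)

lemma tensor_elem_closed:
  "c \<in> carrier C \<Longrightarrow> m \<in> carrier M \<Longrightarrow> tensor_elem C M c m \<in> carrier (tensor C M)"
  unfolding carrier_Q_image tensor_elem_coset by (rule imageI) (rule pair_closed)

lemma relation_zero: "r \<in> tensor_relations C M \<Longrightarrow> tensor_null C M +>\<^bsub>tensor_free C M\<^esub> r = \<zero>\<^bsub>tensor C M\<^esub>"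
  by (rule coset_zero) (unfold tensor_null_eq, rule subsetD[OF linear_span_superset])

lemma tensor_elem_bilinear: "bilinear C M (tensor C M) (tensor_elem C M)"
proof -
  interpret T: module scalars "tensor C M" by (rule module_tensor)
  note v = relation_values[OF coset_linear module_tensor, folded tensor_elem_coset]
  have eq: "x = y" if "x \<ominus>\<^bsub>tensor C M\<^esub> y = \<zero>\<^bsub>tensor C M\<^esub>" "x \<in> carrier (tensor C M)" "y \<in> carrier (tensor C M)" for x y
  proof -
    have "x = (x \<ominus>\<^bsub>tensor C M\<^esub> y) \<oplus>\<^bsub>tensor C M\<^esub> y"
      using that(2,3) by (simp add: T.minus_eq T.a_assoc T.l_neg)
    then show ?thesis using that by simp
  qed
  have eq2: "x = y \<oplus>\<^bsub>tensor C M\<^esub> z" if "x \<ominus>\<^bsub>tensor C M\<^esub> y \<ominus>\<^bsub>tensor C M\<^esub> z = \<zero>\<^bsub>tensor C M\<^esub>"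
    "x \<in> carrier (tensor C M)" "y \<in> carrier (tensor C M)" "z \<in> carrier (tensor C M)" for x y z
    using eq[of x "y \<oplus>\<^bsub>tensor C M\<^esub> z"] that by (simp add: T.minus_eq T.minus_add T.a_assoc)
  show ?thesis
  proof (intro bilinearI linear_mapI)
    show "tensor_elem C M (c \<oplus>\<^bsub>C\<^esub> c') m = tensor_elem C M c m \<oplus>\<^bsub>tensor C M\<^esub> tensor_elem C M c' m"
      if "c \<in> carrier C" "c' \<in> carrier C" "m \<in> carrier M" for c c' m
    proof (rule eq2)
      show "tensor_elem C M (c \<oplus>\<^bsub>C\<^esub> c') m \<ominus>\<^bsub>tensor C M\<^esub> tensor_elem C M c m
          \<ominus>\<^bsub>tensor C M\<^esub> tensor_elem C M c' m = \<zero>\<^bsub>tensor C M\<^esub>"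
        unfolding v(1)[OF that, symmetric]
        by (rule relation_zero) (use that in \<open>unfold tensor_relations_def, blast\<close>)
    qed (use that tensor_elem_closed in simp_all)
    show "tensor_elem C M c (m \<oplus>\<^bsub>M\<^esub> m') = tensor_elem C M c m \<oplus>\<^bsub>tensor C M\<^esub> tensor_elem C M c m'"
      if "c \<in> carrier C" "m \<in> carrier M" "m' \<in> carrier M" for c m m'
    proof (rule eq2)
      show "tensor_elem C M c (m \<oplus>\<^bsub>M\<^esub> m') \<ominus>\<^bsub>tensor C M\<^esub> tensor_elem C M c m
          \<ominus>\<^bsub>tensor C M\<^esub> tensor_elem C M c m' = \<zero>\<^bsub>tensor C M\<^esub>"
        unfolding v(2)[OF that, symmetric]
        by (rule relation_zero) (use that in \<open>unfold tensor_relations_def, blast\<close>)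
    qed (use that tensor_elem_closed in simp_all)
    show "tensor_elem C M (a \<odot>\<^bsub>C\<^esub> c) m = a \<odot>\<^bsub>tensor C M\<^esub> tensor_elem C M c m"
      if "c \<in> carrier C" "m \<in> carrier M" for a c m
    proof (rule eq)
      show "tensor_elem C M (a \<odot>\<^bsub>C\<^esub> c) m \<ominus>\<^bsub>tensor C M\<^esub> a \<odot>\<^bsub>tensor C M\<^esub> tensor_elem C M c m = \<zero>\<^bsub>tensor C M\<^esub>"
        unfolding v(3)[OF that, symmetric]
        by (rule relation_zero) (use that in \<open>unfold tensor_relations_def, blast\<close>)
    qed (use that tensor_elem_closed T.smult_closed in simp_all)
    show "tensor_elem C M c (a \<odot>\<^bsub>M\<^esub> m) = a \<odot>\<^bsub>tensor C M\<^esub> tensor_elem C M c m"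
      if "c \<in> carrier C" "m \<in> carrier M" for a c m
    proof (rule eq)
      show "tensor_elem C M c (a \<odot>\<^bsub>M\<^esub> m) \<ominus>\<^bsub>tensor C M\<^esub> a \<odot>\<^bsub>tensor C M\<^esub> tensor_elem C M c m = \<zero>\<^bsub>tensor C M\<^esub>"
        unfolding v(4)[OF that, symmetric]
        by (rule relation_zero) (use that in \<open>unfold tensor_relations_def, blast\<close>)
    qed (use that tensor_elem_closed T.smult_closed in simp_all)
  qed (use tensor_elem_closed in simp_all)
qed

lemma tensor_elem_linear_left: "m \<in> carrier M \<Longrightarrow> linear_map scalars C (tensor C M) (\<lambda>c. tensor_elem C M c m)"
  and tensor_elem_linear_right: "c \<in> carrier C \<Longrightarrow> linear_map scalars M (tensor C M) (tensor_elem C M c)"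
  using tensor_elem_bilinear by (simp_all add: bilinear_def)

lemma tensor_eqI:
  assumes f: "linear_map scalars (tensor C M) W f" and h: "linear_map scalars (tensor C M) W h"
    and W: "module scalars W"
    and eq: "\<And>c m. c \<in> carrier C \<Longrightarrow> m \<in> carrier M \<Longrightarrow> f (tensor_elem C M c m) = h (tensor_elem C M c m)"
    and t: "t \<in> carrier (tensor C M)"
  shows "f t = h t"
proof -
  obtain x where x: "x \<in> carrier (tensor_free C M)" "t = tensor_null C M +>\<^bsub>tensor_free C M\<^esub> x"
    using t unfolding carrier_Q_image by blast
  note lin = linear_map_compose[OF coset_linear, unfolded tensor_free_def[of C M]]
  have "f (tensor_null C M +>\<^bsub>free_module (carrier C \<times> carrier M)\<^esub> x) =
      h (tensor_null C M +>\<^bsub>free_module (carrier C \<times> carrier M)\<^esub> x)"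
    by (rule free_module_eqI[OF lin[OF f] lin[OF h] W])
      (use eq x(1) in \<open>auto simp: tensor_elem_coset tensor_free_def\<close>)
  then show ?thesis using x(2) by (simp add: tensor_free_def)
qed

lemma tensor_span:
  "carrier (tensor C M) \<subseteq> linear_span scalars (tensor C M)
     {tensor_elem C M c m | c m. c \<in> carrier C \<and> m \<in> carrier M}" (is "_ \<subseteq> ?S")
proof
  fix t assume "t \<in> carrier (tensor C M)"
  then obtain x where x: "x \<in> carrier (tensor_free C M)" "t = tensor_null C M +>\<^bsub>tensor_free C M\<^esub> x"
    unfolding carrier_Q_image by blast
  have S: "{tensor_elem C M c m | c m. c \<in> carrier C \<and> m \<in> carrier M} \<subseteq> carrier (tensor C M)"
    using tensor_elem_closed by blast
  show "t \<in> ?S"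
    unfolding x(2)
  proof (rule linear_map_span_into[OF coset_linear module_tensor_free module_tensor submodule_linear_span[OF module_tensor S]])
    show "x \<in> linear_span scalars (tensor_free C M) (single ` (carrier C \<times> carrier M))"
      using free_module_span x(1) unfolding tensor_free_def by blast
    show "tensor_null C M +>\<^bsub>tensor_free C M\<^esub> y \<in> ?S" if y: "y \<in> single ` (carrier C \<times> carrier M)" for y
    proof -
      obtain c m where "y = single (c, m)" "c \<in> carrier C" "m \<in> carrier M" using y by blast
      then show ?thesis
        by (intro subsetD[OF linear_span_superset]) (auto simp: tensor_elem_coset)
    qed
    show "single ` (carrier C \<times> carrier M) \<subseteq> carrier (tensor_free C M)"
      by (rule image_subsetI) (auto intro: pair_closed)
  qed
qed

text \<open>Universal property of the tensor product: the extension of \<beta> to the free module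
  kills all relations because \<beta> is bilinear, hence kills their span.\<close>

lemma
  assumes \<beta>: "bilinear C M W \<beta>" and W: "module scalars W"
  shows tensor_lift_linear: "linear_map scalars (tensor C M) W (tensor_lift W \<beta>)"
    and tensor_lift_elem: "c \<in> carrier C \<Longrightarrow> m \<in> carrier M \<Longrightarrow> tensor_lift W \<beta> (tensor_elem C M c m) = \<beta> c m"
proof -
  interpret W: module scalars W by fact
  have bl: "m \<in> carrier M \<Longrightarrow> linear_map scalars C W (\<lambda>c. \<beta> c m)"
    and br: "c \<in> carrier C \<Longrightarrow> linear_map scalars M W (\<beta> c)" for c m
    using \<beta> by (simp_all add: bilinear_def)
  let ?L = "free_lift W (\<lambda>p. \<beta> (fst p) (snd p))"
  have cl: "(\<lambda>p. \<beta> (fst p) (snd p)) \<in> carrier C \<times> carrier M \<rightarrow> carrier W"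
    using linear_mapD'(1)[OF bl] by auto
  have L: "linear_map scalars (tensor_free C M) W ?L"
    unfolding tensor_free_def by (rule free_lift_linear[OF W cl])
  have Ls: "?L (single (c, m)) = \<beta> c m" if "c \<in> carrier C" "m \<in> carrier M" for c m
    using free_lift_single[OF W, of "\<lambda>p. \<beta> (fst p) (snd p)" "(c, m)"] linear_mapD'(1)[OF bl] that by simp
  note v = relation_values[OF L W]
  have zero': "x \<ominus>\<^bsub>W\<^esub> x = \<zero>\<^bsub>W\<^esub>" if "x \<in> carrier W" for x
    using that by (simp add: W.minus_eq W.r_neg)
  have zero: "x \<oplus>\<^bsub>W\<^esub> y \<ominus>\<^bsub>W\<^esub> x \<ominus>\<^bsub>W\<^esub> y = \<zero>\<^bsub>W\<^esub>"
    if "x \<in> carrier W" "y \<in> carrier W" for x y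
  proof -
    have "x \<oplus>\<^bsub>W\<^esub> y \<ominus>\<^bsub>W\<^esub> x \<ominus>\<^bsub>W\<^esub> y = (x \<oplus>\<^bsub>W\<^esub> y) \<oplus>\<^bsub>W\<^esub> \<ominus>\<^bsub>W\<^esub> (x \<oplus>\<^bsub>W\<^esub> y)"
      using that by (simp add: W.minus_eq W.minus_add W.a_assoc)
    then show ?thesis using that by (simp add: W.r_neg)
  qed
  have rel: "?L r = \<zero>\<^bsub>W\<^esub>" if "r \<in> tensor_relations C M" for r
    using that unfolding tensor_relations_def
    by (auto simp: v Ls linear_mapD'[OF bl] linear_mapD'[OF br] zero zero')
  have L0: "?L x = \<zero>\<^bsub>W\<^esub>" if "x \<in> tensor_null C M" for x
    using linear_map_span_into[OF L module_tensor_free W submodule_zero[OF W] relations_closed, of x] rel that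
    unfolding tensor_null_eq by blast
  have tl: "tensor_lift W \<beta> = (\<lambda>t. ?L (SOME f. f \<in> t))"
    by (auto simp: tensor_lift_def free_lift_def Let_def)
  show "linear_map scalars (tensor C M) W (tensor_lift W \<beta>)"
    unfolding tl by (rule descend_linear[OF L W L0])
  show "tensor_lift W \<beta> (tensor_elem C M c m) = \<beta> c m" if "c \<in> carrier C" "m \<in> carrier M"
    unfolding tl tensor_elem_coset using descend[OF L W L0 pair_closed[OF that]] Ls[OF that] by simp
qed

end

section \<open>The symmetric algebra by generators and relations: universal property, gradings,
  augmentation, derivations\<close>

section \<open>The symmetric algebra\<close>

subsection \<open>The algebra of words\<close>

lemma word_algebra_simps:
  "carrier (word_algebra V) = carrier (free_module (lists (letters V)))"
  "zero (word_algebra V) = zero (free_module (lists (letters V)))"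
  "add (word_algebra V) = add (free_module (lists (letters V)))"
  "smult (word_algebra V) = smult (free_module (lists (letters V)))"
  "one (word_algebra V) = single []"
  by (simp_all add: word_algebra_def)

lemma linear_map_cong:
  assumes "carrier V = carrier V'" "add V = add V'" "smult V = smult V'"
  shows "linear_map R V W f = linear_map R V' W f"
  using assms by (simp add: linear_map_def)

lemma vector_space_cong:
  assumes "carrier V = carrier W" "add V = add W" "zero V = zero W" "smult V = smult W"
    "module scalars V"
  shows "module scalars W"
proof (rule vector_spaceI)
  show "abelian_group W"
    using abelian_group_cong[OF assms(1-3)] vector_spaceD(9)[OF assms(5)] by blast
qed (use vector_spaceD(1-5)[OF assms(5)] assms(1-4) in simp_all)

lemma module_words: "module scalars (word_algebra V)"
  by (rule vector_space_cong[OF _ _ _ _ module_free]) (simp_all only: word_algebra_simps)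

text \<open>The product of the word algebra on arbitrary functions of lists, free of support
  conditions. Peeling off the first letter replaces \<open>f\<close> by
  \<open>\<lambda>w. f (a # w)\<close>, and associativity becomes an induction over the word for all
  \<open>f\<close> at once.\<close>

definition conv :: "('a list \<Rightarrow> 'k::field) \<Rightarrow> ('a list \<Rightarrow> 'k) \<Rightarrow> 'a list \<Rightarrow> 'k" where
  "conv f h w = (\<Sum>n\<le>length w. f (take n w) * h (drop n w))"

lemma conv_Nil: "conv f h [] = f [] * h []"
  by (simp add: conv_def)

lemma conv_Cons: "conv f h (a # w) = f [] * h (a # w) + conv (\<lambda>w. f (a # w)) h w"
  by (simp add: conv_def sum.atMost_Suc_shift del: sum.atMost_Suc)

lemma conv_linear:
  "conv (\<lambda>w. f w + f' w) h = (\<lambda>w. conv f h w + conv f' h w)"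
  "conv f (\<lambda>w. h w + h' w) = (\<lambda>w. conv f h w + conv f h' w)"
  "conv (\<lambda>w. a * f w) h = (\<lambda>w. a * conv f h w)"
  "conv f (\<lambda>w. a * h w) = (\<lambda>w. a * conv f h w)"
  "conv (\<lambda>w. 0) h = (\<lambda>w. 0)"
  by (auto simp: conv_def fun_eq_iff distrib_left distrib_right sum.distrib sum_distrib_left ac_simps)

lemma conv_assoc: "conv (conv f h) k w = conv f (conv h k) w"
proof (induction w arbitrary: f)
  case (Cons a w)
  then show ?case by (simp add: conv_Cons conv_Nil conv_linear algebra_simps)
qed (simp add: conv_Nil)

lemma conv_single_Nil: "conv (single []) h w = h w"
proof (cases w)
  case (Cons a w')
  have "(\<lambda>w. single [] (a # w)) = (\<lambda>w. 0)" by (simp add: single_def)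
  then show ?thesis by (simp add: Cons conv_Cons conv_linear single_def)
qed (simp add: conv_Nil single_def)

lemma conv_single_Nil_right: "conv f (single []) w = f w"
  by (induction w arbitrary: f) (simp_all add: conv_Cons conv_Nil single_def)

lemma conv_single: "conv (single u) (single v) w = (single (u @ v) w :: 'k::field)"
proof (induction w arbitrary: u)
  case Nil
  then show ?case by (simp add: single_def conv_Nil)
next
  case (Cons a w)
  show ?case
  proof (cases u)
    case Nil
    then show ?thesis by (simp only: conv_single_Nil append_Nil)
  next
    case u: (Cons b u')
    have "(\<lambda>w. single u (a # w)) = (if a = b then single u' else (\<lambda>_. 0 :: 'k))"
      by (auto simp: u single_def)
    then have "conv (single u) (single v) (a # w) = (if a = b then single (u' @ v) w else 0 :: 'k)"
      using Cons.IH[of u'] by (simp add: conv_Cons conv_linear) (simp add: u single_def)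
    then show ?thesis by (auto simp: u single_def)
  qed
qed

lemma conv_closed:
  assumes "f \<in> carrier (free_module (lists X))" "h \<in> carrier (free_module (lists X))"
  shows "conv f h \<in> carrier (free_module (lists X))"
proof -
  let ?S = "(\<lambda>(u, v). u @ v) ` ({w. f w \<noteq> 0} \<times> {w. h w \<noteq> 0})"
  have f: "finite {w. f w \<noteq> 0}" "{w. f w \<noteq> 0} \<subseteq> lists X" and h: "finite {w. h w \<noteq> 0}" "{w. h w \<noteq> 0} \<subseteq> lists X"
    using assms by simp_all
  have "w \<in> ?S" if w: "conv f h w \<noteq> 0" for w
  proof -
    obtain n where "f (take n w) * h (drop n w) \<noteq> 0"
      using sum.not_neutral_contains_not_neutral[OF w[unfolded conv_def]] by blast
    then show ?thesis by (intro image_eqI[of _ _ "(take n w, drop n w)"]) auto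
  qed
  then have sub: "{w. conv f h w \<noteq> 0} \<subseteq> ?S" by (auto simp only: mem_Collect_eq)
  moreover have "finite ?S" using f h by simp
  moreover have "?S \<subseteq> lists X"
  proof
    fix w assume "w \<in> ?S"
    then obtain u v where "w = u @ v" "u \<in> {w. f w \<noteq> 0}" "v \<in> {w. h w \<noteq> 0}" by auto
    then show "w \<in> lists X" using subsetD[OF f(2)] subsetD[OF h(2)] by simp
  qed
  ultimately show ?thesis
    unfolding free_module_simps mem_Collect_eq by (intro conjI finite_subset[OF sub] order.trans[OF sub])
qed

lemma word_mult: "f \<otimes>\<^bsub>word_algebra V\<^esub> h = conv f h"
  by (simp add: word_algebra_def conv_def fun_eq_iff)

lemma word_mult_single: "single u \<otimes>\<^bsub>word_algebra V\<^esub> single v = single (u @ v)"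
  by (rule ext) (simp only: word_mult conv_single)

lemma ring_words: "ring (word_algebra V :: ('k::field, ('k, 'v) words) module)"
proof (rule ringI)
  show "abelian_group (word_algebra V :: ('k, ('k, 'v) words) module)" by (rule vector_spaceD(9)[OF module_words])
  show "Group.monoid (word_algebra V :: ('k, ('k, 'v) words) module)"
  proof (rule monoidI)
    show "\<one>\<^bsub>word_algebra V\<^esub> \<in> carrier (word_algebra V :: ('k, ('k, 'v) words) module)"
      unfolding word_algebra_simps by (rule single_closed) simp
  qed (simp_all only: word_algebra_simps word_mult conv_closed conv_single_Nil conv_single_Nil_right
      conv_assoc fun_eq_iff simp_thms)
qed (simp_all add: word_algebra_simps word_mult conv_linear)

lemma word_smult_assoc:
  "(a \<odot>\<^bsub>word_algebra V\<^esub> f) \<otimes>\<^bsub>word_algebra V\<^esub> h = a \<odot>\<^bsub>word_algebra V\<^esub> (f \<otimes>\<^bsub>word_algebra V\<^esub> h)"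
  "f \<otimes>\<^bsub>word_algebra V\<^esub> (a \<odot>\<^bsub>word_algebra V\<^esub> h) = a \<odot>\<^bsub>word_algebra V\<^esub> (f \<otimes>\<^bsub>word_algebra V\<^esub> h)"
  by (simp_all add: word_algebra_simps word_mult conv_linear)

lemma word_mult_linear:
  assumes "f \<in> carrier (word_algebra V)"
  shows "linear_map scalars (word_algebra V) (word_algebra V) (\<lambda>h. f \<otimes>\<^bsub>word_algebra V\<^esub> h)"
    and "linear_map scalars (word_algebra V) (word_algebra V) (\<lambda>h. h \<otimes>\<^bsub>word_algebra V\<^esub> f)"
proof -
  interpret ring "word_algebra V" by (rule ring_words)
  show "linear_map scalars (word_algebra V) (word_algebra V) (\<lambda>h. f \<otimes>\<^bsub>word_algebra V\<^esub> h)"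
    "linear_map scalars (word_algebra V) (word_algebra V) (\<lambda>h. h \<otimes>\<^bsub>word_algebra V\<^esub> f)"
    using assms by (auto intro!: linear_mapI simp: word_smult_assoc l_distr r_distr)
qed

lemmas linear_map_words = linear_map_cong[OF word_algebra_simps(1,3,4)]

subsection \<open>Linear maps out of the symmetric algebra\<close>

abbreviation sgn_pow :: "int \<Rightarrow> 'k::field" where
  "sgn_pow n \<equiv> (- 1) powi n"

lemma sgn_pow_add: "sgn_pow (m + n) = (sgn_pow m * sgn_pow n :: 'k::field)"
  by (simp add: power_int_add)

lemma sgn_pow_square: "sgn_pow n * sgn_pow n = (1 :: 'k::field)"
  by (cases "even n") (auto simp: power_int_minus_left)

lemma sgn_pow_eq: "sgn_pow n = (if even n then 1 else - 1 :: 'k::field)"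
  by (simp add: power_int_minus_left)

lemma koszul_eq:
  assumes "module scalars V" "x \<in> carrier V"
  shows "koszul V n x = sgn_pow n \<odot>\<^bsub>V\<^esub> x"
  using vector_spaceD(5,8)[OF assms] by (simp add: koszul_def sgn_pow_eq)

text \<open>This is what S(V) sees of V: the letters are homogeneous elements, and the linear
  relations involve sums and multiples within one degree.\<close>

locale graded_summands =
  fixes V :: "('k::field, 'v, 'e) graded_scheme" (structure)
  assumes grade_add: "v \<in> grade V i \<Longrightarrow> v' \<in> grade V i \<Longrightarrow> v \<oplus> v' \<in> grade V i"
    and grade_smult: "v \<in> grade V i \<Longrightarrow> a \<odot> v \<in> grade V i"
begin

abbreviation "W \<equiv> word_algebra V"
abbreviation "S \<equiv> sym_algebra V"
abbreviation "I \<equiv> sym_ideal V"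
abbreviation "X \<equiv> lists (letters V)"

lemma single_word: "u \<in> X \<Longrightarrow> single u \<in> carrier W"
  unfolding word_algebra_simps by (rule single_closed)

lemma letter_iff: "(i, v) \<in> letters V \<longleftrightarrow> v \<in> grade V i"
  by (simp add: letters_def)

lemma relation_values:
  assumes L: "linear_map scalars W U L" and U: "module scalars U"
  shows "\<lbrakk>v \<in> grade V i; v' \<in> grade V i\<rbrakk> \<Longrightarrow>
      L (\<lambda>w. single [(i, v \<oplus> v')] w - single [(i, v)] w - single [(i, v')] w) =
      L (single [(i, v \<oplus> v')]) \<ominus>\<^bsub>U\<^esub> L (single [(i, v)]) \<ominus>\<^bsub>U\<^esub> L (single [(i, v')])"
    and "v \<in> grade V i \<Longrightarrow>
      L (\<lambda>w. single [(i, a \<odot> v)] w - a * single [(i, v)] w) =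
      L (single [(i, a \<odot> v)]) \<ominus>\<^bsub>U\<^esub> a \<odot>\<^bsub>U\<^esub> L (single [(i, v)])"
    and "\<lbrakk>v \<in> grade V i; u \<in> grade V j\<rbrakk> \<Longrightarrow>
      L (\<lambda>w. single [(i, v), (j, u)] w - sgn_pow (i * j) * single [(j, u), (i, v)] w) =
      L (single [(i, v), (j, u)]) \<ominus>\<^bsub>U\<^esub> sgn_pow (i * j) \<odot>\<^bsub>U\<^esub> L (single [(j, u), (i, v)])"
proof -
  have L': "linear_map scalars (free_module X) U L" using L by (simp only: linear_map_words)
  note d = free_linear_diff(1)[OF L' U] free_linear_diff(2)[OF L' U] free_linear_smult(1)[OF L'] free_linear_smult(2)[OF L']
  have c: "single w \<in> carrier (free_module X)" if "w \<in> X" for w using that by (rule single_closed)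
  show "L (\<lambda>w. single [(i, v \<oplus> v')] w - single [(i, v)] w - single [(i, v')] w) =
      L (single [(i, v \<oplus> v')]) \<ominus>\<^bsub>U\<^esub> L (single [(i, v)]) \<ominus>\<^bsub>U\<^esub> L (single [(i, v')])"
    if "v \<in> grade V i" "v' \<in> grade V i"
    by (simp add: d c that letter_iff grade_add del: free_module_simps)
  show "L (\<lambda>w. single [(i, a \<odot> v)] w - a * single [(i, v)] w) =
      L (single [(i, a \<odot> v)]) \<ominus>\<^bsub>U\<^esub> a \<odot>\<^bsub>U\<^esub> L (single [(i, v)])" if "v \<in> grade V i"
    by (simp add: d c that letter_iff grade_smult del: free_module_simps)
  show "L (\<lambda>w. single [(i, v), (j, u)] w - sgn_pow (i * j) * single [(j, u), (i, v)] w) =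
      L (single [(i, v), (j, u)]) \<ominus>\<^bsub>U\<^esub> sgn_pow (i * j) \<odot>\<^bsub>U\<^esub> L (single [(j, u), (i, v)])"
    if "v \<in> grade V i" "u \<in> grade V j"
    by (simp add: d c that letter_iff del: free_module_simps)
qed

lemma sym_relations_closed: "sym_relations V \<subseteq> carrier W"
proof -
  have L: "linear_map scalars (free_module X) W (\<lambda>x. x)"
    unfolding linear_map_words[symmetric] by (rule linear_mapI) auto
  note d = free_linear_diff(2)[OF L module_words] free_linear_smult(2)[OF L] single_closed
  show ?thesis
    unfolding sym_relations_def word_algebra_simps(1)
    by (auto intro!: d simp: letter_iff grade_add grade_smult simp del: free_module_simps)
qed

lemma ideal_I: "ideal I W"
  unfolding sym_ideal_def by (rule ring.genideal_ideal[OF ring_words sym_relations_closed])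

text \<open>Multiplying by a scalar \<open>a\<close> is multiplying by the algebra element
  \<open>a \<odot> 1\<close>, so the ideal is also a subspace.\<close>

lemma submodule_I: "submodule I scalars W"
proof -
  interpret W: ring W by (rule ring_words)
  interpret I: ideal I W by (rule ideal_I)
  interpret M: module scalars W by (rule module_words)
  show ?thesis
  proof (rule M.submoduleI)
    show "a \<odot>\<^bsub>W\<^esub> x \<in> I" if "x \<in> I" for a x
    proof -
      have "a \<odot>\<^bsub>W\<^esub> x = (a \<odot>\<^bsub>W\<^esub> \<one>\<^bsub>W\<^esub>) \<otimes>\<^bsub>W\<^esub> x"
        using that I.a_subset word_smult_assoc(1)[where V = V and a = a and f = "\<one>\<^bsub>W\<^esub>" and h = x] by (auto simp: subset_iff)
      then show ?thesis using that I.I_l_closed M.smult_closed[of a "\<one>\<^bsub>W\<^esub>"] by simp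
    qed
  qed (use I.a_subset I.a_inv_closed in auto)
qed

lemma sym_simps:
  "carrier S = a_rcosets\<^bsub>W\<^esub> I" "mult S = rcoset_mult W I" "\<one>\<^bsub>S\<^esub> = I +>\<^bsub>W\<^esub> single []"
  "zero S = I" "add S = set_add W" "smult S = coset_smult W I"
  "grade S n = sym_class V ` {f \<in> carrier W. \<forall>w. f w \<noteq> 0 \<longrightarrow> sum_list (map fst w) = n}"
  by (simp_all add: sym_algebra_def Let_def FactRing_def word_algebra_simps)

sublocale Q: vector_space_quotient W I S
  by (rule vector_space_quotient.intro) (simp_all only: module_words submodule_I sym_simps)

lemmas module_S = Q.module_Q

lemma class_linear: "linear_map scalars W S (sym_class V)"
  using Q.coset_linear by (simp add: sym_class_def[abs_def])

lemma carrier_S: "carrier S = sym_class V ` carrier W"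
  by (simp add: Q.carrier_Q_image sym_class_def[abs_def])

lemma class_mult:
  "f \<in> carrier W \<Longrightarrow> h \<in> carrier W \<Longrightarrow> sym_class V f \<otimes>\<^bsub>S\<^esub> sym_class V h = sym_class V (f \<otimes>\<^bsub>W\<^esub> h)"
  using ideal.rcoset_mult_add[OF ideal_I] by (simp add: sym_class_def sym_simps)

lemma ring_S: "ring S"
proof -
  interpret R: ring "W Quot I" by (rule ideal.quotient_is_ring[OF ideal_I])
  have eq: "carrier (W Quot I) = carrier S" "mult (W Quot I) = mult S" "one (W Quot I) = one S"
    "add (W Quot I) = add S"
    by (simp_all add: sym_simps FactRing_def word_algebra_simps)
  show ?thesis
  proof (rule ringI)
    show "abelian_group S" by (rule vector_spaceD(9)[OF module_S])
    show "Group.monoid S"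
      by (rule monoidI) (use R.m_assoc R.m_closed R.one_closed R.l_one R.r_one in \<open>simp_all only: eq\<close>)
  qed (use R.l_distr R.r_distr in \<open>simp_all only: eq\<close>)
qed

abbreviation wd :: "(int \<times> 'v) list \<Rightarrow> ('k, 'v) sym" where
  "wd u \<equiv> sym_class V (single u)"

lemma wd_closed: "u \<in> X \<Longrightarrow> wd u \<in> carrier S"
  using single_word carrier_S by blast

lemma wd_append: "u \<in> X \<Longrightarrow> v \<in> X \<Longrightarrow> wd (u @ v) = wd u \<otimes>\<^bsub>S\<^esub> wd v"
  by (simp add: class_mult single_word word_mult_single)

lemma wd_Nil: "wd [] = \<one>\<^bsub>S\<^esub>"
  by (simp add: sym_simps sym_class_def)

lemma sym_smult_assoc:
  assumes "x \<in> carrier S" "y \<in> carrier S"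
  shows "(a \<odot>\<^bsub>S\<^esub> x) \<otimes>\<^bsub>S\<^esub> y = a \<odot>\<^bsub>S\<^esub> (x \<otimes>\<^bsub>S\<^esub> y)"
    and "x \<otimes>\<^bsub>S\<^esub> (a \<odot>\<^bsub>S\<^esub> y) = a \<odot>\<^bsub>S\<^esub> (x \<otimes>\<^bsub>S\<^esub> y)"
proof -
  interpret W: ring W by (rule ring_words)
  interpret M: module scalars W by (rule module_words)
  obtain f h where f: "f \<in> carrier W" "x = sym_class V f" and h: "h \<in> carrier W" "y = sym_class V h"
    using assms unfolding carrier_S by blast
  note c = linear_mapD'(3)[OF class_linear, symmetric]
  show "(a \<odot>\<^bsub>S\<^esub> x) \<otimes>\<^bsub>S\<^esub> y = a \<odot>\<^bsub>S\<^esub> (x \<otimes>\<^bsub>S\<^esub> y)" "x \<otimes>\<^bsub>S\<^esub> (a \<odot>\<^bsub>S\<^esub> y) = a \<odot>\<^bsub>S\<^esub> (x \<otimes>\<^bsub>S\<^esub> y)"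
    using f h by (simp_all add: c class_mult word_smult_assoc)
qed

lemma sym_mult_linear:
  assumes "x \<in> carrier S"
  shows "linear_map scalars S S (\<lambda>y. x \<otimes>\<^bsub>S\<^esub> y)" and "linear_map scalars S S (\<lambda>y. y \<otimes>\<^bsub>S\<^esub> x)"
proof -
  interpret S: ring S by (rule ring_S)
  show "linear_map scalars S S (\<lambda>y. x \<otimes>\<^bsub>S\<^esub> y)" "linear_map scalars S S (\<lambda>y. y \<otimes>\<^bsub>S\<^esub> x)"
    using assms by (auto intro!: linear_mapI simp: sym_smult_assoc S.l_distr S.r_distr)
qed

lemma wd_relations:
  "\<lbrakk>v \<in> grade V i; v' \<in> grade V i\<rbrakk> \<Longrightarrow> wd [(i, v \<oplus> v')] = wd [(i, v)] \<oplus>\<^bsub>S\<^esub> wd [(i, v')]"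
  "v \<in> grade V i \<Longrightarrow> wd [(i, a \<odot> v)] = a \<odot>\<^bsub>S\<^esub> wd [(i, v)]"
  "\<lbrakk>v \<in> grade V i; u \<in> grade V j\<rbrakk> \<Longrightarrow> wd [(i, v), (j, u)] = sgn_pow (i * j) \<odot>\<^bsub>S\<^esub> wd [(j, u), (i, v)]"
proof -
  interpret S: module scalars S by (rule module_S)
  note v = relation_values[OF class_linear module_S]
  have rel: "sym_class V r = \<zero>\<^bsub>S\<^esub>" if "r \<in> sym_relations V" for r
    unfolding sym_class_def using that ring.genideal_self[OF ring_words sym_relations_closed]
    by (intro Q.coset_zero) (auto simp: sym_ideal_def)
  have eq: "x = y" if "x \<ominus>\<^bsub>S\<^esub> y = \<zero>\<^bsub>S\<^esub>" "x \<in> carrier S" "y \<in> carrier S" for x y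
  proof -
    have "x = (x \<ominus>\<^bsub>S\<^esub> y) \<oplus>\<^bsub>S\<^esub> y"
      using that(2,3) by (simp add: S.minus_eq S.a_assoc S.l_neg)
    then show ?thesis using that by simp
  qed
  have eq2: "x = y \<oplus>\<^bsub>S\<^esub> z" if "x \<ominus>\<^bsub>S\<^esub> y \<ominus>\<^bsub>S\<^esub> z = \<zero>\<^bsub>S\<^esub>"
    "x \<in> carrier S" "y \<in> carrier S" "z \<in> carrier S" for x y z
    using eq[of x "y \<oplus>\<^bsub>S\<^esub> z"] that by (simp add: S.minus_eq S.minus_add S.a_assoc)
  show "wd [(i, v \<oplus> v')] = wd [(i, v)] \<oplus>\<^bsub>S\<^esub> wd [(i, v')]" if "v \<in> grade V i" "v' \<in> grade V i"
  proof (rule eq2)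
    show "wd [(i, v \<oplus> v')] \<ominus>\<^bsub>S\<^esub> wd [(i, v)] \<ominus>\<^bsub>S\<^esub> wd [(i, v')] = \<zero>\<^bsub>S\<^esub>"
      unfolding v(1)[OF that, symmetric]
      by (rule rel) (use that in \<open>unfold sym_relations_def, blast\<close>)
  qed (use that in \<open>simp_all add: wd_closed letter_iff grade_add\<close>)
  show "wd [(i, a \<odot> v)] = a \<odot>\<^bsub>S\<^esub> wd [(i, v)]" if "v \<in> grade V i"
  proof (rule eq)
    show "wd [(i, a \<odot> v)] \<ominus>\<^bsub>S\<^esub> a \<odot>\<^bsub>S\<^esub> wd [(i, v)] = \<zero>\<^bsub>S\<^esub>"
      unfolding v(2)[OF that, symmetric]
      by (rule rel) (use that in \<open>unfold sym_relations_def, blast\<close>)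
  qed (use that in \<open>simp_all add: wd_closed letter_iff grade_smult S.smult_closed\<close>)
  show "wd [(i, v), (j, u)] = sgn_pow (i * j) \<odot>\<^bsub>S\<^esub> wd [(j, u), (i, v)]" if "v \<in> grade V i" "u \<in> grade V j"
  proof (rule eq)
    show "wd [(i, v), (j, u)] \<ominus>\<^bsub>S\<^esub> sgn_pow (i * j) \<odot>\<^bsub>S\<^esub> wd [(j, u), (i, v)] = \<zero>\<^bsub>S\<^esub>"
      unfolding v(3)[OF that, symmetric]
      by (rule rel) (use that in \<open>unfold sym_relations_def, blast\<close>)
  qed (use that in \<open>simp_all add: wd_closed letter_iff S.smult_closed\<close>)
qed

lemma sym_eqI:
  assumes f: "linear_map scalars S U f" and h: "linear_map scalars S U h" and U: "module scalars U"
    and eq: "\<And>u. u \<in> X \<Longrightarrow> f (wd u) = h (wd u)" and x: "x \<in> carrier S"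
  shows "f x = h x"
proof -
  obtain t where t: "t \<in> carrier W" "x = sym_class V t" using x unfolding carrier_S by blast
  note lin = linear_map_compose[OF class_linear, unfolded linear_map_words]
  have "f (sym_class V t) = h (sym_class V t)"
    by (rule free_module_eqI[OF lin[OF f] lin[OF h] U])
      (use eq t(1) in \<open>simp_all only: word_algebra_simps\<close>)
  then show ?thesis using t(2) by simp
qed

definition sym_lift :: "('k, 'w, 'h) module_scheme \<Rightarrow> ((int \<times> 'v) list \<Rightarrow> 'w) \<Rightarrow> ('k, 'v) sym \<Rightarrow> 'w" where
  "sym_lift U \<phi> t = free_lift U \<phi> (SOME f. f \<in> t)"

text \<open>The contexts \<open>u\<close> and \<open>w\<close> are there because the ideal is
  two-sided: it is spanned by the products u r w of relations r with words on both sides.\<close>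

definition respects_relations :: "('k, 'w, 'h) module_scheme \<Rightarrow> ((int \<times> 'v) list \<Rightarrow> 'w) \<Rightarrow> bool" where
  "respects_relations U \<phi> \<longleftrightarrow> \<phi> \<in> X \<rightarrow> carrier U \<and>
     (\<forall>u\<in>X. \<forall>w\<in>X. \<forall>i. \<forall>v\<in>grade V i.
        (\<forall>v'\<in>grade V i. \<phi> (u @ [(i, v \<oplus> v')] @ w) = \<phi> (u @ [(i, v)] @ w) \<oplus>\<^bsub>U\<^esub> \<phi> (u @ [(i, v')] @ w)) \<and>
        (\<forall>a. \<phi> (u @ [(i, a \<odot> v)] @ w) = a \<odot>\<^bsub>U\<^esub> \<phi> (u @ [(i, v)] @ w)) \<and>
        (\<forall>j. \<forall>x\<in>grade V j. \<phi> (u @ [(i, v), (j, x)] @ w) =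
           sgn_pow (i * j) \<odot>\<^bsub>U\<^esub> \<phi> (u @ [(j, x), (i, v)] @ w)))"

text \<open>Universal property of the symmetric algebra. The elements that are killed by the free
  extension of \<phi> in every context form a two-sided ideal containing the relations, hence
  contain \<open>I\<close>; the empty context then shows that the extension itself vanishes on
  \<open>I\<close>.\<close>

lemma
  fixes U :: "('k, 'w, 'h) module_scheme"
  assumes \<phi>: "respects_relations U \<phi>" and U: "module scalars U"
  shows sym_lift_linear: "linear_map scalars S U (sym_lift U \<phi>)"
    and sym_lift_word: "u \<in> X \<Longrightarrow> sym_lift U \<phi> (wd u) = \<phi> u"
proof -
  interpret U: module scalars U by fact
  interpret W: ring W by (rule ring_words)
  interpret M: module scalars W by (rule module_words)
  let ?L = "free_lift U \<phi>"
  have cl: "\<phi> \<in> X \<rightarrow> carrier U" using \<phi> by (simp add: respects_relations_def)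
  then have cl': "u \<in> X \<Longrightarrow> \<phi> u \<in> carrier U" for u by blast
  have L: "linear_map scalars W U ?L"
    unfolding linear_map_words by (rule free_lift_linear[OF U cl])
  have Ls: "?L (single u) = \<phi> u" if "u \<in> X" for u
    by (rule free_lift_single[where \<phi> = \<phi>, OF U cl'[OF that]])
  \<comment> \<open>The free extension of \<phi> with its argument placed between the words
    \<open>u\<close> and \<open>w\<close>.\<close>
  define T where "T u w f = ?L ((single u \<otimes>\<^bsub>W\<^esub> f) \<otimes>\<^bsub>W\<^esub> single w)" for u w f
  have T: "linear_map scalars W U (T u w)" if "u \<in> X" "w \<in> X" for u w
    unfolding T_def using that
    by (intro linear_map_compose[OF linear_map_compose[OF word_mult_linear(1) word_mult_linear(2)] L] single_word)
  have Ts: "T u w (single x) = \<phi> (u @ x @ w)" if "u \<in> X" "w \<in> X" "x \<in> X" for u w x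
    unfolding T_def using that by (simp add: word_mult_single Ls)
  have zero': "x \<ominus>\<^bsub>U\<^esub> x = \<zero>\<^bsub>U\<^esub>" if "x \<in> carrier U" for x
    using that by (simp add: U.minus_eq U.r_neg)
  have zero: "x \<oplus>\<^bsub>U\<^esub> y \<ominus>\<^bsub>U\<^esub> x \<ominus>\<^bsub>U\<^esub> y = \<zero>\<^bsub>U\<^esub>" if "x \<in> carrier U" "y \<in> carrier U" for x y
  proof -
    have "x \<oplus>\<^bsub>U\<^esub> y \<ominus>\<^bsub>U\<^esub> x \<ominus>\<^bsub>U\<^esub> y = (x \<oplus>\<^bsub>U\<^esub> y) \<oplus>\<^bsub>U\<^esub> \<ominus>\<^bsub>U\<^esub> (x \<oplus>\<^bsub>U\<^esub> y)"
      using that by (simp add: U.minus_eq U.minus_add U.a_assoc)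
    then show ?thesis using that by (simp add: U.r_neg)
  qed
  \<comment> \<open>Quantifying over all contexts is what makes this set absorb products from both
    sides.\<close>
  define H where "H = {f \<in> carrier W. \<forall>u\<in>X. \<forall>w\<in>X. T u w f = \<zero>\<^bsub>U\<^esub>}"
  have H: "submodule H scalars W"
  proof (rule M.submoduleI)
    note T0 = linear_map_zero[OF T W.abelian_group_axioms U.abelian_group_axioms]
    note Tm = linear_map_minus[OF T W.abelian_group_axioms U.abelian_group_axioms]
    show "\<zero>\<^bsub>W\<^esub> \<in> H" using T0 by (simp add: H_def)
    show "\<ominus>\<^bsub>W\<^esub> f \<in> H" if "f \<in> H" for f using that Tm by (simp add: H_def)
    show "f \<oplus>\<^bsub>W\<^esub> h \<in> H" if "f \<in> H" "h \<in> H" for f h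
      using that linear_mapD'(2)[OF T] by (simp add: H_def)
    show "a \<odot>\<^bsub>W\<^esub> f \<in> H" if "f \<in> H" for a f
      using that linear_mapD'(3)[OF T] vector_spaceD(7)[OF U] vector_spaceD(1)[OF module_words] by (simp add: H_def)
  qed (auto simp: H_def)
  have sv: "single u \<in> carrier W" if "u \<in> X" for u using that by (rule single_word)
  have zero_lin: "linear_map scalars W U (\<lambda>_. \<zero>\<^bsub>U\<^esub>)"
    by (rule linear_mapI) (simp_all add: vector_spaceD(7)[OF U])
  \<comment> \<open>Multiplying by a word \<open>y\<close> merely enlarges the context to
    \<open>u @ y\<close> or \<open>y @ w\<close>; a general factor \<open>x\<close> is reduced to
    words by linearity.\<close>
  have ideal_step: "T u w (x \<otimes>\<^bsub>W\<^esub> f) = \<zero>\<^bsub>U\<^esub>" "T u w (f \<otimes>\<^bsub>W\<^esub> x) = \<zero>\<^bsub>U\<^esub>"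
    if f: "f \<in> H" and x: "x \<in> carrier W" and u: "u \<in> X" and w: "w \<in> X" for f x u w
  proof -
    have fc: "f \<in> carrier W" using f by (simp add: H_def)
    have xc: "x \<in> carrier (free_module X)" using x by (simp only: word_algebra_simps)
    note lin = linear_map_compose[OF _ T[OF u w], unfolded linear_map_words]
    show "T u w (x \<otimes>\<^bsub>W\<^esub> f) = \<zero>\<^bsub>U\<^esub>"
    proof (rule free_module_eqI[OF lin[OF word_mult_linear(2)[OF fc, unfolded linear_map_words]] zero_lin[unfolded linear_map_words] U _ xc])
      fix y assume y: "y \<in> X"
      have "T u w (single y \<otimes>\<^bsub>W\<^esub> f) = T (u @ y) w f"
        unfolding T_def using sv[OF u] sv[OF w] sv[OF y] fc
        by (simp add: W.m_assoc[symmetric] word_mult_single)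
      then show "T u w (single y \<otimes>\<^bsub>W\<^esub> f) = \<zero>\<^bsub>U\<^esub>" using f u w y by (simp add: H_def)
    qed
    show "T u w (f \<otimes>\<^bsub>W\<^esub> x) = \<zero>\<^bsub>U\<^esub>"
    proof (rule free_module_eqI[OF lin[OF word_mult_linear(1)[OF fc, unfolded linear_map_words]] zero_lin[unfolded linear_map_words] U _ xc])
      fix y assume y: "y \<in> X"
      have "T u w (f \<otimes>\<^bsub>W\<^esub> single y) = T u (y @ w) f"
        unfolding T_def using sv[OF u] sv[OF w] sv[OF y] sv[of "y @ w"] w y fc
        by (simp add: W.m_assoc word_mult_single)
      then show "T u w (f \<otimes>\<^bsub>W\<^esub> single y) = \<zero>\<^bsub>U\<^esub>" using f u w y by (simp add: H_def)
    qed
  qed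
  have "ideal H W"
  proof (rule idealI[OF ring_words])
    show "subgroup H (add_monoid W)" using H by (simp add: submodule_def)
  qed (use ideal_step in \<open>auto simp: H_def\<close>)
  moreover have "sym_relations V \<subseteq> H"
  proof
    fix r assume r: "r \<in> sym_relations V"
    have "T u w r = \<zero>\<^bsub>U\<^esub>" if u: "u \<in> X" and w: "w \<in> X" for u w
    proof -
      note rv = relation_values[OF T[OF u w] U]
      have e1: "\<phi> (u @ [(i, v \<oplus> v')] @ w) = \<phi> (u @ [(i, v)] @ w) \<oplus>\<^bsub>U\<^esub> \<phi> (u @ [(i, v')] @ w)"
        if "v \<in> grade V i" "v' \<in> grade V i" for i v v'
        using \<phi> u w that unfolding respects_relations_def by blast
      have e2: "\<phi> (u @ [(i, a \<odot> v)] @ w) = a \<odot>\<^bsub>U\<^esub> \<phi> (u @ [(i, v)] @ w)" if "v \<in> grade V i" for i a v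
        using \<phi> u w that unfolding respects_relations_def by blast
      have e3: "\<phi> (u @ [(i, v), (j, x)] @ w) = sgn_pow (i * j) \<odot>\<^bsub>U\<^esub> \<phi> (u @ [(j, x), (i, v)] @ w)"
        if "v \<in> grade V i" "x \<in> grade V j" for i v j x
        using \<phi> u w that unfolding respects_relations_def by blast
      have X1: "[(i, v)] \<in> X" if "v \<in> grade V i" for i v using that by (simp add: letter_iff)
      have X2: "[(i, v), (j, x)] \<in> X" if "v \<in> grade V i" "x \<in> grade V j" for i v j x
        using that by (simp add: letter_iff)
      have c: "\<phi> (u @ x @ w) \<in> carrier U" if "x \<in> X" for x using cl' u w that by simp
      consider i v v' where "v \<in> grade V i" "v' \<in> grade V i"
          "r = (\<lambda>w. single [(i, v \<oplus> v')] w - single [(i, v)] w - single [(i, v')] w)"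
        | i a v where "v \<in> grade V i" "r = (\<lambda>w. single [(i, a \<odot> v)] w - a * single [(i, v)] w)"
        | i v j x where "v \<in> grade V i" "x \<in> grade V j"
          "r = (\<lambda>w. single [(i, v), (j, x)] w - sgn_pow (i * j) * single [(j, x), (i, v)] w)"
        using r unfolding sym_relations_def by blast
      then show ?thesis
      proof cases
        case 1
        show ?thesis
          unfolding 1(3) rv(1)[OF 1(1,2)] Ts[OF u w X1[OF grade_add[OF 1(1,2)]]] Ts[OF u w X1[OF 1(1)]]
            Ts[OF u w X1[OF 1(2)]] e1[OF 1(1,2)]
          by (rule zero) (rule c[OF X1[OF 1(1)]], rule c[OF X1[OF 1(2)]])
      next
        case 2
        show ?thesis
          unfolding 2(2) rv(2)[OF 2(1)] Ts[OF u w X1[OF grade_smult[OF 2(1)]]] Ts[OF u w X1[OF 2(1)]]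
            e2[OF 2(1)]
          by (rule zero'[OF vector_spaceD(1)[OF U c[OF X1[OF 2(1)]]]])
      next
        case 3
        show ?thesis
          unfolding 3(3) rv(3)[OF 3(1,2)] Ts[OF u w X2[OF 3(1,2)]] Ts[OF u w X2[OF 3(2,1)]] e3[OF 3(1,2)]
          by (rule zero'[OF vector_spaceD(1)[OF U c[OF X2[OF 3(2,1)]]]])
      qed
    qed
    then show "r \<in> H" using r sym_relations_closed by (auto simp: H_def)
  qed
  ultimately have IH: "I \<subseteq> H"
    unfolding sym_ideal_def by (rule W.genideal_minimal)
  have L0: "?L f = \<zero>\<^bsub>U\<^esub>" if "f \<in> I" for f
  proof -
    have "f \<in> H" using IH that by blast
    then have "T [] [] f = \<zero>\<^bsub>U\<^esub>" "f \<in> carrier W" by (auto simp: H_def)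
    moreover have "single [] = \<one>\<^bsub>W\<^esub>" by (simp only: word_algebra_simps)
    ultimately show ?thesis by (simp add: T_def)
  qed
  have tl: "sym_lift U \<phi> = (\<lambda>t. ?L (SOME f. f \<in> t))" by (simp add: sym_lift_def fun_eq_iff)
  show "linear_map scalars S U (sym_lift U \<phi>)"
    unfolding tl by (rule Q.descend_linear[OF L U L0])
  show "sym_lift U \<phi> (wd u) = \<phi> u" if "u \<in> X"
    unfolding tl sym_class_def using Q.descend[OF L U L0 single_word[OF that]] Ls[OF that] by simp
qed

end

lemma submodule_image:
  assumes "linear_map R V W f" "module R V" "module R W"
  shows "submodule (f ` carrier V) R W"
proof -
  interpret V: module R V by fact
  interpret W: module R W by fact
  note f = linear_mapD[OF assms(1)]
  show ?thesis
  proof (rule W.submoduleI)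
    show "f ` carrier V \<subseteq> carrier W" by (rule image_subsetI) (rule f)
    show "\<zero>\<^bsub>W\<^esub> \<in> f ` carrier V"
      using linear_map_zero[OF assms(1) V.abelian_group_axioms W.abelian_group_axioms, symmetric]
      by (rule image_eqI) (rule V.zero_closed)
  next
    fix x assume "x \<in> f ` carrier V"
    then obtain v where v: "v \<in> carrier V" "x = f v" by (rule imageE)
    show "\<ominus>\<^bsub>W\<^esub> x \<in> f ` carrier V"
      unfolding v(2) using linear_map_minus[OF assms(1) V.abelian_group_axioms W.abelian_group_axioms v(1), symmetric]
      by (rule image_eqI) (rule V.a_inv_closed[OF v(1)])
    show "a \<odot>\<^bsub>W\<^esub> x \<in> f ` carrier V" if "a \<in> carrier R" for a
      unfolding v(2) using f(3)[OF that v(1), symmetric]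
      by (rule image_eqI) (rule V.smult_closed[OF that v(1)])
    fix y assume "y \<in> f ` carrier V"
    then obtain w where w: "w \<in> carrier V" "y = f w" by (rule imageE)
    show "x \<oplus>\<^bsub>W\<^esub> y \<in> f ` carrier V"
      unfolding v(2) w(2) using f(2)[OF v(1) w(1), symmetric]
      by (rule image_eqI) (rule V.a_closed[OF v(1) w(1)])
  qed
qed

context graded_summands
begin

interpretation S: ring S by (rule ring_S)
interpretation SM: module scalars S
  rewrites "carrier scalars = UNIV" by (rule module_S) simp

subsection \<open>Gradings of the symmetric algebra\<close>

lemma wd_context:
  assumes "u \<in> X" "x \<in> X" "w \<in> X"
  shows "wd (u @ x @ w) = wd u \<otimes>\<^bsub>S\<^esub> (wd x \<otimes>\<^bsub>S\<^esub> wd w)"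
  using assms by (simp add: wd_append)

lemma letter_word: "v \<in> grade V i \<Longrightarrow> [(i, v)] \<in> X"
  by (simp add: letter_iff)

lemma context_linear:
  assumes "u \<in> X" "w \<in> X"
  shows "linear_map scalars S S (\<lambda>x. wd u \<otimes>\<^bsub>S\<^esub> (x \<otimes>\<^bsub>S\<^esub> wd w))"
  by (rule linear_map_compose[OF sym_mult_linear(2)[OF wd_closed[OF assms(2)]] sym_mult_linear(1)[OF wd_closed[OF assms(1)]]])

text \<open>If \<open>q\<close> sees only the degrees of the letters and not the order of
  neighbours, then the words occurring in one relation are either all kept or all replaced by
  zero.\<close>

lemma respects_selector:
  fixes q :: "(int \<times> 'v) list \<Rightarrow> bool"
  assumes "\<And>u w i v v'. q (u @ [(i, v)] @ w) = q (u @ [(i, v')] @ w)"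
    and "\<And>u w l l'. q (u @ [l, l'] @ w) = q (u @ [l', l] @ w)"
  shows "respects_relations S (\<lambda>u. if q u then wd u else \<zero>\<^bsub>S\<^esub>)"
  unfolding respects_relations_def
proof (intro conjI ballI allI)
  show "(\<lambda>u. if q u then wd u else \<zero>\<^bsub>S\<^esub>) \<in> X \<rightarrow> carrier S" using wd_closed by auto
  fix u w i v assume u: "u \<in> X" and w: "w \<in> X" and v: "v \<in> grade V i"
  note lin = linear_mapD'[OF context_linear[OF u w]]
  have c: "wd [(i, v)] \<in> carrier S" if "v \<in> grade V i" for i v using that by (intro wd_closed letter_word)
  have e: "wd (u @ [(i, v)] @ w) = wd u \<otimes>\<^bsub>S\<^esub> (wd [(i, v)] \<otimes>\<^bsub>S\<^esub> wd w)" if "v \<in> grade V i" for i v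
    using wd_context[OF u _ w, of "[(i, v)]"] letter_word[OF that] by simp
  show "(if q (u @ [(i, v \<oplus> v')] @ w) then wd (u @ [(i, v \<oplus> v')] @ w) else \<zero>\<^bsub>S\<^esub>) =
      (if q (u @ [(i, v)] @ w) then wd (u @ [(i, v)] @ w) else \<zero>\<^bsub>S\<^esub>) \<oplus>\<^bsub>S\<^esub>
      (if q (u @ [(i, v')] @ w) then wd (u @ [(i, v')] @ w) else \<zero>\<^bsub>S\<^esub>)" if v': "v' \<in> grade V i" for v'
    unfolding assms(1)[of u i "v \<oplus> v'" w v] assms(1)[of u i "v'" w v] e[OF v] e[OF v'] e[OF grade_add[OF v v']]
    by (simp add: wd_relations(1)[OF v v'] lin(2)[OF c[OF v] c[OF v']])
  show "(if q (u @ [(i, a \<odot> v)] @ w) then wd (u @ [(i, a \<odot> v)] @ w) else \<zero>\<^bsub>S\<^esub>) =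
      a \<odot>\<^bsub>S\<^esub> (if q (u @ [(i, v)] @ w) then wd (u @ [(i, v)] @ w) else \<zero>\<^bsub>S\<^esub>)" for a
    unfolding assms(1)[of u i "a \<odot> v" w v] e[OF v] e[OF grade_smult[OF v]]
    by (simp add: wd_relations(2)[OF v] lin(3)[OF c[OF v]] vector_spaceD(7)[OF module_S])
  show "(if q (u @ [(i, v), (j, x)] @ w) then wd (u @ [(i, v), (j, x)] @ w) else \<zero>\<^bsub>S\<^esub>) =
      sgn_pow (i * j) \<odot>\<^bsub>S\<^esub> (if q (u @ [(j, x), (i, v)] @ w) then wd (u @ [(j, x), (i, v)] @ w) else \<zero>\<^bsub>S\<^esub>)"
    if x: "x \<in> grade V j" for j x
  proof -
    have X2: "[(i, v), (j, x)] \<in> X" "[(j, x), (i, v)] \<in> X" using v x by (simp_all add: letter_iff)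
    show ?thesis
      unfolding assms(2)[of u "(i, v)" "(j, x)" w] wd_context[OF u X2(1) w] wd_context[OF u X2(2) w]
      by (simp add: wd_relations(3)[OF v x] lin(3)[OF wd_closed[OF X2(2)]] vector_spaceD(7)[OF module_S])
  qed
qed

text \<open>One notion for the degree parts, the powers S^p(V) and, with \<open>q\<close> always
  true, the whole algebra.\<close>

definition part :: "((int \<times> 'v) list \<Rightarrow> bool) \<Rightarrow> ('k, 'v) sym set" where
  "part q = sym_class V ` carrier (free_module {u \<in> X. q u})"

lemma part_linear: "linear_map scalars (free_module {u \<in> X. q u}) S (sym_class V)"
proof -
  have sub: "f \<in> carrier W" if "f \<in> carrier (free_module {u \<in> X. q u})" for f
    using that unfolding word_algebra_simps free_module_simps by blast
  show ?thesis
    using linear_mapD'[OF class_linear] sub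
    by (intro linear_mapI) (simp_all only: word_algebra_simps free_module_def module.simps ring.simps)
qed

lemma part_eqI:
  assumes f: "linear_map scalars S U f" and h: "linear_map scalars S U h" and U: "module scalars U"
    and eq: "\<And>u. u \<in> X \<Longrightarrow> q u \<Longrightarrow> f (wd u) = h (wd u)" and x: "x \<in> part q"
  shows "f x = h x"
proof -
  obtain t where t: "t \<in> carrier (free_module {u \<in> X. q u})" "x = sym_class V t" using x unfolding part_def by blast
  note lin = linear_map_compose[OF part_linear]
  have "f (sym_class V t) = h (sym_class V t)"
    by (rule free_module_eqI[OF lin[OF f] lin[OF h] U _ t(1)]) (use eq in simp)
  then show ?thesis using t(2) by simp
qed

lemma part_into:
  assumes f: "linear_map scalars S U f" and U: "module scalars U" and H: "submodule H scalars U"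
    and eq: "\<And>u. u \<in> X \<Longrightarrow> q u \<Longrightarrow> f (wd u) \<in> H" and x: "x \<in> part q"
  shows "f x \<in> H"
proof -
  obtain t where t: "t \<in> carrier (free_module {u \<in> X. q u})" "x = sym_class V t" using x unfolding part_def by blast
  have "f (sym_class V t) \<in> H"
  proof (rule linear_map_span_into[OF linear_map_compose[OF part_linear f] module_free U H])
    show "single ` {u \<in> X. q u} \<subseteq> carrier (free_module {u \<in> X. q u})"
      by (rule image_subsetI) (rule single_closed)
    show "t \<in> linear_span scalars (free_module {u \<in> X. q u}) (single ` {u \<in> X. q u})"
      using free_module_span t(1) by (rule subsetD)
  qed (use eq in auto)
  then show ?thesis using t(2) by simp
qed

lemma wd_in_part: "u \<in> X \<Longrightarrow> q u \<Longrightarrow> wd u \<in> part q"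
  unfolding part_def by (rule imageI) (rule single_closed, simp)

lemma submodule_part: "submodule (part q) scalars S"
  unfolding part_def by (rule submodule_image[OF part_linear module_free module_S])

lemma part_closed: "x \<in> part q \<Longrightarrow> x \<in> carrier S"
  using submoduleD(1)[OF submodule_part module_S] by blast

lemma grade_S: "grade S n = part (\<lambda>u. sum_list (map fst u) = n)"
proof -
  have "{f \<in> carrier W. \<forall>w. f w \<noteq> 0 \<longrightarrow> sum_list (map fst w) = n} =
      carrier (free_module {u \<in> X. sum_list (map fst u) = n})"
    by (auto simp: word_algebra_simps)
  then show ?thesis unfolding sym_simps part_def by (rule arg_cong)
qed

lemma power_S: "sym_power V n = part (\<lambda>u. length u = n)"
proof -
  have "{f \<in> carrier W. \<forall>w. f w \<noteq> 0 \<longrightarrow> length w = n} = carrier (free_module {u \<in> X. length u = n})"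
    by (auto simp: word_algebra_simps)
  then show ?thesis unfolding sym_power_def part_def by (rule arg_cong)
qed

definition select :: "((int \<times> 'v) list \<Rightarrow> bool) \<Rightarrow> ('k, 'v) sym \<Rightarrow> ('k, 'v) sym" where
  "select q = sym_lift S (\<lambda>u. if q u then wd u else \<zero>\<^bsub>S\<^esub>)"

context
  fixes wt :: "(int \<times> 'v) list \<Rightarrow> 'i"
  assumes wt_letter: "\<And>u w i v v'. wt (u @ [(i, v)] @ w) = wt (u @ [(i, v')] @ w)"
    and wt_swap: "\<And>u w l l'. wt (u @ [l, l'] @ w) = wt (u @ [l', l] @ w)"
begin

lemma select_respects: "respects_relations S (\<lambda>u. if wt u = c then wd u else \<zero>\<^bsub>S\<^esub>)"
  by (rule respects_selector) (metis wt_letter, metis wt_swap)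

lemma select_linear: "linear_map scalars S S (select (\<lambda>u. wt u = c))"
  unfolding select_def by (rule sym_lift_linear[OF select_respects module_S])

lemma select_word: "u \<in> X \<Longrightarrow> select (\<lambda>u. wt u = c) (wd u) = (if wt u = c then wd u else \<zero>\<^bsub>S\<^esub>)"
  unfolding select_def by (rule sym_lift_word[OF select_respects module_S])

text \<open>A weight that depends on the degrees of the letters and is invariant under swapping
  neighbours passes to the quotient, and the selections by weight are the projections of the
  decomposition. Total degree and word length are the two instances.\<close>

lemma direct_sum_parts: "internal_direct_sum S (\<lambda>c. part (\<lambda>u. wt u = c))"
  and component_parts: "x \<in> carrier S \<Longrightarrow> component S (\<lambda>c. part (\<lambda>u. wt u = c)) c x = select (\<lambda>u. wt u = c) x"
proof -
  have id: "linear_map scalars S S (\<lambda>x. x)" by (rule linear_mapI) auto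
  have zero: "linear_map scalars S S (\<lambda>x. \<zero>\<^bsub>S\<^esub>)"
    by (rule linear_mapI) (simp_all add: vector_spaceD(7)[OF module_S])
  have same: "select (\<lambda>u. wt u = c) x = x" if "x \<in> part (\<lambda>u. wt u = c)" for c x
    by (rule part_eqI[OF select_linear id module_S _ that]) (simp add: select_word)
  have other: "select (\<lambda>u. wt u = d) x = \<zero>\<^bsub>S\<^esub>" if "x \<in> part (\<lambda>u. wt u = c)" "d \<noteq> c" for c d x
    by (rule part_eqI[OF select_linear zero module_S _ that(1)]) (use that(2) in \<open>simp add: select_word\<close>)
  have span: "carrier S \<subseteq> linear_span scalars S (\<Union>c. part (\<lambda>u. wt u = c))"
  proof
    fix x assume x: "x \<in> carrier S"
    have "(\<Union>c. part (\<lambda>u. wt u = c)) \<subseteq> carrier S" using part_closed by blast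
    note sp = submodule_linear_span[OF module_S this]
    have xp: "x \<in> part (\<lambda>u. True)"
      using x unfolding carrier_S part_def word_algebra_simps by simp
    show "x \<in> linear_span scalars S (\<Union>c. part (\<lambda>u. wt u = c))"
    proof (rule part_into[OF id module_S sp _ xp])
      fix u assume "u \<in> X"
      then have "wd u \<in> (\<Union>c. part (\<lambda>u. wt u = c))"
        using wd_in_part[of u "\<lambda>u'. wt u' = wt u"] by blast
      then show "wd u \<in> linear_span scalars S (\<Union>c. part (\<lambda>u. wt u = c))"
        by (rule subsetD[OF linear_span_superset])
    qed
  qed
  note * = direct_sum_of_projections[where p = "\<lambda>c. select (\<lambda>u. wt u = c)"
      and A = "\<lambda>c. part (\<lambda>u. wt u = c)", OF module_S submodule_part select_linear same other span]
  show "internal_direct_sum S (\<lambda>c. part (\<lambda>u. wt u = c))" by (rule *(1))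
  show "component S (\<lambda>c. part (\<lambda>u. wt u = c)) c x = select (\<lambda>u. wt u = c) x" if "x \<in> carrier S"
    by (rule *(2)) (assumption | rule that)+
qed

text \<open>A projection sends each word to itself or to zero, so it preserves every part, whatever
  \<open>q\<close> is. This is why the two gradings are compatible, see
  \<open>component_power_grade\<close>.\<close>

lemma select_part: "x \<in> part q \<Longrightarrow> select (\<lambda>u. wt u = c) x \<in> part q"
  by (rule part_into[OF select_linear module_S submodule_part])
    (auto simp: select_word wd_in_part submoduleD(2)[OF submodule_part module_S])

end

lemma part_mult:
  assumes "\<And>u v. u \<in> X \<Longrightarrow> v \<in> X \<Longrightarrow> q u \<Longrightarrow> q' v \<Longrightarrow> q'' (u @ v)" and x: "x \<in> part q" and y: "y \<in> part q'"
  shows "x \<otimes>\<^bsub>S\<^esub> y \<in> part q''"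
proof (rule part_into[OF sym_mult_linear(2)[OF part_closed[OF y]] module_S submodule_part _ x])
  fix u assume u: "u \<in> X" "q u"
  show "wd u \<otimes>\<^bsub>S\<^esub> y \<in> part q''"
  proof (rule part_into[OF sym_mult_linear(1)[OF wd_closed[OF u(1)]] module_S submodule_part _ y])
    show "wd u \<otimes>\<^bsub>S\<^esub> wd v \<in> part q''" if "v \<in> X" "q' v" for v
      using wd_in_part[of "u @ v" q''] assms(1)[OF u(1) that(1) u(2) that(2)] u(1) that(1)
      by (simp add: wd_append)
  qed
qed

lemma direct_sum_grade: "internal_direct_sum S (grade S)"
  using direct_sum_parts[of "\<lambda>u. sum_list (map fst u)"] by (simp add: grade_S[abs_def] algebra_simps)

lemma direct_sum_power: "internal_direct_sum S (sym_power V)"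
  using direct_sum_parts[of length] by (simp add: power_S[abs_def])

lemma submodule_grade: "submodule (grade S n) scalars S" and submodule_power: "submodule (sym_power V p) scalars S"
  by (simp_all only: grade_S power_S submodule_part)

lemma component_power_grade:
  assumes "x \<in> grade S n" shows "component S (sym_power V) p x \<in> grade S n"
proof -
  have "component S (sym_power V) p x = select (\<lambda>u. length u = p) x"
    using component_parts[of length x p] part_closed assms by (simp add: power_S[abs_def] grade_S)
  then show ?thesis using select_part[of length, OF _ _ assms[unfolded grade_S], of p] by (simp add: grade_S)
qed

lemma grade_mult: "x \<in> grade S i \<Longrightarrow> y \<in> grade S j \<Longrightarrow> x \<otimes>\<^bsub>S\<^esub> y \<in> grade S (i + j)"
  unfolding grade_S by (rule part_mult) auto

lemma one_grade: "\<one>\<^bsub>S\<^esub> \<in> grade S 0"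
  unfolding grade_S wd_Nil[symmetric] by (rule wd_in_part) auto

lemma one_power: "\<one>\<^bsub>S\<^esub> \<in> sym_power V 0"
  unfolding power_S wd_Nil[symmetric] by (rule wd_in_part) auto

end

subsection \<open>The augmentation\<close>

text \<open>The ground field as a one-dimensional vector space, to serve as target of linear maps;
  \<open>scalars\<close> is a ring record without scalar multiplication.\<close>

definition ground :: "('k::field, 'k) module" where
  "ground = \<lparr>carrier = UNIV, mult = (*), one = 1, zero = 0, add = (+), smult = (*)\<rparr>"

lemma ground_simps [simp]:
  "carrier ground = UNIV" "x \<oplus>\<^bsub>ground\<^esub> y = x + y" "\<zero>\<^bsub>ground\<^esub> = 0" "a \<odot>\<^bsub>ground\<^esub> x = a * x"
  by (simp_all add: ground_def)

lemma module_ground: "module scalars (ground :: ('k::field, 'k) module)"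
proof (rule vector_spaceI)
  show "abelian_group (ground :: ('k, 'k) module)"
    by (rule abelian_groupI) (auto simp: algebra_simps intro: exI[of _ "- x" for x])
qed (auto simp: algebra_simps)

context graded_summands
begin

interpretation S: ring S by (rule ring_S)
interpretation SM: module scalars S
  rewrites "carrier scalars = UNIV" by (rule module_S) simp

definition augmentation :: "('k, 'v) sym \<Rightarrow> 'k" where
  "augmentation = sym_lift ground (\<lambda>u. if u = [] then 1 else 0)"

lemma augmentation_respects: "respects_relations ground (\<lambda>u. if u = [] then 1 else 0)"
  by (simp add: respects_relations_def)

lemma augmentation_linear: "linear_map scalars S ground augmentation"
  unfolding augmentation_def by (rule sym_lift_linear[OF augmentation_respects module_ground])

lemma augmentation_word: "u \<in> X \<Longrightarrow> augmentation (wd u) = (if u = [] then 1 else 0)"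
  unfolding augmentation_def by (rule sym_lift_word[OF augmentation_respects module_ground])

lemma augmentation_one: "augmentation \<one>\<^bsub>S\<^esub> = 1"
  using augmentation_word[of "[]"] by (simp add: wd_Nil)

lemmas augmentation_simps = linear_mapD'(2,3)[OF augmentation_linear, unfolded ground_simps]

text \<open>A concatenation is empty only if both words are; linearity in each factor extends this
  from words to all elements.\<close>

lemma augmentation_mult:
  assumes x: "x \<in> carrier S" and y: "y \<in> carrier S"
  shows "augmentation (x \<otimes>\<^bsub>S\<^esub> y) = augmentation x * augmentation y"
proof -
  have r: "linear_map scalars S ground (\<lambda>y. a * augmentation y)" for a
    using linear_map_smult[OF augmentation_linear module_S module_ground, of a] by simp
  then have l: "linear_map scalars S ground (\<lambda>y. augmentation y * a)" for a
    by (simp add: mult.commute)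
  show ?thesis
  proof (rule sym_eqI[OF linear_map_compose[OF sym_mult_linear(2)[OF y] augmentation_linear] l module_ground _ x])
    fix u assume u: "u \<in> X"
    show "augmentation (wd u \<otimes>\<^bsub>S\<^esub> y) = augmentation (wd u) * augmentation y"
      by (rule sym_eqI[OF linear_map_compose[OF sym_mult_linear(1)[OF wd_closed[OF u]] augmentation_linear] r module_ground _ y])
        (use u in \<open>auto simp: wd_append[symmetric] augmentation_word\<close>)
  qed
qed

text \<open>The empty word is the only word of length zero, so S^0(V) is the line through 1 and the
  augmentation is the coordinate on it.\<close>

lemma component_power_zero:
  assumes x: "x \<in> carrier S"
  shows "component S (sym_power V) 0 x = augmentation x \<odot>\<^bsub>S\<^esub> \<one>\<^bsub>S\<^esub>"
proof -
  have lin: "linear_map scalars S S (\<lambda>x. augmentation x \<odot>\<^bsub>S\<^esub> \<one>\<^bsub>S\<^esub>)"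
    by (rule linear_mapI) (simp_all add: augmentation_simps vector_spaceD(2,4)[OF module_S] vector_spaceD(1)[OF module_S])
  have "select (\<lambda>u. length u = 0) x = augmentation x \<odot>\<^bsub>S\<^esub> \<one>\<^bsub>S\<^esub>"
  proof (rule sym_eqI[OF select_linear lin module_S _ x])
    show "select (\<lambda>u. length u = 0) (wd u) = augmentation (wd u) \<odot>\<^bsub>S\<^esub> \<one>\<^bsub>S\<^esub>" if u: "u \<in> X" for u
    proof -
      have "select (\<lambda>u. length u = 0) (wd u) = (if length u = 0 then wd u else \<zero>\<^bsub>S\<^esub>)"
        by (rule select_word[OF _ _ u]) simp_all
      then show ?thesis
        using augmentation_word[OF u] by (simp add: wd_Nil vector_spaceD(5,6)[OF module_S] del: length_0_conv)
          (auto simp: wd_Nil vector_spaceD(5,6)[OF module_S])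
    qed
  qed simp_all
  then show ?thesis using component_parts[of length x 0] x by (simp add: power_S[abs_def])
qed

subsection \<open>Derivations\<close>

lemma wd_Cons: "l \<in> letters V \<Longrightarrow> u \<in> X \<Longrightarrow> wd (l # u) = wd [l] \<otimes>\<^bsub>S\<^esub> wd u"
  using wd_append[of "[l]" u] by simp

text \<open>The letter passes the letters of \<open>u\<close> one at a time, and each passage
  contributes the sign of the commutation relation.\<close>

lemma word_letter_commute:
  assumes "u \<in> X" "l \<in> letters V"
  shows "wd u \<otimes>\<^bsub>S\<^esub> wd [l] = sgn_pow (sum_list (map fst u) * fst l) \<odot>\<^bsub>S\<^esub> (wd [l] \<otimes>\<^bsub>S\<^esub> wd u)"
  using assms(1)
proof (induction u rule: list.induct)
  case Nil
  then show ?case using wd_closed[of "[l]"] assms(2) by (simp add: wd_Nil vector_spaceD(5)[OF module_S])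
next
  case (Cons l' u)
  have l': "l' \<in> letters V" and u: "u \<in> X" using Cons.prems by simp_all
  have c: "wd [l'] \<in> carrier S" "wd [l] \<in> carrier S" "wd u \<in> carrier S"
    using wd_closed[of "[l']"] wd_closed[of "[l]"] wd_closed[OF u] l' assms(2) by simp_all
  have ll: "wd [l'] \<otimes>\<^bsub>S\<^esub> wd [l] = sgn_pow (fst l' * fst l) \<odot>\<^bsub>S\<^esub> (wd [l] \<otimes>\<^bsub>S\<^esub> wd [l'])"
    using wd_relations(3)[of "snd l'" "fst l'" "snd l" "fst l"] l' assms(2)
    by (simp add: letters_def split_beta flip: wd_Cons)
  have "wd (l' # u) \<otimes>\<^bsub>S\<^esub> wd [l] = wd [l'] \<otimes>\<^bsub>S\<^esub> (wd u \<otimes>\<^bsub>S\<^esub> wd [l])"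
    using c by (simp add: wd_Cons[OF l' u] S.m_assoc)
  also have "\<dots> = sgn_pow (sum_list (map fst u) * fst l) \<odot>\<^bsub>S\<^esub> ((wd [l'] \<otimes>\<^bsub>S\<^esub> wd [l]) \<otimes>\<^bsub>S\<^esub> wd u)"
    using c by (simp add: Cons.IH[OF u] sym_smult_assoc S.m_assoc)
  also have "\<dots> = sgn_pow (sum_list (map fst u) * fst l) \<odot>\<^bsub>S\<^esub> (sgn_pow (fst l' * fst l) \<odot>\<^bsub>S\<^esub> (wd [l] \<otimes>\<^bsub>S\<^esub> wd (l' # u)))"
    using c by (simp add: ll sym_smult_assoc wd_Cons[OF l' u] S.m_assoc)
  also have "\<dots> = sgn_pow (sum_list (map fst (l' # u)) * fst l) \<odot>\<^bsub>S\<^esub> (wd [l] \<otimes>\<^bsub>S\<^esub> wd (l' # u))"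
    using c wd_closed[OF Cons.prems]
    by (simp add: vector_spaceD(4)[OF module_S, symmetric] sgn_pow_add distrib_right distrib_left mult.commute)
  finally show ?case .
qed

lemma letter_commute:
  assumes x: "x \<in> grade S n" and l: "l \<in> letters V"
  shows "x \<otimes>\<^bsub>S\<^esub> wd [l] = sgn_pow (n * fst l) \<odot>\<^bsub>S\<^esub> (wd [l] \<otimes>\<^bsub>S\<^esub> x)"
proof -
  have lc: "wd [l] \<in> carrier S" using l by (intro wd_closed) simp
  show ?thesis
    by (rule part_eqI[OF sym_mult_linear(2)[OF lc] linear_map_smult[OF sym_mult_linear(1)[OF lc] module_S module_S]
          module_S _ x[unfolded grade_S]])
      (use word_letter_commute l in auto)
qed

end

text \<open>The graded Leibniz rule, letter by letter, with \<delta> prescribing the values on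
  letters. Arguments are words while values are already classes in S(V), so only relations among the
  arguments remain to be respected.\<close>

primrec word_derivation ::
    "('k::field, 'v, 'e) graded_scheme \<Rightarrow> (int \<Rightarrow> 'v \<Rightarrow> ('k, 'v) sym) \<Rightarrow> (int \<times> 'v) list \<Rightarrow> ('k, 'v) sym" where
  "word_derivation V \<delta> [] = \<zero>\<^bsub>sym_algebra V\<^esub>"
| "word_derivation V \<delta> (l # u) =
     (\<delta> (fst l) (snd l) \<otimes>\<^bsub>sym_algebra V\<^esub> sym_class V (single u)) \<oplus>\<^bsub>sym_algebra V\<^esub>
     (- 1) powi fst l \<odot>\<^bsub>sym_algebra V\<^esub> (sym_class V (single [l]) \<otimes>\<^bsub>sym_algebra V\<^esub> word_derivation V \<delta> u)"

locale generator_map = graded_summands V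
  for V :: "('k::field, 'v, 'e) graded_scheme" (structure) +
  fixes \<delta> :: "int \<Rightarrow> 'v \<Rightarrow> ('k, 'v) sym"
  assumes \<delta>_grade: "v \<in> grade V i \<Longrightarrow> \<delta> i v \<in> grade (sym_algebra V) (i + 1)"
    and \<delta>_add: "v \<in> grade V i \<Longrightarrow> v' \<in> grade V i \<Longrightarrow> \<delta> i (v \<oplus> v') = \<delta> i v \<oplus>\<^bsub>sym_algebra V\<^esub> \<delta> i v'"
    and \<delta>_smult: "v \<in> grade V i \<Longrightarrow> \<delta> i (a \<odot> v) = a \<odot>\<^bsub>sym_algebra V\<^esub> \<delta> i v"
begin

interpretation S: ring S by (rule ring_S)
interpretation SM: module scalars S
  rewrites "carrier scalars = UNIV" by (rule module_S) simp

abbreviation "dw \<equiv> word_derivation V \<delta>"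
abbreviation "wdeg u \<equiv> sum_list (map fst u)"

lemma \<delta>_closed: "v \<in> grade V i \<Longrightarrow> \<delta> i v \<in> carrier S"
  using \<delta>_grade part_closed unfolding grade_S by blast

lemma dw_closed: "u \<in> X \<Longrightarrow> dw u \<in> carrier S"
proof (induction u rule: list.induct)
  case (Cons l u)
  then have "snd l \<in> grade V (fst l)" "u \<in> X" "[l] \<in> X" by (auto simp: letters_def)
  then show ?case using Cons.IH by (simp add: \<delta>_closed wd_closed SM.smult_closed)
qed simp

lemma dw_grade: "u \<in> X \<Longrightarrow> dw u \<in> grade S (wdeg u + 1)"
proof (induction u rule: list.induct)
  case (Cons l u)
  note g = submoduleD[OF submodule_grade module_S]
  have l: "snd l \<in> grade V (fst l)" "u \<in> X" "[l] \<in> X" using Cons.prems by (auto simp: letters_def)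
  have wu: "wd w \<in> grade S (wdeg w)" if "w \<in> X" for w
    unfolding grade_S using that by (rule wd_in_part) simp
  have "\<delta> (fst l) (snd l) \<otimes>\<^bsub>S\<^esub> wd u \<in> grade S (wdeg (l # u) + 1)"
    using grade_mult[OF \<delta>_grade[OF l(1)] wu[OF l(2)]] by (simp add: ac_simps)
  moreover have "wd [l] \<otimes>\<^bsub>S\<^esub> dw u \<in> grade S (wdeg (l # u) + 1)"
    using grade_mult[OF wu[OF l(3)] Cons.IH[OF l(2)]] by (simp add: ac_simps)
  ultimately show ?case using g(3,4) by simp
qed (simp add: submoduleD(2)[OF submodule_grade module_S])

lemma dw_letter: "v \<in> grade V i \<Longrightarrow> dw [(i, v)] = \<delta> i v"
  using \<delta>_closed wd_closed[of "[(i, v)]"]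
  by (simp add: wd_Nil letter_iff vector_spaceD(7)[OF module_S])

lemma dw_append:
  assumes "u \<in> X" "v \<in> X"
  shows "dw (u @ v) = (dw u \<otimes>\<^bsub>S\<^esub> wd v) \<oplus>\<^bsub>S\<^esub> sgn_pow (wdeg u) \<odot>\<^bsub>S\<^esub> (wd u \<otimes>\<^bsub>S\<^esub> dw v)"
  using assms(1)
proof (induction u rule: list.induct)
  case Nil
  then show ?case using assms(2) dw_closed[of v] wd_closed[of v] by (simp add: wd_Nil vector_spaceD(5)[OF module_S])
next
  case (Cons l u)
  have l: "snd l \<in> grade V (fst l)" "u \<in> X" "[l] \<in> X" "l \<in> letters V" using Cons.prems by (auto simp: letters_def)
  note c = \<delta>_closed[OF l(1)] wd_closed[OF l(2)] wd_closed[OF l(3)] wd_closed[OF assms(2)] dw_closed[OF l(2)] dw_closed[OF assms(2)]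
  show ?case
    using c Cons.IH[OF l(2)]
    by (simp add: wd_append[OF l(2) assms(2)] wd_Cons[OF l(4,2)] S.l_distr S.r_distr SM.smult_r_distr
        sym_smult_assoc S.m_assoc S.a_assoc SM.smult_closed vector_spaceD(4)[OF module_S, symmetric] sgn_pow_add)
qed

text \<open>The value of the derivation on \<open>u p w\<close>, for \<open>p\<close> of degree \<open>n\<close>, where \<open>p'\<close> stands for its value
  on \<open>p\<close>. It is linear in \<open>(p, p')\<close>, so the relations only have to be checked on \<open>p\<close>.\<close>

definition in_context :: "(int \<times> 'v) list \<Rightarrow> (int \<times> 'v) list \<Rightarrow> int \<Rightarrow> ('k, 'v) sym \<Rightarrow> ('k, 'v) sym \<Rightarrow> ('k, 'v) sym" where
  "in_context u w n p p' = (dw u \<otimes>\<^bsub>S\<^esub> (p \<otimes>\<^bsub>S\<^esub> wd w)) \<oplus>\<^bsub>S\<^esub>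
     sgn_pow (wdeg u) \<odot>\<^bsub>S\<^esub> (wd u \<otimes>\<^bsub>S\<^esub> ((p' \<otimes>\<^bsub>S\<^esub> wd w) \<oplus>\<^bsub>S\<^esub> sgn_pow n \<odot>\<^bsub>S\<^esub> (p \<otimes>\<^bsub>S\<^esub> dw w)))"

lemma dw_context:
  "u \<in> X \<Longrightarrow> x \<in> X \<Longrightarrow> w \<in> X \<Longrightarrow> dw (u @ x @ w) = in_context u w (wdeg x) (wd x) (dw x)"
  by (simp add: dw_append in_context_def wd_append)

lemma in_context_add:
  assumes "u \<in> X" "w \<in> X" "p \<in> carrier S" "p' \<in> carrier S" "r \<in> carrier S" "r' \<in> carrier S"
  shows "in_context u w n (p \<oplus>\<^bsub>S\<^esub> r) (p' \<oplus>\<^bsub>S\<^esub> r') = in_context u w n p p' \<oplus>\<^bsub>S\<^esub> in_context u w n r r'"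
  using assms wd_closed[OF assms(1)] wd_closed[OF assms(2)] dw_closed[OF assms(1)] dw_closed[OF assms(2)]
  by (simp add: in_context_def S.l_distr S.r_distr SM.smult_r_distr SM.smult_closed S.a_ac)

lemma in_context_smult:
  assumes "u \<in> X" "w \<in> X" "p \<in> carrier S" "p' \<in> carrier S"
  shows "in_context u w n (a \<odot>\<^bsub>S\<^esub> p) (a \<odot>\<^bsub>S\<^esub> p') = a \<odot>\<^bsub>S\<^esub> in_context u w n p p'"
  using assms wd_closed[OF assms(1)] wd_closed[OF assms(2)] dw_closed[OF assms(1)] dw_closed[OF assms(2)]
  by (simp add: in_context_def SM.smult_r_distr SM.smult_closed sym_smult_assoc S.r_distr
      vector_spaceD(4)[OF module_S, symmetric] ac_simps)

text \<open>After \<open>letter_commute\<close> has moved the letters to the left of the values of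
  \<delta>, both orders give the same two products. As \<delta> raises the degree by one, the
  exponent is (i + 1) j instead of i j, and the additional sign is precisely the Leibniz sign of the
  other order.\<close>

lemma dw_pair:
  assumes v: "v \<in> grade V i" and x: "x \<in> grade V j"
  shows "dw [(i, v), (j, x)] = sgn_pow (i * j) \<odot>\<^bsub>S\<^esub> dw [(j, x), (i, v)]"
proof -
  have e: "dw [(i, v), (j, x)] = (\<delta> i v \<otimes>\<^bsub>S\<^esub> wd [(j, x)]) \<oplus>\<^bsub>S\<^esub> sgn_pow i \<odot>\<^bsub>S\<^esub> (wd [(i, v)] \<otimes>\<^bsub>S\<^esub> \<delta> j x)"
    if "v \<in> grade V i" "x \<in> grade V j" for i v j x
    using dw_append[of "[(i, v)]" "[(j, x)]"] dw_letter[OF that(1)] dw_letter[OF that(2)] that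
    by (simp add: letter_iff del: word_derivation.simps)
  have comm: "\<delta> i v \<otimes>\<^bsub>S\<^esub> wd [(j, x)] = sgn_pow ((i + 1) * j) \<odot>\<^bsub>S\<^esub> (wd [(j, x)] \<otimes>\<^bsub>S\<^esub> \<delta> i v)"
    if "v \<in> grade V i" "x \<in> grade V j" for i v j x
    using letter_commute[OF \<delta>_grade[OF that(1)], of "(j, x)"] that(2) by (simp add: letter_iff)
  have c: "\<delta> i v \<in> carrier S" "\<delta> j x \<in> carrier S" "wd [(i, v)] \<in> carrier S" "wd [(j, x)] \<in> carrier S"
    using v x by (auto simp: \<delta>_closed wd_closed letter_iff)
  have s1: "sgn_pow (i * j) * sgn_pow ((j + 1) * i) = (sgn_pow i :: 'k)"
    by (simp add: distrib_right sgn_pow_add mult.commute[of j i] mult.assoc[symmetric] sgn_pow_square)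
  have s2: "sgn_pow (i * j) * sgn_pow j = (sgn_pow ((i + 1) * j) :: 'k)"
    by (simp add: distrib_right sgn_pow_add)
  show ?thesis
    unfolding e[OF v x] e[OF x v] comm[OF v x] comm[OF x v]
    using c by (simp add: SM.smult_r_distr SM.smult_closed vector_spaceD(4)[OF module_S, symmetric] s1 s2 S.a_comm)
qed

lemma dw_respects: "respects_relations S dw"
  unfolding respects_relations_def
proof (intro conjI ballI allI)
  show "dw \<in> X \<rightarrow> carrier S" using dw_closed by blast
  fix u w i v assume u: "u \<in> X" and w: "w \<in> X" and v: "v \<in> grade V i"
  have c: "\<delta> i v \<in> carrier S" "wd [(i, v)] \<in> carrier S" "[(i, v)] \<in> X" if "v \<in> grade V i" for i v
    using that by (auto simp: \<delta>_closed wd_closed letter_iff)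
  have e: "dw (u @ [(i, v)] @ w) = in_context u w i (wd [(i, v)]) (\<delta> i v)" if "v \<in> grade V i" for v
    using dw_context[OF u c(3)[OF that] w] dw_letter[OF that] by (simp del: word_derivation.simps)
  show "dw (u @ [(i, v \<oplus> v')] @ w) = dw (u @ [(i, v)] @ w) \<oplus>\<^bsub>S\<^esub> dw (u @ [(i, v')] @ w)"
    if v': "v' \<in> grade V i" for v'
    unfolding e[OF v] e[OF v'] e[OF grade_add[OF v v']] wd_relations(1)[OF v v'] \<delta>_add[OF v v']
    by (rule in_context_add[OF u w]) (fact c[OF v] c[OF v'])+
  show "dw (u @ [(i, a \<odot> v)] @ w) = a \<odot>\<^bsub>S\<^esub> dw (u @ [(i, v)] @ w)" for a
    unfolding e[OF v] e[OF grade_smult[OF v]] wd_relations(2)[OF v] \<delta>_smult[OF v]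
    by (rule in_context_smult[OF u w]) (fact c[OF v])+
  show "dw (u @ [(i, v), (j, x)] @ w) = sgn_pow (i * j) \<odot>\<^bsub>S\<^esub> dw (u @ [(j, x), (i, v)] @ w)"
    if x: "x \<in> grade V j" for j x
  proof -
    have X2: "[(i, v), (j, x)] \<in> X" "[(j, x), (i, v)] \<in> X" using v x by (simp_all add: letter_iff)
    have "wdeg [(i, v), (j, x)] = wdeg [(j, x), (i, v)]" by simp
    then show ?thesis
      unfolding dw_context[OF u X2(1) w] dw_context[OF u X2(2) w] wd_relations(3)[OF v x] dw_pair[OF v x]
      using in_context_smult[OF u w wd_closed[OF X2(2)] dw_closed[OF X2(2)], of "wdeg [(j, x), (i, v)]" "sgn_pow (i * j)"]
      by (simp only:)
  qed
qed

text \<open>For \<open>x\<close> of fixed degree both sides of the Leibniz rule are linear in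
  \<open>x\<close> and in \<open>y\<close>, which reduces it to a pair of words, where it is
  \<open>dw_append\<close>.\<close>

lemma ex_derivation: "\<exists>D. derivation S D \<and> (\<forall>i. \<forall>v\<in>grade V i. D (sym_gen V i v) = \<delta> i v)"
proof -
  define D where "D = sym_lift S dw"
  have lin: "linear_map scalars S S D" and word: "u \<in> X \<Longrightarrow> D (wd u) = dw u" for u
    unfolding D_def using sym_lift_linear[OF dw_respects module_S] sym_lift_word[OF dw_respects module_S] by auto
  note Dc = linear_mapD'(1)[OF lin]
  have deg: "D x \<in> grade S (n + 1)" if "x \<in> grade S n" for x n
    by (rule part_into[OF lin module_S submodule_grade _ that[unfolded grade_S]]) (use dw_grade word in auto)
  have leib: "D (x \<otimes>\<^bsub>S\<^esub> y) = (D x \<otimes>\<^bsub>S\<^esub> y) \<oplus>\<^bsub>S\<^esub> sgn_pow i \<odot>\<^bsub>S\<^esub> (x \<otimes>\<^bsub>S\<^esub> D y)"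
    if x: "x \<in> grade S i" and y: "y \<in> carrier S" for i x y
  proof (rule part_eqI[OF _ _ module_S _ x[unfolded grade_S]])
    show "linear_map scalars S S (\<lambda>x. D (x \<otimes>\<^bsub>S\<^esub> y))"
      by (rule linear_map_compose[OF sym_mult_linear(2)[OF y] lin])
    show "linear_map scalars S S (\<lambda>x. (D x \<otimes>\<^bsub>S\<^esub> y) \<oplus>\<^bsub>S\<^esub> sgn_pow i \<odot>\<^bsub>S\<^esub> (x \<otimes>\<^bsub>S\<^esub> D y))"
      by (intro linear_map_add linear_map_smult module_S linear_map_compose[OF lin sym_mult_linear(2)[OF y]]
          sym_mult_linear(2)[OF Dc[OF y]])
    fix u assume u: "u \<in> X" "wdeg u = i"
    note uc = wd_closed[OF u(1)]
    show "D (wd u \<otimes>\<^bsub>S\<^esub> y) = (D (wd u) \<otimes>\<^bsub>S\<^esub> y) \<oplus>\<^bsub>S\<^esub> sgn_pow i \<odot>\<^bsub>S\<^esub> (wd u \<otimes>\<^bsub>S\<^esub> D y)"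
    proof (rule sym_eqI[OF _ _ module_S _ y])
      show "linear_map scalars S S (\<lambda>y. D (wd u \<otimes>\<^bsub>S\<^esub> y))"
        by (rule linear_map_compose[OF sym_mult_linear(1)[OF uc] lin])
      show "linear_map scalars S S (\<lambda>y. (D (wd u) \<otimes>\<^bsub>S\<^esub> y) \<oplus>\<^bsub>S\<^esub> sgn_pow i \<odot>\<^bsub>S\<^esub> (wd u \<otimes>\<^bsub>S\<^esub> D y))"
        by (intro linear_map_add linear_map_smult module_S linear_map_compose[OF lin sym_mult_linear(1)[OF uc]]
            sym_mult_linear(1)[OF Dc[OF uc]])
    qed (use u dw_append in \<open>simp add: wd_append[symmetric] word\<close>)
  qed
  have "derivation S D"
    unfolding derivation_def has_degree_def
  proof (intro conjI allI ballI lin deg)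
    fix i x y assume x: "x \<in> grade S i" and y: "y \<in> carrier S"
    then have "x \<otimes>\<^bsub>S\<^esub> D y \<in> carrier S" using Dc part_closed[OF x[unfolded grade_S]] by simp
    then show "D (x \<otimes>\<^bsub>S\<^esub> y) = (D x \<otimes>\<^bsub>S\<^esub> y) \<oplus>\<^bsub>S\<^esub> koszul S i (x \<otimes>\<^bsub>S\<^esub> D y)"
      using leib[OF x y] by (simp add: koszul_eq[OF module_S])
  qed
  moreover have "D (sym_gen V i v) = \<delta> i v" if "v \<in> grade V i" for i v
    unfolding sym_gen_def using word[of "[(i, v)]"] dw_letter[OF that] that
    by (simp add: letter_iff del: word_derivation.simps)
  ultimately show ?thesis by blast
qed

end

context graded_summands
begin

text \<open>On a word l u' the Leibniz rule gives the products of D l with u' and of l with D u'.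
  The multiplicative augmentation kills the first through D l, by assumption, and the second through
  the letter l.\<close>

lemma derivation_augmentation:
  assumes D: "derivation S D" and gen: "\<And>i v. v \<in> grade V i \<Longrightarrow> augmentation (D (sym_gen V i v)) = 0"
    and x: "x \<in> carrier S"
  shows "augmentation (D x) = 0"
proof -
  interpret S: ring S by (rule ring_S)
  have lin: "linear_map scalars S S D" and leib: "\<And>i a b. a \<in> grade S i \<Longrightarrow> b \<in> carrier S \<Longrightarrow>
      D (a \<otimes>\<^bsub>S\<^esub> b) = (D a \<otimes>\<^bsub>S\<^esub> b) \<oplus>\<^bsub>S\<^esub> koszul S i (a \<otimes>\<^bsub>S\<^esub> D b)"
    using D by (auto simp: derivation_def)
  note Dc = linear_mapD'(1)[OF lin]
  have "D \<one>\<^bsub>S\<^esub> = D \<one>\<^bsub>S\<^esub> \<oplus>\<^bsub>S\<^esub> D \<one>\<^bsub>S\<^esub>"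
    using leib[OF one_grade, of "\<one>\<^bsub>S\<^esub>"] Dc[of "\<one>\<^bsub>S\<^esub>"] by (simp add: koszul_def)
  then have one: "D \<one>\<^bsub>S\<^esub> = \<zero>\<^bsub>S\<^esub>" using Dc[of "\<one>\<^bsub>S\<^esub>"] S.add.r_cancel_one'[of "D \<one>\<^bsub>S\<^esub>" "D \<one>\<^bsub>S\<^esub>"] by simp
  have aug0: "augmentation \<zero>\<^bsub>S\<^esub> = 0"
    using linear_map_zero[OF augmentation_linear S.abelian_group_axioms vector_spaceD(9)[OF module_ground]] by simp
  have zero: "linear_map scalars S ground (\<lambda>x. 0)" by (rule linear_mapI) auto
  show ?thesis
  proof (rule sym_eqI[OF linear_map_compose[OF lin augmentation_linear] zero module_ground _ x])
    fix u assume u: "u \<in> X"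
    show "augmentation (D (wd u)) = 0"
    proof (cases u)
      case Nil
      then show ?thesis by (simp add: wd_Nil one aug0)
    next
      case (Cons l u')
      have l: "snd l \<in> grade V (fst l)" "[l] \<in> X" "l \<in> letters V" "u' \<in> X" using u Cons by (auto simp: letters_def)
      have g: "wd [l] \<in> grade S (fst l)" unfolding grade_S using l(2) by (rule wd_in_part) simp
      note c = wd_closed[OF l(2)] wd_closed[OF l(4)]
      have "D (wd u) = (D (wd [l]) \<otimes>\<^bsub>S\<^esub> wd u') \<oplus>\<^bsub>S\<^esub> sgn_pow (fst l) \<odot>\<^bsub>S\<^esub> (wd [l] \<otimes>\<^bsub>S\<^esub> D (wd u'))"
        using leib[OF g c(2)] c Dc by (simp add: Cons wd_Cons[OF l(3,4)] koszul_eq[OF module_S])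
      moreover have "augmentation (D (wd [l])) = 0"
        using gen[OF l(1)] by (simp add: sym_gen_def)
      moreover have "augmentation (wd [l]) = 0" using augmentation_word[OF l(2)] by simp
      ultimately show ?thesis
        using c Dc by (simp add: augmentation_simps augmentation_mult vector_spaceD(1)[OF module_S])
    qed
  qed
qed

end

section \<open>Existence of the two parts of the Chevalley-Eilenberg differential, by structure
  constants\<close>

section \<open>The Chevalley-Eilenberg algebra\<close>

lemma finsum_ground: "finsum ground f I = sum f I"
proof -
  interpret module scalars "ground :: ('a, 'a) module" by (rule module_ground)
  show ?thesis by (induction I rule: infinite_finite_induct) simp_all
qed

lemma parity_homogeneous:
  assumes "internal_direct_sum V (grade V)" "x \<in> grade V i"
  shows "parity V x = koszul V i x"
proof -
  interpret internal_direct_sum V "grade V" by fact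
  have xc: "x \<in> carrier V" using assms(2) summand_closed(1) by blast
  have "{j. component V (grade V) j x \<noteq> \<zero>\<^bsub>V\<^esub>} = (if x = \<zero>\<^bsub>V\<^esub> then {} else {i})"
    by (auto simp: component_delta[OF assms(2)])
  moreover have z: "\<ominus>\<^bsub>V\<^esub> \<zero>\<^bsub>V\<^esub> = \<zero>\<^bsub>V\<^esub>" by (rule minus_equality) simp_all
  ultimately show ?thesis
    using xc by (cases "x = \<zero>\<^bsub>V\<^esub>") (simp_all add: parity_def component_delta[OF assms(2)] koszul_def z)
qed

context homogeneous_basis
begin

lemma functional_expand:
  assumes "module scalars V" "linear_map scalars V ground \<xi>" "x \<in> carrier V"
  shows "\<xi> x = (\<Sum>b\<in>B. co b x * \<xi> b)"
proof -
  interpret module scalars V by fact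
  have c: "(\<lambda>b. co b x \<odot> b) \<in> B \<rightarrow> carrier V" using basis_closed by auto
  have "\<xi> x = \<xi> (\<Oplus>b\<in>B. co b x \<odot> b)" by (rule arg_cong[OF expand[OF assms(3)]])
  also have "\<dots> = (\<Sum>b\<in>B. \<xi> (co b x \<odot> b))"
    using linear_map_finsum[OF assms(2) abelian_group_axioms vector_spaceD(9)[OF module_ground] c]
    by (simp only: finsum_ground)
  also have "\<dots> = (\<Sum>b\<in>B. co b x * \<xi> b)"
    using linear_mapD'(3)[OF assms(2)] basis_closed by (intro sum.cong) auto
  finally show ?thesis .
qed

end

lemma truncate_simps:
  "carrier (dg.truncate g) = carrier g" "add (dg.truncate g) = add g" "smult (dg.truncate g) = smult g"
  "zero (dg.truncate g) = zero g" "grade (dg.truncate g) = grade g" "diff (dg.truncate g) = diff g"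
  by (simp_all add: dg.truncate_def)

definition functionals :: "('k::field, 'g, 'e) graded_scheme \<Rightarrow> ('g \<Rightarrow> 'k) set" where
  "functionals V = {\<xi>. linear_map scalars V ground \<xi> \<and> (\<forall>x. x \<notin> carrier V \<longrightarrow> \<xi> x = 0)}"

definition functionals_degree :: "('k::field, 'g, 'e) graded_scheme \<Rightarrow> int \<Rightarrow> ('g \<Rightarrow> 'k) set" where
  "functionals_degree V i = {\<xi> \<in> functionals V. \<forall>j. j \<noteq> - i \<longrightarrow> (\<forall>x\<in>grade V j. \<xi> x = 0)}"

lemma dual_space_simps:
  "carrier (dual_space V) = functionals V"
  "\<xi> \<oplus>\<^bsub>dual_space V\<^esub> \<eta> = (\<lambda>x. \<xi> x + \<eta> x)" "a \<odot>\<^bsub>dual_space V\<^esub> \<xi> = (\<lambda>x. a * \<xi> x)"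
  "\<zero>\<^bsub>dual_space V\<^esub> = (\<lambda>x. 0)" "grade (dual_space V) i = functionals_degree V i"
  by (auto simp: dual_space_def functionals_def functionals_degree_def ground_def)

lemma dual_simps:
  "carrier (dual V) = carrier (dual_space V)" "add (dual V) = add (dual_space V)"
  "smult (dual V) = smult (dual_space V)" "zero (dual V) = zero (dual_space V)"
  "grade (dual V) = grade (dual_space V)"
  "diff (dual V) \<xi> = (\<lambda>x. if x \<in> carrier V then - parity (dual_space V) \<xi> (diff V x) else 0)"
  by (simp_all add: dual_def graded.defs dg.defs)

lemma shift_simps:
  "carrier (shift p V) = carrier V" "add (shift p V) = add V" "smult (shift p V) = smult V"
  "zero (shift p V) = zero V" "grade (shift p V) i = grade V (i + p)"
  "diff (shift p V) x = koszul V p (diff V x)"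
  by (simp_all add: shift_def)

lemma functionals_add: "\<xi> \<in> functionals V \<Longrightarrow> \<eta> \<in> functionals V \<Longrightarrow> (\<lambda>x. \<xi> x + \<eta> x) \<in> functionals V"
  and functionals_smult: "\<xi> \<in> functionals V \<Longrightarrow> (\<lambda>x. a * \<xi> x) \<in> functionals V"
  and functionals_minus: "\<xi> \<in> functionals V \<Longrightarrow> (\<lambda>x. - \<xi> x) \<in> functionals V"
  by (simp_all add: functionals_def linear_map_def algebra_simps)

lemma functionals_degree_add:
    "\<xi> \<in> functionals_degree V i \<Longrightarrow> \<eta> \<in> functionals_degree V i \<Longrightarrow> (\<lambda>x. \<xi> x + \<eta> x) \<in> functionals_degree V i"
  and functionals_degree_smult: "\<xi> \<in> functionals_degree V i \<Longrightarrow> (\<lambda>x. a * \<xi> x) \<in> functionals_degree V i"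
  by (simp_all add: functionals_degree_def functionals_add functionals_smult)

lemma zero_functional: "(\<lambda>x. 0) \<in> functionals V"
  by (simp add: functionals_def linear_map_def)

lemma module_dual_space: "module scalars (dual_space V)"
proof (rule vector_spaceI)
  show "abelian_group (dual_space V)"
  proof (rule abelian_groupI)
    show "\<exists>\<eta>\<in>carrier (dual_space V). \<eta> \<oplus>\<^bsub>dual_space V\<^esub> \<xi> = \<zero>\<^bsub>dual_space V\<^esub>" if "\<xi> \<in> carrier (dual_space V)" for \<xi>
      using functionals_minus[of \<xi> V] that
      by (intro bexI[of _ "\<lambda>x. - \<xi> x"]) (simp_all add: dual_space_simps)
  qed (simp_all add: dual_space_simps functionals_add zero_functional add.commute add.left_commute)
qed (simp_all add: dual_space_simps functionals_smult algebra_simps)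

lemma dual_space_minus: "\<xi> \<in> functionals V \<Longrightarrow> \<ominus>\<^bsub>dual_space V\<^esub> \<xi> = (\<lambda>x. - \<xi> x)"
  using vector_spaceD(8)[OF module_dual_space, of \<xi> V] by (simp add: dual_space_simps)

locale lie_basis = dg_lie_algebra g + homogeneous_basis g B deg co
  for g :: "('k::real_or_complex, 'g) dg_lie" (structure) and B deg co
begin

lemma module_g: "module scalars g"
  by (rule module_axioms)

abbreviation "V \<equiv> CE_gens g"

definition dual_basis :: "'g \<Rightarrow> 'g \<Rightarrow> 'k" where
  "dual_basis b = (\<lambda>x. if x \<in> carrier g then co b x else 0)"

lemma dual_basis_functional: "b \<in> B \<Longrightarrow> dual_basis b \<in> functionals_degree g (- deg b)"
  using summand_closed(1) smult_closed
  by (auto simp: functionals_degree_def functionals_def linear_map_def dual_basis_def co_add co_smult co_grade)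

lemma functional_sum:
  assumes "\<xi> \<in> functionals g" shows "\<xi> = (\<lambda>x. \<Sum>b\<in>B. \<xi> b * dual_basis b x)"
proof
  show "\<xi> x = (\<Sum>b\<in>B. \<xi> b * dual_basis b x)" for x
    using functional_expand[OF module_g, of \<xi> x] assms
    by (cases "x \<in> carrier g") (simp_all add: functionals_def dual_basis_def mult.commute)
qed

text \<open>The differential of the dual involves \<open>parity\<close>, which is defined by
  components and hence presupposes a direct sum. The projection to degree \<open>j\<close> keeps the
  values on basis elements of degree \<open>- j\<close>, because a functional of degree
  \<open>j\<close> lives there.\<close>

lemma direct_sum_dual: "internal_direct_sum (dual_space g) (grade (dual_space g))"
proof -
  let ?D = "dual_space g"
  interpret D: module scalars ?D by (rule module_dual_space)
  define p where "p j \<xi> = (\<lambda>x. \<Sum>b\<in>B. (if deg b = - j then \<xi> b else 0) * dual_basis b x)" for j \<xi>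
  have sumc: "(\<lambda>x. \<Sum>b\<in>C. c b * dual_basis b x) \<in> functionals g" if "C \<subseteq> B" for c C
    using finite_subset[OF that finite_basis] that
  proof (induction C rule: finite_induct)
    case empty
    then show ?case by (simp add: zero_functional)
  next
    case (insert b C)
    have "(\<lambda>x. c b * dual_basis b x) \<in> functionals g"
      using dual_basis_functional[of b] insert.prems functionals_smult by (auto simp: functionals_degree_def)
    then show ?case using insert functionals_add by auto
  qed
  have submod: "submodule (grade ?D i) scalars ?D" for i
  proof (rule D.submoduleI)
    show "grade ?D i \<subseteq> carrier ?D" by (auto simp: dual_space_simps functionals_degree_def)
    show "\<ominus>\<^bsub>?D\<^esub> \<xi> \<in> grade ?D i" if "\<xi> \<in> grade ?D i" for \<xi>
    proof -
      have "\<ominus>\<^bsub>?D\<^esub> \<xi> = (\<lambda>x. (- 1) * \<xi> x)"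
        using that dual_space_minus[of \<xi> g] by (simp add: dual_space_simps functionals_degree_def)
      then show ?thesis using that functionals_degree_smult[of \<xi> g i "- 1"] by (simp only: dual_space_simps)
    qed
  qed (auto simp: dual_space_simps functionals_degree_add functionals_degree_smult, simp_all add: functionals_degree_def zero_functional)
  have lin: "linear_map scalars ?D ?D (p j)" for j
  proof (rule linear_mapI)
    show "p j \<xi> \<in> carrier ?D" for \<xi> unfolding p_def dual_space_simps by (rule sumc) simp
  qed (auto simp: dual_space_simps p_def fun_eq_iff distrib_right sum_distrib_left simp flip: sum.distrib intro!: sum.cong)
  have val: "\<xi> b = 0" if "\<xi> \<in> grade ?D j" "b \<in> B" "deg b \<noteq> - j" for \<xi> j b
    using that basis_grade[OF that(2)] by (auto simp: dual_space_simps functionals_degree_def)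
  have same: "p j \<xi> = \<xi>" if "\<xi> \<in> grade ?D j" for j \<xi>
  proof -
    have "p j \<xi> = (\<lambda>x. \<Sum>b\<in>B. \<xi> b * dual_basis b x)"
      unfolding p_def using val[OF that] by (auto intro!: sum.cong)
    moreover have "\<xi> \<in> functionals g" using that by (simp add: dual_space_simps functionals_degree_def)
    ultimately show ?thesis using functional_sum[of \<xi>] by simp
  qed
  have other: "p j \<xi> = \<zero>\<^bsub>?D\<^esub>" if "\<xi> \<in> grade ?D i" "j \<noteq> i" for i j \<xi>
    unfolding p_def dual_space_simps using val[OF that(1)] that(2) by (auto intro!: sum.neutral)
  have span: "carrier ?D \<subseteq> linear_span scalars ?D (\<Union>i. grade ?D i)"
  proof
    fix \<xi> assume \<xi>: "\<xi> \<in> carrier ?D"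
    have gc: "(\<Union>i. grade ?D i) \<subseteq> carrier ?D" using submoduleD(1)[OF submod module_dual_space] by blast
    note sp = submoduleD[OF submodule_linear_span[OF module_dual_space gc] module_dual_space]
    have "(\<lambda>x. \<Sum>b\<in>C. \<xi> b * dual_basis b x) \<in> linear_span scalars ?D (\<Union>i. grade ?D i)" if "C \<subseteq> B" for C
      using finite_subset[OF that finite_basis] that
    proof (induction C rule: finite_induct)
      case empty
      then show ?case using sp(2) by (simp add: dual_space_simps)
    next
      case (insert b C)
      have "dual_basis b \<in> (\<Union>i. grade ?D i)" using dual_basis_functional[of b] insert.prems by (auto simp: dual_space_simps)
      then have "dual_basis b \<in> linear_span scalars ?D (\<Union>i. grade ?D i)" by (rule subsetD[OF linear_span_superset])
      then have "\<xi> b \<odot>\<^bsub>?D\<^esub> dual_basis b \<in> linear_span scalars ?D (\<Union>i. grade ?D i)" using sp(4) by simp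
      from sp(3)[OF this insert.IH] show ?case using insert by (simp add: dual_space_simps)
    qed
    from this[of B] show "\<xi> \<in> linear_span scalars ?D (\<Union>i. grade ?D i)"
      using functional_sum[of \<xi>] \<xi> by (simp add: dual_space_simps)
  qed
  show ?thesis
    by (rule direct_sum_of_projections(1)[where p = p, OF module_dual_space submod lin same other span]) assumption+
qed

lemma parity_dual:
  assumes "\<xi> \<in> functionals_degree g i"
  shows "parity (dual_space g) \<xi> = (\<lambda>x. sgn_pow i * \<xi> x)"
proof -
  have "\<xi> \<in> grade (dual_space g) i" "\<xi> \<in> carrier (dual_space g)"
    using assms by (simp_all add: dual_space_simps functionals_degree_def)
  then show ?thesis
    using parity_homogeneous[OF direct_sum_dual, of \<xi> i]
      koszul_eq[OF module_dual_space, of \<xi> g i] by (simp add: dual_space_simps)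
qed

lemma dual_space_truncate: "dual_space (dg.truncate g) = dual_space g"
  by (simp add: dual_space_def linear_map_def truncate_simps)

lemma V_simps:
  "grade V i = functionals_degree g (i - 1)" "\<xi> \<oplus>\<^bsub>V\<^esub> \<eta> = (\<lambda>x. \<xi> x + \<eta> x)" "a \<odot>\<^bsub>V\<^esub> \<xi> = (\<lambda>x. a * \<xi> x)"
  by (simp_all add: shift_simps dual_simps dual_space_truncate dual_space_simps)

lemma gradeD:
  assumes "\<xi> \<in> functionals_degree g i"
  shows "linear_map scalars g ground \<xi>" "\<xi> \<in> functionals g" "x \<in> grade g j \<Longrightarrow> j \<noteq> - i \<Longrightarrow> \<xi> x = 0"
    "x \<notin> carrier g \<Longrightarrow> \<xi> x = 0"
  using assms by (auto simp: functionals_degree_def functionals_def)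

text \<open>A generator of degree \<open>i\<close> is a functional of degree \<open>i - 1\<close>.
  The minus sign of the dual differential cancels against the one introduced by the shift by -1, and
  the parity of the functional remains.\<close>

lemma V_diff:
  assumes "\<xi> \<in> grade V i"
  shows "diff V \<xi> = (\<lambda>x. if x \<in> carrier g then sgn_pow (i - 1) * \<xi> (diff g x) else 0)"
proof -
  let ?h = "\<lambda>x. if x \<in> carrier g then - (sgn_pow (i - 1) * \<xi> (diff g x)) else 0"
  have \<xi>: "\<xi> \<in> functionals_degree g (i - 1)" using assms by (simp add: V_simps)
  have h: "diff (dual (dg.truncate g)) \<xi> = ?h"
    by (rule ext) (simp add: dual_simps dual_space_truncate parity_dual[OF \<xi>] truncate_simps)
  have "?h \<in> functionals g"
    using linear_mapD'[OF linear_map_compose[OF diff_linear gradeD(1)[OF \<xi>]]]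
    by (simp add: functionals_def linear_map_def algebra_simps)
  then have "\<ominus>\<^bsub>dual_space g\<^esub> ?h = (\<lambda>x. - ?h x)" by (rule dual_space_minus)
  moreover have "a_inv (dual (dg.truncate g)) = a_inv (dual_space g)"
    by (rule a_inv_cong) (simp_all add: dual_simps dual_space_truncate)
  ultimately show ?thesis by (auto simp: shift_simps koszul_def h)
qed

sublocale V: graded_summands V
  by unfold_locales (simp_all only: V_simps functionals_degree_add functionals_degree_smult)

lemma CE_alg_eq: "CE_alg g = sym_algebra V"
  by (simp add: CE_alg_def)

lemma V_diff_grade:
  assumes "\<xi> \<in> grade V i" shows "diff V \<xi> \<in> grade V (i + 1)"
proof -
  have \<xi>: "\<xi> \<in> functionals_degree g (i - 1)" using assms by (simp add: V_simps)
  note l = linear_mapD'[OF linear_map_compose[OF diff_linear gradeD(1)[OF \<xi>]]]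
  have "\<xi> (diff g x) = 0" if "x \<in> grade g j" "j \<noteq> - i" for x j
    using diff_degree that by (intro gradeD(3)[OF \<xi>, of _ "j + 1"]) (auto simp: has_degree_def)
  then show ?thesis
    unfolding V_diff[OF assms] V_simps functionals_degree_def functionals_def
    using l by (simp add: linear_map_def algebra_simps)
qed

lemma generator_map_d0: "generator_map V (\<lambda>i \<xi>. sym_gen V (i + 1) (diff V \<xi>))"
proof
  fix \<xi> \<eta> i and a :: 'k assume \<xi>: "\<xi> \<in> grade V i"
  show "sym_gen V (i + 1) (diff V \<xi>) \<in> grade (sym_algebra V) (i + 1 )"
    unfolding sym_gen_def V.grade_S using V_diff_grade[OF \<xi>] by (intro V.wd_in_part V.letter_word) simp_all
  show "sym_gen V (i + 1) (diff V (\<xi> \<oplus>\<^bsub>V\<^esub> \<eta>)) =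
      sym_gen V (i + 1) (diff V \<xi>) \<oplus>\<^bsub>sym_algebra V\<^esub> sym_gen V (i + 1) (diff V \<eta>)" if \<eta>: "\<eta> \<in> grade V i"
  proof -
    have "diff V (\<xi> \<oplus>\<^bsub>V\<^esub> \<eta>) = diff V \<xi> \<oplus>\<^bsub>V\<^esub> diff V \<eta>"
      unfolding V_diff[OF \<xi>] V_diff[OF \<eta>] V_diff[OF V.grade_add[OF \<xi> \<eta>]] unfolding V_simps by (auto simp: distrib_left)
    then show ?thesis
      unfolding sym_gen_def using V.wd_relations(1)[OF V_diff_grade[OF \<xi>] V_diff_grade[OF \<eta>]] by simp
  qed
  have "diff V (a \<odot>\<^bsub>V\<^esub> \<xi>) = a \<odot>\<^bsub>V\<^esub> diff V \<xi>"
    unfolding V_diff[OF \<xi>] V_diff[OF V.grade_smult[OF \<xi>]] unfolding V_simps by auto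
  then show "sym_gen V (i + 1) (diff V (a \<odot>\<^bsub>V\<^esub> \<xi>)) = a \<odot>\<^bsub>sym_algebra V\<^esub> sym_gen V (i + 1) (diff V \<xi>)"
    unfolding sym_gen_def using V.wd_relations(2)[OF V_diff_grade[OF \<xi>]] by simp
qed

text \<open>Once some derivation has the prescribed values on generators, the one selected by
  \<open>SOME\<close> has them too.\<close>

lemma CE_d0_spec:
  "derivation (CE_alg g) (CE_d0 g) \<and>
   (\<forall>i. \<forall>\<xi>\<in>grade V i. CE_d0 g (sym_gen V i \<xi>) = sym_gen V (i + 1) (diff V \<xi>))"
  unfolding CE_d0_def CE_alg_eq
  by (rule someI_ex[OF generator_map.ex_derivation[OF generator_map_d0]])

text \<open>The functional dual to \<open>b\<close> has degree \<open>- deg b\<close>, which becomes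
  \<open>1 - deg b\<close> after the shift.\<close>

definition quadratic_word :: "'g \<times> 'g \<Rightarrow> (int \<times> ('g \<Rightarrow> 'k)) list" where
  "quadratic_word = (\<lambda>(b, c). [(1 - deg b, dual_basis b), (1 - deg c, dual_basis c)])"

text \<open>Every unordered pair of basis elements occurs twice in \<open>B \<times> B\<close>, hence the division by \<open>2\<close>;
  the signs undo those in the pairing \<^const>\<open>quadratic_value\<close>.\<close>

definition structure_coeff :: "int \<Rightarrow> ('g \<Rightarrow> 'k) \<Rightarrow> 'g \<times> 'g \<Rightarrow> 'k" where
  "structure_coeff i \<xi> = (\<lambda>(b, c). sgn_pow ((1 - deg b) * (1 - deg c)) * sgn_pow (i + deg b) * \<xi> (bracket g b c) / 2)"

definition dual_bracket :: "int \<Rightarrow> ('g \<Rightarrow> 'k) \<Rightarrow> ('k, 'g \<Rightarrow> 'k) words" where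
  "dual_bracket i \<xi> = (\<lambda>w. \<Sum>p\<in>B \<times> B. structure_coeff i \<xi> p * single (quadratic_word p) w)"

lemma quadratic_word: "p \<in> B \<times> B \<Longrightarrow> quadratic_word p \<in> V.X"
  using dual_basis_functional by (auto simp: quadratic_word_def letters_def V_simps)

lemma dual_bracket_support:
  assumes "dual_bracket i \<xi> w \<noteq> 0"
  shows "\<exists>p\<in>B \<times> B. w = quadratic_word p \<and> structure_coeff i \<xi> p \<noteq> 0"
proof -
  obtain p where "p \<in> B \<times> B" "structure_coeff i \<xi> p * single (quadratic_word p) w \<noteq> 0"
    using sum.not_neutral_contains_not_neutral[OF assms[unfolded dual_bracket_def]] .
  then show ?thesis by (intro bexI[of _ p]) (auto simp: single_def split: if_splits)
qed

lemma dual_bracket_subset: "{w. dual_bracket i \<xi> w \<noteq> 0} \<subseteq> quadratic_word ` (B \<times> B)"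
proof
  fix w assume "w \<in> {w. dual_bracket i \<xi> w \<noteq> 0}"
  then have "dual_bracket i \<xi> w \<noteq> 0" by simp
  from dual_bracket_support[OF this] show "w \<in> quadratic_word ` (B \<times> B)" by blast
qed

lemma dual_bracket_closed: "dual_bracket i \<xi> \<in> carrier V.W"
proof -
  have "quadratic_word ` (B \<times> B) \<subseteq> V.X" by (rule image_subsetI) (rule quadratic_word)
  then show ?thesis
    unfolding word_algebra_simps free_module_simps mem_Collect_eq
    using finite_basis by (intro conjI finite_subset[OF dual_bracket_subset] order.trans[OF dual_bracket_subset]) simp_all
qed

text \<open>A nonzero structure constant forces the bracket of \<open>b\<close> and \<open>c\<close>
  into degree \<open>1 - i\<close>, where \<xi> lives; so \<open>deg b + deg c = 1 - i\<close>, and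
  the two letters have total degree \<open>2 - (1 - i)\<close>.\<close>

lemma dual_bracket_degree:
  assumes \<xi>: "\<xi> \<in> grade V i" and w: "dual_bracket i \<xi> w \<noteq> 0"
  shows "length w = 2" and "sum_list (map fst w) = i + 1"
proof -
  obtain b c where bc: "b \<in> B" "c \<in> B" "w = quadratic_word (b, c)" "structure_coeff i \<xi> (b, c) \<noteq> 0"
    using dual_bracket_support[OF w] by blast
  have \<xi>': "\<xi> \<in> functionals_degree g (i - 1)" using \<xi> by (simp add: V_simps)
  have "\<xi> (bracket g b c) \<noteq> 0" using bc(4) by (simp add: structure_coeff_def)
  then have "deg b + deg c = - (i - 1)"
    using gradeD(3)[OF \<xi>' bracket_degree[OF basis_grade[OF bc(1)] basis_grade[OF bc(2)]]] by blast
  then show "sum_list (map fst w) = i + 1" "length w = 2" by (auto simp: bc(3) quadratic_word_def)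
qed

lemma generator_map_d1: "generator_map V (\<lambda>i \<xi>. sym_class V (dual_bracket i \<xi>))"
proof
  fix \<xi> \<eta> i and a :: 'k assume \<xi>: "\<xi> \<in> grade V i"
  show "sym_class V (dual_bracket i \<xi>) \<in> grade (sym_algebra V) (i + 1)"
    unfolding V.sym_simps using dual_bracket_closed dual_bracket_degree(2)[OF \<xi>] by (intro imageI) simp
  have "dual_bracket i (\<xi> \<oplus>\<^bsub>V\<^esub> \<eta>) = dual_bracket i \<xi> \<oplus>\<^bsub>V.W\<^esub> dual_bracket i \<eta>"
    by (simp add: dual_bracket_def structure_coeff_def V_simps word_algebra_simps split_beta algebra_simps
        add_divide_distrib sum.distrib)
  then show "sym_class V (dual_bracket i (\<xi> \<oplus>\<^bsub>V\<^esub> \<eta>)) =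
      sym_class V (dual_bracket i \<xi>) \<oplus>\<^bsub>sym_algebra V\<^esub> sym_class V (dual_bracket i \<eta>)"
    using linear_mapD'(2)[OF V.class_linear dual_bracket_closed dual_bracket_closed] by simp
  have "dual_bracket i (a \<odot>\<^bsub>V\<^esub> \<xi>) = a \<odot>\<^bsub>V.W\<^esub> dual_bracket i \<xi>"
    by (simp add: dual_bracket_def structure_coeff_def V_simps word_algebra_simps split_beta algebra_simps
        sum_distrib_left)
  then show "sym_class V (dual_bracket i (a \<odot>\<^bsub>V\<^esub> \<xi>)) = a \<odot>\<^bsub>sym_algebra V\<^esub> sym_class V (dual_bracket i \<xi>)"
    using linear_mapD'(3)[OF V.class_linear dual_bracket_closed] by simp
qed

text \<open>The coefficient of a word is itself a sum over pairs of basis elements. Exchanging the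
  two sums takes care of pairs that might give the same word.\<close>

lemma sum_over_support:
  fixes val :: "(int \<times> ('g \<Rightarrow> 'k)) list \<Rightarrow> 'k"
  shows "(\<Sum>w\<in>{w. dual_bracket i \<xi> w \<noteq> 0}. dual_bracket i \<xi> w * val w) =
    (\<Sum>p\<in>B \<times> B. structure_coeff i \<xi> p * val (quadratic_word p))"
proof -
  let ?Q = "quadratic_word ` (B \<times> B)"
  have fin: "finite (B \<times> B)" using finite_basis by simp
  have "(\<Sum>w\<in>{w. dual_bracket i \<xi> w \<noteq> 0}. dual_bracket i \<xi> w * val w) = (\<Sum>w\<in>?Q. dual_bracket i \<xi> w * val w)"
    using fin by (intro sum.mono_neutral_left dual_bracket_subset) auto
  also have "\<dots> = (\<Sum>w\<in>?Q. \<Sum>p\<in>B \<times> B. if w = quadratic_word p then structure_coeff i \<xi> p * val w else 0)"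
    by (auto simp: dual_bracket_def sum_distrib_right single_def intro!: sum.cong)
  also have "\<dots> = (\<Sum>p\<in>B \<times> B. \<Sum>w\<in>?Q. if w = quadratic_word p then structure_coeff i \<xi> p * val w else 0)"
    by (rule sum.swap)
  also have "\<dots> = (\<Sum>p\<in>B \<times> B. structure_coeff i \<xi> p * val (quadratic_word p))"
    using fin by (intro sum.cong) (auto simp: sum.delta')
  finally show ?thesis .
qed

text \<open>The pairing of a product of two functionals with (x, y) has two summands, one for each
  order. After renaming the indices in the second half, graded antisymmetry of the bracket makes the
  two halves equal, which compensates the division by 2. What remains is the expansion of \<xi> of
  the bracket in the coordinates of \<open>x\<close> and \<open>y\<close>.\<close>

lemma quadratic_value_dual_bracket:
  assumes \<xi>: "\<xi> \<in> grade V i" and x: "x \<in> grade g a" and y: "y \<in> grade g b"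
  shows "quadratic_value (dual_bracket i \<xi>) a x y = sgn_pow ((i - 1) + 1 + a) * \<xi> (bracket g x y)"
proof -
  have \<xi>': "\<xi> \<in> functionals_degree g (i - 1)" using \<xi> by (simp add: V_simps)
  note lin = gradeD(1)[OF \<xi>']
  have xc: "x \<in> carrier g" and yc: "y \<in> carrier g" using x y summand_closed(1) by blast+
  have bc: "c \<in> carrier g" if "c \<in> B" for c using basis_closed that by blast
  let ?s = "\<lambda>c d. sgn_pow ((1 - deg c) * (1 - deg d)) :: 'k"
  let ?m = "\<lambda>c d. structure_coeff i \<xi> (c, d)"
  \<comment> \<open>The degree \<open>a\<close> of \<open>x\<close> may be replaced by
    \<open>deg c\<close> in every sign multiplied by this coordinate.\<close>
  have cox: "co c x = 0" if "c \<in> B" "deg c \<noteq> a" for c using co_grade[OF x that] .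
  have sg: "sgn_pow ((1 - deg d) * (deg c - 1)) = ?s c d" for c d
  proof -
    have "(1 - deg d) * (deg c - 1) = - ((1 - deg c) * (1 - deg d))" by (simp add: algebra_simps)
    then show ?thesis by (simp add: power_int_minus_left)
  qed
  have antisym: "?s c d * \<xi> (bracket g d c) * sgn_pow (i + deg d) = sgn_pow (i + deg c) * \<xi> (bracket g c d)"
    if "c \<in> B" "d \<in> B" for c d
  proof -
    have "bracket g d c = sgn_pow (deg d * deg c + 1) \<odot> bracket g c d"
      using bracket_antisym[OF basis_grade[OF that(2)] basis_grade[OF that(1)]]
        koszul_eq[OF module_g linear_mapD'(1)[OF bracket_linear_right[OF bc[OF that(1)]] bc[OF that(2)]]] by simp
    then have "\<xi> (bracket g d c) = sgn_pow (deg d * deg c + 1) * \<xi> (bracket g c d)"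
      using linear_mapD'(3)[OF lin linear_mapD'(1)[OF bracket_linear_right[OF bc[OF that(1)]] bc[OF that(2)]]] by simp
    then show ?thesis by (simp add: sgn_pow_eq)
  qed
  have "quadratic_value (dual_bracket i \<xi>) a x y =
      (\<Sum>p\<in>B \<times> B. structure_coeff i \<xi> p * (case quadratic_word p of
        [(i, \<xi>), (j, \<eta>)] \<Rightarrow> sgn_pow (j * (a - 1)) * \<xi> x * \<eta> y +
                            sgn_pow (i * j) * sgn_pow (i * (a - 1)) * \<eta> x * \<xi> y
      | _ \<Rightarrow> 0))"
    unfolding quadratic_value_def by (rule sum_over_support)
  also have "\<dots> = (\<Sum>p\<in>B \<times> B. case p of (c, d) \<Rightarrow> ?m c d * (sgn_pow ((1 - deg d) * (a - 1)) * co c x * co d y +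
        ?s c d * sgn_pow ((1 - deg c) * (a - 1)) * co d x * co c y))"
    using xc yc by (intro sum.cong) (auto simp: quadratic_word_def dual_basis_def)
  also have "\<dots> = (\<Sum>c\<in>B. \<Sum>d\<in>B. ?m c d * (sgn_pow ((1 - deg d) * (a - 1)) * co c x * co d y +
        ?s c d * sgn_pow ((1 - deg c) * (a - 1)) * co d x * co c y))"
    by (simp add: sum.cartesian_product)
  also have "\<dots> = (\<Sum>c\<in>B. \<Sum>d\<in>B. ?m c d * ?s c d * co c x * co d y + ?m c d * co d x * co c y)"
  proof (intro sum.cong refl)
    fix c d assume c: "c \<in> B" and d: "d \<in> B"
    have e1: "sgn_pow ((1 - deg d) * (a - 1)) * co c x = ?s c d * co c x"
      using cox[OF c] sg[of d c] by (cases "deg c = a") auto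
    have e2: "?s c d * sgn_pow ((1 - deg c) * (a - 1)) * co d x = co d x"
      using cox[OF d] sg[of c d] sgn_pow_square[of "(1 - deg c) * (1 - deg d)"]
      by (cases "deg d = a") (auto simp: mult.commute[of "1 - deg d"])
    show "?m c d * (sgn_pow ((1 - deg d) * (a - 1)) * co c x * co d y +
        ?s c d * sgn_pow ((1 - deg c) * (a - 1)) * co d x * co c y) = ?m c d * ?s c d * co c x * co d y + ?m c d * co d x * co c y"
      unfolding e1 e2 by (simp add: algebra_simps)
  qed
  also have "\<dots> = (\<Sum>c\<in>B. \<Sum>d\<in>B. ?m c d * ?s c d * co c x * co d y) + (\<Sum>c\<in>B. \<Sum>d\<in>B. ?m c d * co d x * co c y)"
    by (simp add: sum.distrib)
  \<comment> \<open>Renaming the indices in the half with the roles of \<open>x\<close> and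
    \<open>y\<close> exchanged, so that both halves carry the same product of coordinates.\<close>
  also have "(\<Sum>c\<in>B. \<Sum>d\<in>B. ?m c d * co d x * co c y) = (\<Sum>c\<in>B. \<Sum>d\<in>B. ?m d c * co c x * co d y)"
    by (rule sum.swap)
  also have "(\<Sum>c\<in>B. \<Sum>d\<in>B. ?m c d * ?s c d * co c x * co d y) + \<dots> =
      (\<Sum>c\<in>B. \<Sum>d\<in>B. (?m c d * ?s c d + ?m d c) * co c x * co d y)"
    by (simp add: sum.distrib[symmetric] distrib_right)
  also have "\<dots> = (\<Sum>c\<in>B. \<Sum>d\<in>B. sgn_pow (i + a) * (co c x * (co d y * \<xi> (bracket g c d))))"
  proof (intro sum.cong refl)
    fix c d assume c: "c \<in> B" and d: "d \<in> B"
    have 1: "?m c d * ?s c d = sgn_pow (i + deg c) * \<xi> (bracket g c d) / 2"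
      using sgn_pow_square[of "(1 - deg c) * (1 - deg d)", where 'k = 'k]
      by (simp add: structure_coeff_def mult_ac)
    have 2: "?m d c = sgn_pow (i + deg c) * \<xi> (bracket g c d) / 2"
      using antisym[OF c d] by (simp add: structure_coeff_def mult_ac)
    have "?m c d * ?s c d + ?m d c = sgn_pow (i + deg c) * \<xi> (bracket g c d)"
      unfolding 1 2 by simp
    then show "(?m c d * ?s c d + ?m d c) * co c x * co d y = sgn_pow (i + a) * (co c x * (co d y * \<xi> (bracket g c d)))"
      using cox[OF c] by (cases "deg c = a") (auto simp: mult_ac)
  qed
  also have "\<dots> = sgn_pow (i + a) * (\<Sum>c\<in>B. co c x * (\<Sum>d\<in>B. co d y * \<xi> (bracket g c d)))"
    by (simp add: sum_distrib_left)
  also have "(\<Sum>c\<in>B. co c x * (\<Sum>d\<in>B. co d y * \<xi> (bracket g c d))) = (\<Sum>c\<in>B. co c x * \<xi> (bracket g c y))"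
    using functional_expand[OF module_g linear_map_compose[OF bracket_linear_right[OF bc] lin] yc]
    by (intro sum.cong) simp_all
  also have "\<dots> = \<xi> (bracket g x y)"
    using functional_expand[OF module_g linear_map_compose[OF bracket_linear_left[OF yc] lin] xc] by simp
  finally show ?thesis by simp
qed

lemma CE_d1_spec:
  "derivation (CE_alg g) (CE_d1 g) \<and>
   (\<forall>i. \<forall>\<xi>\<in>grade V i. \<exists>f\<in>carrier (word_algebra V).
        (\<forall>w. f w \<noteq> 0 \<longrightarrow> length w = 2) \<and>
        CE_d1 g (sym_gen V i \<xi>) = sym_class V f \<and>
        (\<forall>a b. \<forall>x\<in>grade g a. \<forall>y\<in>grade g b.
           quadratic_value f a x y = (-1) powi ((i - 1) + 1 + a) * \<xi> (bracket g x y)))"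
proof -
  obtain D where D: "derivation (sym_algebra V) D" "\<forall>i. \<forall>\<xi>\<in>grade V i. D (sym_gen V i \<xi>) = sym_class V (dual_bracket i \<xi>)"
    using generator_map.ex_derivation[OF generator_map_d1] by blast
  have "\<exists>D. derivation (CE_alg g) D \<and>
     (\<forall>i. \<forall>\<xi>\<in>grade V i. \<exists>f\<in>carrier (word_algebra V).
        (\<forall>w. f w \<noteq> 0 \<longrightarrow> length w = 2) \<and>
        D (sym_gen V i \<xi>) = sym_class V f \<and>
        (\<forall>a b. \<forall>x\<in>grade g a. \<forall>y\<in>grade g b.
           quadratic_value f a x y = (-1) powi ((i - 1) + 1 + a) * \<xi> (bracket g x y)))"
    unfolding CE_alg_eq
  proof (intro exI[of _ D] conjI allI ballI D(1))
    fix i \<xi> assume \<xi>: "\<xi> \<in> grade V i"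
    show "\<exists>f\<in>carrier (word_algebra V). (\<forall>w. f w \<noteq> 0 \<longrightarrow> length w = 2) \<and>
        D (sym_gen V i \<xi>) = sym_class V f \<and>
        (\<forall>a b. \<forall>x\<in>grade g a. \<forall>y\<in>grade g b.
           quadratic_value f a x y = (-1) powi ((i - 1) + 1 + a) * \<xi> (bracket g x y))"
      using D(2) \<xi> dual_bracket_degree(1)[OF \<xi>] quadratic_value_dual_bracket[OF \<xi>]
      by (intro bexI[OF _ dual_bracket_closed[of i \<xi>]]) simp
  qed
  from someI_ex[OF this] show ?thesis unfolding CE_d1_def .
qed

end

section \<open>C(g, M) as a module over C(g): action, degree, word length, coordinates\<close>

section \<open>Cochains with coefficients\<close>

lemma parity_linear:
  assumes "module scalars V" "internal_direct_sum V (grade V)" "\<And>i. submodule (grade V i) scalars V"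
  shows "linear_map scalars V V (parity V)"
proof -
  interpret module scalars V by fact
  interpret D: internal_direct_sum V "grade V" by fact
  let ?c = "component V (grade V)"
  note lin = linear_mapD'[OF component_linear[OF assms(2,1,3)]]
  \<comment> \<open>The sum may run over any finite set containing the support, which allows a
    common index set for two elements.\<close>
  have parity_eq: "parity V x = (\<Oplus>\<^bsub>V\<^esub>i\<in>J. sgn_pow i \<odot>\<^bsub>V\<^esub> ?c i x)"
    if "x \<in> carrier V" "finite J" "{i. ?c i x \<noteq> \<zero>\<^bsub>V\<^esub>} \<subseteq> J" for x J
  proof -
    have "parity V x = (\<Oplus>\<^bsub>V\<^esub>i\<in>{i. ?c i x \<noteq> \<zero>\<^bsub>V\<^esub>}. sgn_pow i \<odot>\<^bsub>V\<^esub> ?c i x)"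
      unfolding parity_def using D.component_closed[OF that(1)]
      by (intro finsum_cong') (auto simp: koszul_eq[OF assms(1)])
    also have "\<dots> = (\<Oplus>\<^bsub>V\<^esub>i\<in>J. sgn_pow i \<odot>\<^bsub>V\<^esub> ?c i x)"
    proof (rule finsum_superset[OF that(2,3)])
      show "sgn_pow i \<odot>\<^bsub>V\<^esub> ?c i x = \<zero>\<^bsub>V\<^esub>" if "i \<in> J - {i. ?c i x \<noteq> \<zero>\<^bsub>V\<^esub>}" for i
        using that vector_spaceD(7)[OF assms(1)] by simp
    qed (use D.component_closed[OF that(1)] in simp)
    finally show ?thesis .
  qed
  show ?thesis
  proof (rule linear_mapI)
    fix x assume x: "x \<in> carrier V"
    let ?J = "{i. ?c i x \<noteq> \<zero>\<^bsub>V\<^esub>}"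
    have J: "finite ?J" by (rule D.finite_support[OF x])
    show "parity V x \<in> carrier V"
      unfolding parity_eq[OF x J order_refl] using D.component_closed[OF x] by (intro finsum_closed) simp
    show "parity V (a \<odot>\<^bsub>V\<^esub> x) = a \<odot>\<^bsub>V\<^esub> parity V x" for a
    proof -
      have "parity V (a \<odot>\<^bsub>V\<^esub> x) = (\<Oplus>\<^bsub>V\<^esub>i\<in>?J. sgn_pow i \<odot>\<^bsub>V\<^esub> ?c i (a \<odot>\<^bsub>V\<^esub> x))"
        using lin(3)[OF x] vector_spaceD(1)[OF assms(1) x] vector_spaceD(7)[OF assms(1)]
        by (intro parity_eq J) auto
      also have "\<dots> = (\<Oplus>\<^bsub>V\<^esub>i\<in>?J. a \<odot>\<^bsub>V\<^esub> (sgn_pow i \<odot>\<^bsub>V\<^esub> ?c i x))"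
        using lin(3)[OF x] D.component_closed[OF x]
        by (intro finsum_cong') (simp_all add: vector_spaceD(4)[OF assms(1), symmetric] mult.commute)
      also have "\<dots> = a \<odot>\<^bsub>V\<^esub> parity V x"
        unfolding parity_eq[OF x J order_refl] using D.component_closed[OF x] J
        by (intro finsum_smult_ldistr[symmetric]) simp_all
      finally show ?thesis .
    qed
    fix y assume y: "y \<in> carrier V"
    let ?K = "?J \<union> {i. ?c i y \<noteq> \<zero>\<^bsub>V\<^esub>}"
    have K: "finite ?K" using J D.finite_support[OF y] by simp
    have "parity V (x \<oplus>\<^bsub>V\<^esub> y) = (\<Oplus>\<^bsub>V\<^esub>i\<in>?K. sgn_pow i \<odot>\<^bsub>V\<^esub> ?c i (x \<oplus>\<^bsub>V\<^esub> y))"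
      using lin(2)[OF x y] x y by (intro parity_eq K) auto
    also have "\<dots> = (\<Oplus>\<^bsub>V\<^esub>i\<in>?K. sgn_pow i \<odot>\<^bsub>V\<^esub> ?c i x \<oplus>\<^bsub>V\<^esub> sgn_pow i \<odot>\<^bsub>V\<^esub> ?c i y)"
      using lin(2)[OF x y] D.component_closed[OF x] D.component_closed[OF y]
      by (intro finsum_cong') (simp_all add: smult_r_distr)
    also have "\<dots> = (\<Oplus>\<^bsub>V\<^esub>i\<in>?K. sgn_pow i \<odot>\<^bsub>V\<^esub> ?c i x) \<oplus>\<^bsub>V\<^esub> (\<Oplus>\<^bsub>V\<^esub>i\<in>?K. sgn_pow i \<odot>\<^bsub>V\<^esub> ?c i y)"
      using D.component_closed[OF x] D.component_closed[OF y] by (intro finsum_addf) simp_all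
    also have "\<dots> = parity V x \<oplus>\<^bsub>V\<^esub> parity V y"
      using parity_eq[OF x K] parity_eq[OF y K] by simp
    finally show "parity V (x \<oplus>\<^bsub>V\<^esub> y) = parity V x \<oplus>\<^bsub>V\<^esub> parity V y" .
  qed
qed

text \<open>Interface between the construction of C(g) by words and everything that follows.
  \<open>eps\<close> is the augmentation, tied to the grading by word length through
  \<open>component_zero\<close>; \<open>eps_diff\<close> is what later makes the component of a
  differential in C^0(g, M) square to zero.\<close>

locale CE_algebra =
  fixes g :: "('k::field, 'g) dg_lie" and eps :: "('k, 'g) CE \<Rightarrow> 'k"
  assumes ring_A: "ring (CE_alg g)"
    and module_A: "module scalars (CE_alg g)"
    and smult_mult: "\<lbrakk>x \<in> carrier (CE_alg g); y \<in> carrier (CE_alg g)\<rbrakk> \<Longrightarrow>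
      (a \<odot>\<^bsub>CE_alg g\<^esub> x) \<otimes>\<^bsub>CE_alg g\<^esub> y = a \<odot>\<^bsub>CE_alg g\<^esub> (x \<otimes>\<^bsub>CE_alg g\<^esub> y)"
    and mult_smult: "\<lbrakk>x \<in> carrier (CE_alg g); y \<in> carrier (CE_alg g)\<rbrakk> \<Longrightarrow>
      x \<otimes>\<^bsub>CE_alg g\<^esub> (a \<odot>\<^bsub>CE_alg g\<^esub> y) = a \<odot>\<^bsub>CE_alg g\<^esub> (x \<otimes>\<^bsub>CE_alg g\<^esub> y)"
    and direct_sum_grade: "internal_direct_sum (CE_alg g) (grade (CE_alg g))"
    and submodule_grade: "submodule (grade (CE_alg g) n) scalars (CE_alg g)"
    and grade_mult: "\<lbrakk>x \<in> grade (CE_alg g) i; y \<in> grade (CE_alg g) j\<rbrakk> \<Longrightarrow>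
      x \<otimes>\<^bsub>CE_alg g\<^esub> y \<in> grade (CE_alg g) (i + j)"
    and one_grade: "\<one>\<^bsub>CE_alg g\<^esub> \<in> grade (CE_alg g) 0"
    and direct_sum_power: "internal_direct_sum (CE_alg g) (CE_power g)"
    and submodule_power: "submodule (CE_power g p) scalars (CE_alg g)"
    and component_power_grade: "x \<in> grade (CE_alg g) n \<Longrightarrow>
      component (CE_alg g) (CE_power g) p x \<in> grade (CE_alg g) n"
    and one_power: "\<one>\<^bsub>CE_alg g\<^esub> \<in> CE_power g 0"
    and eps_linear: "linear_map scalars (CE_alg g) ground eps"
    and eps_one: "eps \<one>\<^bsub>CE_alg g\<^esub> = 1"
    and eps_mult: "\<lbrakk>x \<in> carrier (CE_alg g); y \<in> carrier (CE_alg g)\<rbrakk> \<Longrightarrow>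
      eps (x \<otimes>\<^bsub>CE_alg g\<^esub> y) = eps x * eps y"
    and component_zero: "x \<in> carrier (CE_alg g) \<Longrightarrow>
      component (CE_alg g) (CE_power g) 0 x = eps x \<odot>\<^bsub>CE_alg g\<^esub> \<one>\<^bsub>CE_alg g\<^esub>"
    and derivation_diff: "derivation (CE_alg g) (CE_diff g)"
    and eps_diff: "x \<in> carrier (CE_alg g) \<Longrightarrow> eps (CE_diff g x) = 0"

lemma derivation_add:
  assumes "derivation A D" "derivation A E" "ring A" "module scalars A"
    "\<And>i. submodule (grade A i) scalars A"
  shows "derivation A (\<lambda>x. D x \<oplus>\<^bsub>A\<^esub> E x)"
proof -
  interpret ring A by fact
  have D: "linear_map scalars A A D" "\<And>i a. a \<in> grade A i \<Longrightarrow> D a \<in> grade A (i + 1)"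
    "\<And>i a b. a \<in> grade A i \<Longrightarrow> b \<in> carrier A \<Longrightarrow> D (a \<otimes>\<^bsub>A\<^esub> b) = (D a \<otimes>\<^bsub>A\<^esub> b) \<oplus>\<^bsub>A\<^esub> koszul A i (a \<otimes>\<^bsub>A\<^esub> D b)"
    using assms(1) by (auto simp: derivation_def has_degree_def)
  have E: "linear_map scalars A A E" "\<And>i a. a \<in> grade A i \<Longrightarrow> E a \<in> grade A (i + 1)"
    "\<And>i a b. a \<in> grade A i \<Longrightarrow> b \<in> carrier A \<Longrightarrow> E (a \<otimes>\<^bsub>A\<^esub> b) = (E a \<otimes>\<^bsub>A\<^esub> b) \<oplus>\<^bsub>A\<^esub> koszul A i (a \<otimes>\<^bsub>A\<^esub> E b)"
    using assms(2) by (auto simp: derivation_def has_degree_def)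
  note cl = linear_mapD'(1)[OF D(1)] linear_mapD'(1)[OF E(1)]
  show ?thesis
    unfolding derivation_def has_degree_def
  proof (intro conjI allI ballI linear_map_add[OF D(1) E(1) assms(4,4)])
    show "D a \<oplus>\<^bsub>A\<^esub> E a \<in> grade A (i + 1)" if "a \<in> grade A i" for i a
      using submoduleD(3)[OF assms(5,4)] D(2) E(2) that by blast
    fix i a b assume a: "a \<in> grade A i" and b: "b \<in> carrier A"
    have ac: "a \<in> carrier A" using submoduleD(1)[OF assms(5,4)] a by blast
    show "D (a \<otimes>\<^bsub>A\<^esub> b) \<oplus>\<^bsub>A\<^esub> E (a \<otimes>\<^bsub>A\<^esub> b) =
        ((D a \<oplus>\<^bsub>A\<^esub> E a) \<otimes>\<^bsub>A\<^esub> b) \<oplus>\<^bsub>A\<^esub> koszul A i (a \<otimes>\<^bsub>A\<^esub> (D b \<oplus>\<^bsub>A\<^esub> E b))"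
      using cl ac b by (simp add: D(3)[OF a b] E(3)[OF a b] koszul_def l_distr r_distr minus_add a_ac)
  qed
qed

lemma (in lie_basis) CE_algebra: "CE_algebra g V.augmentation"
proof (rule CE_algebra.intro)
  have CP: "CE_power g p = sym_power V p" for p by (simp add: CE_power_def)
  have CP': "CE_power g = sym_power V" by (rule ext) (rule CP)
  show "ring (CE_alg g)" "module scalars (CE_alg g)" unfolding CE_alg_eq by (fact V.ring_S V.module_S)+
  show "internal_direct_sum (CE_alg g) (grade (CE_alg g))" "submodule (grade (CE_alg g) n) scalars (CE_alg g)"
    "\<one>\<^bsub>CE_alg g\<^esub> \<in> grade (CE_alg g) 0" "internal_direct_sum (CE_alg g) (CE_power g)"
    "submodule (CE_power g p) scalars (CE_alg g)" "\<one>\<^bsub>CE_alg g\<^esub> \<in> CE_power g 0"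
    "linear_map scalars (CE_alg g) ground V.augmentation" "V.augmentation \<one>\<^bsub>CE_alg g\<^esub> = 1" for n p
    unfolding CE_alg_eq CP'
    by (fact V.direct_sum_grade V.submodule_grade V.one_grade V.direct_sum_power V.submodule_power V.one_power
        V.augmentation_linear V.augmentation_one)+
  show "(a \<odot>\<^bsub>CE_alg g\<^esub> x) \<otimes>\<^bsub>CE_alg g\<^esub> y = a \<odot>\<^bsub>CE_alg g\<^esub> (x \<otimes>\<^bsub>CE_alg g\<^esub> y)"
    "x \<otimes>\<^bsub>CE_alg g\<^esub> (a \<odot>\<^bsub>CE_alg g\<^esub> y) = a \<odot>\<^bsub>CE_alg g\<^esub> (x \<otimes>\<^bsub>CE_alg g\<^esub> y)"
    "V.augmentation (x \<otimes>\<^bsub>CE_alg g\<^esub> y) = V.augmentation x * V.augmentation y"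
    if "x \<in> carrier (CE_alg g)" "y \<in> carrier (CE_alg g)" for a x y
    using that unfolding CE_alg_eq by (fact V.sym_smult_assoc V.augmentation_mult)+
  show "x \<otimes>\<^bsub>CE_alg g\<^esub> y \<in> grade (CE_alg g) (i + j)" if "x \<in> grade (CE_alg g) i" "y \<in> grade (CE_alg g) j" for x y i j
    using that unfolding CE_alg_eq by (rule V.grade_mult)
  show "component (CE_alg g) (CE_power g) p x \<in> grade (CE_alg g) n" if "x \<in> grade (CE_alg g) n" for x n p
    using that unfolding CE_alg_eq CP' by (rule V.component_power_grade)
  show "component (CE_alg g) (CE_power g) 0 x = V.augmentation x \<odot>\<^bsub>CE_alg g\<^esub> \<one>\<^bsub>CE_alg g\<^esub>"
    if "x \<in> carrier (CE_alg g)" for x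
    using that unfolding CE_alg_eq CP' by (rule V.component_power_zero)
  have d0: "derivation (CE_alg g) (CE_d0 g)" and d1: "derivation (CE_alg g) (CE_d1 g)"
    using CE_d0_spec CE_d1_spec by blast+
  show "derivation (CE_alg g) (CE_diff g)"
    using derivation_add[OF d0 d1] V.ring_S V.module_S V.submodule_grade
    by (simp add: CE_alg_eq CE_diff_def[abs_def])
  show "V.augmentation (CE_diff g x) = 0" if x: "x \<in> carrier (CE_alg g)" for x
  proof -
    note x' = x[unfolded CE_alg_eq]
    \<comment> \<open>A derivation need only be tested on generators. Here they are sent to words of
      length one, and in the second half to combinations of words of length two; the augmentation
      kills both.\<close>
    have "V.augmentation (CE_d0 g x) = 0"
    proof (rule V.derivation_augmentation[OF d0[unfolded CE_alg_eq] _ x'])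
      fix i \<xi> assume \<xi>: "\<xi> \<in> grade V i"
      have "V.augmentation (sym_class V (single [(i + 1, diff V \<xi>)])) = 0"
        using V.augmentation_word[of "[(i + 1, diff V \<xi>)]"] V_diff_grade[OF \<xi>] by (simp add: V.letter_iff)
      then show "V.augmentation (CE_d0 g (sym_gen V i \<xi>)) = 0" using CE_d0_spec \<xi> by (simp add: sym_gen_def)
    qed
    moreover have "V.augmentation (CE_d1 g x) = 0"
    proof (rule V.derivation_augmentation[OF d1[unfolded CE_alg_eq] _ x'])
      fix i \<xi> assume \<xi>: "\<xi> \<in> grade V i"
      then obtain f where f: "f \<in> carrier (word_algebra V)" "\<forall>w. f w \<noteq> 0 \<longrightarrow> length w = 2"
        "CE_d1 g (sym_gen V i \<xi>) = sym_class V f" using CE_d1_spec by blast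
      have p: "sym_class V f \<in> V.part (\<lambda>w. length w = 2)"
        unfolding V.power_S[symmetric] sym_power_def using f(1,2) by (intro imageI) simp
      have zero: "linear_map scalars V.S ground (\<lambda>x. 0)" by (rule linear_mapI) simp_all
      have "V.augmentation (sym_class V f) = 0"
        by (rule V.part_eqI[OF V.augmentation_linear zero module_ground _ p]) (auto simp: V.augmentation_word)
      then show "V.augmentation (CE_d1 g (sym_gen V i \<xi>)) = 0" by (simp only: f(3))
    qed
    ultimately show ?thesis
      using V.augmentation_simps(1)[OF linear_mapD'(1)[of V.S V.S "CE_d0 g" x] linear_mapD'(1)[of V.S V.S "CE_d1 g" x]]
        d0 d1 x' by (simp add: CE_diff_def CE_alg_eq derivation_def)
  qed
qed

lemma ex_CE_algebra:
  fixes h :: "('k::real_or_complex, 'g) dg_lie"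
  assumes "dg_lie_algebra h"
  shows "\<exists>eps. CE_algebra h eps"
proof -
  interpret h: dg_lie_algebra h by fact
  obtain B deg co where "homogeneous_basis h B deg co"
    using h.ex_homogeneous_basis[OF h.finite_dim] by blast
  then interpret lie_basis h B deg co by (intro lie_basis.intro assms)
  show ?thesis using CE_algebra by blast
qed

context CE_algebra
begin

abbreviation "A \<equiv> CE_alg g"

interpretation A: ring A by (rule ring_A)
interpretation AM: module scalars A
  rewrites "carrier scalars = UNIV" by (rule module_A) simp

lemma grade_closed: "x \<in> grade A n \<Longrightarrow> x \<in> carrier A"
  using submoduleD(1)[OF submodule_grade module_A] by blast

lemma power_closed: "x \<in> CE_power g n \<Longrightarrow> x \<in> carrier A"
  using submoduleD(1)[OF submodule_power module_A] by blast

lemma mult_linear: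
  assumes "c \<in> carrier A"
  shows "linear_map scalars A A (\<lambda>x. c \<otimes>\<^bsub>A\<^esub> x)" "linear_map scalars A A (\<lambda>x. x \<otimes>\<^bsub>A\<^esub> c)"
  using assms by (auto intro!: linear_mapI simp: A.l_distr A.r_distr smult_mult mult_smult)

lemma grade_span: "carrier A \<subseteq> linear_span scalars A (\<Union>i. grade A i)"
proof
  interpret D: internal_direct_sum A "grade A" by (rule direct_sum_grade)
  fix x assume x: "x \<in> carrier A"
  have gc: "(\<Union>i. grade A i) \<subseteq> carrier A" using grade_closed by blast
  have "(\<Oplus>\<^bsub>A\<^esub>i\<in>{i. component A (grade A) i x \<noteq> \<zero>\<^bsub>A\<^esub>}. component A (grade A) i x) \<in> linear_span scalars A (\<Union>i. grade A i)"
    using D.component_in[OF x] by (intro finsum_in_linear_span[OF module_A gc] subsetD[OF linear_span_superset]) blast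
  then show "x \<in> linear_span scalars A (\<Union>i. grade A i)" by (simp only: D.sum_support[OF x])
qed

lemma homogeneous_eqI:
  assumes "linear_map scalars A W f" "linear_map scalars A W h" "module scalars W"
    and "\<And>i x. x \<in> grade A i \<Longrightarrow> f x = h x" and "x \<in> carrier A"
  shows "f x = h x"
proof (rule linear_map_eq_on_span[OF assms(1,2) module_A assms(3)])
  show "(\<Union>i. grade A i) \<subseteq> carrier A" using grade_closed by blast
  show "x \<in> linear_span scalars A (\<Union>i. grade A i)" using grade_span assms(5) by blast
qed (use assms(4) in blast)

lemma parity_A_linear: "linear_map scalars A A (parity A)"
  by (rule parity_linear[OF module_A direct_sum_grade submodule_grade])

lemma parity_grade: "x \<in> grade A i \<Longrightarrow> parity A x = sgn_pow i \<odot>\<^bsub>A\<^esub> x"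
  using parity_homogeneous[OF direct_sum_grade] koszul_eq[OF module_A grade_closed] by simp

lemma parity_mult:
  assumes c: "c \<in> grade A i" and x: "x \<in> carrier A"
  shows "parity A (c \<otimes>\<^bsub>A\<^esub> x) = sgn_pow i \<odot>\<^bsub>A\<^esub> (c \<otimes>\<^bsub>A\<^esub> parity A x)"
proof (rule homogeneous_eqI[OF _ _ module_A _ x])
  note lc = mult_linear(1)[OF grade_closed[OF c]]
  show "linear_map scalars A A (\<lambda>x. parity A (c \<otimes>\<^bsub>A\<^esub> x))"
    by (rule linear_map_compose[OF lc parity_A_linear])
  show "linear_map scalars A A (\<lambda>x. sgn_pow i \<odot>\<^bsub>A\<^esub> (c \<otimes>\<^bsub>A\<^esub> parity A x))"
    by (rule linear_map_smult[OF linear_map_compose[OF parity_A_linear lc] module_A module_A])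
  fix j y assume y: "y \<in> grade A j"
  show "parity A (c \<otimes>\<^bsub>A\<^esub> y) = sgn_pow i \<odot>\<^bsub>A\<^esub> (c \<otimes>\<^bsub>A\<^esub> parity A y)"
    using grade_closed[OF c] grade_closed[OF y]
    by (simp add: parity_grade[OF grade_mult[OF c y]] parity_grade[OF y] mult_smult sgn_pow_add
        vector_spaceD(4)[OF module_A])
qed

text \<open>The augmentation vanishes outside degree 0: projecting a homogeneous element to word
  length zero keeps its degree, while the result is a multiple of 1 and has degree 0. So the sign in
  \<open>parity\<close> is never seen.\<close>

lemma eps_parity: "x \<in> carrier A \<Longrightarrow> eps (parity A x) = eps x"
proof (rule homogeneous_eqI[OF linear_map_compose[OF parity_A_linear eps_linear] eps_linear module_ground])
  note e = linear_mapD'[OF eps_linear, unfolded ground_simps]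
  fix i x assume x: "x \<in> grade A i"
  show "eps (parity A x) = eps x"
  proof (cases "i = 0")
    case True
    then show ?thesis using e(3)[OF grade_closed[OF x]] by (simp add: parity_grade[OF x])
  next
    case False
    interpret D: internal_direct_sum A "grade A" by (rule direct_sum_grade)
    have "eps x \<odot>\<^bsub>A\<^esub> \<one>\<^bsub>A\<^esub> \<in> grade A i"
      using component_power_grade[OF x, of 0] component_zero[OF grade_closed[OF x]] by simp
    moreover have "eps x \<odot>\<^bsub>A\<^esub> \<one>\<^bsub>A\<^esub> \<in> grade A 0" using submoduleD(4)[OF submodule_grade module_A _ one_grade] by simp
    ultimately have "eps x \<odot>\<^bsub>A\<^esub> \<one>\<^bsub>A\<^esub> = \<zero>\<^bsub>A\<^esub>"
      using D.component_same D.component_other[of "eps x \<odot>\<^bsub>A\<^esub> \<one>\<^bsub>A\<^esub>" i 0] False by metis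
    then have "eps (eps x \<odot>\<^bsub>A\<^esub> \<one>\<^bsub>A\<^esub>) = eps \<zero>\<^bsub>A\<^esub>" by simp
    then have "eps x = 0"
      using e(3)[of "\<one>\<^bsub>A\<^esub>" "eps x"] eps_one
        linear_map_zero[OF eps_linear A.abelian_group_axioms vector_spaceD(9)[OF module_ground]] by simp
    then show ?thesis using e(3)[OF grade_closed[OF x]] by (simp add: parity_grade[OF x])
  qed
qed

lemma diff_linear: "linear_map scalars A A (CE_diff g)"
  and diff_degree: "x \<in> grade A i \<Longrightarrow> CE_diff g x \<in> grade A (i + 1)"
  and diff_mult: "x \<in> grade A i \<Longrightarrow> y \<in> carrier A \<Longrightarrow>
    CE_diff g (x \<otimes>\<^bsub>A\<^esub> y) = (CE_diff g x \<otimes>\<^bsub>A\<^esub> y) \<oplus>\<^bsub>A\<^esub> koszul A i (x \<otimes>\<^bsub>A\<^esub> CE_diff g y)"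
  using derivation_diff by (auto simp: derivation_def has_degree_def)

lemma diff_one: "CE_diff g \<one>\<^bsub>A\<^esub> = \<zero>\<^bsub>A\<^esub>"
proof -
  have c: "CE_diff g \<one>\<^bsub>A\<^esub> \<in> carrier A" using linear_mapD'(1)[OF diff_linear] by simp
  have "CE_diff g \<one>\<^bsub>A\<^esub> = CE_diff g \<one>\<^bsub>A\<^esub> \<oplus>\<^bsub>A\<^esub> CE_diff g \<one>\<^bsub>A\<^esub>"
    using diff_mult[OF one_grade, of "\<one>\<^bsub>A\<^esub>"] c by (simp add: koszul_def)
  then show ?thesis using c A.add.r_cancel_one'[of "CE_diff g \<one>\<^bsub>A\<^esub>" "CE_diff g \<one>\<^bsub>A\<^esub>"] by simp
qed

end

text \<open>M enters as a graded space with a basis, without differential or structure maps. The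
  same calculus thus applies to the space built from a basis of a semifree module, before that space
  carries a structure.\<close>

locale cochain_module = CE_algebra g eps
  for g :: "('k::field, 'g) dg_lie" and eps +
  fixes M :: "('k, 'm, 'e) graded_scheme"
    and B :: "'m set" and deg :: "'m \<Rightarrow> int" and co :: "'m \<Rightarrow> 'm \<Rightarrow> 'k"
  assumes graded_M: "graded_vector_space M" and basis_M: "homogeneous_basis M B deg co"
begin

interpretation A: ring A by (rule ring_A)
interpretation M: graded_vector_space M by (rule graded_M)
interpretation MB: homogeneous_basis M B deg co by (rule basis_M)

lemma module_M: "module scalars M"
  by (rule M.module_axioms)

abbreviation "T \<equiv> cochains g M"
abbreviation "te \<equiv> tensor_elem A M"
abbreviation "act \<equiv> cochains_act g M"

sublocale T: tensor_product A M
  by (rule tensor_product.intro) (fact module_A module_M)+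

lemmas module_T = T.module_tensor

lemmas abelian_A = vector_spaceD(9)[OF module_A]
lemmas abelian_M = vector_spaceD(9)[OF module_M]
lemmas abelian_T = vector_spaceD(9)[OF module_T]

interpretation TM: module scalars T
  rewrites "carrier scalars = UNIV" by (rule module_T) simp

lemma basis_closed: "b \<in> B \<Longrightarrow> b \<in> carrier M"
  using MB.basis_closed by blast

lemma grade_M_closed: "m \<in> grade M j \<Longrightarrow> m \<in> carrier M"
  using M.summand_closed(1) by blast

lemma te_closed: "c \<in> carrier A \<Longrightarrow> m \<in> carrier M \<Longrightarrow> te c m \<in> carrier T"
  by (rule T.tensor_elem_closed)

lemmas te_left = T.tensor_elem_linear_left
lemmas te_right = T.tensor_elem_linear_right

subsection \<open>The action of the Chevalley-Eilenberg algebra\<close>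

lemma act_bilinear: "c \<in> carrier A \<Longrightarrow> bilinear A M T (\<lambda>c' m. te (c \<otimes>\<^bsub>A\<^esub> c') m)"
  using linear_map_compose[OF mult_linear(1) te_left] te_right by (intro bilinearI) simp_all

lemma act_linear: "c \<in> carrier A \<Longrightarrow> linear_map scalars T T (act c)"
  unfolding cochains_act_def by (rule T.tensor_lift_linear[OF act_bilinear module_T])

lemma act_elem: "c \<in> carrier A \<Longrightarrow> c' \<in> carrier A \<Longrightarrow> m \<in> carrier M \<Longrightarrow> act c (te c' m) = te (c \<otimes>\<^bsub>A\<^esub> c') m"
  unfolding cochains_act_def by (rule T.tensor_lift_elem[OF act_bilinear module_T])

lemma act_closed: "c \<in> carrier A \<Longrightarrow> t \<in> carrier T \<Longrightarrow> act c t \<in> carrier T"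
  using linear_mapD'(1)[OF act_linear] .

lemma act_linear_left: "t \<in> carrier T \<Longrightarrow> linear_map scalars A T (\<lambda>c. act c t)"
proof (rule linear_mapI)
  assume t: "t \<in> carrier T"
  fix c assume c: "c \<in> carrier A"
  show "act c t \<in> carrier T" by (rule act_closed[OF c t])
  show "act (c \<oplus>\<^bsub>A\<^esub> c') t = act c t \<oplus>\<^bsub>T\<^esub> act c' t" if c': "c' \<in> carrier A" for c'
    by (rule T.tensor_eqI[OF act_linear linear_map_add[OF act_linear act_linear module_T module_T] module_T _ t])
      (use c c' linear_mapD'(2)[OF te_left] in \<open>simp_all add: act_elem A.l_distr\<close>)
  show "act (a \<odot>\<^bsub>A\<^esub> c) t = a \<odot>\<^bsub>T\<^esub> act c t" for a
    by (rule T.tensor_eqI[OF act_linear linear_map_smult[OF act_linear module_T module_T] module_T _ t])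
      (use c linear_mapD'(3)[OF te_left] in \<open>simp_all add: act_elem smult_mult vector_spaceD(1)[OF module_A]\<close>)
qed

lemma act_mult:
  assumes "c \<in> carrier A" "c' \<in> carrier A" "t \<in> carrier T"
  shows "act (c \<otimes>\<^bsub>A\<^esub> c') t = act c (act c' t)"
  by (rule T.tensor_eqI[OF act_linear linear_map_compose[OF act_linear act_linear] module_T _ assms(3)])
    (use assms(1,2) in \<open>simp_all add: act_elem A.m_assoc\<close>)

lemma act_one: "t \<in> carrier T \<Longrightarrow> act \<one>\<^bsub>A\<^esub> t = t"
  by (rule T.tensor_eqI[OF act_linear _ module_T])
    (auto simp: act_elem intro: linear_mapI)

lemma te_act: "c \<in> carrier A \<Longrightarrow> m \<in> carrier M \<Longrightarrow> te c m = act c (te \<one>\<^bsub>A\<^esub> m)"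
  by (simp add: act_elem)

text \<open>The ground field acts through C(g). Hence additive maps compatible with the C(g)-action
  are automatically linear over the ground field.\<close>

lemma act_smult_one: "t \<in> carrier T \<Longrightarrow> act (a \<odot>\<^bsub>A\<^esub> \<one>\<^bsub>A\<^esub>) t = a \<odot>\<^bsub>T\<^esub> t"
  using linear_mapD'(3)[OF act_linear_left, of t "\<one>\<^bsub>A\<^esub>" a] by (simp add: act_one)

lemmas act_add = linear_mapD'(2)[OF act_linear]
lemmas act_add_left = linear_mapD'(2)[OF act_linear_left]
lemmas act_smult_left = linear_mapD'(3)[OF act_linear_left]

subsection \<open>Gradings\<close>

abbreviation "homogeneous_tensors n \<equiv> {te c m | c m i j. c \<in> grade A i \<and> m \<in> grade M j \<and> i + j = n}"

lemma grade_T: "grade T n = linear_span scalars T (homogeneous_tensors n)"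
  unfolding tensor_simps(5)
  by (rule fun_cong[OF linear_span_cong]) (simp_all only: tensor_simps)

lemma homogeneous_tensors_closed: "homogeneous_tensors n \<subseteq> carrier T"
  using te_closed grade_closed grade_M_closed by blast

lemma submodule_grade_T: "submodule (grade T n) scalars T"
  unfolding grade_T by (rule submodule_linear_span[OF module_T homogeneous_tensors_closed])

lemma grade_T_closed: "t \<in> grade T n \<Longrightarrow> t \<in> carrier T"
  using submoduleD(1)[OF submodule_grade_T module_T] by blast

lemma te_grade: "c \<in> grade A i \<Longrightarrow> m \<in> grade M j \<Longrightarrow> te c m \<in> grade T (i + j)"
  unfolding grade_T by (rule subsetD[OF linear_span_superset]) blast

lemma grade_T_into:
  assumes "linear_map scalars T W f" "module scalars W" "submodule H scalars W"
    and "\<And>c m i j. c \<in> grade A i \<Longrightarrow> m \<in> grade M j \<Longrightarrow> i + j = n \<Longrightarrow> f (te c m) \<in> H"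
    and "t \<in> grade T n"
  shows "f t \<in> H"
  by (rule linear_map_span_into[OF assms(1) module_T assms(2,3) homogeneous_tensors_closed[of n] _ assms(5)[unfolded grade_T]])
    (use assms(4) in blast)

lemma grade_T_eqI:
  assumes "linear_map scalars T W f" "linear_map scalars T W h" "module scalars W"
    and "\<And>c m i j. c \<in> grade A i \<Longrightarrow> m \<in> grade M j \<Longrightarrow> i + j = n \<Longrightarrow> f (te c m) = h (te c m)"
    and "t \<in> grade T n"
  shows "f t = h t"
  by (rule linear_map_eq_on_span[OF assms(1,2) module_T assms(3) homogeneous_tensors_closed[of n] _ assms(5)[unfolded grade_T]])
    (use assms(4) in blast)

lemma te_expand:
  assumes c: "c \<in> carrier A" and m: "m \<in> carrier M"
  shows "te c m = (\<Oplus>\<^bsub>T\<^esub>b\<in>B. co b m \<odot>\<^bsub>T\<^esub> te c b)"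
proof -
  have "te c m = te c (\<Oplus>\<^bsub>M\<^esub>b\<in>B. co b m \<odot>\<^bsub>M\<^esub> b)" by (rule arg_cong[OF MB.expand[OF m]])
  also have "\<dots> = (\<Oplus>\<^bsub>T\<^esub>b\<in>B. te c (co b m \<odot>\<^bsub>M\<^esub> b))"
    using vector_spaceD(1)[OF module_M] basis_closed
    by (intro linear_map_finsum[OF te_right[OF c] abelian_M abelian_T]) simp
  also have "\<dots> = (\<Oplus>\<^bsub>T\<^esub>b\<in>B. co b m \<odot>\<^bsub>T\<^esub> te c b)"
    using linear_mapD'(3)[OF te_right[OF c]] basis_closed te_closed[OF c] TM.smult_closed
    by (intro TM.finsum_cong') auto
  finally show ?thesis .
qed

lemma coordinate_bilinear:
  assumes "\<And>b. b \<in> B \<Longrightarrow> linear_map scalars A W (f b)" "module scalars W"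
  shows "bilinear A M W (\<lambda>c m. \<Oplus>\<^bsub>W\<^esub>b\<in>B. co b m \<odot>\<^bsub>W\<^esub> f b c)"
proof (rule bilinearI)
  interpret W: module scalars W by (rule assms(2))
  show "linear_map scalars A W (\<lambda>c. \<Oplus>\<^bsub>W\<^esub>b\<in>B. co b m \<odot>\<^bsub>W\<^esub> f b c)" for m
    by (intro linear_map_finsum_fun[OF module_A assms(2)] linear_map_smult[OF assms(1) module_A assms(2)])
  fix c assume c: "c \<in> carrier A"
  show "linear_map scalars M W (\<lambda>m. \<Oplus>\<^bsub>W\<^esub>b\<in>B. co b m \<odot>\<^bsub>W\<^esub> f b c)"
  proof (rule linear_map_finsum_fun[OF module_M assms(2)])
    show "linear_map scalars M W (\<lambda>m. co b m \<odot>\<^bsub>W\<^esub> f b c)" if b: "b \<in> B" for b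
      using linear_mapD'(1)[OF assms(1)[OF b] c] b
      by (intro linear_mapI) (simp_all add: MB.co_add MB.co_smult vector_spaceD(2,4)[OF assms(2)])
  qed
qed

text \<open>Expanding \<open>m\<close> in the homogeneous basis reduces degree \<open>n\<close> of c
  \<otimes> m to the components of \<open>c\<close> in the degrees \<open>n - deg b\<close>, which
  avoids a sum over pairs of degrees.\<close>

definition grade_projection :: "int \<Rightarrow> ('k, 'g, 'm) cochain \<Rightarrow> ('k, 'g, 'm) cochain" where
  "grade_projection n = tensor_lift T (\<lambda>c m. \<Oplus>\<^bsub>T\<^esub>b\<in>B. co b m \<odot>\<^bsub>T\<^esub> te (component A (grade A) (n - deg b) c) b)"

lemma grade_projection_bilinear:
  "bilinear A M T (\<lambda>c m. \<Oplus>\<^bsub>T\<^esub>b\<in>B. co b m \<odot>\<^bsub>T\<^esub> te (component A (grade A) (n - deg b) c) b)"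
  using linear_map_compose[OF component_linear[OF direct_sum_grade module_A submodule_grade] te_left[OF basis_closed]]
  by (intro coordinate_bilinear module_T)

lemma grade_projection_linear: "linear_map scalars T T (grade_projection n)"
  unfolding grade_projection_def by (rule T.tensor_lift_linear[OF grade_projection_bilinear module_T])

lemma grade_projection_elem:
  assumes c: "c \<in> grade A i" and m: "m \<in> grade M j"
  shows "grade_projection n (te c m) = (if n = i + j then te c m else \<zero>\<^bsub>T\<^esub>)"
proof -
  interpret D: internal_direct_sum A "grade A" by (rule direct_sum_grade)
  let ?c = "if n = i + j then c else \<zero>\<^bsub>A\<^esub>"
  have c': "?c \<in> carrier A" using grade_closed[OF c] by simp
  have te0: "te \<zero>\<^bsub>A\<^esub> b = \<zero>\<^bsub>T\<^esub>" if "b \<in> carrier M" for b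
    using linear_map_zero[OF te_left[OF that] abelian_A abelian_T] .
  have "grade_projection n (te c m) = (\<Oplus>\<^bsub>T\<^esub>b\<in>B. co b m \<odot>\<^bsub>T\<^esub> te (component A (grade A) (n - deg b) c) b)"
    unfolding grade_projection_def
    by (rule T.tensor_lift_elem[OF grade_projection_bilinear module_T grade_closed[OF c] grade_M_closed[OF m]])
  also have "\<dots> = (\<Oplus>\<^bsub>T\<^esub>b\<in>B. co b m \<odot>\<^bsub>T\<^esub> te ?c b)"
  proof (rule TM.finsum_cong')
    show "(\<lambda>b. co b m \<odot>\<^bsub>T\<^esub> te ?c b) \<in> B \<rightarrow> carrier T"
      using te_closed[OF c' basis_closed] TM.smult_closed by blast
    show "co b m \<odot>\<^bsub>T\<^esub> te (component A (grade A) (n - deg b) c) b = co b m \<odot>\<^bsub>T\<^esub> te ?c b" if b: "b \<in> B" for b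
    proof (cases "deg b = j")
      case True
      then have "component A (grade A) (n - deg b) c = ?c" using D.component_delta[OF c, of "n - deg b"] by auto
      then show ?thesis by simp
    next
      case False
      then have "co b m = 0" using MB.co_grade[OF m b] by simp
      then show ?thesis
        using te_closed[OF c' basis_closed[OF b]] te_closed[OF D.component_closed[OF grade_closed[OF c]] basis_closed[OF b]]
        by (simp only: vector_spaceD(6)[OF module_T])
    qed
  qed simp
  also have "\<dots> = te ?c m" by (rule te_expand[OF c' grade_M_closed[OF m], symmetric])
  finally show ?thesis using te0[OF grade_M_closed[OF m]] by simp
qed

lemma grade_T_span: "carrier T \<subseteq> linear_span scalars T (\<Union>n. grade T n)"
proof -
  have gc: "(\<Union>n. grade T n) \<subseteq> carrier T" using grade_T_closed by blast
  note sub = submodule_linear_span[OF module_T gc]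
  note sp = submoduleD[OF sub module_T]
  have te_b: "te c b \<in> linear_span scalars T (\<Union>n. grade T n)" if c: "c \<in> carrier A" and b: "b \<in> B" for c b
  proof (rule linear_map_span_into[OF te_left[OF basis_closed[OF b]] module_A module_T sub])
    show "(\<Union>i. grade A i) \<subseteq> carrier A" using grade_closed by blast
    show "c \<in> linear_span scalars A (\<Union>i. grade A i)" using grade_span c by blast
    show "te x b \<in> linear_span scalars T (\<Union>n. grade T n)" if "x \<in> (\<Union>i. grade A i)" for x
      using te_grade[OF _ MB.basis_grade[OF b]] that by (intro subsetD[OF linear_span_superset]) blast
  qed
  have "te c m \<in> linear_span scalars T (\<Union>n. grade T n)" if c: "c \<in> carrier A" and m: "m \<in> carrier M" for c m
    unfolding te_expand[OF c m] using te_b[OF c] sp(4) by (intro finsum_in_linear_span[OF module_T gc]) simp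
  then have "{te c m | c m. c \<in> carrier A \<and> m \<in> carrier M} \<subseteq> linear_span scalars T (\<Union>n. grade T n)" by blast
  from order.trans[OF T.tensor_span linear_span_least[OF sub this]] show ?thesis .
qed

lemma direct_sum_T: "internal_direct_sum T (grade T)"
proof (rule direct_sum_of_projections(1)[where p = grade_projection, OF module_T submodule_grade_T grade_projection_linear _ _ grade_T_span])
  have id: "linear_map scalars T T (\<lambda>x. x)" by (rule linear_mapI) auto
  have zero: "linear_map scalars T T (\<lambda>x. \<zero>\<^bsub>T\<^esub>)"
    by (rule linear_mapI) (simp_all add: vector_spaceD(7)[OF module_T])
  show "grade_projection i x = x" if "x \<in> grade T i" for i x
    by (rule grade_T_eqI[OF grade_projection_linear id module_T _ that]) (simp add: grade_projection_elem)
  show "grade_projection j x = \<zero>\<^bsub>T\<^esub>" if "x \<in> grade T i" "j \<noteq> i" for i j x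
    by (rule grade_T_eqI[OF grade_projection_linear zero module_T _ that(1)]) (use that(2) in \<open>simp add: grade_projection_elem\<close>)
qed

lemma act_grade: "c \<in> grade A i \<Longrightarrow> t \<in> grade T n \<Longrightarrow> act c t \<in> grade T (i + n)"
proof (rule grade_T_into[OF act_linear module_T submodule_grade_T])
  assume c: "c \<in> grade A i"
  then show "c \<in> carrier A" by (rule grade_closed)
  show "act c (te c' m) \<in> grade T (i + n)" if "c' \<in> grade A i'" "m \<in> grade M j" "i' + j = n" for c' m i' j
    using te_grade[OF grade_mult[OF c that(1)] that(2)] that(3)
      act_elem[OF grade_closed[OF c] grade_closed[OF that(1)] grade_M_closed[OF that(2)]]
    by (simp add: add.assoc)
qed

subsection \<open>Word length\<close>

abbreviation "power_tensors k \<equiv> {te c m | c m. c \<in> CE_power g k \<and> m \<in> carrier M}"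

lemma power_tensors_closed: "power_tensors k \<subseteq> carrier T"
  using te_closed power_closed by blast

lemma submodule_power_T: "submodule (cochains_power g M k) scalars T"
  unfolding cochains_power_def by (rule submodule_linear_span[OF module_T power_tensors_closed])

definition power_projection :: "nat \<Rightarrow> ('k, 'g, 'm) cochain \<Rightarrow> ('k, 'g, 'm) cochain" where
  "power_projection k = tensor_lift T (\<lambda>c m. te (component A (CE_power g) k c) m)"

lemma component_power_linear: "linear_map scalars A A (component A (CE_power g) k)"
  by (rule component_linear[OF direct_sum_power module_A submodule_power])

lemma power_projection_bilinear: "bilinear A M T (\<lambda>c m. te (component A (CE_power g) k c) m)"
  using linear_map_compose[OF component_power_linear te_left] te_right[OF linear_mapD'(1)[OF component_power_linear]]
  by (intro bilinearI)

lemma power_projection_linear: "linear_map scalars T T (power_projection k)"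
  unfolding power_projection_def by (rule T.tensor_lift_linear[OF power_projection_bilinear module_T])

lemma power_projection_elem:
  "c \<in> carrier A \<Longrightarrow> m \<in> carrier M \<Longrightarrow> power_projection k (te c m) = te (component A (CE_power g) k c) m"
  unfolding power_projection_def by (rule T.tensor_lift_elem[OF power_projection_bilinear module_T])

lemma direct_sum_power_T: "internal_direct_sum T (cochains_power g M)"
  and component_power_T: "t \<in> carrier T \<Longrightarrow> component T (cochains_power g M) k t = power_projection k t"
proof -
  interpret D: internal_direct_sum A "CE_power g" by (rule direct_sum_power)
  have id: "linear_map scalars T T (\<lambda>x. x)" by (rule linear_mapI) auto
  have zero: "linear_map scalars T T (\<lambda>x. \<zero>\<^bsub>T\<^esub>)"
    by (rule linear_mapI) (simp_all add: vector_spaceD(7)[OF module_T])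
  have te0: "te \<zero>\<^bsub>A\<^esub> m = \<zero>\<^bsub>T\<^esub>" if "m \<in> carrier M" for m
    using linear_map_zero[OF te_left[OF that] abelian_A abelian_T] .
  have elem: "power_projection k (te c m) = (if k = l then te c m else \<zero>\<^bsub>T\<^esub>)"
    if "c \<in> CE_power g l" "m \<in> carrier M" for c m k l
    using that by (simp add: power_projection_elem power_closed D.component_delta[OF that(1)] te0)
  have same: "power_projection k x = x" if "x \<in> cochains_power g M k" for k x
    by (rule linear_map_eq_on_span[OF power_projection_linear id module_T module_T power_tensors_closed _
          that[unfolded cochains_power_def]]) (use elem in auto)
  have other: "power_projection l x = \<zero>\<^bsub>T\<^esub>" if "x \<in> cochains_power g M k" "l \<noteq> k" for k l x
    by (rule linear_map_eq_on_span[OF power_projection_linear zero module_T module_T power_tensors_closed _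
          that(1)[unfolded cochains_power_def]]) (use elem that(2) in auto)
  have gc: "(\<Union>k. cochains_power g M k) \<subseteq> carrier T" using submoduleD(1)[OF submodule_power_T module_T] by blast
  note sub = submodule_linear_span[OF module_T gc]
  have "te c m \<in> linear_span scalars T (\<Union>k. cochains_power g M k)" if c: "c \<in> carrier A" and m: "m \<in> carrier M" for c m
  proof -
    let ?K = "{k. component A (CE_power g) k c \<noteq> \<zero>\<^bsub>A\<^esub>}"
    have "te c m = te (\<Oplus>\<^bsub>A\<^esub>k\<in>?K. component A (CE_power g) k c) m" by (simp only: D.sum_support[OF c])
    also have "\<dots> = (\<Oplus>\<^bsub>T\<^esub>k\<in>?K. te (component A (CE_power g) k c) m)"
      using D.component_closed[OF c]
      by (intro linear_map_finsum[OF te_left[OF m] abelian_A abelian_T]) simp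
    also have "\<dots> \<in> linear_span scalars T (\<Union>k. cochains_power g M k)"
    proof (rule finsum_in_linear_span[OF module_T gc])
      fix k
      have "te (component A (CE_power g) k c) m \<in> cochains_power g M k"
        unfolding cochains_power_def using D.component_in[OF c] m by (intro subsetD[OF linear_span_superset]) blast
      then show "te (component A (CE_power g) k c) m \<in> linear_span scalars T (\<Union>k. cochains_power g M k)"
        by (intro subsetD[OF linear_span_superset]) blast
    qed
    finally show ?thesis .
  qed
  then have "{te c m | c m. c \<in> carrier A \<and> m \<in> carrier M} \<subseteq> linear_span scalars T (\<Union>k. cochains_power g M k)" by blast
  from order.trans[OF T.tensor_span linear_span_least[OF sub this]]
  have span: "carrier T \<subseteq> linear_span scalars T (\<Union>k. cochains_power g M k)" .
  note * = direct_sum_of_projections[where p = power_projection and A = "cochains_power g M",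
      OF module_T submodule_power_T power_projection_linear same other span]
  show "internal_direct_sum T (cochains_power g M)"
    by (rule *(1)) assumption+
  show "component T (cochains_power g M) k t = power_projection k t" if "t \<in> carrier T"
    by (rule *(2)) (assumption | rule that)+
qed

lemma component_power_T_linear: "linear_map scalars T T (component T (cochains_power g M) k)"
  by (rule component_linear[OF direct_sum_power_T module_T submodule_power_T])

lemma component_power_T_grade:
  assumes "t \<in> grade T n" shows "component T (cochains_power g M) k t \<in> grade T n"
  unfolding component_power_T[OF grade_T_closed[OF assms]]
proof (rule grade_T_into[OF power_projection_linear module_T submodule_grade_T _ assms])
  show "power_projection k (te c m) \<in> grade T n" if "c \<in> grade A i" "m \<in> grade M j" "i + j = n" for c m i j
    using te_grade[OF component_power_grade[OF that(1)] that(2)] that(3)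
    by (simp add: power_projection_elem grade_closed[OF that(1)] grade_M_closed[OF that(2)])
qed

lemma te_one_power: "m \<in> carrier M \<Longrightarrow> te \<one>\<^bsub>A\<^esub> m \<in> cochains_power g M 0"
  unfolding cochains_power_def using one_power by (intro subsetD[OF linear_span_superset]) blast

lemma te_one_linear: "linear_map scalars M T (te \<one>\<^bsub>A\<^esub>)"
  by (rule te_right) simp

lemma te_one_grade: "m \<in> grade M j \<Longrightarrow> te \<one>\<^bsub>A\<^esub> m \<in> grade T j"
  using te_grade[OF one_grade, of m j] by simp

subsection \<open>Augmentation and coordinates\<close>

text \<open>The map eps \<otimes> id, that is, the projection of C(g, M) onto C^0(g, M) read as an
  element of M; see \<open>component_power_T_zero\<close>.\<close>

definition coefficient :: "('k, 'g, 'm) cochain \<Rightarrow> 'm" where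
  "coefficient = tensor_lift M (\<lambda>c m. eps c \<odot>\<^bsub>M\<^esub> m)"

lemma coefficient_bilinear: "bilinear A M M (\<lambda>c m. eps c \<odot>\<^bsub>M\<^esub> m)"
  using linear_mapD'[OF eps_linear, unfolded ground_simps]
  by (intro bilinearI linear_mapI)
    (simp_all add: vector_spaceD(2,3)[OF module_M] vector_spaceD(1)[OF module_M]
      vector_spaceD(4)[OF module_M, symmetric] mult.commute)

lemma coefficient_linear: "linear_map scalars T M coefficient"
  unfolding coefficient_def by (rule T.tensor_lift_linear[OF coefficient_bilinear module_M])

lemma coefficient_elem: "c \<in> carrier A \<Longrightarrow> m \<in> carrier M \<Longrightarrow> coefficient (te c m) = eps c \<odot>\<^bsub>M\<^esub> m"
  unfolding coefficient_def by (rule T.tensor_lift_elem[OF coefficient_bilinear module_M])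

lemma coefficient_act:
  assumes c: "c \<in> carrier A" and t: "t \<in> carrier T"
  shows "coefficient (act c t) = eps c \<odot>\<^bsub>M\<^esub> coefficient t"
  by (rule T.tensor_eqI[OF linear_map_compose[OF act_linear[OF c] coefficient_linear]
        linear_map_smult[OF coefficient_linear module_T module_M] module_M _ t])
    (use c in \<open>simp add: act_elem coefficient_elem eps_mult vector_spaceD(4)[OF module_M]\<close>)

lemma component_power_T_zero:
  assumes t: "t \<in> carrier T"
  shows "component T (cochains_power g M) 0 t = te \<one>\<^bsub>A\<^esub> (coefficient t)"
  unfolding component_power_T[OF t]
proof (rule T.tensor_eqI[OF power_projection_linear linear_map_compose[OF coefficient_linear te_one_linear] module_T _ t])
  fix c m assume c: "c \<in> carrier A" and m: "m \<in> carrier M"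
  show "power_projection 0 (te c m) = te \<one>\<^bsub>A\<^esub> (coefficient (te c m))"
    using linear_mapD'(3)[OF te_left[OF m], of "\<one>\<^bsub>A\<^esub>"] linear_mapD'(3)[OF te_one_linear m]
    by (simp add: power_projection_elem[OF c m] coefficient_elem[OF c m] component_zero[OF c])
qed

text \<open>If \<open>c\<close> has degree \<open>i\<close> and nonzero augmentation, its component
  of word length zero shows that 1 has degree \<open>i\<close> as well; as 1 is nonzero of degree 0,
  this forces \<open>i = 0\<close>. So only tensors with \<open>m\<close> already in degree
  \<open>n\<close> contribute.\<close>

lemma coefficient_grade:
  assumes "t \<in> grade T n" shows "coefficient t \<in> grade M n"
proof -
  interpret D: internal_direct_sum A "grade A" by (rule direct_sum_grade)
  show ?thesis
  proof (rule grade_T_into[OF coefficient_linear module_M M.submodule_grade _ assms])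
    fix c m i j assume c: "c \<in> grade A i" and m: "m \<in> grade M j" and n: "i + j = n"
    show "coefficient (te c m) \<in> grade M n"
    proof (cases "eps c = 0")
      case True
      then show ?thesis
        using vector_spaceD(6)[OF module_M grade_M_closed[OF m]] submoduleD(2)[OF M.submodule_grade module_M]
        by (simp add: coefficient_elem grade_closed[OF c] grade_M_closed[OF m])
    next
      case False
      have "eps c \<odot>\<^bsub>A\<^esub> \<one>\<^bsub>A\<^esub> \<in> grade A i"
        using component_power_grade[OF c, of 0] component_zero[OF grade_closed[OF c]] by simp
      then have "(1 / eps c) \<odot>\<^bsub>A\<^esub> (eps c \<odot>\<^bsub>A\<^esub> \<one>\<^bsub>A\<^esub>) \<in> grade A i"
        using submoduleD(4)[OF submodule_grade module_A] by simp
      then have one: "\<one>\<^bsub>A\<^esub> \<in> grade A i"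
        using False vector_spaceD(5)[OF module_A, of "\<one>\<^bsub>A\<^esub>"] by (simp add: vector_spaceD(4)[OF module_A, symmetric])
      have "\<one>\<^bsub>A\<^esub> \<noteq> \<zero>\<^bsub>A\<^esub>"
        using eps_one linear_map_zero[OF eps_linear abelian_A vector_spaceD(9)[OF module_ground]] by auto
      then have "i = 0" using D.component_same[OF one] D.component_other[OF one_grade, of i] by auto
      then show ?thesis
        using M.grade_smult[OF m] n by (simp add: coefficient_elem grade_closed[OF c] grade_M_closed[OF m])
    qed
  qed
qed

text \<open>The map id \<otimes> co b. By \<open>coordinate_expand\<close> and
  \<open>coordinate_sum\<close> these are the coordinates with respect to the elements 1 \<otimes>
  b, which therefore form a C(g)-basis of C(g, M).\<close>

definition coordinate :: "'m \<Rightarrow> ('k, 'g, 'm) cochain \<Rightarrow> ('k, 'g) CE" where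
  "coordinate b = tensor_lift A (\<lambda>c m. co b m \<odot>\<^bsub>A\<^esub> c)"

lemma coordinate_bilinear': "b \<in> B \<Longrightarrow> bilinear A M A (\<lambda>c m. co b m \<odot>\<^bsub>A\<^esub> c)"
  by (intro bilinearI linear_mapI)
    (simp_all add: MB.co_add MB.co_smult vector_spaceD(2,3)[OF module_A] vector_spaceD(1)[OF module_A]
      vector_spaceD(4)[OF module_A, symmetric] mult.commute)

lemma coordinate_linear: "b \<in> B \<Longrightarrow> linear_map scalars T A (coordinate b)"
  unfolding coordinate_def by (rule T.tensor_lift_linear[OF coordinate_bilinear' module_A])

lemma coordinate_elem:
  "b \<in> B \<Longrightarrow> c \<in> carrier A \<Longrightarrow> m \<in> carrier M \<Longrightarrow> coordinate b (te c m) = co b m \<odot>\<^bsub>A\<^esub> c"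
  unfolding coordinate_def by (rule T.tensor_lift_elem[OF coordinate_bilinear' module_A])

lemma coordinate_expand:
  assumes t: "t \<in> carrier T"
  shows "t = (\<Oplus>\<^bsub>T\<^esub>b\<in>B. te (coordinate b t) b)"
proof (rule T.tensor_eqI[OF _ _ module_T _ t])
  show "linear_map scalars T T (\<lambda>x. x)" by (rule linear_mapI) auto
  show "linear_map scalars T T (\<lambda>t. \<Oplus>\<^bsub>T\<^esub>b\<in>B. te (coordinate b t) b)"
    by (rule linear_map_finsum_fun[OF module_T module_T])
      (rule linear_map_compose[OF coordinate_linear te_left[OF basis_closed]])
  fix c m assume c: "c \<in> carrier A" and m: "m \<in> carrier M"
  have "te c m = (\<Oplus>\<^bsub>T\<^esub>b\<in>B. co b m \<odot>\<^bsub>T\<^esub> te c b)" by (rule te_expand[OF c m])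
  also have "\<dots> = (\<Oplus>\<^bsub>T\<^esub>b\<in>B. te (coordinate b (te c m)) b)"
    using vector_spaceD(1)[OF module_T te_closed[OF c basis_closed]] linear_mapD'(1)[OF coordinate_linear te_closed[OF c m]]
      linear_mapD'(3)[OF te_left[OF basis_closed] c] coordinate_elem[OF _ c m]
    by (intro TM.finsum_cong') auto
  finally show "te c m = (\<Oplus>\<^bsub>T\<^esub>b\<in>B. te (coordinate b (te c m)) b)" .
qed

lemma coordinate_sum:
  assumes c: "c \<in> B \<rightarrow> carrier A" and b: "b \<in> B"
  shows "coordinate b (\<Oplus>\<^bsub>T\<^esub>b'\<in>B. te (c b') b') = c b"
proof -
  have "coordinate b (\<Oplus>\<^bsub>T\<^esub>b'\<in>B. te (c b') b') = (\<Oplus>\<^bsub>A\<^esub>b'\<in>B. coordinate b (te (c b') b'))"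
    using c te_closed basis_closed
    by (intro linear_map_finsum[OF coordinate_linear[OF b] abelian_T abelian_A]) auto
  also have "\<dots> = (\<Oplus>\<^bsub>A\<^esub>b'\<in>B. if b' = b then c b else \<zero>\<^bsub>A\<^esub>)"
  proof (rule A.finsum_cong')
    show "coordinate b (te (c b') b') = (if b' = b then c b else \<zero>\<^bsub>A\<^esub>)" if b': "b' \<in> B" for b'
    proof -
      have "c b' \<in> carrier A" using c b' by blast
      then show ?thesis
        using MB.co_basis[OF b b'] coordinate_elem[OF b _ basis_closed[OF b']]
        by (auto simp: vector_spaceD(5,6)[OF module_A])
    qed
  qed (use c b in auto)
  also have "\<dots> = c b" using c b MB.finite_basis by (intro A.finsum_delta) auto
  finally show ?thesis .
qed

end

section \<open>Extensions of maps M \<rightarrow> C(g, N), their components, and the Leibniz rule of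
  the total differential\<close>

section \<open>Infinity-modules and their extensions\<close>

locale cochain_pair =
  M: cochain_module g eps M BM degM coM + N: cochain_module g eps N BN degN coN
  for g :: "('k::field, 'g) dg_lie" and eps
    and M :: "('k, 'm, 'e) graded_scheme" and BM degM coM
    and N :: "('k, 'n, 'f) graded_scheme" and BN degN coN
begin

interpretation A: ring M.A by (rule M.ring_A)
interpretation D: internal_direct_sum N.T "cochains_power g N" by (rule N.direct_sum_power_T)

subsection \<open>Extensions of linear maps\<close>

context
  fixes \<phi> :: "'m \<Rightarrow> ('k, 'g, 'n) cochain"
  assumes \<phi>: "linear_map scalars M N.T \<phi>"
begin

lemma even_bilinear: "bilinear M.A M N.T (\<lambda>c m. N.act c (\<phi> m))"
  using N.act_linear_left[OF linear_mapD'(1)[OF \<phi>]] linear_map_compose[OF \<phi> N.act_linear]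
  by (intro bilinearI)

lemma odd_bilinear: "bilinear M.A M N.T (\<lambda>c m. N.act (parity M.A c) (\<phi> m))"
  using linear_map_compose[OF M.parity_A_linear N.act_linear_left[OF linear_mapD'(1)[OF \<phi>]]]
    linear_map_compose[OF \<phi> N.act_linear[OF linear_mapD'(1)[OF M.parity_A_linear]]]
  by (intro bilinearI)

lemma even_linear: "linear_map scalars M.T N.T (extend_even g N \<phi>)"
  unfolding extend_even_def by (rule M.T.tensor_lift_linear[OF even_bilinear N.module_T])

lemma odd_linear: "linear_map scalars M.T N.T (extend_odd g N \<phi>)"
  unfolding extend_odd_def by (rule M.T.tensor_lift_linear[OF odd_bilinear N.module_T])

lemma even_elem: "c \<in> carrier M.A \<Longrightarrow> m \<in> carrier M \<Longrightarrow> extend_even g N \<phi> (M.te c m) = N.act c (\<phi> m)"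
  unfolding extend_even_def by (rule M.T.tensor_lift_elem[OF even_bilinear N.module_T])

lemma odd_elem:
  "c \<in> carrier M.A \<Longrightarrow> m \<in> carrier M \<Longrightarrow> extend_odd g N \<phi> (M.te c m) = N.act (parity M.A c) (\<phi> m)"
  unfolding extend_odd_def by (rule M.T.tensor_lift_elem[OF odd_bilinear N.module_T])

lemma even_te_one: "m \<in> carrier M \<Longrightarrow> extend_even g N \<phi> (M.te \<one>\<^bsub>M.A\<^esub> m) = \<phi> m"
  using linear_mapD'(1)[OF \<phi>] by (simp add: even_elem N.act_one)

lemma even_act:
  assumes c: "c \<in> carrier M.A" and t: "t \<in> carrier M.T"
  shows "extend_even g N \<phi> (M.act c t) = N.act c (extend_even g N \<phi> t)"
  by (rule M.T.tensor_eqI[OF linear_map_compose[OF M.act_linear[OF c] even_linear]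
        linear_map_compose[OF even_linear N.act_linear[OF c]] N.module_T _ t])
    (use c linear_mapD'(1)[OF \<phi>] in \<open>simp add: M.act_elem even_elem N.act_mult\<close>)

lemma odd_act:
  assumes c: "c \<in> grade M.A i" and t: "t \<in> carrier M.T"
  shows "extend_odd g N \<phi> (M.act c t) = sgn_pow i \<odot>\<^bsub>N.T\<^esub> N.act c (extend_odd g N \<phi> t)"
proof -
  note cc = M.grade_closed[OF c]
  show ?thesis
  proof (rule M.T.tensor_eqI[OF linear_map_compose[OF M.act_linear[OF cc] odd_linear]
        linear_map_smult[OF linear_map_compose[OF odd_linear N.act_linear[OF cc]] M.module_T N.module_T] N.module_T _ t])
    fix c' m assume c': "c' \<in> carrier M.A" and m: "m \<in> carrier M"
    have "parity M.A c' \<in> carrier M.A" using linear_mapD'(1)[OF M.parity_A_linear c'] .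
    then show "extend_odd g N \<phi> (M.act c (M.te c' m)) = sgn_pow i \<odot>\<^bsub>N.T\<^esub> N.act c (extend_odd g N \<phi> (M.te c' m))"
      using cc c' m linear_mapD'(1)[OF \<phi> m]
      by (simp add: M.act_elem odd_elem N.act_mult M.parity_mult[OF c] N.act_smult_left)
  qed
qed

lemma even_degree:
  assumes "has_degree 0 M N.T \<phi>" shows "has_degree 0 M.T N.T (extend_even g N \<phi>)"
  unfolding has_degree_def
proof (intro allI ballI)
  fix n t assume t: "t \<in> grade M.T n"
  show "extend_even g N \<phi> t \<in> grade N.T (n + 0)"
  proof (rule M.grade_T_into[OF even_linear N.module_T N.submodule_grade_T _ t])
    show "extend_even g N \<phi> (M.te c m) \<in> grade N.T (n + 0)"
      if "c \<in> grade M.A i" "m \<in> grade M j" "i + j = n" for c m i j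
      using N.act_grade[OF that(1), of "\<phi> m" j] assms that
      by (simp add: even_elem M.grade_closed M.grade_M_closed has_degree_def)
  qed
qed

lemma odd_degree:
  assumes "has_degree 1 M N.T \<phi>" shows "has_degree 1 M.T N.T (extend_odd g N \<phi>)"
  unfolding has_degree_def
proof (intro allI ballI)
  fix n t assume t: "t \<in> grade M.T n"
  show "extend_odd g N \<phi> t \<in> grade N.T (n + 1)"
  proof (rule M.grade_T_into[OF odd_linear N.module_T N.submodule_grade_T _ t])
    show "extend_odd g N \<phi> (M.te c m) \<in> grade N.T (n + 1)"
      if "c \<in> grade M.A i" "m \<in> grade M j" "i + j = n" for c m i j
    proof -
      have \<phi>m: "\<phi> m \<in> grade N.T (j + 1)" using assms that(2) by (simp add: has_degree_def)
      have "N.act c (\<phi> m) \<in> grade N.T (n + 1)" using N.act_grade[OF that(1) \<phi>m] by (simp add: that(3)[symmetric] add.assoc)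
      then have "sgn_pow i \<odot>\<^bsub>N.T\<^esub> N.act c (\<phi> m) \<in> grade N.T (n + 1)"
        using submoduleD(4)[OF N.submodule_grade_T N.module_T] by simp
      then show ?thesis
        using that linear_mapD'(1)[OF \<phi>] M.grade_closed M.grade_M_closed
        by (simp add: odd_elem M.parity_grade N.act_smult_left)
    qed
  qed
qed

end

lemma even_cong:
  assumes "linear_map scalars M N.T \<phi>" "linear_map scalars M N.T \<psi>"
    "\<And>m. m \<in> carrier M \<Longrightarrow> \<phi> m = \<psi> m" "t \<in> carrier M.T"
  shows "extend_even g N \<phi> t = extend_even g N \<psi> t"
  by (rule M.T.tensor_eqI[OF even_linear[OF assms(1)] even_linear[OF assms(2)] N.module_T _ assms(4)])
    (use assms(1-3) in \<open>simp add: even_elem\<close>)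

text \<open>Every c \<otimes> m is \<open>c\<close> applied to 1 \<otimes> m. The hypotheses are
  those available for a morphism of dg modules; linearity over the ground field is recovered by
  letting scalars act as multiples of the unit of C(g).\<close>

lemma determined_by_generators:
  assumes add: "\<And>s t. s \<in> carrier M.T \<Longrightarrow> t \<in> carrier M.T \<Longrightarrow> F (s \<oplus>\<^bsub>M.T\<^esub> t) = F s \<oplus>\<^bsub>N.T\<^esub> F t"
    and act: "\<And>c t. c \<in> carrier M.A \<Longrightarrow> t \<in> carrier M.T \<Longrightarrow> F (M.act c t) = N.act c (F t)"
    and cl: "\<And>t. t \<in> carrier M.T \<Longrightarrow> F t \<in> carrier N.T"
  shows "linear_map scalars M.T N.T F"
    and "linear_map scalars M N.T (\<lambda>m. F (M.te \<one>\<^bsub>M.A\<^esub> m))"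
    and "t \<in> carrier M.T \<Longrightarrow> extend_even g N (\<lambda>m. F (M.te \<one>\<^bsub>M.A\<^esub> m)) t = F t"
proof -
  show lin: "linear_map scalars M.T N.T F"
  proof (rule linear_mapI)
    fix a t assume t: "t \<in> carrier M.T"
    have "F (a \<odot>\<^bsub>M.T\<^esub> t) = F (M.act (a \<odot>\<^bsub>M.A\<^esub> \<one>\<^bsub>M.A\<^esub>) t)" using M.act_smult_one[OF t] by simp
    also have "\<dots> = a \<odot>\<^bsub>N.T\<^esub> F t"
      using act[OF _ t] vector_spaceD(1)[OF M.module_A] N.act_smult_one[OF cl[OF t]] by simp
    finally show "F (a \<odot>\<^bsub>M.T\<^esub> t) = a \<odot>\<^bsub>N.T\<^esub> F t" .
  qed (fact cl add)+
  show \<phi>: "linear_map scalars M N.T (\<lambda>m. F (M.te \<one>\<^bsub>M.A\<^esub> m))"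
    by (rule linear_map_compose[OF M.te_one_linear lin])
  show "extend_even g N (\<lambda>m. F (M.te \<one>\<^bsub>M.A\<^esub> m)) t = F t" if t: "t \<in> carrier M.T"
  proof (rule M.T.tensor_eqI[OF even_linear[OF \<phi>] lin N.module_T _ t])
    fix c m assume c: "c \<in> carrier M.A" and m: "m \<in> carrier M"
    have "extend_even g N (\<lambda>m. F (M.te \<one>\<^bsub>M.A\<^esub> m)) (M.te c m) = N.act c (F (M.te \<one>\<^bsub>M.A\<^esub> m))"
      by (rule even_elem[OF \<phi> c m])
    also have "\<dots> = F (M.act c (M.te \<one>\<^bsub>M.A\<^esub> m))"
      by (rule act[OF c M.te_closed[OF A.one_closed m], symmetric])
    also have "\<dots> = F (M.te c m)" by (simp only: M.te_act[OF c m, symmetric])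
    finally show "extend_even g N (\<lambda>m. F (M.te \<one>\<^bsub>M.A\<^esub> m)) (M.te c m) = F (M.te c m)" .
  qed
qed

subsection \<open>Locally finite families\<close>

lemma familyD:
  assumes "locally_finite_family n g M N \<phi>"
  shows "linear_map scalars M N.T (\<phi> k)" "m \<in> grade M j \<Longrightarrow> \<phi> k m \<in> grade N.T (j + n)"
    "m \<in> carrier M \<Longrightarrow> \<phi> k m \<in> cochains_power g N k"
    "m \<in> carrier M \<Longrightarrow> finite {k. \<phi> k m \<noteq> \<zero>\<^bsub>N.T\<^esub>}"
proof -
  show "linear_map scalars M N.T (\<phi> k)" "m \<in> grade M j \<Longrightarrow> \<phi> k m \<in> grade N.T (j + n)"
    "m \<in> carrier M \<Longrightarrow> \<phi> k m \<in> cochains_power g N k"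
    using assms unfolding locally_finite_family_def has_degree_def by blast+
  assume "m \<in> carrier M"
  then obtain l where "\<forall>k\<ge>l. \<phi> k m = \<zero>\<^bsub>N.T\<^esub>" using assms unfolding locally_finite_family_def by blast
  then have "{k. \<phi> k m \<noteq> \<zero>\<^bsub>N.T\<^esub>} \<subseteq> {..<l}" by (auto simp: not_le[symmetric])
  then show "finite {k. \<phi> k m \<noteq> \<zero>\<^bsub>N.T\<^esub>}" by (rule finite_subset) simp
qed

context
  fixes n \<phi> assumes fam: "locally_finite_family n g M N \<phi>"
begin

lemma total_closed: "m \<in> carrier M \<Longrightarrow> total g N \<phi> m \<in> carrier N.T"
  unfolding total_def using linear_mapD'(1)[OF familyD(1)[OF fam]] by (intro D.finsum_closed) simp

lemma component_total:
  assumes m: "m \<in> carrier M"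
  shows "component N.T (cochains_power g N) k (total g N \<phi> m) = \<phi> k m"
  unfolding total_def
  by (rule D.component_eqI[where f = "\<lambda>k. \<phi> k m", OF familyD(4)[OF fam m] familyD(3)[OF fam m]]) simp_all

text \<open>The sum in \<open>total\<close> runs over a support that varies with the argument, so
  linearity is checked on components, which are the individual maps of the family.\<close>

lemma total_linear: "linear_map scalars M N.T (total g N \<phi>)"
proof (rule linear_mapI)
  note add = linear_mapD'[OF N.component_power_T_linear]
  note \<phi> = linear_mapD'[OF familyD(1)[OF fam]]
  have MV: "module scalars M" by (rule M.module_M)
  interpret MG: abelian_group M by (rule M.abelian_M)
  fix m assume m: "m \<in> carrier M"
  show "total g N \<phi> m \<in> carrier N.T" by (rule total_closed[OF m])
  show "total g N \<phi> (m \<oplus>\<^bsub>M\<^esub> m') = total g N \<phi> m \<oplus>\<^bsub>N.T\<^esub> total g N \<phi> m'" if m': "m' \<in> carrier M" for m'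
    by (rule D.eq_by_components)
      (use m m' total_closed in \<open>simp_all add: component_total D.component_add \<phi>\<close>)
  show "total g N \<phi> (a \<odot>\<^bsub>M\<^esub> m) = a \<odot>\<^bsub>N.T\<^esub> total g N \<phi> m" for a
    by (rule D.eq_by_components)
      (use m total_closed in \<open>simp_all add: component_total add(3) \<phi> vector_spaceD(1)[OF MV] vector_spaceD(1)[OF N.module_T]\<close>)
qed

lemma total_degree: "has_degree n M N.T (total g N \<phi>)"
  unfolding has_degree_def
proof (intro allI ballI)
  fix j m assume m: "m \<in> grade M j"
  show "total g N \<phi> m \<in> grade N.T (j + n)"
    unfolding total_def using familyD(2)[OF fam m]
    by (intro submodule_finsum[OF N.submodule_grade_T N.module_T]) simp
qed

end

text \<open>Local finiteness is the finiteness of the support of an element in the direct sum of the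
  C^k(g, N). The equation for \<phi> is required on the carrier only, so that extensional families
  are covered.\<close>

lemma family_of_components:
  assumes lin: "linear_map scalars M N.T F" and deg: "has_degree n M N.T F"
    and \<phi>: "\<And>k m. m \<in> carrier M \<Longrightarrow> \<phi> k m = component N.T (cochains_power g N) k (F m)"
  shows "locally_finite_family n g M N \<phi>" and "m \<in> carrier M \<Longrightarrow> total g N \<phi> m = F m"
proof -
  note cl = linear_mapD'(1)[OF lin]
  interpret MG: abelian_group M by (rule M.abelian_M)
  have "linear_map scalars M N.T (\<lambda>m. component N.T (cochains_power g N) k (F m))" for k
    by (rule linear_map_compose[OF lin N.component_power_T_linear])
  then have "linear_map scalars M N.T (\<phi> k)" for k
    using vector_spaceD(1)[OF M.module_M] by (simp add: linear_map_def \<phi> Pi_def)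
  moreover have "has_degree n M N.T (\<phi> k)" for k
    using deg N.component_power_T_grade M.grade_M_closed by (auto simp: has_degree_def \<phi>)
  moreover have "\<phi> k ` carrier M \<subseteq> cochains_power g N k" for k
    using D.component_in[OF cl] by (auto simp: \<phi>)
  moreover have "\<exists>l. \<forall>k\<ge>l. \<phi> k m = \<zero>\<^bsub>N.T\<^esub>" if m: "m \<in> carrier M" for m
  proof -
    have fin: "finite {k. \<phi> k m \<noteq> \<zero>\<^bsub>N.T\<^esub>}" using D.finite_support[OF cl[OF m]] by (simp add: \<phi> m)
    then obtain l where "\<forall>k\<in>{k. \<phi> k m \<noteq> \<zero>\<^bsub>N.T\<^esub>}. k < l" using finite_nat_set_iff_bounded by blast
    then have "\<forall>k\<ge>l. \<phi> k m = \<zero>\<^bsub>N.T\<^esub>" using not_le by blast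
    then show ?thesis by blast
  qed
  ultimately show fam: "locally_finite_family n g M N \<phi>" unfolding locally_finite_family_def by blast
  show "total g N \<phi> m = F m" if m: "m \<in> carrier M"
    by (rule D.eq_by_components[OF total_closed[OF fam m] cl[OF m]]) (simp add: component_total[OF fam m] \<phi> m)
qed

end

subsection \<open>The total differential\<close>

lemma CE_simps:
  "carrier (CE g) = carrier (CE_alg g)" "mult (CE g) = mult (CE_alg g)" "one (CE g) = one (CE_alg g)"
  "zero (CE g) = zero (CE_alg g)" "add (CE g) = add (CE_alg g)" "smult (CE g) = smult (CE_alg g)"
  "grade (CE g) = grade (CE_alg g)" "diff (CE g) = CE_diff g"
  by (simp_all add: CE_def graded.defs dg.defs)

lemma CE_module_simps:
  "carrier (CE_module g M) = carrier (cochains g M)" "zero (CE_module g M) = zero (cochains g M)"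
  "add (CE_module g M) = add (cochains g M)" "smult (CE_module g M) = cochains_act g M"
  "grade (CE_module g M) = grade (cochains g M)" "diff (CE_module g M) = d_tot g M"
  by (simp_all add: CE_module_def)

lemma (in CE_algebra) ring_CE: "ring (CE g)"
proof -
  interpret A: ring "CE_alg g" by (rule ring_A)
  show ?thesis
  proof (rule ringI)
    show "abelian_group (CE g)"
      by (rule abelian_group_cong[OF _ _ _ A.is_abelian_group]) (simp_all add: CE_simps)
    show "Group.monoid (CE g)" by (rule monoidI) (simp_all add: CE_simps A.m_assoc)
  qed (simp_all add: CE_simps A.l_distr A.r_distr)
qed

text \<open>Vanishing of the square of \<open>d_tot\<close> is kept apart, because the formulas
  proved here are themselves used to establish it for \<open>twisted_module\<close>.\<close>

locale infty_cochains = cochain_module g eps M B deg co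
  for g :: "('k::field, 'g) dg_lie" and eps
    and M :: "('k, 'g, 'm) infty_module" and B deg co +
  assumes family_d: "locally_finite_family 1 g M M (structure_map M)"
begin

sublocale self: cochain_pair g eps M B deg co M B deg co
  by unfold_locales

interpretation A: ring A by (rule ring_A)
interpretation TT: abelian_group T by (rule abelian_T)

abbreviation "\<delta> \<equiv> total g M (structure_map M)"

lemmas \<delta>_linear = self.total_linear[OF family_d]
lemmas \<delta>_degree = self.total_degree[OF family_d]

lemma diff_tensor_bilinear: "bilinear A M T (\<lambda>c m. te (CE_diff g c) m)"
  using linear_map_compose[OF diff_linear te_left] te_right[OF linear_mapD'(1)[OF diff_linear]]
  by (intro bilinearI)

abbreviation "d_left \<equiv> tensor_lift T (\<lambda>c m. te (CE_diff g c) m)"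

lemma d_left_linear: "linear_map scalars T T d_left"
  by (rule T.tensor_lift_linear[OF diff_tensor_bilinear module_T])

lemma d_left_elem: "c \<in> carrier A \<Longrightarrow> m \<in> carrier M \<Longrightarrow> d_left (te c m) = te (CE_diff g c) m"
  by (rule T.tensor_lift_elem[OF diff_tensor_bilinear module_T])

lemma d_tot_linear: "linear_map scalars T T (d_tot g M)"
  unfolding d_tot_def[abs_def]
  by (rule linear_map_add[OF d_left_linear self.odd_linear[OF \<delta>_linear] module_T module_T])

lemma d_tot_elem:
  "c \<in> carrier A \<Longrightarrow> m \<in> carrier M \<Longrightarrow> d_tot g M (te c m) = te (CE_diff g c) m \<oplus>\<^bsub>T\<^esub> act (parity A c) (\<delta> m)"
  by (simp add: d_tot_def d_left_elem self.odd_elem[OF \<delta>_linear])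

lemma parity_one: "parity A \<one>\<^bsub>A\<^esub> = \<one>\<^bsub>A\<^esub>"
  using parity_grade[OF one_grade] vector_spaceD(5)[OF module_A, of "\<one>\<^bsub>A\<^esub>"] by simp

text \<open>The Chevalley-Eilenberg differential kills 1, and 1 is even; only the structure maps are
  left.\<close>

lemma d_tot_te_one:
  assumes m: "m \<in> carrier M" shows "d_tot g M (te \<one>\<^bsub>A\<^esub> m) = \<delta> m"
  using linear_map_zero[OF te_left[OF m] abelian_A abelian_T] linear_mapD'(1)[OF \<delta>_linear m]
  by (simp add: d_tot_elem m diff_one parity_one act_one)

lemma d_left_degree: "t \<in> grade T n \<Longrightarrow> d_left t \<in> grade T (n + 1)"
proof (rule grade_T_into[OF d_left_linear module_T submodule_grade_T])
  show "d_left (te c m) \<in> grade T (n + 1)" if "c \<in> grade A i" "m \<in> grade M j" "i + j = n" for c m i j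
    using te_grade[OF diff_degree[OF that(1)] that(2)] that(3)
    by (simp add: d_left_elem grade_closed[OF that(1)] grade_M_closed[OF that(2)] ac_simps)
qed

lemma d_tot_degree: "has_degree 1 T T (d_tot g M)"
  using self.odd_degree[OF \<delta>_linear \<delta>_degree] d_left_degree submoduleD(3)[OF submodule_grade_T module_T]
  unfolding has_degree_def d_tot_def by blast

lemma d_left_act:
  assumes c: "c \<in> grade A i" and t: "t \<in> carrier T"
  shows "d_left (act c t) = act (CE_diff g c) t \<oplus>\<^bsub>T\<^esub> sgn_pow i \<odot>\<^bsub>T\<^esub> act c (d_left t)"
proof -
  note cc = grade_closed[OF c] and dc = linear_mapD'(1)[OF diff_linear grade_closed[OF c]]
  show ?thesis
  proof (rule T.tensor_eqI[OF linear_map_compose[OF act_linear[OF cc] d_left_linear]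
        linear_map_add[OF act_linear[OF dc] linear_map_smult[OF linear_map_compose[OF d_left_linear act_linear[OF cc]]
            module_T module_T] module_T module_T] module_T _ t])
    fix c' m assume c': "c' \<in> carrier A" and m: "m \<in> carrier M"
    have dc': "CE_diff g c' \<in> carrier A" using linear_mapD'(1)[OF diff_linear c'] .
    have "CE_diff g (c \<otimes>\<^bsub>A\<^esub> c') = (CE_diff g c \<otimes>\<^bsub>A\<^esub> c') \<oplus>\<^bsub>A\<^esub> sgn_pow i \<odot>\<^bsub>A\<^esub> (c \<otimes>\<^bsub>A\<^esub> CE_diff g c')"
      using diff_mult[OF c c'] koszul_eq[OF module_A, of "c \<otimes>\<^bsub>A\<^esub> CE_diff g c'" i] cc dc' by simp
    then show "d_left (act c (te c' m)) = act (CE_diff g c) (te c' m) \<oplus>\<^bsub>T\<^esub> sgn_pow i \<odot>\<^bsub>T\<^esub> act c (d_left (te c' m))"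
      using cc dc c' dc' m linear_mapD'(2,3)[OF te_left[OF m]] vector_spaceD(1)[OF module_A]
      by (simp add: act_elem d_left_elem)
  qed
qed

text \<open>The part coming from C(g) contributes the derivative of \<open>c\<close>. The part
  coming from the structure maps merely commutes with \<open>c\<close> up to sign, and the Koszul
  sign in \<open>extend_odd\<close> makes this the same sign as in the first part.\<close>

lemma d_tot_act:
  assumes c: "c \<in> grade A i" and t: "t \<in> carrier T"
  shows "d_tot g M (act c t) = act (CE_diff g c) t \<oplus>\<^bsub>T\<^esub> koszul T i (act c (d_tot g M t))"
proof -
  note cc = grade_closed[OF c] and dc = linear_mapD'(1)[OF diff_linear grade_closed[OF c]]
  have cl: "d_left t \<in> carrier T" "extend_odd g M \<delta> t \<in> carrier T"
    using linear_mapD'(1)[OF d_left_linear t] linear_mapD'(1)[OF self.odd_linear[OF \<delta>_linear] t] .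
  have "koszul T i (act c (d_tot g M t)) = sgn_pow i \<odot>\<^bsub>T\<^esub> act c (d_tot g M t)"
    by (rule koszul_eq[OF module_T act_closed[OF cc linear_mapD'(1)[OF d_tot_linear t]]])
  then show ?thesis
    using cc dc cl t act_closed
    by (simp add: d_tot_def d_left_act[OF c t] self.odd_act[OF \<delta>_linear c t] act_add vector_spaceD(1,3)[OF module_T] TT.a_assoc)
qed

lemma CE_module_dg:
  assumes square: "\<And>t. t \<in> carrier T \<Longrightarrow> d_tot g M (d_tot g M t) = \<zero>\<^bsub>T\<^esub>"
  shows "dg_module (CE g) (CE_module g M)"
proof (intro dg_module.intro dg_module_axioms.intro)
  show "ring (CE g)" by (rule ring_CE)
  show "internal_direct_sum (CE_module g M) (grade (CE_module g M))"
    unfolding CE_module_simps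
    by (rule internal_direct_sum_cong[OF _ _ _ direct_sum_T]) (simp_all add: CE_module_simps)
  have k: "koszul (CE_module g M) = koszul T"
    using a_inv_cong[of "CE_module g M" T] by (simp add: koszul_def CE_module_simps fun_eq_iff)
  show "diff (CE_module g M) (c \<odot>\<^bsub>CE_module g M\<^esub> x) =
      diff (CE g) c \<odot>\<^bsub>CE_module g M\<^esub> x \<oplus>\<^bsub>CE_module g M\<^esub> koszul (CE_module g M) i (c \<odot>\<^bsub>CE_module g M\<^esub> diff (CE_module g M) x)"
    if "c \<in> grade (CE g) i" "x \<in> carrier (CE_module g M)" for c i x
    using that d_tot_act by (simp add: k CE_module_simps CE_simps)
  show "has_degree 1 (CE_module g M) (CE_module g M) (diff (CE_module g M))"
    using d_tot_degree by (simp add: has_degree_def CE_module_simps)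
qed (simp_all add: CE_module_simps CE_simps act_closed act_add_left act_add act_mult act_one act_grade square
    linear_mapD'[OF d_tot_linear])

end

section \<open>Fully faithful functors and equivalences for categories given by records\<close>

section \<open>Categories\<close>

lemma categoryD:
  assumes "is_category C"
  shows "X \<in> Obj C \<Longrightarrow> Id C X \<in> Hom C X X"
    and "\<lbrakk>X \<in> Obj C; Y \<in> Obj C; Z \<in> Obj C; f \<in> Hom C X Y; h \<in> Hom C Y Z\<rbrakk> \<Longrightarrow> Comp C X Y Z h f \<in> Hom C X Z"
    and "\<lbrakk>X \<in> Obj C; Y \<in> Obj C; f \<in> Hom C X Y\<rbrakk> \<Longrightarrow> Comp C X X Y f (Id C X) = f"
    and "\<lbrakk>X \<in> Obj C; Y \<in> Obj C; f \<in> Hom C X Y\<rbrakk> \<Longrightarrow> Comp C X Y Y (Id C Y) f = f"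
    and "\<lbrakk>W \<in> Obj C; X \<in> Obj C; Y \<in> Obj C; Z \<in> Obj C; f \<in> Hom C W X; h \<in> Hom C X Y; k \<in> Hom C Y Z\<rbrakk> \<Longrightarrow>
        Comp C W X Z (Comp C X Y Z k h) f = Comp C W Y Z k (Comp C W X Y h f)"
  using assms unfolding is_category_def by blast+

lemma categoryI:
  assumes "\<And>X. X \<in> Obj C \<Longrightarrow> Id C X \<in> Hom C X X"
    and "\<And>X Y Z f h. \<lbrakk>X \<in> Obj C; Y \<in> Obj C; Z \<in> Obj C; f \<in> Hom C X Y; h \<in> Hom C Y Z\<rbrakk> \<Longrightarrow> Comp C X Y Z h f \<in> Hom C X Z"
    and "\<And>X Y f. \<lbrakk>X \<in> Obj C; Y \<in> Obj C; f \<in> Hom C X Y\<rbrakk> \<Longrightarrow> Comp C X X Y f (Id C X) = f"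
    and "\<And>X Y f. \<lbrakk>X \<in> Obj C; Y \<in> Obj C; f \<in> Hom C X Y\<rbrakk> \<Longrightarrow> Comp C X Y Y (Id C Y) f = f"
    and "\<And>W X Y Z f h k. \<lbrakk>W \<in> Obj C; X \<in> Obj C; Y \<in> Obj C; Z \<in> Obj C; f \<in> Hom C W X; h \<in> Hom C X Y; k \<in> Hom C Y Z\<rbrakk> \<Longrightarrow>
        Comp C W X Z (Comp C X Y Z k h) f = Comp C W Y Z k (Comp C W X Y h f)"
  shows "is_category C"
  unfolding is_category_def using assms by (intro conjI ballI) simp_all

text \<open>A structure whose hom-sets, identities and composition are pulled back along bijections to the
  hom-sets of a category is itself a category, so no law of the source has to be checked.\<close>

lemma fully_faithful_pullback:
  assumes D: "is_category D"
    and obj: "\<And>X. X \<in> Obj C \<Longrightarrow> on_obj F X \<in> Obj D"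
    and up: "\<And>X Y f. \<lbrakk>X \<in> Obj C; Y \<in> Obj C; f \<in> Hom C X Y\<rbrakk> \<Longrightarrow> on_hom F X Y f \<in> Hom D (on_obj F X) (on_obj F Y)"
    and lo: "\<And>X Y h. \<lbrakk>X \<in> Obj C; Y \<in> Obj C; h \<in> Hom D (on_obj F X) (on_obj F Y)\<rbrakk> \<Longrightarrow> lo X Y h \<in> Hom C X Y"
    and lo_up: "\<And>X Y f. \<lbrakk>X \<in> Obj C; Y \<in> Obj C; f \<in> Hom C X Y\<rbrakk> \<Longrightarrow> lo X Y (on_hom F X Y f) = f"
    and up_lo: "\<And>X Y h. \<lbrakk>X \<in> Obj C; Y \<in> Obj C; h \<in> Hom D (on_obj F X) (on_obj F Y)\<rbrakk> \<Longrightarrow> on_hom F X Y (lo X Y h) = h"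
    and id: "\<And>X. X \<in> Obj C \<Longrightarrow> Id C X = lo X X (Id D (on_obj F X))"
    and comp: "\<And>X Y Z f h. \<lbrakk>X \<in> Obj C; Y \<in> Obj C; Z \<in> Obj C; f \<in> Hom C X Y; h \<in> Hom C Y Z\<rbrakk> \<Longrightarrow>
      Comp C X Y Z h f = lo X Z (Comp D (on_obj F X) (on_obj F Y) (on_obj F Z) (on_hom F Y Z h) (on_hom F X Y f))"
  shows "fully_faithful C D F"
proof -
  note d = categoryD[OF D]
  have up_id: "on_hom F X X (Id C X) = Id D (on_obj F X)" if "X \<in> Obj C" for X
    using id[OF that] up_lo[OF that that d(1)[OF obj[OF that]]] by simp
  have up_comp: "on_hom F X Z (Comp C X Y Z h f) =
      Comp D (on_obj F X) (on_obj F Y) (on_obj F Z) (on_hom F Y Z h) (on_hom F X Y f)"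
    if "X \<in> Obj C" "Y \<in> Obj C" "Z \<in> Obj C" "f \<in> Hom C X Y" "h \<in> Hom C Y Z" for X Y Z f h
    using comp[OF that] up_lo[OF that(1,3) d(2)[OF obj[OF that(1)] obj[OF that(2)] obj[OF that(3)] up[OF that(1,2,4)] up[OF that(2,3,5)]]]
    by simp
  have id_closed: "Id C X \<in> Hom C X X" if "X \<in> Obj C" for X
    unfolding id[OF that] by (rule lo[OF that that d(1)[OF obj[OF that]]])
  have comp_closed: "Comp C X Y Z h f \<in> Hom C X Z"
    if "X \<in> Obj C" "Y \<in> Obj C" "Z \<in> Obj C" "f \<in> Hom C X Y" "h \<in> Hom C Y Z" for X Y Z f h
    using comp[OF that] lo[OF that(1,3) d(2)[OF obj[OF that(1)] obj[OF that(2)] obj[OF that(3)] up[OF that(1,2,4)] up[OF that(2,3,5)]]]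
    by simp
  have inj: "f = h" if "X \<in> Obj C" "Y \<in> Obj C" "f \<in> Hom C X Y" "h \<in> Hom C X Y" "on_hom F X Y f = on_hom F X Y h" for X Y f h
    using arg_cong[OF that(5), of "lo X Y"] unfolding lo_up[OF that(1-3)] lo_up[OF that(1,2,4)] .
  have C: "is_category C"
  proof (rule categoryI)
    show "Comp C X X Y f (Id C X) = f" if "X \<in> Obj C" "Y \<in> Obj C" "f \<in> Hom C X Y" for X Y f
      by (rule inj[OF that(1,2) comp_closed[OF that(1,1,2) id_closed[OF that(1)] that(3)] that(3)])
        (unfold up_comp[OF that(1,1,2) id_closed[OF that(1)] that(3)] up_id[OF that(1)],
          rule d(3)[OF obj[OF that(1)] obj[OF that(2)] up[OF that]])
    show "Comp C X Y Y (Id C Y) f = f" if "X \<in> Obj C" "Y \<in> Obj C" "f \<in> Hom C X Y" for X Y f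
      by (rule inj[OF that(1,2) comp_closed[OF that(1,2,2,3) id_closed[OF that(2)]] that(3)])
        (unfold up_comp[OF that(1,2,2,3) id_closed[OF that(2)]] up_id[OF that(2)],
          rule d(4)[OF obj[OF that(1)] obj[OF that(2)] up[OF that]])
    show "Comp C W X Z (Comp C X Y Z k h) f = Comp C W Y Z k (Comp C W X Y h f)"
      if "W \<in> Obj C" "X \<in> Obj C" "Y \<in> Obj C" "Z \<in> Obj C" "f \<in> Hom C W X" "h \<in> Hom C X Y" "k \<in> Hom C Y Z" for W X Y Z f h k
    proof -
      note kh = comp_closed[OF that(2,3,4,6,7)] and hf = comp_closed[OF that(1,2,3,5,6)]
      show ?thesis
        by (rule inj[OF that(1,4) comp_closed[OF that(1,2,4,5) kh] comp_closed[OF that(1,3,4) hf that(7)]])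
          (unfold up_comp[OF that(1,2,4,5) kh] up_comp[OF that(1,3,4) hf that(7)] up_comp[OF that(2,3,4,6,7)] up_comp[OF that(1,2,3,5,6)],
            rule d(5)[OF obj[OF that(1)] obj[OF that(2)] obj[OF that(3)] obj[OF that(4)] up[OF that(1,2,5)] up[OF that(2,3,6)] up[OF that(3,4,7)]])
    qed
  qed (fact id_closed comp_closed)+
  show ?thesis
    unfolding fully_faithful_def is_functor_def
  proof (intro conjI ballI)
    show "bij_betw (on_hom F X Y) (Hom C X Y) (Hom D (on_obj F X) (on_obj F Y))" if "X \<in> Obj C" "Y \<in> Obj C" for X Y
      by (rule bij_betw_byWitness[where f' = "lo X Y"]) (use that lo_up up_lo up lo in auto)
  qed (fact C D obj up up_id up_comp)+
qed

lemma full_subcategory_simps: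
  "Obj (full_subcategory D S) = Obj D \<inter> S" "Hom (full_subcategory D S) = Hom D"
  "Id (full_subcategory D S) = Id D" "Comp (full_subcategory D S) = Comp D"
  by (simp_all add: full_subcategory_def)

lemma is_category_full_subcategory:
  assumes "is_category D" shows "is_category (full_subcategory D S)"
  by (rule categoryI) (use categoryD[OF assms] in \<open>simp_all add: full_subcategory_simps\<close>)

text \<open>For every object in the image an isomorphic object of the source is chosen. The inverse
  functor conjugates morphisms by the chosen isomorphisms and lifts the result along the bijections
  on hom-sets; each law then holds because it holds after applying \<open>F\<close>.\<close>

lemma equivalence_of_fully_faithful:
  assumes ff: "fully_faithful C D F" and im: "\<And>X. X \<in> Obj C \<Longrightarrow> on_obj F X \<in> S"
    and ess: "\<And>Y. Y \<in> Obj D \<Longrightarrow> Y \<in> S \<Longrightarrow> \<exists>X\<in>Obj C. \<exists>e. is_iso D (on_obj F X) Y e"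
  shows "is_equivalence C (full_subcategory D S) F"
proof -
  let ?D = "full_subcategory D S"
  have C: "is_category C" and D: "is_category D" and obj: "\<And>X. X \<in> Obj C \<Longrightarrow> on_obj F X \<in> Obj D"
    and up: "\<And>X Y f. X \<in> Obj C \<Longrightarrow> Y \<in> Obj C \<Longrightarrow> f \<in> Hom C X Y \<Longrightarrow> on_hom F X Y f \<in> Hom D (on_obj F X) (on_obj F Y)"
    and up_id: "\<And>X. X \<in> Obj C \<Longrightarrow> on_hom F X X (Id C X) = Id D (on_obj F X)"
    and up_comp: "\<And>X Y Z f h. X \<in> Obj C \<Longrightarrow> Y \<in> Obj C \<Longrightarrow> Z \<in> Obj C \<Longrightarrow> f \<in> Hom C X Y \<Longrightarrow> h \<in> Hom C Y Z \<Longrightarrow>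
        on_hom F X Z (Comp C X Y Z h f) = Comp D (on_obj F X) (on_obj F Y) (on_obj F Z) (on_hom F Y Z h) (on_hom F X Y f)"
    and bij: "\<And>X Y. X \<in> Obj C \<Longrightarrow> Y \<in> Obj C \<Longrightarrow> bij_betw (on_hom F X Y) (Hom C X Y) (Hom D (on_obj F X) (on_obj F Y))"
    using ff unfolding fully_faithful_def is_functor_def by blast+
  note c = categoryD[OF C] and d = categoryD[OF D]
  define lo where "lo X Y = inv_into (Hom C X Y) (on_hom F X Y)" for X Y
  have lo: "lo X Y h \<in> Hom C X Y" "on_hom F X Y (lo X Y h) = h"
    if "X \<in> Obj C" "Y \<in> Obj C" "h \<in> Hom D (on_obj F X) (on_obj F Y)" for X Y h
    using bij[OF that(1,2)] that(3) unfolding lo_def bij_betw_def by (auto intro: inv_into_into f_inv_into_f)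
  have inj: "f = h" if "X \<in> Obj C" "Y \<in> Obj C" "f \<in> Hom C X Y" "h \<in> Hom C X Y" "on_hom F X Y f = on_hom F X Y h" for X Y f h
    using bij[OF that(1,2)] that(3-5) unfolding bij_betw_def inj_on_def by blast
  \<comment> \<open>The triple \<open>t\<close> consists of a preimage object and a pair of mutually
    inverse isomorphisms, packed together so that a single choice function fixes all three.\<close>
  define P where "P Y t \<longleftrightarrow> fst t \<in> Obj C \<and> fst (snd t) \<in> Hom D (on_obj F (fst t)) Y \<and> snd (snd t) \<in> Hom D Y (on_obj F (fst t)) \<and>
      Comp D (on_obj F (fst t)) Y (on_obj F (fst t)) (snd (snd t)) (fst (snd t)) = Id D (on_obj F (fst t)) \<and>
      Comp D Y (on_obj F (fst t)) Y (fst (snd t)) (snd (snd t)) = Id D Y" for Y t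
  have "\<exists>t. P Y t" if Y: "Y \<in> Obj D" "Y \<in> S" for Y
  proof -
    obtain X e where X: "X \<in> Obj C" and "is_iso D (on_obj F X) Y e" using ess[OF Y] by blast
    then obtain e' where "e \<in> Hom D (on_obj F X) Y" "e' \<in> Hom D Y (on_obj F X)"
      "Comp D (on_obj F X) Y (on_obj F X) e' e = Id D (on_obj F X)" "Comp D Y (on_obj F X) Y e e' = Id D Y"
      unfolding is_iso_def by blast
    then have "P Y (X, e, e')" using X by (simp add: P_def)
    then show ?thesis by blast
  qed
  then obtain t where t: "\<And>Y. Y \<in> Obj D \<Longrightarrow> Y \<in> S \<Longrightarrow> P Y (t Y)" by metis
  define G where "G Y = fst (t Y)" for Y
  define e where "e Y = fst (snd (t Y))" for Y
  define e' where "e' Y = snd (snd (t Y))" for Y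
  have G: "G Y \<in> Obj C" and e: "e Y \<in> Hom D (on_obj F (G Y)) Y" and e': "e' Y \<in> Hom D Y (on_obj F (G Y))"
    and e'e: "Comp D (on_obj F (G Y)) Y (on_obj F (G Y)) (e' Y) (e Y) = Id D (on_obj F (G Y))"
    and ee': "Comp D Y (on_obj F (G Y)) Y (e Y) (e' Y) = Id D Y" if "Y \<in> Obj D" "Y \<in> S" for Y
    using t[OF that] by (simp_all add: P_def G_def e_def e'_def)
  \<comment> \<open>The conjugate of \<open>k\<close>, still a morphism of the target category; the
    inverse functor sends \<open>k\<close> to its preimage.\<close>
  define Gd where "Gd Y Z k = Comp D (on_obj F (G Y)) Z (on_obj F (G Z)) (e' Z) (Comp D (on_obj F (G Y)) Y Z k (e Y))" for Y Z k
  have Gd: "Gd Y Z k \<in> Hom D (on_obj F (G Y)) (on_obj F (G Z))"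
    if "Y \<in> Obj D" "Y \<in> S" "Z \<in> Obj D" "Z \<in> S" "k \<in> Hom D Y Z" for Y Z k
    unfolding Gd_def using that G e e' obj
    by (auto intro!: d(2)[of "on_obj F (G Y)" Z] d(2)[of "on_obj F (G Y)" Y])
  have Gd_id: "Gd Y Y (Id D Y) = Id D (on_obj F (G Y))" if "Y \<in> Obj D" "Y \<in> S" for Y
    unfolding Gd_def using that d(4)[OF obj[OF G[OF that]] that(1) e[OF that]] e'e[OF that] by simp
  have e_Gd: "Comp D (on_obj F (G Y)) (on_obj F (G Z)) Z (e Z) (Gd Y Z k) = Comp D (on_obj F (G Y)) Y Z k (e Y)"
    if Y: "Y \<in> Obj D" "Y \<in> S" and Z: "Z \<in> Obj D" "Z \<in> S" and k: "k \<in> Hom D Y Z" for Y Z k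
  proof -
    have ke: "Comp D (on_obj F (G Y)) Y Z k (e Y) \<in> Hom D (on_obj F (G Y)) Z"
      by (rule d(2)[OF obj[OF G[OF Y]] Y(1) Z(1) e[OF Y] k])
    show ?thesis
      unfolding Gd_def d(5)[OF obj[OF G[OF Y]] Z(1) obj[OF G[OF Z]] Z(1) ke e'[OF Z] e[OF Z], symmetric] ee'[OF Z]
      by (rule d(4)[OF obj[OF G[OF Y]] Z(1) ke])
  qed
  have Gd_e': "Comp D Y (on_obj F (G Y)) (on_obj F (G Z)) (Gd Y Z k) (e' Y) = Comp D Y Z (on_obj F (G Z)) (e' Z) k"
    if Y: "Y \<in> Obj D" "Y \<in> S" and Z: "Z \<in> Obj D" "Z \<in> S" and k: "k \<in> Hom D Y Z" for Y Z k
  proof -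
    have ke: "Comp D (on_obj F (G Y)) Y Z k (e Y) \<in> Hom D (on_obj F (G Y)) Z"
      by (rule d(2)[OF obj[OF G[OF Y]] Y(1) Z(1) e[OF Y] k])
    show ?thesis
      unfolding Gd_def d(5)[OF Y(1) obj[OF G[OF Y]] Z(1) obj[OF G[OF Z]] e'[OF Y] ke e'[OF Z]]
        d(5)[OF Y(1) obj[OF G[OF Y]] Y(1) Z(1) e'[OF Y] e[OF Y] k] ee'[OF Y] d(3)[OF Y(1) Z(1) k] ..
  qed
  have Gd_comp: "Gd X Z (Comp D X Y Z h k) = Comp D (on_obj F (G X)) (on_obj F (G Y)) (on_obj F (G Z)) (Gd Y Z h) (Gd X Y k)"
    if X: "X \<in> Obj D" "X \<in> S" and Y: "Y \<in> Obj D" "Y \<in> S" and Z: "Z \<in> Obj D" "Z \<in> S"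
      and k: "k \<in> Hom D X Y" and h: "h \<in> Hom D Y Z" for X Y Z h k
  proof -
    note ob = obj[OF G[OF X]] obj[OF G[OF Y]] obj[OF G[OF Z]]
    have ke: "Comp D (on_obj F (G X)) X Y k (e X) \<in> Hom D (on_obj F (G X)) Y"
      by (rule d(2)[OF ob(1) X(1) Y(1) e[OF X] k])
    \<comment> \<open>Reassociated so that \<open>Gd_e'\<close> applies; in it the isomorphism
      \<open>e Y\<close> and its inverse cancel.\<close>
    have "Comp D (on_obj F (G X)) (on_obj F (G Y)) (on_obj F (G Z)) (Gd Y Z h) (Gd X Y k) =
        Comp D (on_obj F (G X)) Y (on_obj F (G Z)) (Comp D Y (on_obj F (G Y)) (on_obj F (G Z)) (Gd Y Z h) (e' Y))
          (Comp D (on_obj F (G X)) X Y k (e X))"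
      unfolding Gd_def[of X] by (rule d(5)[OF ob(1) Y(1) ob(2,3) ke e'[OF Y] Gd[OF Y Z h], symmetric])
    also have "\<dots> = Comp D (on_obj F (G X)) Z (on_obj F (G Z)) (e' Z) (Comp D (on_obj F (G X)) Y Z h (Comp D (on_obj F (G X)) X Y k (e X)))"
      unfolding Gd_e'[OF Y Z h] by (rule d(5)[OF ob(1) Y(1) Z(1) ob(3) ke h e'[OF Z]])
    also have "\<dots> = Gd X Z (Comp D X Y Z h k)"
      unfolding Gd_def d(5)[OF ob(1) X(1) Y(1) Z(1) e[OF X] k h] ..
    finally show ?thesis by simp
  qed
  define GF where "GF = \<lparr>on_obj = G, on_hom = (\<lambda>Y Z k. lo (G Y) (G Z) (Gd Y Z k))\<rparr>"
  note fs = full_subcategory_simps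
  have FD: "is_functor C ?D F"
    unfolding is_functor_def fs using is_category_full_subcategory[OF D] C obj im up up_id up_comp by blast
  have GF: "is_functor ?D C GF"
    unfolding is_functor_def fs
  proof (intro conjI ballI)
    show "is_category ?D" by (rule is_category_full_subcategory[OF D])
    show "is_category C" by (rule C)
    show "on_obj GF Y \<in> Obj C" if "Y \<in> Obj D \<inter> S" for Y using that G by (simp add: GF_def)
    show "on_hom GF Y Z k \<in> Hom C (on_obj GF Y) (on_obj GF Z)" if "Y \<in> Obj D \<inter> S" "Z \<in> Obj D \<inter> S" "k \<in> Hom D Y Z" for Y Z k
      using that G lo(1) Gd by (simp add: GF_def)
    show "on_hom GF Y Y (Id D Y) = Id C (on_obj GF Y)" if "Y \<in> Obj D \<inter> S" for Y
    proof -
      have Y: "Y \<in> Obj D" "Y \<in> S" using that by auto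
      have i: "Id D (on_obj F (G Y)) \<in> Hom D (on_obj F (G Y)) (on_obj F (G Y))" by (rule d(1)[OF obj[OF G[OF Y]]])
      show ?thesis
        unfolding GF_def cat_map.simps Gd_id[OF Y]
        by (rule inj[OF G[OF Y] G[OF Y] lo(1)[OF G[OF Y] G[OF Y] i] c(1)[OF G[OF Y]]])
          (simp add: lo(2)[OF G[OF Y] G[OF Y] i] up_id G[OF Y])
    qed
    show "on_hom GF X Z (Comp D X Y Z h k) = Comp C (on_obj GF X) (on_obj GF Y) (on_obj GF Z) (on_hom GF Y Z h) (on_hom GF X Y k)"
      if "X \<in> Obj D \<inter> S" "Y \<in> Obj D \<inter> S" "Z \<in> Obj D \<inter> S" "k \<in> Hom D X Y" "h \<in> Hom D Y Z" for X Y Z k h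
    proof -
      have X: "X \<in> Obj D" "X \<in> S" and Y: "Y \<in> Obj D" "Y \<in> S" and Z: "Z \<in> Obj D" "Z \<in> S" using that by auto
      note k = that(4) and h = that(5)
      note g = G[OF X] G[OF Y] G[OF Z]
      note l1 = lo[OF g(1,2) Gd[OF X Y k]] and l2 = lo[OF g(2,3) Gd[OF Y Z h]]
      have hk: "Gd X Z (Comp D X Y Z h k) \<in> Hom D (on_obj F (G X)) (on_obj F (G Z))"
        by (rule Gd[OF X Z d(2)[OF X(1) Y(1) Z(1) k h]])
      show ?thesis
        unfolding GF_def cat_map.simps
        by (rule inj[OF g(1,3) lo(1)[OF g(1,3) hk] c(2)[OF g l1(1) l2(1)]])
          (unfold lo(2)[OF g(1,3) hk] up_comp[OF g l1(1) l2(1)] l1(2) l2(2), rule Gd_comp[OF X Y Z k h])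
    qed
  qed
  \<comment> \<open>The unit lifts the inverse isomorphisms \<open>e'\<close>, and its naturality
    becomes \<open>Gd_e'\<close> after applying \<open>F\<close>. The counit consists of the
    isomorphisms \<open>e\<close> themselves.\<close>
  define eta where "eta X = lo X (G (on_obj F X)) (e' (on_obj F X))" for X
  have eta: "natural_iso C C id_functor (comp_functor GF F) eta"
    unfolding natural_iso_def id_functor_def comp_functor_def GF_def cat_map.simps
  proof (intro conjI ballI)
    fix X assume X: "X \<in> Obj C"
    note FX = obj[OF X] im[OF X]
    note g = G[OF FX]
    have h1: "eta X \<in> Hom C X (G (on_obj F X))" "on_hom F X (G (on_obj F X)) (eta X) = e' (on_obj F X)"
      unfolding eta_def using lo[OF X g e'[OF FX]] by auto
    note h2 = lo[OF g X e[OF FX]]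
    show "is_iso C X (G (on_obj F X)) (eta X)"
      unfolding is_iso_def
    proof (intro conjI bexI[of _ "lo (G (on_obj F X)) X (e (on_obj F X))"])
      show "Comp C X (G (on_obj F X)) X (lo (G (on_obj F X)) X (e (on_obj F X))) (eta X) = Id C X"
        by (rule inj[OF X X c(2)[OF X g X h1(1) h2(1)] c(1)[OF X]])
          (simp add: up_comp[OF X g X h1(1) h2(1)] h1(2) h2(2) up_id[OF X] ee'[OF FX])
      show "Comp C (G (on_obj F X)) X (G (on_obj F X)) (eta X) (lo (G (on_obj F X)) X (e (on_obj F X))) = Id C (G (on_obj F X))"
        by (rule inj[OF g g c(2)[OF g X g h2(1) h1(1)] c(1)[OF g]])
          (simp add: up_comp[OF g X g h2(1) h1(1)] h1(2) h2(2) up_id[OF g] e'e[OF FX])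
    qed (fact h1 h2)+
  next
    fix X Y f assume X: "X \<in> Obj C" and Y: "Y \<in> Obj C" and f: "f \<in> Hom C X Y"
    note FX = obj[OF X] im[OF X] and FY = obj[OF Y] im[OF Y]
    note gX = G[OF FX] and gY = G[OF FY]
    have hX: "eta X \<in> Hom C X (G (on_obj F X))" "on_hom F X (G (on_obj F X)) (eta X) = e' (on_obj F X)"
      unfolding eta_def using lo[OF X gX e'[OF FX]] by auto
    have hY: "eta Y \<in> Hom C Y (G (on_obj F Y))" "on_hom F Y (G (on_obj F Y)) (eta Y) = e' (on_obj F Y)"
      unfolding eta_def using lo[OF Y gY e'[OF FY]] by auto
    note l = lo[OF gX gY Gd[OF FX FY up[OF X Y f]]]
    show "Comp C X Y (G (on_obj F Y)) (eta Y) f =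
        Comp C X (G (on_obj F X)) (G (on_obj F Y)) (lo (G (on_obj F X)) (G (on_obj F Y)) (Gd (on_obj F X) (on_obj F Y) (on_hom F X Y f))) (eta X)"
      by (rule inj[OF X gY c(2)[OF X Y gY f hY(1)] c(2)[OF X gX gY hX(1) l(1)]])
        (simp add: up_comp[OF X Y gY f hY(1)] up_comp[OF X gX gY hX(1) l(1)] hX(2) hY(2) l(2) Gd_e'[OF FX FY up[OF X Y f]])
  qed
  have eps: "natural_iso ?D ?D (comp_functor F GF) id_functor e"
    unfolding natural_iso_def id_functor_def comp_functor_def GF_def cat_map.simps fs
  proof (intro conjI ballI)
    fix Y assume "Y \<in> Obj D \<inter> S"
    then have Y: "Y \<in> Obj D" "Y \<in> S" by auto
    show "is_iso ?D (on_obj F (G Y)) Y (e Y)"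
      unfolding is_iso_def fs using e[OF Y] e'[OF Y] e'e[OF Y] ee'[OF Y] by blast
    fix Z k assume "Z \<in> Obj D \<inter> S" and k: "k \<in> Hom D Y Z"
    then have Z: "Z \<in> Obj D" "Z \<in> S" by auto
    show "Comp D (on_obj F (G Y)) (on_obj F (G Z)) Z (e Z) (on_hom F (G Y) (G Z) (lo (G Y) (G Z) (Gd Y Z k))) =
        Comp D (on_obj F (G Y)) Y Z k (e Y)"
      unfolding lo(2)[OF G[OF Y] G[OF Z] Gd[OF Y Z k]] by (rule e_Gd[OF Y Z k])
  qed
  show ?thesis unfolding is_equivalence_def using FD GF eta eps by blast
qed

lemma is_category_dgMod: "is_category (dgMod A)"
proof (rule categoryI)
  fix P assume "P \<in> Obj (dgMod A)"
  then interpret dg_module A P by (simp add: dgMod_def)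
  show "Id (dgMod A) P \<in> Hom (dgMod A) P P"
    using summand_closed(1) by (auto simp: dgMod_def linear_map_def has_degree_def act_closed diff_closed subset_iff)
next
  fix P Q R F G assume "P \<in> Obj (dgMod A)" and F: "F \<in> Hom (dgMod A) P Q" and G: "G \<in> Hom (dgMod A) Q R"
  then interpret dg_module A P by (simp add: dgMod_def)
  have g: "x \<in> carrier P" if "x \<in> grade P i" for x i using summand_closed(1) that by blast
  show "Comp (dgMod A) P Q R G F \<in> Hom (dgMod A) P R"
    using F G by (auto simp: dgMod_def linear_map_def has_degree_def act_closed diff_closed compose_def Pi_def g)
next
  fix P Q F assume F: "F \<in> Hom (dgMod A) P Q"
  show "Comp (dgMod A) P P Q F (Id (dgMod A) P) = F"
    using F by (auto simp: dgMod_def compose_def extensional_def fun_eq_iff)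
  show "Comp (dgMod A) P Q Q (Id (dgMod A) Q) F = F"
    using F by (auto simp: dgMod_def compose_def extensional_def fun_eq_iff linear_map_def Pi_def)
next
  fix P Q R U F G H assume F: "F \<in> Hom (dgMod A) P Q"
  show "Comp (dgMod A) P Q U (Comp (dgMod A) Q R U H G) F = Comp (dgMod A) P R U H (Comp (dgMod A) P Q R G F)"
    using F by (auto simp: dgMod_def compose_def fun_eq_iff linear_map_def Pi_def)
qed

section \<open>Full faithfulness, and the image of the functor: finitely generated semifree
  modules\<close>

section \<open>The Chevalley-Eilenberg functor\<close>

context CE_algebra
begin

interpretation A: ring A by (rule ring_A)

lemma one_nonzero: "\<one>\<^bsub>A\<^esub> \<noteq> \<zero>\<^bsub>A\<^esub>"
  using eps_one linear_map_zero[OF eps_linear vector_spaceD(9)[OF module_A] vector_spaceD(9)[OF module_ground]] by auto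

lemma ex_infty_cochains:
  assumes "is_infty_module g M"
  shows "\<exists>B deg co. infty_cochains g eps M B deg co"
proof -
  interpret M: finite_dim_complex M using assms by (simp add: is_infty_module_def)
  obtain B deg co where "homogeneous_basis M B deg co"
    using M.ex_homogeneous_basis[OF M.finite_dim] by blast
  then have "infty_cochains g eps M B deg co"
    using assms M.graded_vector_space_axioms CE_algebra_axioms
    by (intro infty_cochains.intro cochain_module.intro cochain_module_axioms.intro infty_cochains_axioms.intro)
      (simp_all add: is_infty_module_def)
  then show ?thesis by blast
qed

text \<open>Inverse of the functor on hom-sets. Composition in \<open>lfMod\<close> is by definition
  \<open>lower\<close> applied to the composite of the extensions, which is the form that
  \<open>fully_faithful_pullback\<close> expects.\<close>

definition lower :: "('k, 'g, 'm) infty_module \<Rightarrow> ('k, 'g, 'm) infty_module \<Rightarrow>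
    (('k, 'g, 'm) cochain \<Rightarrow> ('k, 'g, 'm) cochain) \<Rightarrow> ('k, 'g, 'm) infty_hom" where
  "lower M N F = (\<lambda>k. \<lambda>m\<in>carrier M.
     component (cochains g N) (cochains_power g N) k (F (tensor_elem A M \<one>\<^bsub>A\<^esub> m)))"

abbreviation "lf_hom M N \<equiv> Hom (lfMod g) M N"
abbreviation "dg_hom M N \<equiv> Hom (dgMod (CE g)) (CE_module g M) (CE_module g N)"

lemma dg_hom_iff:
  "F \<in> dg_hom M N \<longleftrightarrow> F \<in> extensional (carrier (cochains g M)) \<and>
     (\<forall>t\<in>carrier (cochains g M). F t \<in> carrier (cochains g N)) \<and>
     (\<forall>s\<in>carrier (cochains g M). \<forall>t\<in>carrier (cochains g M).
        F (s \<oplus>\<^bsub>cochains g M\<^esub> t) = F s \<oplus>\<^bsub>cochains g N\<^esub> F t) \<and>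
     (\<forall>c\<in>carrier A. \<forall>t\<in>carrier (cochains g M). F (cochains_act g M c t) = cochains_act g N c (F t)) \<and>
     has_degree 0 (cochains g M) (cochains g N) F \<and>
     (\<forall>t\<in>carrier (cochains g M). F (d_tot g M t) = d_tot g N (F t))"
  by (auto simp: dgMod_def linear_map_def CE_module_simps CE_simps has_degree_def Pi_def)

lemma lf_hom_iff:
  "f \<in> lf_hom M N \<longleftrightarrow> (\<forall>k. f k \<in> extensional (carrier M)) \<and> is_infty_hom g M N f"
  by (simp add: lfMod_def)

context
  fixes M N :: "('k, 'g, 'm) infty_module" and BM degM coM BN degN coN
  assumes M: "infty_cochains g eps M BM degM coM" and N: "infty_cochains g eps N BN degN coN"
begin

interpretation M: infty_cochains g eps M BM degM coM by (rule M)
interpretation N: infty_cochains g eps N BN degN coN by (rule N)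
interpretation P: cochain_pair g eps M BM degM coM N BN degN coN ..

lemma up_hom:
  assumes f: "f \<in> lf_hom M N"
  shows "restrict (infty_extension g N f) (carrier M.T) \<in> dg_hom M N"
    and "m \<in> carrier M \<Longrightarrow> infty_extension g N f (M.te \<one>\<^bsub>A\<^esub> m) = total g N f m"
    and "t \<in> carrier M.T \<Longrightarrow> infty_extension g N f t \<in> carrier N.T"
    and "lower M N (restrict (infty_extension g N f) (carrier M.T)) = f"
proof -
  have fam: "locally_finite_family 0 g M N f"
    and d: "\<And>t. t \<in> carrier M.T \<Longrightarrow> infty_extension g N f (d_tot g M t) = d_tot g N (infty_extension g N f t)"
    and extl: "\<And>k. f k \<in> extensional (carrier M)"
    using f by (simp_all add: lf_hom_iff is_infty_hom_def)
  note tl = P.total_linear[OF fam]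
  have E: "infty_extension g N f = extend_even g N (total g N f)" by (simp add: infty_extension_def)
  note l = linear_mapD'[OF P.even_linear[OF tl]]
  have deg: "has_degree 0 M.T N.T (infty_extension g N f)"
    unfolding E by (rule P.even_degree[OF tl P.total_degree[OF fam]])
  interpret TM: abelian_group M.T by (rule M.abelian_T)
  show "restrict (infty_extension g N f) (carrier M.T) \<in> dg_hom M N"
    unfolding dg_hom_iff
    using l(1,2) P.even_act[OF tl] deg d M.act_closed M.grade_T_closed linear_mapD'(1)[OF M.d_tot_linear]
    by (simp add: E has_degree_def)
  show one: "infty_extension g N f (M.te \<one>\<^bsub>A\<^esub> m) = total g N f m" if "m \<in> carrier M" for m
    unfolding E by (rule P.even_te_one[OF tl that])
  show "infty_extension g N f t \<in> carrier N.T" if "t \<in> carrier M.T" for t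
    unfolding E by (rule l(1)[OF that])
  show "lower M N (restrict (infty_extension g N f) (carrier M.T)) = f"
  proof (rule ext, rule ext)
    fix k m
    show "lower M N (restrict (infty_extension g N f) (carrier M.T)) k m = f k m"
      using extl[of k] M.te_closed[of "\<one>\<^bsub>A\<^esub>" m] one[of m] P.component_total[OF fam, of m k]
      by (cases "m \<in> carrier M") (simp_all add: lower_def extensional_def)
  qed
qed

lemma lower_hom:
  assumes F: "F \<in> dg_hom M N"
  shows "lower M N F \<in> lf_hom M N"
    and "restrict (infty_extension g N (lower M N F)) (carrier M.T) = F"
proof -
  note F' = F[unfolded dg_hom_iff]
  have cl: "\<And>t. t \<in> carrier M.T \<Longrightarrow> F t \<in> carrier N.T"
    and add: "\<And>s t. s \<in> carrier M.T \<Longrightarrow> t \<in> carrier M.T \<Longrightarrow> F (s \<oplus>\<^bsub>M.T\<^esub> t) = F s \<oplus>\<^bsub>N.T\<^esub> F t"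
    and act: "\<And>c t. c \<in> carrier A \<Longrightarrow> t \<in> carrier M.T \<Longrightarrow> F (M.act c t) = N.act c (F t)"
    and deg: "has_degree 0 M.T N.T F"
    and d: "\<And>t. t \<in> carrier M.T \<Longrightarrow> F (d_tot g M t) = d_tot g N (F t)"
    and ext: "F \<in> extensional (carrier M.T)"
    using F' by blast+
  have gen2: "linear_map scalars M N.T (\<lambda>m. F (M.te \<one>\<^bsub>A\<^esub> m))"
    by (rule P.determined_by_generators(2)) (use add act cl in auto)
  have gen3: "extend_even g N (\<lambda>m. F (M.te \<one>\<^bsub>A\<^esub> m)) t = F t" if "t \<in> carrier M.T" for t
    by (rule P.determined_by_generators(3)) (use add act cl that in auto)
  have deg': "has_degree 0 M N.T (\<lambda>m. F (M.te \<one>\<^bsub>A\<^esub> m))"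
    using deg M.te_one_grade by (simp add: has_degree_def)
  have comp: "m \<in> carrier M \<Longrightarrow> lower M N F k m = component N.T (cochains_power g N) k (F (M.te \<one>\<^bsub>A\<^esub> m))" for k m
    by (simp add: lower_def)
  note fam = P.family_of_components[OF gen2 deg' comp]
  have E: "infty_extension g N (lower M N F) t = F t" if t: "t \<in> carrier M.T" for t
  proof -
    have "infty_extension g N (lower M N F) t = extend_even g N (\<lambda>m. F (M.te \<one>\<^bsub>A\<^esub> m)) t"
      unfolding infty_extension_def by (rule P.even_cong[OF P.total_linear[OF fam(1)] gen2 fam(2) t])
    then show ?thesis using gen3[OF t] by simp
  qed
  show "lower M N F \<in> lf_hom M N"
    unfolding lf_hom_iff is_infty_hom_def
    using fam(1) d linear_mapD'(1)[OF M.d_tot_linear] by (simp add: E) (simp add: lower_def)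
  show "restrict (infty_extension g N (lower M N F)) (carrier M.T) = F"
    using ext E by (auto simp: extensional_def fun_eq_iff)
qed

end

lemma fully_faithful_CE_functor:
  "fully_faithful (lfMod g :: (('k, 'g, 'm) infty_module, ('k, 'g, 'm) infty_hom) category) (dgMod (CE g)) (CE_functor g)"
proof (rule fully_faithful_pullback[where lo = lower, OF is_category_dgMod])
  let ?C = "lfMod g :: (('k, 'g, 'm) infty_module, ('k, 'g, 'm) infty_hom) category"
  have ex: "\<exists>B deg co. infty_cochains g eps X B deg co" if "X \<in> Obj ?C" for X
    using that ex_infty_cochains by (simp add: lfMod_def)
  have F: "on_obj (CE_functor g) X = CE_module g X"
    "on_hom (CE_functor g) X Y f = restrict (infty_extension g Y f) (carrier (cochains g X))"
    for X Y :: "('k, 'g, 'm) infty_module" and f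
    by (simp_all add: CE_functor_def)
  fix X assume X: "X \<in> Obj ?C"
  then obtain BX dX cX where IX: "infty_cochains g eps X BX dX cX" using ex by blast
  interpret X: infty_cochains g eps X BX dX cX by (rule IX)
  show "on_obj (CE_functor g) X \<in> Obj (dgMod (CE g))"
    using X.CE_module_dg X by (simp add: F dgMod_def lfMod_def is_infty_module_def)
  \<comment> \<open>The element 1 \<otimes> m lies in C^0(g, X), so the identity map has components
    only for \<open>k = 0\<close>.\<close>
  show "Id ?C X = lower X X (Id (dgMod (CE g)) (on_obj (CE_functor g) X))"
  proof (rule ext, rule ext)
    interpret D: internal_direct_sum X.T "cochains_power g X" by (rule X.direct_sum_power_T)
    fix k m
    show "Id ?C X k m = lower X X (Id (dgMod (CE g)) (on_obj (CE_functor g) X)) k m"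
      using X.te_closed[of "\<one>\<^bsub>A\<^esub>" m] D.component_delta[OF X.te_one_power, of m k]
      by (cases "m \<in> carrier X") (simp_all add: lfMod_def lower_def dgMod_def F CE_module_simps)
  qed
  fix Y assume Y: "Y \<in> Obj ?C"
  then obtain BY dY cY where IY: "infty_cochains g eps Y BY dY cY" using ex by blast
  show "on_hom (CE_functor g) X Y f \<in> Hom (dgMod (CE g)) (on_obj (CE_functor g) X) (on_obj (CE_functor g) Y)"
    "lower X Y (on_hom (CE_functor g) X Y f) = f" if "f \<in> Hom ?C X Y" for f
    unfolding F by (fact up_hom[OF IX IY that])+
  show "lower X Y h \<in> Hom ?C X Y" "on_hom (CE_functor g) X Y (lower X Y h) = h"
    if "h \<in> Hom (dgMod (CE g)) (on_obj (CE_functor g) X) (on_obj (CE_functor g) Y)" for h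
    unfolding F by (fact lower_hom[OF IX IY that[unfolded F]])+
  fix Z f h assume Z: "Z \<in> Obj ?C" and f: "f \<in> Hom ?C X Y" and h: "h \<in> Hom ?C Y Z"
  show "Comp ?C X Y Z h f = lower X Z (Comp (dgMod (CE g)) (on_obj (CE_functor g) X) (on_obj (CE_functor g) Y)
      (on_obj (CE_functor g) Z) (on_hom (CE_functor g) Y Z h) (on_hom (CE_functor g) X Y f))"
  proof (rule ext, rule ext)
    fix k m
    show "Comp ?C X Y Z h f k m = lower X Z (Comp (dgMod (CE g)) (on_obj (CE_functor g) X) (on_obj (CE_functor g) Y)
        (on_obj (CE_functor g) Z) (on_hom (CE_functor g) Y Z h) (on_hom (CE_functor g) X Y f)) k m"
      using X.te_closed[of "\<one>\<^bsub>A\<^esub>" m] up_hom(3)[OF IX IY f]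
      by (cases "m \<in> carrier X") (simp_all add: lfMod_def lower_def dgMod_def F CE_module_simps compose_def)
  qed
qed

end

context infty_cochains
begin

interpretation A: ring A by (rule ring_A)
interpretation TT: abelian_group T by (rule abelian_T)
interpretation MB: homogeneous_basis M B deg co by (rule basis_M)

text \<open>The coordinate at \<open>b\<close> is 1 on 1 \<otimes> b and 0 on the other generators,
  and these differ since the augmentation sends 1 to 1.\<close>

lemma te_one_inj: "inj_on (te \<one>\<^bsub>A\<^esub>) B"
proof (rule inj_onI)
  fix b b' assume b: "b \<in> B" and b': "b' \<in> B" and eq: "te \<one>\<^bsub>A\<^esub> b = te \<one>\<^bsub>A\<^esub> b'"
  have "co b b \<odot>\<^bsub>A\<^esub> \<one>\<^bsub>A\<^esub> = co b b' \<odot>\<^bsub>A\<^esub> \<one>\<^bsub>A\<^esub>"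
    using arg_cong[OF eq, of "coordinate b"] coordinate_elem[OF b _ basis_closed[OF b]] coordinate_elem[OF b _ basis_closed[OF b']] by simp
  then show "b = b'"
    using MB.co_basis[OF b b] MB.co_basis[OF b b'] vector_spaceD(5,6)[OF module_A, of "\<one>\<^bsub>A\<^esub>"] one_nonzero
    by (auto split: if_splits)
qed

abbreviation "gens \<equiv> te \<one>\<^bsub>A\<^esub> ` B"

lemma gens_closed: "gens \<subseteq> carrier T"
  by (rule image_subsetI) (simp add: te_closed basis_closed)

lemma sum_over_gens:
  assumes "c \<in> gens \<rightarrow> carrier A"
  shows "(\<Oplus>\<^bsub>T\<^esub>y\<in>gens. act (c y) y) = (\<Oplus>\<^bsub>T\<^esub>b\<in>B. te (c (te \<one>\<^bsub>A\<^esub> b)) b)"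
proof -
  have "(\<Oplus>\<^bsub>T\<^esub>y\<in>gens. act (c y) y) = (\<Oplus>\<^bsub>T\<^esub>b\<in>B. act (c (te \<one>\<^bsub>A\<^esub> b)) (te \<one>\<^bsub>A\<^esub> b))"
    by (rule TT.finsum_reindex[OF _ te_one_inj]) (use assms gens_closed act_closed in auto)
  also have "\<dots> = (\<Oplus>\<^bsub>T\<^esub>b\<in>B. te (c (te \<one>\<^bsub>A\<^esub> b)) b)"
  proof (rule TT.finsum_cong')
    have c: "c (te \<one>\<^bsub>A\<^esub> b) \<in> carrier A" if "b \<in> B" for b using assms that by blast
    show "(\<lambda>b. te (c (te \<one>\<^bsub>A\<^esub> b)) b) \<in> B \<rightarrow> carrier T" using te_closed[OF c basis_closed] by blast
    show "act (c (te \<one>\<^bsub>A\<^esub> b)) (te \<one>\<^bsub>A\<^esub> b) = te (c (te \<one>\<^bsub>A\<^esub> b)) b" if "b \<in> B" for b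
      by (rule te_act[OF c[OF that] basis_closed[OF that], symmetric])
  qed simp
  finally show ?thesis .
qed

text \<open>The coordinates reindexed by the generators 1 \<otimes> b and extended by zero, which is
  the shape of coefficient function that \<open>semifree\<close> asks for.\<close>

definition gen_coeff :: "('k, 'g, 'm) cochain \<Rightarrow> ('k, 'g, 'm) cochain \<Rightarrow> ('k, 'g) CE" where
  "gen_coeff t y = (if y \<in> gens then coordinate (inv_into B (te \<one>\<^bsub>A\<^esub>) y) t else \<zero>\<^bsub>A\<^esub>)"

lemma gen_coeff_te: "b \<in> B \<Longrightarrow> gen_coeff t (te \<one>\<^bsub>A\<^esub> b) = coordinate b t"
  by (simp add: gen_coeff_def inv_into_f_f[OF te_one_inj])

lemma gen_coeff_closed: "t \<in> carrier T \<Longrightarrow> gen_coeff t y \<in> carrier A"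
  using linear_mapD'(1)[OF coordinate_linear] inv_into_into[of y "te \<one>\<^bsub>A\<^esub>" B] by (simp add: gen_coeff_def)

lemma gen_coeff_expand:
  assumes t: "t \<in> carrier T" shows "t = (\<Oplus>\<^bsub>T\<^esub>y\<in>gens. act (gen_coeff t y) y)"
proof -
  have "(\<Oplus>\<^bsub>T\<^esub>y\<in>gens. act (gen_coeff t y) y) = (\<Oplus>\<^bsub>T\<^esub>b\<in>B. te (gen_coeff t (te \<one>\<^bsub>A\<^esub> b)) b)"
    by (rule sum_over_gens) (simp add: gen_coeff_closed[OF t])
  also have "\<dots> = (\<Oplus>\<^bsub>T\<^esub>b\<in>B. te (coordinate b t) b)"
    using te_closed[OF linear_mapD'(1)[OF coordinate_linear t] basis_closed]
    by (intro TT.finsum_cong') (simp_all add: gen_coeff_te)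
  also have "\<dots> = t" by (rule coordinate_expand[OF t, symmetric])
  finally show ?thesis by (rule sym)
qed

lemma act_zero: "t \<in> carrier T \<Longrightarrow> act \<zero>\<^bsub>A\<^esub> t = \<zero>\<^bsub>T\<^esub>"
  using linear_map_zero[OF act_linear_left abelian_A abelian_T] .

lemma finsum_CE_module: "finsum (CE_module g M) = finsum T"
  by (rule finsum_ring_cong) (simp_all add: CE_module_simps)

lemma finitely_generated_CE_module: "finitely_generated (CE g) (CE_module g M)"
  unfolding finitely_generated_def CE_module_simps CE_simps finsum_CE_module
proof (intro exI[of _ gens] conjI ballI)
  show "finite gens" using MB.finite_basis by simp
  show "\<exists>c\<in>gens \<rightarrow> carrier A. t = (\<Oplus>\<^bsub>T\<^esub>y\<in>gens. act (c y) y)" if "t \<in> carrier T" for t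
    using gen_coeff_expand[OF that] gen_coeff_closed[OF that] by (intro bexI[of _ "gen_coeff t"]) auto
qed (rule gens_closed)

lemma semifree_CE_module: "semifree (CE g) (CE_module g M)"
  unfolding semifree_def CE_module_simps CE_simps finsum_CE_module
proof (intro exI[of _ gens] conjI ballI)
  show "\<exists>i. y \<in> grade T i" if "y \<in> gens" for y
    using that te_one_grade[OF MB.basis_grade] by blast
  fix t assume t: "t \<in> carrier T"
  \<comment> \<open>\<open>semifree\<close> sums over the support of the coefficients. Passing to
    the fixed finite index set makes \<open>sum_over_gens\<close> and \<open>coordinate_sum\<close>
    applicable.\<close>
  have sup: "(\<Oplus>\<^bsub>T\<^esub>y\<in>{y. c y \<noteq> \<zero>\<^bsub>A\<^esub>}. act (c y) y) = (\<Oplus>\<^bsub>T\<^esub>y\<in>gens. act (c y) y)"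
    if c: "\<forall>y. c y \<in> carrier A" "\<forall>y. y \<notin> gens \<longrightarrow> c y = \<zero>\<^bsub>A\<^esub>" for c
    using c gens_closed act_zero act_closed MB.finite_basis by (intro TT.finsum_superset) auto
  show "\<exists>!c. (\<forall>y. c y \<in> carrier A) \<and> (\<forall>y. y \<notin> gens \<longrightarrow> c y = \<zero>\<^bsub>A\<^esub>) \<and> finite {y. c y \<noteq> \<zero>\<^bsub>A\<^esub>} \<and>
      t = (\<Oplus>\<^bsub>T\<^esub>y\<in>{y. c y \<noteq> \<zero>\<^bsub>A\<^esub>}. act (c y) y)"
  proof (rule ex1I[of _ "gen_coeff t"])
    have 1: "\<forall>y. gen_coeff t y \<in> carrier A" "\<forall>y. y \<notin> gens \<longrightarrow> gen_coeff t y = \<zero>\<^bsub>A\<^esub>"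
      using gen_coeff_closed[OF t] by (simp_all add: gen_coeff_def)
    have "{y. gen_coeff t y \<noteq> \<zero>\<^bsub>A\<^esub>} \<subseteq> gens" using 1(2) by blast
    then have 2: "finite {y. gen_coeff t y \<noteq> \<zero>\<^bsub>A\<^esub>}" by (rule finite_subset) (simp add: MB.finite_basis)
    show "(\<forall>y. gen_coeff t y \<in> carrier A) \<and> (\<forall>y. y \<notin> gens \<longrightarrow> gen_coeff t y = \<zero>\<^bsub>A\<^esub>) \<and> finite {y. gen_coeff t y \<noteq> \<zero>\<^bsub>A\<^esub>} \<and>
        t = (\<Oplus>\<^bsub>T\<^esub>y\<in>{y. gen_coeff t y \<noteq> \<zero>\<^bsub>A\<^esub>}. act (gen_coeff t y) y)"
      unfolding sup[OF 1] using 1 2 gen_coeff_expand[OF t] by blast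
  next
    fix c assume c: "(\<forall>y. c y \<in> carrier A) \<and> (\<forall>y. y \<notin> gens \<longrightarrow> c y = \<zero>\<^bsub>A\<^esub>) \<and> finite {y. c y \<noteq> \<zero>\<^bsub>A\<^esub>} \<and>
        t = (\<Oplus>\<^bsub>T\<^esub>y\<in>{y. c y \<noteq> \<zero>\<^bsub>A\<^esub>}. act (c y) y)"
    then have cc: "\<forall>y. c y \<in> carrier A" "\<forall>y. y \<notin> gens \<longrightarrow> c y = \<zero>\<^bsub>A\<^esub>" by blast+
    have "t = (\<Oplus>\<^bsub>T\<^esub>y\<in>gens. act (c y) y)" using c sup[OF cc] by (elim conjE) (erule trans)
    also have "\<dots> = (\<Oplus>\<^bsub>T\<^esub>b\<in>B. te (c (te \<one>\<^bsub>A\<^esub> b)) b)" using cc(1) by (intro sum_over_gens) simp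
    finally have e: "t = (\<Oplus>\<^bsub>T\<^esub>b\<in>B. te (c (te \<one>\<^bsub>A\<^esub> b)) b)" .
    show "c = gen_coeff t"
    proof
      fix y
      show "c y = gen_coeff t y"
      proof (cases "y \<in> gens")
        case True
        then obtain b where b: "b \<in> B" "y = te \<one>\<^bsub>A\<^esub> b" by blast
        have "coordinate b t = c (te \<one>\<^bsub>A\<^esub> b)"
          by (subst e, rule coordinate_sum[where c = "\<lambda>b. c (te \<one>\<^bsub>A\<^esub> b)"]) (use cc(1) b(1) in auto)
        then show ?thesis by (simp add: b(2) gen_coeff_te[OF b(1)])
      qed (use cc(2) in \<open>simp add: gen_coeff_def\<close>)
    qed
  qed
qed

end

section \<open>Realising a finite-dimensional graded space inside the type \<open>'m\<close>\<close>

section \<open>Graded vector spaces with a prescribed finite basis\<close>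

text \<open>An infinite set is equinumerous with its square, so one coordinate can be merged with
  the code of the remaining ones at each step of the induction.\<close>

lemma finitely_supported_functions_embed:
  assumes "finite I" and inf: "infinite (UNIV :: 'k set)"
  shows "\<exists>j :: ('i \<Rightarrow> 'k::zero) \<Rightarrow> 'k. inj_on j {f. \<forall>i. i \<notin> I \<longrightarrow> f i = 0}"
  using assms(1)
proof (induction I)
  case empty
  have "{f :: 'i \<Rightarrow> 'k. \<forall>i. i \<notin> {} \<longrightarrow> f i = 0} = {\<lambda>i. 0}" by auto
  then show ?case by simp
next
  case (insert i I)
  then obtain j :: "('i \<Rightarrow> 'k) \<Rightarrow> 'k" where j: "inj_on j {f. \<forall>i. i \<notin> I \<longrightarrow> f i = 0}" by blast
  have "(card_of (UNIV \<times> UNIV :: ('k \<times> 'k) set), card_of (UNIV :: 'k set)) \<in> ordLeq"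
    by (rule ordIso_imp_ordLeq[OF card_of_Times_same_infinite[OF inf]])
  then obtain p :: "'k \<times> 'k \<Rightarrow> 'k" where p: "inj p"
    unfolding card_of_ordLeq[symmetric] by auto
  have "inj_on (\<lambda>f. p (f i, j (f(i := 0)))) {f. \<forall>l. l \<notin> insert i I \<longrightarrow> f l = 0}"
  proof (rule inj_onI)
    fix f h :: "'i \<Rightarrow> 'k"
    assume f: "f \<in> {f. \<forall>l. l \<notin> insert i I \<longrightarrow> f l = 0}" and h: "h \<in> {f. \<forall>l. l \<notin> insert i I \<longrightarrow> f l = 0}"
      and eq: "p (f i, j (f(i := 0))) = p (h i, j (h(i := 0)))"
    have i: "f i = h i" and r: "j (f(i := 0)) = j (h(i := 0))" using injD[OF p eq] by auto
    have "f(i := 0) = h(i := 0)" using f h by (intro inj_onD[OF j, OF r]) auto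
    then show "f = h" using i by (metis fun_upd_triv fun_upd_upd)
  qed
  then show ?case by blast
qed

text \<open>Transport of structure along the injection \<open>j\<close>. The parameter
  \<open>rest\<close> stands for further record fields, in which a grading is inserted
  later.\<close>

lemma ex_transported_free_module:
  fixes j :: "('i \<Rightarrow> 'k::field) \<Rightarrow> 'm" and rest :: 'e
  assumes "inj_on j (carrier (free_module I))"
  defines "V \<equiv> free_module I" and "h \<equiv> inv_into (carrier (free_module I)) j"
  defines "W \<equiv> \<lparr>carrier = j ` carrier V, mult = undefined, one = undefined, zero = j \<zero>\<^bsub>V\<^esub>,
      add = (\<lambda>x y. j (h x \<oplus>\<^bsub>V\<^esub> h y)), smult = (\<lambda>a x. j (a \<odot>\<^bsub>V\<^esub> h x)), \<dots> = rest\<rparr>"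
  shows "module scalars W" and "linear_map scalars V W j" and "linear_map scalars W V h"
proof -
  interpret V: module scalars V rewrites "carrier scalars = UNIV"
    unfolding V_def by (rule module_free) simp
  have hj: "h (j f) = f" if "f \<in> carrier V" for f
    using inv_into_f_f[OF assms(1)] that by (simp add: h_def V_def)
  have "abelian_group W"
  proof (rule abelian_groupI)
    show "\<exists>y\<in>carrier W. y \<oplus>\<^bsub>W\<^esub> x = \<zero>\<^bsub>W\<^esub>" if "x \<in> carrier W" for x
    proof -
      obtain f where f: "f \<in> carrier V" "x = j f" using \<open>x \<in> carrier W\<close> by (auto simp: W_def)
      have "j (\<ominus>\<^bsub>V\<^esub> f) \<oplus>\<^bsub>W\<^esub> x = \<zero>\<^bsub>W\<^esub>" using f V.l_neg[OF f(1)] by (simp add: W_def hj)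
      then show ?thesis using V.a_inv_closed[OF f(1)] by (intro bexI[of _ "j (\<ominus>\<^bsub>V\<^esub> f)"]) (simp_all add: W_def)
    qed
  qed (auto simp: W_def hj V.a_ac)
  then show "module scalars W"
    by (rule vector_spaceI) (auto simp: W_def hj vector_spaceD(2,3)[OF V.module_axioms] vector_spaceD(1,5)[OF V.module_axioms] vector_spaceD(4)[OF V.module_axioms])
  show "linear_map scalars V W j" by (rule linear_mapI) (simp_all add: W_def hj)
  show "linear_map scalars W V h" by (rule linear_mapI) (auto simp: W_def hj vector_spaceD(1)[OF V.module_axioms])
qed

text \<open>The part of degree \<open>i\<close> is the span of the basis elements of that degree,
  described by the vanishing of the other coordinates; discarding those coordinates gives the
  projections.\<close>

lemma graded_by_basis:
  fixes V :: "('k::field, 'v, 'e) graded_scheme"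
  assumes V: "module scalars V" and fin: "finite B" and B: "B \<subseteq> carrier V"
    and co: "\<And>b. b \<in> B \<Longrightarrow> linear_map scalars V ground (co b)"
    and expand: "\<And>x. x \<in> carrier V \<Longrightarrow> x = (\<Oplus>\<^bsub>V\<^esub>b\<in>B. co b x \<odot>\<^bsub>V\<^esub> b)"
    and co_basis: "\<And>b b'. b \<in> B \<Longrightarrow> b' \<in> B \<Longrightarrow> co b b' = (if b' = b then 1 else 0)"
    and grade: "\<And>i. grade V i = {x \<in> carrier V. \<forall>b\<in>B. deg b \<noteq> i \<longrightarrow> co b x = 0}"
  shows "graded_vector_space V" and "homogeneous_basis V B deg co"
proof -
  interpret V: module scalars V rewrites "carrier scalars = UNIV" by (rule V) simp
  note co' = linear_mapD'[OF co, unfolded ground_simps]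
  have co0: "co b \<zero>\<^bsub>V\<^esub> = 0" if "b \<in> B" for b
    using linear_map_zero[OF co[OF that] V.abelian_group_axioms vector_spaceD(9)[OF module_ground]] by simp
  have sub: "submodule (grade V i) scalars V" for i
    by (rule V.submoduleI)
      (auto simp: grade co'(2,3) co0 V.a_inv_closed vector_spaceD(1)[OF V] vector_spaceD(8)[OF V])
  show "homogeneous_basis V B deg co"
    using fin B co' expand co_basis by unfold_locales (auto simp: grade co_basis)
  define p where "p i x = (\<Oplus>\<^bsub>V\<^esub>b\<in>B. (if deg b = i then co b x else 0) \<odot>\<^bsub>V\<^esub> b)" for i x
  have "internal_direct_sum V (grade V)"
  proof (rule direct_sum_of_projections(1)[where p = p, OF V sub])
    show "linear_map scalars V V (p i)" for i
      unfolding p_def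
    proof (rule linear_map_finsum_fun[OF V V])
      show "linear_map scalars V V (\<lambda>x. (if deg b = i then co b x else 0) \<odot>\<^bsub>V\<^esub> b)" if b: "b \<in> B" for b
        using b B co'(1)[OF b] vector_spaceD(1,2,6)[OF V, of b] vector_spaceD(4)[OF V, of b] vector_spaceD(7)[OF V]
        by (cases "deg b = i") (auto intro!: linear_mapI simp: co'(2,3)[OF b])
    qed
    show "p i x = x" if x: "x \<in> grade V i" for i x
    proof -
      have xc: "x \<in> carrier V" using x by (simp add: grade)
      have "p i x = (\<Oplus>\<^bsub>V\<^esub>b\<in>B. co b x \<odot>\<^bsub>V\<^esub> b)"
        unfolding p_def using x B vector_spaceD(1)[OF V] by (intro V.finsum_cong') (auto simp: grade)
      also have "\<dots> = x" by (rule expand[OF xc, symmetric])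
      finally show ?thesis .
    qed
    show "p l x = \<zero>\<^bsub>V\<^esub>" if x: "x \<in> grade V i" and "l \<noteq> i" for i l x
      unfolding p_def
    proof (rule V.add.finprod_one_eqI)
      show "(if deg b = l then co b x else 0) \<odot>\<^bsub>V\<^esub> b = \<zero>\<^bsub>V\<^esub>" if "b \<in> B" for b
        using x \<open>l \<noteq> i\<close> that B vector_spaceD(6)[OF V, of b] by (auto simp: grade)
    qed
    show "carrier V \<subseteq> linear_span scalars V (\<Union>i. grade V i)"
    proof
      fix x assume x: "x \<in> carrier V"
      have gc: "(\<Union>i. grade V i) \<subseteq> carrier V" by (auto simp: grade)
      have "b \<in> grade V (deg b)" if "b \<in> B" for b using that B by (auto simp: grade co_basis)
      then have "co b x \<odot>\<^bsub>V\<^esub> b \<in> (\<Union>i. grade V i)" if "b \<in> B" for b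
        using submoduleD(4)[OF sub V] that by (intro UN_I[of "deg b"]) auto
      then have "(\<Oplus>\<^bsub>V\<^esub>b\<in>B. co b x \<odot>\<^bsub>V\<^esub> b) \<in> linear_span scalars V (\<Union>i. grade V i)"
        using linear_span_superset[of "\<Union>i. grade V i" scalars V] by (intro finsum_in_linear_span[OF V gc]) blast
      then show "x \<in> linear_span scalars V (\<Union>i. grade V i)" using expand[OF x] by simp
    qed
  qed
  then show "graded_vector_space V"
    using V submoduleD(4)[OF sub V] by (intro graded_vector_space.intro graded_vector_space_axioms.intro) auto
qed

text \<open>This is where the size of \<open>'m\<close> enters: functions from the finite set
  \<open>I\<close> to k are encoded in k, which is infinite, and k is placed in \<open>'m\<close> by
  \<iota>. The index set may live in any type, such as that of the cochains.\<close>

lemma ex_graded_vector_space_with_basis: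
  fixes \<iota> :: "'k::field \<Rightarrow> 'm" and I :: "'i set" and deg :: "'i \<Rightarrow> int"
  assumes I: "finite I" and inf: "infinite (UNIV :: 'k set)" and \<iota>: "inj \<iota>"
  shows "\<exists>(M :: ('k, 'm, 'e) graded_scheme) e d co. graded_vector_space M \<and> inj_on e I \<and>
           homogeneous_basis M (e ` I) d co \<and> (\<forall>i\<in>I. d (e i) = deg i)"
proof -
  define V where "V = (free_module I :: ('k, 'i \<Rightarrow> 'k) module)"
  obtain j0 :: "('i \<Rightarrow> 'k) \<Rightarrow> 'k" where j0: "inj_on j0 {f. \<forall>i. i \<notin> I \<longrightarrow> f i = 0}"
    using finitely_supported_functions_embed[OF I inf] by blast
  have "inj_on j0 (carrier V)" by (rule inj_on_subset[OF j0]) (auto simp: V_def)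
  then have "inj_on (\<iota> \<circ> j0) (carrier V)" using \<iota> by (intro comp_inj_on) (auto intro: inj_on_subset)
  then obtain j :: "('i \<Rightarrow> 'k) \<Rightarrow> 'm" where j: "inj_on j (carrier V)" by blast
  define h where "h = inv_into (carrier V) j"
  define e where "e i = j (single i)" for i
  define r where "r = inv_into I e"
  define co where "co b x = h x (r b)" for b x
  define W :: "('k, 'm, 'e) graded_scheme" where
    "W = \<lparr>carrier = j ` carrier V, mult = undefined, one = undefined, zero = j \<zero>\<^bsub>V\<^esub>,
      add = (\<lambda>x y. j (h x \<oplus>\<^bsub>V\<^esub> h y)), smult = (\<lambda>a x. j (a \<odot>\<^bsub>V\<^esub> h x)),
      grade = (\<lambda>i. {x \<in> j ` carrier V. \<forall>b\<in>e ` I. deg (r b) \<noteq> i \<longrightarrow> co b x = 0}), \<dots> = undefined\<rparr>"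
  note W = ex_transported_free_module[OF j[unfolded V_def], folded V_def, folded h_def,
      where rest = "\<lparr>grade = (\<lambda>i. {x \<in> j ` carrier V. \<forall>b\<in>e ` I. deg (r b) \<noteq> i \<longrightarrow> co b x = 0}), \<dots> = (undefined :: 'e)\<rparr>",
      folded W_def]
  have V: "module scalars V" unfolding V_def by (rule module_free)
  interpret VG: abelian_group V by (rule vector_spaceD(9)[OF V])
  interpret WG: abelian_group W by (rule vector_spaceD(9)[OF W(1)])
  have single: "single i \<in> carrier V" if "i \<in> I" for i unfolding V_def by (rule single_closed[OF that])
  have hj: "h (j f) = f" if "f \<in> carrier V" for f using inv_into_f_f[OF j that] by (simp add: h_def)
  have e: "inj_on e I"
  proof (rule inj_onI)
    fix i l assume i: "i \<in> I" and l: "l \<in> I" and eq: "e i = e l"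
    have "single i = (single l :: 'i \<Rightarrow> 'k)" using eq by (intro inj_onD[OF j _ single[OF i] single[OF l]]) (simp add: e_def)
    from fun_cong[OF this, of i] show "i = l" by (simp add: single_def split: if_splits)
  qed
  have r: "r (e i) = i" if "i \<in> I" for i using inv_into_f_f[OF e that] by (simp add: r_def)
  have eval: "linear_map scalars V ground (\<lambda>f. f i)" for i
    by (rule linear_mapI) (simp_all add: V_def)
  have eC: "e i \<in> carrier W" if "i \<in> I" for i using linear_mapD'(1)[OF W(2) single[OF that]] by (simp add: e_def)
  have expand: "x = (\<Oplus>\<^bsub>W\<^esub>b\<in>e ` I. co b x \<odot>\<^bsub>W\<^esub> b)" if x: "x \<in> carrier W" for x
  proof -
    obtain f where f: "f \<in> carrier V" "x = j f" using x by (auto simp: W_def)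
    have cl: "f l \<odot>\<^bsub>V\<^esub> single l \<in> carrier V" if "l \<in> I" for l
      by (rule vector_spaceD(1)[OF V single[OF that]])
    have "f = (\<Oplus>\<^bsub>V\<^esub>l\<in>I. f l \<odot>\<^bsub>V\<^esub> single l)"
    proof
      fix i
      have "(\<Oplus>\<^bsub>V\<^esub>l\<in>I. f l \<odot>\<^bsub>V\<^esub> single l) i = (\<Sum>l\<in>I. (f l \<odot>\<^bsub>V\<^esub> single l) i)"
        unfolding finsum_ground[symmetric] using cl
        by (intro linear_map_finsum[OF eval VG.abelian_group_axioms vector_spaceD(9)[OF module_ground]]) blast
      also have "\<dots> = (\<Sum>l\<in>I. if l = i then f i else 0)"
        by (intro sum.cong) (auto simp: V_def single_def)
      also have "\<dots> = f i" using f(1) I by (auto simp: V_def)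
      finally show "f i = (\<Oplus>\<^bsub>V\<^esub>l\<in>I. f l \<odot>\<^bsub>V\<^esub> single l) i" by (rule sym)
    qed
    then have "j f = j (\<Oplus>\<^bsub>V\<^esub>l\<in>I. f l \<odot>\<^bsub>V\<^esub> single l)" by (rule arg_cong)
    also have "\<dots> = (\<Oplus>\<^bsub>W\<^esub>l\<in>I. j (f l \<odot>\<^bsub>V\<^esub> single l))"
      using cl by (intro linear_map_finsum[OF W(2) VG.abelian_group_axioms WG.abelian_group_axioms]) blast
    also have "\<dots> = (\<Oplus>\<^bsub>W\<^esub>l\<in>I. co (e l) x \<odot>\<^bsub>W\<^esub> e l)"
      using linear_mapD'(3)[OF W(2) single] vector_spaceD(1)[OF W(1) eC] f
      by (intro WG.finsum_cong') (auto simp: co_def r[unfolded e_def] hj e_def)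
    also have "\<dots> = (\<Oplus>\<^bsub>W\<^esub>b\<in>e ` I. co b x \<odot>\<^bsub>W\<^esub> b)"
      using vector_spaceD(1)[OF W(1) eC] by (intro WG.finsum_reindex[symmetric, OF _ e]) auto
    finally show ?thesis by (simp add: f(2))
  qed
  have co: "linear_map scalars W ground (co b)" for b
    unfolding co_def by (rule linear_map_compose[OF W(3) eval])
  have co_basis: "co b b' = (if b' = b then 1 else 0)" if b: "b \<in> e ` I" and b': "b' \<in> e ` I" for b b'
  proof -
    obtain i l where "i \<in> I" "l \<in> I" "b = e i" "b' = e l" using b b' by blast
    moreover from this have "co b b' = single l i" by (simp add: co_def r) (simp add: e_def hj[OF single])
    ultimately show ?thesis using inj_on_eq_iff[OF e, of l i] by (simp add: single_def eq_commute[of i l])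
  qed
  have "finite (e ` I)" "e ` I \<subseteq> carrier W" using I eC by auto
  note graded = graded_by_basis[OF W(1) this co expand co_basis, where deg = "\<lambda>b. deg (r b)"]
  have "graded_vector_space W" "homogeneous_basis W (e ` I) (\<lambda>b. deg (r b)) co"
    by (rule graded; simp add: W_def)+
  then show ?thesis using e r
    by (intro exI[of _ W] exI[of _ e] exI[of _ "\<lambda>b. deg (r b)"] exI[of _ co]) simp
qed

section \<open>From a square-zero operator with the Leibniz rule on C(g) \<otimes> M to an
  infinity-module\<close>

section \<open>Infinity-modules from twisted differentials\<close>

text \<open>The tensor product looks only at the graded vector space. Replacing differential and
  structure maps therefore leaves C(g, M) literally the same, and nothing has to be
  transported.\<close>

lemma cochains_update:
  fixes M :: "('k::field, 'm, 't) dg_family"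
  shows "cochains g (M\<lparr>diff := d, structure_map := s\<rparr>) = cochains g M"
    and "tensor_elem (CE_alg g) (M\<lparr>diff := d, structure_map := s\<rparr>) = tensor_elem (CE_alg g) M"
  by (simp_all add: tensor_def tensor_space_def tensor_free_def tensor_null_def tensor_elem_def fun_eq_iff)

locale twisted_differential = cochain_module g eps M B deg co
  for g :: "('k::field, 'g) dg_lie" and eps and M :: "('k, 'g, 'm) infty_module" and B deg co +
  fixes d :: "('k, 'g, 'm) cochain \<Rightarrow> ('k, 'g, 'm) cochain"
  assumes d_closed: "t \<in> carrier (cochains g M) \<Longrightarrow> d t \<in> carrier (cochains g M)"
    and d_add: "\<lbrakk>s \<in> carrier (cochains g M); t \<in> carrier (cochains g M)\<rbrakk> \<Longrightarrow>
      d (s \<oplus>\<^bsub>cochains g M\<^esub> t) = d s \<oplus>\<^bsub>cochains g M\<^esub> d t"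
    and d_degree: "has_degree 1 (cochains g M) (cochains g M) d"
    and d_act: "\<lbrakk>c \<in> grade (CE_alg g) i; t \<in> carrier (cochains g M)\<rbrakk> \<Longrightarrow>
      d (cochains_act g M c t) = cochains_act g M (CE_diff g c) t
        \<oplus>\<^bsub>cochains g M\<^esub> koszul (cochains g M) i (cochains_act g M c (d t))"
    and d_square: "t \<in> carrier (cochains g M) \<Longrightarrow> d (d t) = \<zero>\<^bsub>cochains g M\<^esub>"
begin

interpretation A: ring A by (rule ring_A)
interpretation MV: graded_vector_space M by (rule graded_M)
interpretation MB: homogeneous_basis M B deg co by (rule basis_M)
interpretation TT: abelian_group T by (rule abelian_T)

text \<open>Scalars act as multiples of 1, which have degree 0 and are killed by the differential of
  C(g); linearity is thus a case of the Leibniz rule.\<close>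

lemma d_linear: "linear_map scalars T T d"
proof (rule linear_mapI)
  fix a t assume t: "t \<in> carrier T"
  have one: "a \<odot>\<^bsub>A\<^esub> \<one>\<^bsub>A\<^esub> \<in> grade A 0" using submoduleD(4)[OF submodule_grade module_A _ one_grade] by simp
  have "CE_diff g (a \<odot>\<^bsub>A\<^esub> \<one>\<^bsub>A\<^esub>) = \<zero>\<^bsub>A\<^esub>"
    using linear_mapD'(3)[OF diff_linear, of "\<one>\<^bsub>A\<^esub>" a] by (simp add: diff_one vector_spaceD(7)[OF module_A])
  moreover have "act \<zero>\<^bsub>A\<^esub> t = \<zero>\<^bsub>T\<^esub>" by (rule linear_map_zero[OF act_linear_left[OF t] abelian_A abelian_T])
  ultimately show "d (a \<odot>\<^bsub>T\<^esub> t) = a \<odot>\<^bsub>T\<^esub> d t"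
    using d_act[OF one t] by (simp add: act_smult_one t d_closed koszul_def vector_spaceD(1)[OF module_T])
qed (simp_all add: d_closed d_add)

abbreviation "d_one m \<equiv> d (te \<one>\<^bsub>A\<^esub> m)"

text \<open>The fields \<open>diff\<close> and \<open>structure_map\<close> of M are placeholders
  and are overwritten. By \<open>component_power_T_zero\<close> the new differential is the
  structure map for \<open>k = 0\<close>, read in M.\<close>

definition twisted_module :: "('k, 'g, 'm) infty_module" where
  "twisted_module = M\<lparr>diff := \<lambda>m. coefficient (d_one m),
     structure_map := \<lambda>k m. component T (cochains_power g M) k (d_one m)\<rparr>"

lemma twisted_simps:
  "carrier twisted_module = carrier M" "zero twisted_module = zero M" "add twisted_module = add M"
  "smult twisted_module = smult M" "grade twisted_module = grade M"
  "diff twisted_module = (\<lambda>m. coefficient (d_one m))"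
  "structure_map twisted_module = (\<lambda>k m. component T (cochains_power g M) k (d_one m))"
  "cochains g twisted_module = T" "tensor_elem A twisted_module = te"
  "cochains_power g twisted_module = cochains_power g M" "cochains_act g twisted_module = act"
  by (simp_all add: twisted_module_def cochains_update cochains_power_def[abs_def] cochains_act_def[abs_def])

lemma d_one_linear: "linear_map scalars M T (\<lambda>m. d_one m)"
  by (rule linear_map_compose[OF te_one_linear d_linear])

lemma d_one_degree: "has_degree 1 M T (\<lambda>m. d_one m)"
  using d_degree te_one_grade by (simp add: has_degree_def)

lemma finsum_twisted: "finsum twisted_module = finsum M"
  by (rule finsum_ring_cong) (simp_all add: twisted_simps)

lemma module_twisted: "module scalars twisted_module"
  by (rule vector_space_cong[OF _ _ _ _ module_M]) (simp_all add: twisted_simps)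

lemma graded_twisted: "graded_vector_space twisted_module"
proof (intro graded_vector_space.intro graded_vector_space_axioms.intro)
  show "internal_direct_sum twisted_module (grade twisted_module)"
    unfolding twisted_simps
    by (rule internal_direct_sum_cong[OF _ _ _ MV.internal_direct_sum_axioms]) (simp_all add: twisted_simps)
qed (simp_all add: module_twisted, simp add: twisted_simps MV.grade_smult)

lemma basis_twisted: "homogeneous_basis twisted_module B deg co"
  using basis_M by (simp add: homogeneous_basis_def twisted_simps finsum_twisted)

lemma cochain_module_twisted: "cochain_module g eps twisted_module B deg co"
  using CE_algebra_axioms graded_twisted basis_twisted
  by (intro cochain_module.intro cochain_module_axioms.intro)

lemma family_twisted: "locally_finite_family 1 g twisted_module twisted_module (structure_map twisted_module)"
  and total_twisted: "m \<in> carrier M \<Longrightarrow> total g twisted_module (structure_map twisted_module) m = d_one m"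
proof -
  interpret N: cochain_pair g eps twisted_module B deg co twisted_module B deg co
    using cochain_module_twisted by (intro cochain_pair.intro)
  have lin: "linear_map scalars twisted_module (cochains g twisted_module) (\<lambda>m. d_one m)"
    using d_one_linear by (simp add: linear_map_def twisted_simps)
  have deg: "has_degree 1 twisted_module (cochains g twisted_module) (\<lambda>m. d_one m)"
    using d_one_degree by (simp add: has_degree_def twisted_simps)
  have comp: "structure_map twisted_module k m =
      component (cochains g twisted_module) (cochains_power g twisted_module) k (d_one m)" for k m
    by (simp add: twisted_simps)
  note family = N.family_of_components[OF lin deg comp]
  show "locally_finite_family 1 g twisted_module twisted_module (structure_map twisted_module)" by (rule family(1))
  show "total g twisted_module (structure_map twisted_module) m = d_one m" if "m \<in> carrier M"
    using that by (intro family(2)) (simp add: twisted_simps)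
qed

lemma infty_cochains_twisted: "infty_cochains g eps twisted_module B deg co"
  by (intro infty_cochains.intro cochain_module_twisted infty_cochains_axioms.intro family_twisted)

text \<open>Both operators agree on the elements 1 \<otimes> m and satisfy the same Leibniz rule,
  which determines them on c \<otimes> m for homogeneous \<open>c\<close>.\<close>

lemma d_tot_twisted: "t \<in> carrier T \<Longrightarrow> d_tot g twisted_module t = d t"
proof -
  interpret N: infty_cochains g eps twisted_module B deg co by (rule infty_cochains_twisted)
  have lin: "linear_map scalars T T (d_tot g twisted_module)" using N.d_tot_linear unfolding twisted_simps .
  assume t: "t \<in> carrier T"
  show "d_tot g twisted_module t = d t"
  proof (rule T.tensor_eqI[OF lin d_linear module_T _ t])
    fix c m assume c: "c \<in> carrier A" and m: "m \<in> carrier M"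
    show "d_tot g twisted_module (te c m) = d (te c m)"
    proof (rule homogeneous_eqI[OF linear_map_compose[OF te_left[OF m] lin] linear_map_compose[OF te_left[OF m] d_linear] module_T _ c])
      fix i c assume c: "c \<in> grade A i"
      have "d_tot g twisted_module (te \<one>\<^bsub>A\<^esub> m) = d_one m"
        using N.d_tot_te_one m total_twisted by (simp add: twisted_simps)
      then show "d_tot g twisted_module (te c m) = d (te c m)"
        using N.d_tot_act[OF c, of "te \<one>\<^bsub>A\<^esub> m"] d_act[OF c, of "te \<one>\<^bsub>A\<^esub> m"] te_closed[OF A.one_closed m]
        by (simp add: te_act[OF grade_closed[OF c] m] twisted_simps)
    qed
  qed
qed

text \<open>Applied to the formula for d (c \<otimes> m), the augmentation kills the derivative of
  \<open>c\<close> and does not see the parity sign. Hence eps \<otimes> id intertwines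
  \<open>d\<close> with the candidate differential of M, which then squares to zero because
  \<open>d\<close> does.\<close>

lemma coefficient_d: "t \<in> carrier T \<Longrightarrow> coefficient (d t) = coefficient (d_one (coefficient t))"
proof (rule T.tensor_eqI[OF linear_map_compose[OF d_linear coefficient_linear]
      linear_map_compose[OF coefficient_linear linear_map_compose[OF d_one_linear coefficient_linear]] module_M])
  interpret N: infty_cochains g eps twisted_module B deg co by (rule infty_cochains_twisted)
  fix c m assume c: "c \<in> carrier A" and m: "m \<in> carrier M"
  have dc: "CE_diff g c \<in> carrier A" and pc: "parity A c \<in> carrier A" and dm: "d_one m \<in> carrier T"
    using linear_mapD'(1)[OF diff_linear c] linear_mapD'(1)[OF parity_A_linear c] linear_mapD'(1)[OF d_one_linear m] .
  have "d (te c m) = te (CE_diff g c) m \<oplus>\<^bsub>T\<^esub> act (parity A c) (d_one m)"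
    using N.d_tot_elem[of c m] c m by (simp add: twisted_simps total_twisted[unfolded twisted_simps] d_tot_twisted te_closed)
  then have "coefficient (d (te c m)) = eps c \<odot>\<^bsub>M\<^esub> coefficient (d_one m)"
    using dc pc dm c m linear_mapD'(1)[OF coefficient_linear dm]
    by (simp add: linear_mapD'(2)[OF coefficient_linear] te_closed act_closed coefficient_elem coefficient_act
        eps_diff eps_parity vector_spaceD(1,6)[OF module_M])
  also have "\<dots> = coefficient (d_one (coefficient (te c m)))"
    using c m dm by (simp add: coefficient_elem linear_mapD'(3)[OF d_one_linear] linear_mapD'(3)[OF coefficient_linear])
  finally show "coefficient (d (te c m)) = coefficient (d_one (coefficient (te c m)))" .
qed

lemma is_infty_module_twisted: "is_infty_module g twisted_module"
  unfolding is_infty_module_def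
proof (intro conjI ballI)
  show "finite_dim_complex twisted_module"
  proof (intro finite_dim_complex.intro finite_dim_complex_axioms.intro graded_twisted)
    show "finitely_generated scalars twisted_module"
      unfolding finitely_generated_def twisted_simps finsum_twisted
    proof (intro exI[of _ B] conjI ballI MB.finite_basis MB.basis_closed)
      show "\<exists>c\<in>B \<rightarrow> carrier scalars. x = (\<Oplus>\<^bsub>M\<^esub>b\<in>B. c b \<odot>\<^bsub>M\<^esub> b)" if "x \<in> carrier M" for x
        using MB.expand[OF that] by (intro bexI[of _ "\<lambda>b. co b x"]) auto
    qed
    show "linear_map scalars twisted_module twisted_module (diff twisted_module)"
      using linear_map_compose[OF d_one_linear coefficient_linear] by (simp add: linear_map_def twisted_simps)
    show "has_degree 1 twisted_module twisted_module (diff twisted_module)"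
      using d_one_degree coefficient_grade by (simp add: has_degree_def twisted_simps)
    fix m assume "m \<in> carrier twisted_module"
    then have m: "m \<in> carrier M" by (simp add: twisted_simps)
    have "coefficient (d_one (coefficient (d_one m))) = coefficient (d (d_one m))"
      by (rule coefficient_d[symmetric, OF linear_mapD'(1)[OF d_one_linear m]])
    also have "\<dots> = \<zero>\<^bsub>M\<^esub>"
      using linear_map_zero[OF coefficient_linear abelian_T abelian_M] by (simp add: d_square te_closed m)
    finally show "diff twisted_module (diff twisted_module m) = \<zero>\<^bsub>twisted_module\<^esub>" by (simp add: twisted_simps)
  qed
  show "structure_map twisted_module 0 m = tensor_elem A twisted_module \<one>\<^bsub>A\<^esub> (diff twisted_module m)"
    if "m \<in> carrier twisted_module" for m
    using that linear_mapD'(1)[OF d_one_linear] by (simp add: twisted_simps component_power_T_zero)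
  show "d_tot g twisted_module (d_tot g twisted_module t) = \<zero>\<^bsub>cochains g twisted_module\<^esub>"
    if "t \<in> carrier (cochains g twisted_module)" for t
    using that by (simp add: twisted_simps d_tot_twisted d_closed d_square)
qed (rule family_twisted)

end

section \<open>Essential surjectivity: a finite homogeneous basis turns a semifree module into C(g)
  \<otimes> M\<close>

section \<open>Finitely generated semifree modules\<close>

text \<open>Linearity and compatibility with the differentials pass to the inverse map;
  \<open>reflect\<close> supplies what is left, that the inverse has degree 0.\<close>

lemma dgMod_isoI:
  assumes X: "dg_module A X" and Y: "dg_module A Y" and F: "F \<in> Hom (dgMod A) X Y"
    and bij: "bij_betw F (carrier X) (carrier Y)"
    and reflect: "\<And>x n. x \<in> carrier X \<Longrightarrow> F x \<in> grade Y n \<Longrightarrow> x \<in> grade X n"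
  shows "is_iso (dgMod A) X Y F"
proof -
  interpret X: dg_module A X by (rule X)
  interpret Y: dg_module A Y by (rule Y)
  have ext: "F \<in> extensional (carrier X)"
    and cl: "\<And>x. x \<in> carrier X \<Longrightarrow> F x \<in> carrier Y"
    and add: "\<And>x y. x \<in> carrier X \<Longrightarrow> y \<in> carrier X \<Longrightarrow> F (x \<oplus>\<^bsub>X\<^esub> y) = F x \<oplus>\<^bsub>Y\<^esub> F y"
    and act: "\<And>c x. c \<in> carrier A \<Longrightarrow> x \<in> carrier X \<Longrightarrow> F (c \<odot>\<^bsub>X\<^esub> x) = c \<odot>\<^bsub>Y\<^esub> F x"
    and diff: "\<And>x. x \<in> carrier X \<Longrightarrow> F (diff X x) = diff Y (F x)"
    using F by (auto simp: dgMod_def linear_map_def)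
  define G where "G = restrict (inv_into (carrier X) F) (carrier Y)"
  have GF: "G (F x) = x" if "x \<in> carrier X" for x
    using that bij cl by (simp add: G_def bij_betw_def inv_into_f_f)
  have G: "G y \<in> carrier X" "F (G y) = y" if "y \<in> carrier Y" for y
    using that bij by (auto simp: G_def bij_betw_def inv_into_into f_inv_into_f)
  have "linear_map A Y X G"
  proof (rule linear_mapI)
    show "G (x \<oplus>\<^bsub>Y\<^esub> y) = G x \<oplus>\<^bsub>X\<^esub> G y" if "x \<in> carrier Y" "y \<in> carrier Y" for x y
      using GF[of "G x \<oplus>\<^bsub>X\<^esub> G y"] G[OF that(1)] G[OF that(2)] by (simp add: add)
    show "G (c \<odot>\<^bsub>Y\<^esub> y) = c \<odot>\<^bsub>X\<^esub> G y" if "c \<in> carrier A" "y \<in> carrier Y" for c y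
      using GF[of "c \<odot>\<^bsub>X\<^esub> G y"] G[OF that(2)] that(1) by (simp add: act X.act_closed)
  qed (rule G(1))
  moreover have "has_degree 0 Y X G"
    unfolding has_degree_def
  proof (intro allI ballI)
    fix n y assume y: "y \<in> grade Y n"
    then have "y \<in> carrier Y" using Y.summand_closed(1) by blast
    from reflect[OF G(1)[OF this], of n] G(2)[OF this] y show "G y \<in> grade X (n + 0)" by simp
  qed
  moreover have "G (diff Y y) = diff X (G y)" if "y \<in> carrier Y" for y
    using GF[of "diff X (G y)"] G[OF that] by (simp add: diff X.diff_closed)
  ultimately have G_hom: "G \<in> Hom (dgMod A) Y X" by (simp add: dgMod_def G_def)
  have comp: "compose (carrier X) G F = restrict (\<lambda>x. x) (carrier X)"
    "compose (carrier Y) F G = restrict (\<lambda>x. x) (carrier Y)"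
    by (simp_all add: compose_def fun_eq_iff GF G(2))
  show ?thesis
    unfolding is_iso_def by (intro conjI bexI[OF _ G_hom] F) (simp_all only: dgMod_def category.simps comp)
qed

lemma (in dg_module) act_finsum:
  assumes c: "c \<in> carrier A" and f: "f \<in> I \<rightarrow> carrier P"
  shows "c \<odot>\<^bsub>P\<^esub> (\<Oplus>\<^bsub>P\<^esub>i\<in>I. f i) = (\<Oplus>\<^bsub>P\<^esub>i\<in>I. c \<odot>\<^bsub>P\<^esub> f i)"
  \<comment> \<open>an additive map is linear over an empty set of scalars\<close>
proof (rule linear_map_finsum[where R = "A\<lparr>carrier := {}\<rparr>", OF _ _ _ f])
  show "linear_map (A\<lparr>carrier := {}\<rparr>) P P (\<lambda>x. c \<odot>\<^bsub>P\<^esub> x)"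
    by (rule linear_mapI) (simp_all add: c act_closed act_r_distr)
qed (rule abelian_group_axioms)+

lemma (in dg_module) act_zero: "x \<in> carrier P \<Longrightarrow> \<zero>\<^bsub>A\<^esub> \<odot>\<^bsub>P\<^esub> x = \<zero>\<^bsub>P\<^esub>"
  using act_l_distr[of "\<zero>\<^bsub>A\<^esub>" "\<zero>\<^bsub>A\<^esub>" x] act_closed[of "\<zero>\<^bsub>A\<^esub>" x]
    add.r_cancel_one'[of "\<zero>\<^bsub>A\<^esub> \<odot>\<^bsub>P\<^esub> x" "\<zero>\<^bsub>A\<^esub> \<odot>\<^bsub>P\<^esub> x"] by simp

text \<open>The generators involve only a finite set \<open>K\<close> of basis elements, so
  \<open>K\<close> already spans. A basis element outside \<open>K\<close> would then have two
  expansions, itself and one over \<open>K\<close>, against uniqueness; so the given basis equals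
  \<open>K\<close> and is finite.\<close>

lemma ex_finite_basis:
  fixes A :: "('k, 'c, 'e) dg_scheme" and P :: "('c, 'p, 'f) dg_scheme"
  assumes "dg_module A P" "finitely_generated A P" "semifree A P" and one: "\<one>\<^bsub>A\<^esub> \<noteq> \<zero>\<^bsub>A\<^esub>"
  obtains J where "finite J" "\<And>b. b \<in> J \<Longrightarrow> \<exists>i. b \<in> grade P i"
    "\<And>x. x \<in> carrier P \<Longrightarrow> \<exists>c\<in>J \<rightarrow> carrier A. x = (\<Oplus>\<^bsub>P\<^esub>b\<in>J. c b \<odot>\<^bsub>P\<^esub> b)"
    "\<And>c c' b. c \<in> J \<rightarrow> carrier A \<Longrightarrow> c' \<in> J \<rightarrow> carrier A \<Longrightarrow>
      (\<Oplus>\<^bsub>P\<^esub>b\<in>J. c b \<odot>\<^bsub>P\<^esub> b) = (\<Oplus>\<^bsub>P\<^esub>b\<in>J. c' b \<odot>\<^bsub>P\<^esub> b) \<Longrightarrow> b \<in> J \<Longrightarrow> c b = c' b"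
proof -
  interpret dg_module A P by (rule assms(1))
  obtain G where G: "finite G" "G \<subseteq> carrier P"
    and gen: "\<And>x. x \<in> carrier P \<Longrightarrow> \<exists>a\<in>G \<rightarrow> carrier A. x = (\<Oplus>\<^bsub>P\<^esub>y\<in>G. a y \<odot>\<^bsub>P\<^esub> y)"
    using assms(2) unfolding finitely_generated_def by blast
  \<comment> \<open>\<open>Q J x c\<close> says that \<open>c\<close>, extended by zero outside
    \<open>J\<close>, is the coefficient family of \<open>x\<close>; this is the property whose
    unique solvability \<open>semifree\<close> asserts.\<close>
  define Q where "Q J x c \<longleftrightarrow> (\<forall>b. c b \<in> carrier A) \<and> (\<forall>b. b \<notin> J \<longrightarrow> c b = \<zero>\<^bsub>A\<^esub>) \<and> finite {b. c b \<noteq> \<zero>\<^bsub>A\<^esub>} \<and>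
    x = (\<Oplus>\<^bsub>P\<^esub>b\<in>{b. c b \<noteq> \<zero>\<^bsub>A\<^esub>}. c b \<odot>\<^bsub>P\<^esub> b)" for J x c
  have "\<exists>J. (\<forall>b\<in>J. \<exists>i. b \<in> grade P i) \<and> (\<forall>x\<in>carrier P. \<exists>!c. Q J x c)"
    using assms(3) unfolding semifree_def Q_def .
  then obtain J where "\<forall>b\<in>J. \<exists>i. b \<in> grade P i" and "\<forall>x\<in>carrier P. \<exists>!c. Q J x c"
    by (elim exE conjE)
  note J = bspec[OF this(1)] and ex1 = bspec[OF this(2)]
  have JC: "J \<subseteq> carrier P" using J summand_closed(1) by blast
  define comb where "comb K c = (\<Oplus>\<^bsub>P\<^esub>b\<in>K. c b \<odot>\<^bsub>P\<^esub> b)" for K and c :: "'p \<Rightarrow> 'c"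
  have term_closed: "(\<lambda>b. c b \<odot>\<^bsub>P\<^esub> b) \<in> K \<rightarrow> carrier P" if "K \<subseteq> J" "c \<in> K \<rightarrow> carrier A" for K c
  proof (rule Pi_I)
    show "c b \<odot>\<^bsub>P\<^esub> b \<in> carrier P" if "b \<in> K" for b
      using that \<open>K \<subseteq> J\<close> \<open>c \<in> K \<rightarrow> carrier A\<close> JC by (intro act_closed) auto
  qed
  have Q_comb: "Q J (comb K c) (\<lambda>b. if b \<in> K then c b else \<zero>\<^bsub>A\<^esub>)" if K: "finite K" "K \<subseteq> J" and c: "c \<in> K \<rightarrow> carrier A" for K c
  proof -
    let ?c = "\<lambda>b. if b \<in> K then c b else \<zero>\<^bsub>A\<^esub>"
    have cc: "\<forall>b. ?c b \<in> carrier A" using c by auto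
    have sub: "{b. ?c b \<noteq> \<zero>\<^bsub>A\<^esub>} \<subseteq> K" by auto
    have "(\<Oplus>\<^bsub>P\<^esub>b\<in>{b. ?c b \<noteq> \<zero>\<^bsub>A\<^esub>}. ?c b \<odot>\<^bsub>P\<^esub> b) = (\<Oplus>\<^bsub>P\<^esub>b\<in>K. ?c b \<odot>\<^bsub>P\<^esub> b)"
    proof (rule finsum_superset[OF K(1) sub])
      show "?c b \<odot>\<^bsub>P\<^esub> b = \<zero>\<^bsub>P\<^esub>" if "b \<in> K - {b. ?c b \<noteq> \<zero>\<^bsub>A\<^esub>}" for b
        using that K(2) JC act_zero[of b] by auto
      show "(\<lambda>b. ?c b \<odot>\<^bsub>P\<^esub> b) \<in> K \<rightarrow> carrier P" using c by (intro term_closed[OF K(2)]) auto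
    qed
    also have "\<dots> = comb K c" unfolding comb_def using term_closed[OF K(2) c] by (intro finsum_cong') auto
    finally have "comb K c = (\<Oplus>\<^bsub>P\<^esub>b\<in>{b. ?c b \<noteq> \<zero>\<^bsub>A\<^esub>}. ?c b \<odot>\<^bsub>P\<^esub> b)" by (rule sym)
    then show ?thesis unfolding Q_def using cc K(2) finite_subset[OF sub K(1)] by auto
  qed
  have comb_closed: "comb K c \<in> carrier P" if "K \<subseteq> J" "c \<in> K \<rightarrow> carrier A" for K c
    unfolding comb_def by (rule finsum_closed[OF term_closed[OF that]])
  define cf where "cf x = (THE c. Q J x c)" for x
  have cf: "Q J x (cf x)" if "x \<in> carrier P" for x unfolding cf_def by (rule theI'[OF ex1[OF that]])
  have cf_eq: "cf x = c" if "x \<in> carrier P" "Q J x c" for x c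
    unfolding cf_def by (rule the1_equality[OF ex1[OF that(1)], OF that(2)])
  define K where "K = (\<Union>y\<in>G. {b. cf y b \<noteq> \<zero>\<^bsub>A\<^esub>})"
  have "finite {b. cf y b \<noteq> \<zero>\<^bsub>A\<^esub>}" "{b. cf y b \<noteq> \<zero>\<^bsub>A\<^esub>} \<subseteq> J" if "y \<in> G" for y
    using cf[of y] that G(2) unfolding Q_def by blast+
  then have K: "finite K" "K \<subseteq> J" using G(1) unfolding K_def by blast+
  define H where "H = {comb K c | c. c \<in> K \<rightarrow> carrier A}"
  have H_add: "x \<oplus>\<^bsub>P\<^esub> y \<in> H" if x: "x \<in> H" and y: "y \<in> H" for x y
  proof -
    obtain c c' where c: "c \<in> K \<rightarrow> carrier A" "x = comb K c" and c': "c' \<in> K \<rightarrow> carrier A" "y = comb K c'"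
      using x y unfolding H_def by blast
    have "x \<oplus>\<^bsub>P\<^esub> y = (\<Oplus>\<^bsub>P\<^esub>b\<in>K. c b \<odot>\<^bsub>P\<^esub> b \<oplus>\<^bsub>P\<^esub> c' b \<odot>\<^bsub>P\<^esub> b)"
      unfolding c(2) c'(2) comb_def by (rule finsum_addf[symmetric, OF term_closed[OF K(2) c(1)] term_closed[OF K(2) c'(1)]])
    also have "\<dots> = comb K (\<lambda>b. c b \<oplus>\<^bsub>A\<^esub> c' b)"
      unfolding comb_def
    proof (rule finsum_cong'[OF refl])
      show cc: "(\<lambda>b. (c b \<oplus>\<^bsub>A\<^esub> c' b) \<odot>\<^bsub>P\<^esub> b) \<in> K \<rightarrow> carrier P" using c(1) c'(1) by (intro term_closed[OF K(2)]) auto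
      show "c b \<odot>\<^bsub>P\<^esub> b \<oplus>\<^bsub>P\<^esub> c' b \<odot>\<^bsub>P\<^esub> b = (c b \<oplus>\<^bsub>A\<^esub> c' b) \<odot>\<^bsub>P\<^esub> b" if "b \<in> K" for b
        using that c(1) c'(1) K(2) JC by (intro act_l_distr[symmetric]) auto
    qed
    finally show ?thesis using c(1) c'(1) unfolding H_def by blast
  qed
  have H_act: "a \<odot>\<^bsub>P\<^esub> x \<in> H" if a: "a \<in> carrier A" and x: "x \<in> H" for a x
  proof -
    obtain c where c: "c \<in> K \<rightarrow> carrier A" "x = comb K c" using x unfolding H_def by blast
    have "a \<odot>\<^bsub>P\<^esub> x = (\<Oplus>\<^bsub>P\<^esub>b\<in>K. a \<odot>\<^bsub>P\<^esub> (c b \<odot>\<^bsub>P\<^esub> b))"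
      unfolding c(2) comb_def by (rule act_finsum[OF a term_closed[OF K(2) c(1)]])
    also have "\<dots> = comb K (\<lambda>b. a \<otimes>\<^bsub>A\<^esub> c b)"
      unfolding comb_def
    proof (rule finsum_cong'[OF refl])
      show "(\<lambda>b. (a \<otimes>\<^bsub>A\<^esub> c b) \<odot>\<^bsub>P\<^esub> b) \<in> K \<rightarrow> carrier P" using a c(1) by (intro term_closed[OF K(2)]) auto
      show "a \<odot>\<^bsub>P\<^esub> (c b \<odot>\<^bsub>P\<^esub> b) = (a \<otimes>\<^bsub>A\<^esub> c b) \<odot>\<^bsub>P\<^esub> b" if "b \<in> K" for b
        using that a c(1) K(2) JC by (intro act_assoc[symmetric]) auto
    qed
    finally show ?thesis using a c(1) unfolding H_def by blast
  qed
  have "comb K (\<lambda>b. \<zero>\<^bsub>A\<^esub>) = \<zero>\<^bsub>P\<^esub>"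
    unfolding comb_def using K(2) JC act_zero by (intro add.finprod_one_eqI) blast
  then have H_zero: "\<zero>\<^bsub>P\<^esub> \<in> H" unfolding H_def by (intro CollectI exI[of _ "\<lambda>b. \<zero>\<^bsub>A\<^esub>"]) simp
  have GH: "y \<in> H" if y: "y \<in> G" for y
  proof -
    have q: "Q J y (cf y)" using y G(2) by (intro cf) blast
    have sub: "{b. cf y b \<noteq> \<zero>\<^bsub>A\<^esub>} \<subseteq> K" using y unfolding K_def by blast
    have c: "cf y \<in> K \<rightarrow> carrier A" using q unfolding Q_def by blast
    have "(\<Oplus>\<^bsub>P\<^esub>b\<in>{b. cf y b \<noteq> \<zero>\<^bsub>A\<^esub>}. cf y b \<odot>\<^bsub>P\<^esub> b) = comb K (cf y)"
      unfolding comb_def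
      by (rule finsum_superset[OF K(1) sub _ term_closed[OF K(2) c]]) (use K(2) JC act_zero in auto)
    then have "y = comb K (cf y)" using q unfolding Q_def by metis
    then show ?thesis using c unfolding H_def by blast
  qed
  have HC: "H \<subseteq> carrier P" using comb_closed[OF K(2)] unfolding H_def by blast
  have span: "x \<in> H" if x: "x \<in> carrier P" for x
  proof -
    obtain a where a: "a \<in> G \<rightarrow> carrier A" and e: "x = (\<Oplus>\<^bsub>P\<^esub>y\<in>G. a y \<odot>\<^bsub>P\<^esub> y)" using gen[OF x] by blast
    have t: "a y \<odot>\<^bsub>P\<^esub> y \<in> H" if "y \<in> G" for y using that a by (intro H_act GH) auto
    have "(\<Oplus>\<^bsub>P\<^esub>y\<in>F. a y \<odot>\<^bsub>P\<^esub> y) \<in> H" if "finite F" "F \<subseteq> G" for F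
      using that
    proof (induction F rule: finite_induct)
      case (insert y F)
      then have "(\<Oplus>\<^bsub>P\<^esub>y\<in>insert y F. a y \<odot>\<^bsub>P\<^esub> y) = a y \<odot>\<^bsub>P\<^esub> y \<oplus>\<^bsub>P\<^esub> (\<Oplus>\<^bsub>P\<^esub>y\<in>F. a y \<odot>\<^bsub>P\<^esub> y)"
        using t HC by (intro finsum_insert) auto
      then show ?case using insert t by (simp add: H_add)
    qed (simp add: H_zero)
    then show ?thesis using G(1) unfolding e by blast
  qed
  \<comment> \<open>In the trivial expansion \<open>b\<close> has coefficient 1 at itself. Since 1
    is nonzero, an expansion over \<open>K\<close> can agree with it only if \<open>b\<close> lies
    in \<open>K\<close>.\<close>
  have "b \<in> K" if b: "b \<in> J" for b
  proof -
    have bc: "b \<in> carrier P" using b JC by blast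
    obtain c where c: "c \<in> K \<rightarrow> carrier A" "b = comb K c" using span[OF bc] unfolding H_def by blast
    have q: "Q J b (\<lambda>y. if y \<in> K then c y else \<zero>\<^bsub>A\<^esub>)" using Q_comb[OF K c(1)] unfolding c(2)[symmetric] .
    have "comb {b} (\<lambda>y. \<one>\<^bsub>A\<^esub>) = b" unfolding comb_def using bc by (simp add: act_one)
    then have q': "Q J b (\<lambda>y. if y \<in> {b} then \<one>\<^bsub>A\<^esub> else \<zero>\<^bsub>A\<^esub>)" using Q_comb[of "{b}" "\<lambda>y. \<one>\<^bsub>A\<^esub>"] b by simp
    from fun_cong[OF trans[OF cf_eq[OF bc q, symmetric] cf_eq[OF bc q']], of b] show ?thesis using one by (auto split: if_splits)
  qed
  then have JK: "J = K" using K(2) by blast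
  show ?thesis
  proof (rule that[of J])
    show "finite J" using K(1) JK by simp
    show "\<exists>c\<in>J \<rightarrow> carrier A. x = (\<Oplus>\<^bsub>P\<^esub>b\<in>J. c b \<odot>\<^bsub>P\<^esub> b)" if "x \<in> carrier P" for x
      using span[OF that] unfolding H_def comb_def JK by blast
    show "c b = c' b" if c: "c \<in> J \<rightarrow> carrier A" and c': "c' \<in> J \<rightarrow> carrier A" and b: "b \<in> J"
      and eq: "(\<Oplus>\<^bsub>P\<^esub>b\<in>J. c b \<odot>\<^bsub>P\<^esub> b) = (\<Oplus>\<^bsub>P\<^esub>b\<in>J. c' b \<odot>\<^bsub>P\<^esub> b)" for c c' b
    proof -
      note q = Q_comb[OF \<open>finite J\<close> order.refl]
      have "comb J c' = comb J c" using eq unfolding comb_def by simp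
      from trans[OF cf_eq[OF _ q[OF c], symmetric] cf_eq[OF _ q[OF c', unfolded this]]] comb_closed[OF order.refl c]
      have "(\<lambda>b. if b \<in> J then c b else \<zero>\<^bsub>A\<^esub>) = (\<lambda>b. if b \<in> J then c' b else \<zero>\<^bsub>A\<^esub>)" by blast
      from fun_cong[OF this, of b] show ?thesis using b by simp
    qed
  qed (rule J)
qed

text \<open>The C(g)-basis of \<open>P\<close> is indexed through \<beta> by a basis of M, because
  the elements of \<open>P\<close> are cochains whereas those of M have type
  \<open>'m\<close>.\<close>

locale free_dg_module = cochain_module g eps M B deg co + P: dg_module "CE g" P
  for g :: "('k::field, 'g) dg_lie" and eps and M :: "('k, 'g, 'm) infty_module" and B deg co
    and P :: "(('k, 'g) CE, ('k, 'g, 'm) cochain) dg" +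
  fixes \<beta> :: "'m \<Rightarrow> ('k, 'g, 'm) cochain"
  assumes \<beta>_grade: "b \<in> B \<Longrightarrow> \<beta> b \<in> grade P (deg b)"
    and \<beta>_span: "x \<in> carrier P \<Longrightarrow> \<exists>c\<in>B \<rightarrow> carrier (CE g). x = (\<Oplus>\<^bsub>P\<^esub>b\<in>B. c b \<odot>\<^bsub>P\<^esub> \<beta> b)"
    and \<beta>_independent: "\<lbrakk>c \<in> B \<rightarrow> carrier (CE g); c' \<in> B \<rightarrow> carrier (CE g);
      (\<Oplus>\<^bsub>P\<^esub>b\<in>B. c b \<odot>\<^bsub>P\<^esub> \<beta> b) = (\<Oplus>\<^bsub>P\<^esub>b\<in>B. c' b \<odot>\<^bsub>P\<^esub> \<beta> b); b \<in> B\<rbrakk> \<Longrightarrow> c b = c' b"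
begin

interpretation A: ring A by (rule ring_A)
interpretation TT: abelian_group T by (rule abelian_T)
interpretation MB: homogeneous_basis M B deg co by (rule basis_M)
interpretation DT: internal_direct_sum T "grade T" by (rule direct_sum_T)
interpretation DA: internal_direct_sum A "grade A" by (rule direct_sum_grade)

lemmas P_act = P.act_closed[unfolded CE_simps] P.act_l_distr[unfolded CE_simps]
  P.act_assoc[unfolded CE_simps] P.act_degree[unfolded CE_simps] P.diff_act[unfolded CE_simps]

lemma \<beta>_closed: "b \<in> B \<Longrightarrow> \<beta> b \<in> carrier P"
  using \<beta>_grade P.summand_closed(1) by blast

lemma coordinate_closed: "b \<in> B \<Longrightarrow> t \<in> carrier T \<Longrightarrow> coordinate b t \<in> carrier A"
  using linear_mapD'(1)[OF coordinate_linear] .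

lemma coordinate_act:
  assumes b: "b \<in> B" and c: "c \<in> carrier A" and t: "t \<in> carrier T"
  shows "coordinate b (act c t) = c \<otimes>\<^bsub>A\<^esub> coordinate b t"
  by (rule T.tensor_eqI[OF linear_map_compose[OF act_linear[OF c] coordinate_linear[OF b]]
        linear_map_compose[OF coordinate_linear[OF b] mult_linear(1)[OF c]] module_A _ t])
    (use b c linear_mapD'(3)[OF mult_linear(1)[OF c]] in \<open>simp add: act_elem coordinate_elem\<close>)

lemma coordinate_grade:
  assumes b: "b \<in> B" and t: "t \<in> grade T n"
  shows "coordinate b t \<in> grade A (n - deg b)"
proof (rule grade_T_into[OF coordinate_linear[OF b] module_A submodule_grade _ t])
  fix c m i j assume c: "c \<in> grade A i" and m: "m \<in> grade M j" and n: "i + j = n"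
  show "coordinate b (te c m) \<in> grade A (n - deg b)"
  proof (cases "deg b = j")
    case True
    then show ?thesis
      using submoduleD(4)[OF submodule_grade module_A _ c] n
      by (auto simp: coordinate_elem b grade_closed[OF c] grade_M_closed[OF m])
  next
    case False
    then show ?thesis
      using MB.co_grade[OF m b] DA.summand_closed(2)
      by (simp add: coordinate_elem b grade_closed[OF c] grade_M_closed[OF m] vector_spaceD(6)[OF module_A])
  qed
qed

text \<open>The C(g)-linear map sending 1 \<otimes> b to \<open>\<beta> b\<close>. It is written
  with coordinates because the scalars of the record \<open>P\<close> are the elements of C(g), so
  that \<open>tensor_lift\<close>, which expects a target over the ground field, does not
  apply.\<close>

definition \<Phi> :: "('k, 'g, 'm) cochain \<Rightarrow> ('k, 'g, 'm) cochain" where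
  "\<Phi> t = (\<Oplus>\<^bsub>P\<^esub>b\<in>B. coordinate b t \<odot>\<^bsub>P\<^esub> \<beta> b)"

lemma \<Phi>_terms: "t \<in> carrier T \<Longrightarrow> (\<lambda>b. coordinate b t \<odot>\<^bsub>P\<^esub> \<beta> b) \<in> B \<rightarrow> carrier P"
  by (rule Pi_I) (simp add: P_act(1) coordinate_closed \<beta>_closed)

lemma \<Phi>_closed: "t \<in> carrier T \<Longrightarrow> \<Phi> t \<in> carrier P"
  unfolding \<Phi>_def by (rule P.finsum_closed[OF \<Phi>_terms])

lemma \<Phi>_add:
  assumes s: "s \<in> carrier T" and t: "t \<in> carrier T"
  shows "\<Phi> (s \<oplus>\<^bsub>T\<^esub> t) = \<Phi> s \<oplus>\<^bsub>P\<^esub> \<Phi> t"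
proof -
  have "\<Phi> (s \<oplus>\<^bsub>T\<^esub> t) = (\<Oplus>\<^bsub>P\<^esub>b\<in>B. coordinate b s \<odot>\<^bsub>P\<^esub> \<beta> b \<oplus>\<^bsub>P\<^esub> coordinate b t \<odot>\<^bsub>P\<^esub> \<beta> b)"
    unfolding \<Phi>_def
  proof (rule P.finsum_cong'[OF refl])
    show "(\<lambda>b. coordinate b s \<odot>\<^bsub>P\<^esub> \<beta> b \<oplus>\<^bsub>P\<^esub> coordinate b t \<odot>\<^bsub>P\<^esub> \<beta> b) \<in> B \<rightarrow> carrier P"
      by (rule Pi_I) (simp add: P_act(1) coordinate_closed \<beta>_closed s t)
    show "coordinate b (s \<oplus>\<^bsub>T\<^esub> t) \<odot>\<^bsub>P\<^esub> \<beta> b = coordinate b s \<odot>\<^bsub>P\<^esub> \<beta> b \<oplus>\<^bsub>P\<^esub> coordinate b t \<odot>\<^bsub>P\<^esub> \<beta> b"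
      if "b \<in> B" for b
      using that by (simp add: linear_mapD'(2)[OF coordinate_linear] s t P_act(2) coordinate_closed \<beta>_closed)
  qed
  then show ?thesis unfolding \<Phi>_def by (simp only: P.finsum_addf[OF \<Phi>_terms[OF s] \<Phi>_terms[OF t]])
qed

lemma \<Phi>_act:
  assumes c: "c \<in> carrier A" and t: "t \<in> carrier T"
  shows "\<Phi> (act c t) = c \<odot>\<^bsub>P\<^esub> \<Phi> t"
proof -
  have "\<Phi> (act c t) = (\<Oplus>\<^bsub>P\<^esub>b\<in>B. c \<odot>\<^bsub>P\<^esub> (coordinate b t \<odot>\<^bsub>P\<^esub> \<beta> b))"
    unfolding \<Phi>_def
  proof (rule P.finsum_cong'[OF refl])
    show "(\<lambda>b. c \<odot>\<^bsub>P\<^esub> (coordinate b t \<odot>\<^bsub>P\<^esub> \<beta> b)) \<in> B \<rightarrow> carrier P"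
      by (rule Pi_I) (simp add: P_act(1) coordinate_closed \<beta>_closed c t)
    show "coordinate b (act c t) \<odot>\<^bsub>P\<^esub> \<beta> b = c \<odot>\<^bsub>P\<^esub> (coordinate b t \<odot>\<^bsub>P\<^esub> \<beta> b)" if "b \<in> B" for b
      using that by (simp add: coordinate_act c t P_act(3) coordinate_closed \<beta>_closed)
  qed
  also have "\<dots> = c \<odot>\<^bsub>P\<^esub> \<Phi> t"
    unfolding \<Phi>_def by (rule P.act_finsum[unfolded CE_simps, symmetric, OF c \<Phi>_terms[OF t]])
  finally show ?thesis .
qed

lemma \<Phi>_linear: "linear_map (CE g) (CE_module g M) P \<Phi>"
  by (rule linear_mapI) (simp_all add: CE_module_simps CE_simps \<Phi>_closed \<Phi>_add \<Phi>_act)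

lemma abelian_CE_module: "abelian_group (CE_module g M)"
  by (rule abelian_group_cong[OF _ _ _ abelian_T]) (simp_all add: CE_module_simps)

lemma \<Phi>_zero: "\<Phi> \<zero>\<^bsub>T\<^esub> = \<zero>\<^bsub>P\<^esub>"
  using linear_map_zero[OF \<Phi>_linear abelian_CE_module P.abelian_group_axioms] by (simp add: CE_module_simps)

lemma \<Phi>_koszul: "t \<in> carrier T \<Longrightarrow> \<Phi> (koszul T i t) = koszul P i (\<Phi> t)"
  using linear_map_minus[OF \<Phi>_linear abelian_CE_module P.abelian_group_axioms, of t]
    a_inv_cong[of "CE_module g M" T] by (simp add: CE_module_simps koszul_def)

lemma \<Phi>_finsum: "f \<in> I \<rightarrow> carrier T \<Longrightarrow> \<Phi> (\<Oplus>\<^bsub>T\<^esub>i\<in>I. f i) = (\<Oplus>\<^bsub>P\<^esub>i\<in>I. \<Phi> (f i))"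
  using linear_map_finsum[OF \<Phi>_linear abelian_CE_module P.abelian_group_axioms, of f I]
  by (simp add: CE_module_simps finsum_ring_cong[of "CE_module g M" T])

lemma \<Phi>_inj: "inj_on \<Phi> (carrier T)"
proof (rule inj_onI)
  fix s t assume s: "s \<in> carrier T" and t: "t \<in> carrier T" and eq: "\<Phi> s = \<Phi> t"
  have "coordinate b s = coordinate b t" if "b \<in> B" for b
    by (rule \<beta>_independent[OF _ _ eq[unfolded \<Phi>_def] that]) (simp_all add: CE_simps coordinate_closed s t)
  then have "(\<Oplus>\<^bsub>T\<^esub>b\<in>B. te (coordinate b s) b) = (\<Oplus>\<^bsub>T\<^esub>b\<in>B. te (coordinate b t) b)"
    by (intro TT.finsum_cong') (simp_all add: te_closed coordinate_closed basis_closed t)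
  then show "s = t" using coordinate_expand[OF s] coordinate_expand[OF t] by metis
qed

lemma \<Phi>_bij: "bij_betw \<Phi> (carrier T) (carrier P)"
  unfolding bij_betw_def
proof (intro conjI \<Phi>_inj equalityI image_subsetI subsetI)
  fix x assume "x \<in> carrier P"
  then obtain c where c: "c \<in> B \<rightarrow> carrier A" and x: "x = (\<Oplus>\<^bsub>P\<^esub>b\<in>B. c b \<odot>\<^bsub>P\<^esub> \<beta> b)"
    using \<beta>_span by (auto simp: CE_simps)
  let ?t = "\<Oplus>\<^bsub>T\<^esub>b\<in>B. te (c b) b"
  have "\<Phi> ?t = x"
    unfolding \<Phi>_def x
  proof (rule P.finsum_cong'[OF refl])
    show "(\<lambda>b. c b \<odot>\<^bsub>P\<^esub> \<beta> b) \<in> B \<rightarrow> carrier P" using c P_act(1) \<beta>_closed by blast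
  qed (simp only: coordinate_sum[OF c])
  moreover have "?t \<in> carrier T" using c te_closed basis_closed by (intro TT.finsum_closed) blast
  ultimately show "x \<in> \<Phi> ` carrier T" by (rule image_eqI[OF sym])
qed (rule \<Phi>_closed)

lemma \<Phi>_grade:
  assumes t: "t \<in> grade T n" shows "\<Phi> t \<in> grade P n"
proof -
  have summand: "coordinate b t \<odot>\<^bsub>P\<^esub> \<beta> b \<in> grade P n" if "b \<in> B" for b
    using P_act(4)[OF coordinate_grade[OF that t] \<beta>_grade[OF that]] by simp
  have "(\<Oplus>\<^bsub>P\<^esub>b\<in>F. coordinate b t \<odot>\<^bsub>P\<^esub> \<beta> b) \<in> grade P n" if "F \<subseteq> B" "finite F" for F
    using that(2,1)
  proof (induction F rule: finite_induct)
    case (insert b F)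
    then have "(\<Oplus>\<^bsub>P\<^esub>b\<in>insert b F. coordinate b t \<odot>\<^bsub>P\<^esub> \<beta> b) =
        coordinate b t \<odot>\<^bsub>P\<^esub> \<beta> b \<oplus>\<^bsub>P\<^esub> (\<Oplus>\<^bsub>P\<^esub>b\<in>F. coordinate b t \<odot>\<^bsub>P\<^esub> \<beta> b)"
      using \<Phi>_terms[OF grade_T_closed[OF t]] by (intro P.finsum_insert) auto
    then show ?case using insert summand P.summand_closed(3) by simp
  qed (simp add: P.summand_closed(2))
  then show ?thesis unfolding \<Phi>_def using MB.finite_basis by blast
qed

text \<open>As \<Phi> preserves degrees, it commutes with taking components. If the image equals its
  own component of degree \<open>n\<close>, then so does \<open>t\<close>, by injectivity.\<close>

lemma \<Phi>_reflects_grade: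
  assumes t: "t \<in> carrier T" and n: "\<Phi> t \<in> grade P n"
  shows "t \<in> grade T n"
proof -
  let ?K = "{k. component T (grade T) k t \<noteq> \<zero>\<^bsub>T\<^esub>}"
  note cl = DT.component_closed[OF t]
  have "\<Phi> t = \<Phi> (\<Oplus>\<^bsub>T\<^esub>k\<in>?K. component T (grade T) k t)" by (simp only: DT.sum_support[OF t])
  also have "\<dots> = (\<Oplus>\<^bsub>P\<^esub>k\<in>?K. \<Phi> (component T (grade T) k t))" using cl by (intro \<Phi>_finsum) blast
  finally have "component P (grade P) n (\<Phi> t) = \<Phi> (component T (grade T) n t)"
    using \<Phi>_grade[OF DT.component_in[OF t]] \<Phi>_zero
    by (intro P.component_eqI[where f = "\<lambda>k. \<Phi> (component T (grade T) k t)", OF DT.finite_support[OF t]]) auto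
  then have "\<Phi> (component T (grade T) n t) = \<Phi> t" using P.component_same[OF n] by simp
  then have "component T (grade T) n t = t" by (intro inj_onD[OF \<Phi>_inj _ cl t])
  then show ?thesis using DT.component_in[OF t, of n] by simp
qed

definition pulled_diff where "pulled_diff t = inv_into (carrier T) \<Phi> (diff P (\<Phi> t))"

lemma pulled_diff_closed: "t \<in> carrier T \<Longrightarrow> pulled_diff t \<in> carrier T"
  and \<Phi>_pulled_diff: "t \<in> carrier T \<Longrightarrow> \<Phi> (pulled_diff t) = diff P (\<Phi> t)"
  using inv_into_into[of "diff P (\<Phi> t)" \<Phi> "carrier T"] f_inv_into_f[of "diff P (\<Phi> t)" \<Phi> "carrier T"]
    bij_betw_imp_surj_on[OF \<Phi>_bij] P.diff_closed[OF \<Phi>_closed]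
  by (auto simp: pulled_diff_def)

lemma koszul_closed: "t \<in> carrier T \<Longrightarrow> koszul T i t \<in> carrier T"
  by (simp add: koszul_def)

text \<open>Each identity is tested after applying the injective map \<Phi>, where it becomes the
  corresponding property of the differential of \<open>P\<close>.\<close>

lemma twisted_differential: "twisted_differential g eps M B deg co pulled_diff"
proof (intro twisted_differential.intro twisted_differential_axioms.intro cochain_module_axioms)
  note eqI = inj_onD[OF \<Phi>_inj]
  show "pulled_diff t \<in> carrier T" if "t \<in> carrier T" for t by (rule pulled_diff_closed[OF that])
  show "pulled_diff (s \<oplus>\<^bsub>T\<^esub> t) = pulled_diff s \<oplus>\<^bsub>T\<^esub> pulled_diff t" if "s \<in> carrier T" "t \<in> carrier T" for s t
    by (rule eqI) (use that in \<open>simp_all add: \<Phi>_pulled_diff \<Phi>_add pulled_diff_closed P.diff_add \<Phi>_closed\<close>)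
  show "has_degree 1 T T pulled_diff"
    using P.diff_degree \<Phi>_grade \<Phi>_reflects_grade[OF pulled_diff_closed[OF grade_T_closed]] \<Phi>_pulled_diff[OF grade_T_closed]
    by (simp add: has_degree_def)
  show "pulled_diff (act c t) = act (CE_diff g c) t \<oplus>\<^bsub>T\<^esub> koszul T i (act c (pulled_diff t))" if c: "c \<in> grade A i" and t: "t \<in> carrier T" for c i t
    by (rule eqI)
      (use grade_closed[OF c] linear_mapD'(1)[OF diff_linear grade_closed[OF c]] t in
        \<open>simp_all add: \<Phi>_pulled_diff act_closed pulled_diff_closed \<Phi>_add \<Phi>_act \<Phi>_koszul koszul_closed P_act(5)[OF c] \<Phi>_closed\<close>)
  show "pulled_diff (pulled_diff t) = \<zero>\<^bsub>T\<^esub>" if "t \<in> carrier T" for t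
    by (rule eqI) (use that in \<open>simp_all add: \<Phi>_pulled_diff pulled_diff_closed P.diff_diff \<Phi>_closed \<Phi>_zero\<close>)
qed

lemma ex_infty_module_iso: "\<exists>N. is_infty_module g N \<and> (\<exists>F. is_iso (dgMod (CE g)) (CE_module g N) P F)"
proof -
  interpret N: twisted_differential g eps M B deg co pulled_diff by (rule twisted_differential)
  interpret NI: infty_cochains g eps N.twisted_module B deg co by (rule N.infty_cochains_twisted)
  let ?N = "CE_module g N.twisted_module"
  note simps = CE_module_simps N.twisted_simps
  have iso: "is_iso (dgMod (CE g)) ?N P (restrict \<Phi> (carrier T))"
  proof (rule dgMod_isoI[OF NI.CE_module_dg P.dg_module_axioms])
    show "d_tot g N.twisted_module (d_tot g N.twisted_module t) = \<zero>\<^bsub>cochains g N.twisted_module\<^esub>"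
      if "t \<in> carrier (cochains g N.twisted_module)" for t
      using N.is_infty_module_twisted that unfolding is_infty_module_def by blast
    show "restrict \<Phi> (carrier T) \<in> Hom (dgMod (CE g)) ?N P"
      using \<Phi>_grade grade_T_closed
      by (auto simp: dgMod_def linear_map_def has_degree_def simps CE_simps \<Phi>_closed \<Phi>_add \<Phi>_act act_closed
          N.d_tot_twisted pulled_diff_closed \<Phi>_pulled_diff)
    show "bij_betw (restrict \<Phi> (carrier T)) (carrier ?N) (carrier P)"
    proof -
      have "carrier ?N = carrier T" by (simp add: simps)
      then show ?thesis using bij_betw_cong[of "carrier T" "restrict \<Phi> (carrier T)" \<Phi>] \<Phi>_bij by simp
    qed
  qed (simp add: simps \<Phi>_reflects_grade)
  show ?thesis using N.is_infty_module_twisted iso by blast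
qed

end

lemma (in CE_algebra) CE_functor_essentially_surjective:
  fixes P :: "(('k, 'g) CE, ('k, 'g, 'm) cochain) dg" and \<iota> :: "'k \<Rightarrow> 'm"
  assumes dg: "dg_module (CE g) P" and fg: "finitely_generated (CE g) P" and free: "semifree (CE g) P"
    and inf: "infinite (UNIV :: 'k set)" and \<iota>: "inj \<iota>"
  shows "\<exists>N :: ('k, 'g, 'm) infty_module. is_infty_module g N \<and> (\<exists>F. is_iso (dgMod (CE g)) (CE_module g N) P F)"
proof -
  interpret P: dg_module "CE g" P by (rule dg)
  have "\<one>\<^bsub>CE g\<^esub> \<noteq> \<zero>\<^bsub>CE g\<^esub>" using one_nonzero by (simp add: CE_simps)
  from ex_finite_basis[OF dg fg free this]
  obtain J where J: "finite J" "\<And>b. b \<in> J \<Longrightarrow> \<exists>i. b \<in> grade P i"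
    and span: "\<And>x. x \<in> carrier P \<Longrightarrow> \<exists>c\<in>J \<rightarrow> carrier (CE g). x = (\<Oplus>\<^bsub>P\<^esub>b\<in>J. c b \<odot>\<^bsub>P\<^esub> b)"
    and indep: "\<And>c c' b. c \<in> J \<rightarrow> carrier (CE g) \<Longrightarrow> c' \<in> J \<rightarrow> carrier (CE g) \<Longrightarrow>
      (\<Oplus>\<^bsub>P\<^esub>b\<in>J. c b \<odot>\<^bsub>P\<^esub> b) = (\<Oplus>\<^bsub>P\<^esub>b\<in>J. c' b \<odot>\<^bsub>P\<^esub> b) \<Longrightarrow> b \<in> J \<Longrightarrow> c b = c' b"
    by blast
  obtain D where D: "\<And>b. b \<in> J \<Longrightarrow> b \<in> grade P (D b)" using J(2) by metis
  obtain M :: "('k, 'g, 'm) infty_module" and e deg co where M: "graded_vector_space M" and e: "inj_on e J"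
    and basis: "homogeneous_basis M (e ` J) deg co" and deg: "\<forall>b\<in>J. deg (e b) = D b"
    using ex_graded_vector_space_with_basis[OF J(1) inf \<iota>, of D] by blast
  \<comment> \<open>\<open>e\<close> copies the basis of \<open>P\<close> into \<open>'m\<close>,
    and \<beta> takes the copies back to the original basis elements.\<close>
  define \<beta> where "\<beta> = inv_into J e"
  have \<beta>: "\<beta> (e b) = b" if "b \<in> J" for b using inv_into_f_f[OF e that] by (simp add: \<beta>_def)
  have JC: "J \<subseteq> carrier P" using J(2) P.summand_closed(1) by blast
  have reindex: "(\<Oplus>\<^bsub>P\<^esub>y\<in>e ` J. c y \<odot>\<^bsub>P\<^esub> \<beta> y) = (\<Oplus>\<^bsub>P\<^esub>b\<in>J. c (e b) \<odot>\<^bsub>P\<^esub> b)"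
    if c: "c \<in> e ` J \<rightarrow> carrier (CE g)" for c
  proof -
    have cl: "c (e b) \<odot>\<^bsub>P\<^esub> b \<in> carrier P" if "b \<in> J" for b using that c JC by (intro P.act_closed) auto
    have "(\<Oplus>\<^bsub>P\<^esub>y\<in>e ` J. c y \<odot>\<^bsub>P\<^esub> \<beta> y) = (\<Oplus>\<^bsub>P\<^esub>b\<in>J. c (e b) \<odot>\<^bsub>P\<^esub> \<beta> (e b))"
      by (rule P.finsum_reindex[OF _ e]) (use cl in \<open>auto simp: \<beta>\<close>)
    also have "\<dots> = (\<Oplus>\<^bsub>P\<^esub>b\<in>J. c (e b) \<odot>\<^bsub>P\<^esub> b)" using cl by (intro P.finsum_cong') (simp_all add: \<beta>)
    finally show ?thesis .
  qed
  have "free_dg_module g eps M (e ` J) deg co P \<beta>"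
  proof (intro free_dg_module.intro free_dg_module_axioms.intro cochain_module.intro cochain_module_axioms.intro)
    show "\<beta> b \<in> grade P (deg b)" if "b \<in> e ` J" for b using that D deg by (auto simp: \<beta>)
    show "\<exists>c\<in>e ` J \<rightarrow> carrier (CE g). x = (\<Oplus>\<^bsub>P\<^esub>y\<in>e ` J. c y \<odot>\<^bsub>P\<^esub> \<beta> y)" if x: "x \<in> carrier P" for x
    proof -
      obtain c where c: "c \<in> J \<rightarrow> carrier (CE g)" "x = (\<Oplus>\<^bsub>P\<^esub>b\<in>J. c b \<odot>\<^bsub>P\<^esub> b)" using span[OF x] by blast
      have c': "(\<lambda>y. c (\<beta> y)) \<in> e ` J \<rightarrow> carrier (CE g)" using c(1) by (auto simp: \<beta>)
      have "(\<Oplus>\<^bsub>P\<^esub>y\<in>e ` J. c (\<beta> y) \<odot>\<^bsub>P\<^esub> \<beta> y) = (\<Oplus>\<^bsub>P\<^esub>b\<in>J. c (\<beta> (e b)) \<odot>\<^bsub>P\<^esub> b)" by (rule reindex[OF c'])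
      also have "\<dots> = x" unfolding c(2) using c(1) JC by (intro P.finsum_cong') (auto simp: \<beta> intro!: P.act_closed)
      finally show ?thesis using c' by (intro bexI[of _ "\<lambda>y. c (\<beta> y)"]) (rule sym)
    qed
    show "c b = c' b" if c: "c \<in> e ` J \<rightarrow> carrier (CE g)" and c': "c' \<in> e ` J \<rightarrow> carrier (CE g)" and b: "b \<in> e ` J"
      and eq: "(\<Oplus>\<^bsub>P\<^esub>y\<in>e ` J. c y \<odot>\<^bsub>P\<^esub> \<beta> y) = (\<Oplus>\<^bsub>P\<^esub>y\<in>e ` J. c' y \<odot>\<^bsub>P\<^esub> \<beta> y)" for c c' b
    proof -
      obtain i where i: "i \<in> J" "b = e i" using b by blast
      have "c (e i) = c' (e i)"
        by (rule indep[of "\<lambda>i. c (e i)" "\<lambda>i. c' (e i)", OF _ _ eq[unfolded reindex[OF c] reindex[OF c']] i(1)]) (use c c' in auto)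
      then show ?thesis by (simp add: i(2))
    qed
  qed (rule CE_algebra_axioms M basis dg)+
  then show ?thesis by (rule free_dg_module.ex_infty_module_iso)
qed

theorem proposition1p9:
  fixes g :: "('k::real_or_complex, 'g) dg_lie"
  assumes "dg_lie_algebra g"
  shows "fully_faithful
           (lfMod g :: (('k, 'g, 'm) infty_module, ('k, 'g, 'm) infty_hom) category)
           (dgMod (CE g)) (CE_functor g) \<and>
         ((\<exists>\<iota> :: 'k \<Rightarrow> 'm. inj \<iota>) \<longrightarrow>
         is_equivalence
           (lfMod g :: (('k, 'g, 'm) infty_module, ('k, 'g, 'm) infty_hom) category)
           (fgsMod (CE g)) (CE_functor g))"
proof -
  obtain eps where "CE_algebra g eps" using ex_CE_algebra[OF assms] by blast
  then interpret CE_algebra g eps .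
  let ?C = "lfMod g :: (('k, 'g, 'm) infty_module, ('k, 'g, 'm) infty_hom) category"
  have ff: "fully_faithful ?C (dgMod (CE g)) (CE_functor g)" by (rule fully_faithful_CE_functor)
  have "is_equivalence ?C (fgsMod (CE g)) (CE_functor g)" if \<iota>: "inj \<iota>" for \<iota> :: "'k \<Rightarrow> 'm"
    unfolding fgsMod_def
  proof (rule equivalence_of_fully_faithful[OF ff])
    fix X assume "X \<in> Obj ?C"
    then have "is_infty_module g X" by (simp add: lfMod_def)
    then obtain B deg co where "infty_cochains g eps X B deg co" using ex_infty_cochains by blast
    then interpret X: infty_cochains g eps X B deg co .
    show "on_obj (CE_functor g) X \<in> {P. finitely_generated (CE g) P \<and> semifree (CE g) P}"
      using X.finitely_generated_CE_module X.semifree_CE_module by (simp add: CE_functor_def)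
  next
    fix Y :: "(('k, 'g) CE, ('k, 'g, 'm) cochain) dg"
    assume "Y \<in> Obj (dgMod (CE g))" and "Y \<in> {P. finitely_generated (CE g) P \<and> semifree (CE g) P}"
    then have "dg_module (CE g) Y" "finitely_generated (CE g) Y" "semifree (CE g) Y" by (simp_all add: dgMod_def)
    \<comment> \<open>A field of characteristic zero is infinite, as the encoding of finitely many
      scalars in one requires.\<close>
    from CE_functor_essentially_surjective[OF this infinite_UNIV_char_0 \<iota>]
    show "\<exists>X\<in>Obj ?C. \<exists>F. is_iso (dgMod (CE g)) (on_obj (CE_functor g) X) Y F"
      by (simp add: lfMod_def CE_functor_def)
  qed
  with ff show ?thesis by blast
qed

end
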